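(* Let $\mathcal K_\bullet\in\mathbb K$ and $0\le\sigma\le1$. The Scott–Zhang-type operator $J_\bullet:L^2(\Gamma)\to\mathcal X_\bullet$ defined in the context satisfies the following properties (i)–(iv) with a constant $C_{\rm sz}>0$ depending only on $\gamma,p,\widehat{\mathcal Q}_0,w_{\min},w_{\max}$ and $\sigma$: (i) Local projection property: for all $v\in L^2(\Gamma)$ and all $Q\in\mathcal Q_\bullet$, $(J_\bullet v)|_Q=v|_Q$ if $v|_{\pi^p_\bullet(Q)}\in\mathcal X_\bullet|_{\pi_\bullet^p(Q)}:=\{V_\bullet|_{\pi_\bullet^p(Q)}:V_\bullet\in\mathcal X_\bullet\}$. (ii) Local $L^2$-stability: for all $v\in L^2(\Gamma)$ and all $Q\in\mathcal Q_\bullet$, $\|J_\bullet v\|_{L^2(Q)}\le C_{\rm sz}\|v\|_{L^2(\pi^p_\bullet(Q))}$. (iii) Local $H^1$-stability: for all $v\in H^1(\Gamma)$ and all $Q\in\mathcal Q_\bullet$, $|J_\bullet v|_{H^1(Q)}\le C_{\rm sz}|v|_{H^1(\pi_\bullet^p(Q))}$. (iv) Approximation properties: for all $v\in H^\sigma(\Gamma)$, $$\|h_\bullet^{-\sigma}(1-J_\bullet)v\|_{L^2(\Gamma)}\le C_{\rm sz}\|v\|_{H^\sigma(\Gamma)},$$ and for all $v\in H^1(\Gamma)$, $$\|(1-J_\bullet)v\|_{H^\sigma(\Gamma)}\le C_{\rm sz}\|h_\bullet^{1-\sigma}\partial_\Gamma v\|_{L^2(\Gamma)}.$$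
   Context: **Geometry.** $\Omega\subset\mathbb R^2$ is a bounded Lipschitz domain with connected boundary $\Gamma=\partial\Omega$, parametrized by a continuous, piecewise continuously differentiable closed path $\gamma:[a,b]\to\Gamma$ such that $\gamma|_{[a,b)}$ and $\gamma|_{(a,b]}$ are bijective onto $\Gamma$; $\gamma^{-1}$ denotes the inverse of one of these restrictions. The one-sided derivatives satisfy $\gamma'^{\ell}(t)\ne0$ for $t\in(a,b]$, $\gamma'^{r}(t)\ne0$ for $t\in[a,b)$, and for all $c>0$: $\gamma'^\ell(t)+c\gamma'^r(t)\neq0$ for $t\in(a,b)$ and $\gamma'^\ell(b)+c\gamma'^r(a)\ne0$. **Sobolev spaces.** $H^0(\Gamma)=L^2(\Gamma)$ (arclength measure); $|v|_{H^1(\Gamma_0)}:=\|\partial_\Gamma v\|_{L^2(\Gamma_0)}$ with arclength derivative $\partial_\Gamma$; $\|v\|_{H^1(\Gamma)}^2=\|v\|_{L^2(\Gamma)}^2+|v|_{H^1(\Gamma)}^2$; for $0<\sigma<1$, $H^\sigma(\Gamma)=[L^2(\Gamma),H^1(\Gamma)]_\sigma$ by the $K$-method of interpolation. **Knot vectors.** Fix a degree $p\in\mathbb N$, $p\ge1$. A knot vector $\mathcal K_\bullet$ consists of nodes $\mathcal N_\bullet=\{z_{\bullet,j}=\gamma(\widehat z_{\bullet,j}):j=1,\dots,n_\bullet\}$, $a=\widehat z_{\bullet,0}<\widehat z_{\bullet,1}<\dots<\widehat z_{\bullet,n_\bullet}=b$, $z_{\bullet,0}:=z_{\bullet,n_\bullet}$,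 with $\gamma|_{[\widehat z_{\bullet,j-1},\widehat z_{\bullet,j}]}\in C^1$, and multiplicities $\#_\bullet z_{\bullet,j}\in\{1,\dots,p\}$ for $1\le j\le n_\bullet-1$ and $\#_\bullet z_{\bullet,n_\bullet}=p+1$; $\mathcal K_\bullet$ is the sequence of nodes repeated according to multiplicity. $N_\bullet:=\sum_{z\in\mathcal N_\bullet}\#_\bullet z$. Elements: $\mathcal Q_\bullet=\{Q_{\bullet,j}=\gamma([\widehat z_{\bullet,j-1},\widehat z_{\bullet,j}])\}_{j=1}^{n_\bullet}$, and $\widehat{\mathcal Q}_\bullet$ is the corresponding partition of $[a,b]$. $h_Q$ is the arclength of $Q$, $\widehat h_Q:=|\gamma^{-1}(Q)|$ the length in the parameter domain, $h_\bullet|_Q:=h_Q$. Patches for $\Gamma_0\subseteq\Gamma$: $\pi^0_\bullet(\Gamma_0)=\Gamma_0$, $\pi^m_\bullet(\Gamma_0)=\bigcup\{Q\in\mathcal Q_\bullet:Q\cap\pi_\bullet^{m-1}(\Gamma_0)\ne\emptyset\}$. **Refinement.** A fixed initial knot vector $\mathcal K_0$ is given, $\widehat\kappa_0:=\max\{\widehat h_Q/\widehat h_{Q'}:Q,Q'\in\mathcal Q_0,\ Q\cap Q'\ne\emptyset\}$. For $\mathcal M_\bullet\subseteq\mathcal N_\bullet$, $\mathtt{refine}(\mathcal K_\bullet,\mathcal M_\bullet)$ is obtained as follows: (i) $\mathcal M'_\bullet:=\emptyset$; (ii) if both nodes of $Q\in\mathcal Q_\bullet$ belong to $\mathcal M_\bullet$,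 add $Q$ to $\mathcal M_\bullet'$; (iii) for all other nodes in $\mathcal M_\bullet$, increase the multiplicity by one if it is $\le p-1$, otherwise add the elements containing the node to $\mathcal M'_\bullet$; (iv) recursively enrich $\mathcal M_\bullet'$ by all $Q\in\mathcal Q_\bullet\setminus\mathcal M'_\bullet$ for which there is $Q'\in\mathcal M'_\bullet$ with $Q\cap Q'\ne\emptyset$ and $\max\{\widehat h_Q/\widehat h_{Q'},\widehat h_{Q'}/\widehat h_Q\}>\widehat\kappa_0$, until nothing is added; (v) bisect all $Q\in\mathcal M'_\bullet$ by inserting the midpoint of $\gamma^{-1}(Q)$ as a knot of multiplicity one. $\mathbb K$ is the set of all knot vectors obtained from $\mathcal K_0$ by finitely many (possibly zero) such steps with arbitrary marked sets. (All $\mathcal K_\bullet\in\mathbb K$ satisfy $\widehat h_Q/\widehat h_{Q'}\le2\widehat\kappa_0$ for $Q,Q'\in\mathcal Q_\bullet$ with $Q\cap Q'\neq\emptyset$.) **Ansatz spaces.** For $\mathcal K_\bullet\in\mathbb K$ let $t_{\bullet,-p}=\dots=t_{\bullet,0}=a$ and let $(t_{\bullet,i})_{i=1}^{N_\bullet}$ be the nondecreasing sequence of the $\widehat z_{\bullet,j}$, $j\ge 1$, repeated with multiplicity. $\widehat B_{\bullet,i,p}$, $i=1-p,\dots,N_\bullet-p$, is the (right-continuous) B-spline of degree $p$ with knots $t_{\bullet,i-1},\dots,t_{\bullet,i+p}$, normalized so that these B-splines form a partition of unity on $[a,b)$. Initial weights $w_{0,i}>0$, $i=1-p,\dots,N_0-p$,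 with $w_{0,1-p}=w_{0,N_0-p}$ are given; $w_{\min},w_{\max}$ are their minimum and maximum, $\widehat W_0:=\sum_kw_{0,k}\widehat B_{0,k,p}$ on $[a,b)$. For $\mathcal K_\bullet\in\mathbb K$ the weights $w_{\bullet,i}$ are the unique numbers with $\widehat W_0=\sum_kw_{\bullet,k}\widehat B_{\bullet,k,p}$ (they satisfy $w_{\min}\le w_{\bullet,i}\le w_{\max}$). Set $\widehat R_{\bullet,i,p}:=w_{\bullet,i}\widehat B_{\bullet,i,p}/\widehat W_0$, $R_{\bullet,i,p}:=\widehat R_{\bullet,i,p}\circ\gamma^{-1}$, and $\mathcal X_\bullet:=\{V\in\mathrm{span}\{R_{\bullet,i,p}:i=1-p,\dots,N_\bullet-p\}:V(\gamma(a))=V(\gamma(b-))\}\subset H^1(\Gamma)$. **Scott–Zhang-type operator.** Let $\widehat B^*_{\bullet,i,p}\in L^2(a,b)$ be fixed dual functions, depending only on $t_{\bullet,i-1},\dots,t_{\bullet,i+p}$, with $\mathrm{supp}\,\widehat B^*_{\bullet,i,p}=\mathrm{supp}\,\widehat B_{\bullet,i,p}=[t_{\bullet,i-1},t_{\bullet,i+p}]$, $\int_a^b\widehat B^*_{\bullet,i,p}\widehat B_{\bullet,j,p}\,dt=\delta_{ij}$ and $\|\widehat B^*_{\bullet,i,p}\|_{L^2(a,b)}\le9^p(2p+3)|\mathrm{supp}\,\widehat B_{\bullet,i,p}|^{-1/2}$ (such functions exist). Put $\widehat R^*_{\bullet,i,p}:=\widehat B^*_{\bullet,i,p}\widehat W_0/w_{\bullet,i}$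 and $$J_\bullet v:=\Big(\int_a^b\tfrac{\widehat R^*_{\bullet,1-p,p}+\widehat R^*_{\bullet,N_\bullet-p,p}}2(v\circ\gamma)\,dt\Big)(R_{\bullet,1-p,p}+R_{\bullet,N_\bullet-p,p})+\sum_{i=2-p}^{N_\bullet-p-1}\Big(\int_a^b\widehat R^*_{\bullet,i,p}(v\circ\gamma)\,dt\Big)R_{\bullet,i,p}.$$ *)

theory Defs
  imports "HOL-Analysis.Analysis" "HOL-Library.Multiset"
begin

section \<open>Geometry\<close>

text \<open>Near every boundary point the domain is, in suitable orthonormal coordinates, the region
  strictly below the graph of a Lipschitz function.\<close>

definition lipschitz_domain :: "(real^2) set \<Rightarrow> bool" where
  "lipschitz_domain \<Omega> \<longleftrightarrow> open \<Omega> \<and> connected \<Omega> \<and> \<Omega> \<noteq> {} \<and>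
     (\<forall>x\<in>frontier \<Omega>. \<exists>U e1 e2 L. \<exists>g::real \<Rightarrow> real.
        open U \<and> x \<in> U \<and> norm e1 = 1 \<and> norm e2 = 1 \<and> e1 \<bullet> e2 = 0 \<and> L-lipschitz_on UNIV g \<and>
        \<Omega> \<inter> U = {y \<in> U. y \<bullet> e2 < g (y \<bullet> e1)})"

text \<open>\<open>C\<^sup>1\<close> on the closed interval, with one-sided derivatives at the end points.  The library's
  \<^const>\<open>piecewise_C1_differentiable_on\<close> would not do below: it allows the derivative to blow up
  at the exceptional points.\<close>

definition C1_on_interval :: "(real \<Rightarrow> real^2) \<Rightarrow> real \<Rightarrow> real \<Rightarrow> bool" where
  "C1_on_interval \<gamma> c d \<longleftrightarrow>
     (\<exists>D. (\<forall>t\<in>{c..d}. (\<gamma> has_vector_derivative D t) (at t within {c..d})) \<and>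
          continuous_on {c..d} D)"

text \<open>Parameter intervals \<open>[c,d]\<close> are encoded as pairs \<open>(c,d)\<close>.  A finite set \<open>Z\<close> of points of
  \<open>(a,b]\<close> with \<open>b \<in> Z\<close> cuts \<open>[a,b]\<close> into the following intervals.\<close>

definition cells :: "real \<Rightarrow> real set \<Rightarrow> (real \<times> real) set" where
  "cells a Z = {(c, d). c \<in> insert a Z \<and> d \<in> Z \<and> c < d \<and> {c<..<d} \<inter> Z = {}}"

definition piecewise_C1 :: "(real \<Rightarrow> real^2) \<Rightarrow> real \<Rightarrow> real \<Rightarrow> bool" where
  "piecewise_C1 \<gamma> a b \<longleftrightarrow>
     (\<exists>Z. finite Z \<and> Z \<subseteq> {a<..b} \<and> b \<in> Z \<and> (\<forall>(c, d)\<in>cells a Z. C1_on_interval \<gamma> c d))"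

definition left_deriv :: "(real \<Rightarrow> real^2) \<Rightarrow> real \<Rightarrow> real^2" where
  "left_deriv \<gamma> t = vector_derivative \<gamma> (at_left t)"

definition right_deriv :: "(real \<Rightarrow> real^2) \<Rightarrow> real \<Rightarrow> real^2" where
  "right_deriv \<gamma> t = vector_derivative \<gamma> (at_right t)"

definition boundary_parametrization ::
    "(real \<Rightarrow> real^2) \<Rightarrow> real \<Rightarrow> real \<Rightarrow> (real^2) set \<Rightarrow> bool" where
  "boundary_parametrization \<gamma> a b \<Gamma> \<longleftrightarrow>
     a < b \<and> continuous_on {a..b} \<gamma> \<and> piecewise_C1 \<gamma> a b \<and> \<gamma> a = \<gamma> b \<and>
     bij_betw \<gamma> {a..<b} \<Gamma> \<and> bij_betw \<gamma> {a<..b} \<Gamma> \<and>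
     (\<forall>t\<in>{a<..b}. left_deriv \<gamma> t \<noteq> 0) \<and>
     (\<forall>t\<in>{a..<b}. right_deriv \<gamma> t \<noteq> 0) \<and>
     (\<forall>c>0. (\<forall>t\<in>{a<..<b}. left_deriv \<gamma> t + c *\<^sub>R right_deriv \<gamma> t \<noteq> 0) \<and>
            left_deriv \<gamma> b + c *\<^sub>R right_deriv \<gamma> a \<noteq> 0)"


section \<open>Sobolev spaces on the boundary\<close>

text \<open>Elements of the function spaces are represented by Borel functions on \<open>\<Gamma>\<close>; only their
  equivalence classes modulo null sets matter.\<close>

definition speed :: "(real \<Rightarrow> real^2) \<Rightarrow> real \<Rightarrow> real" where
  "speed \<gamma> t = norm (right_deriv \<gamma> t)"

definition arclength_measure :: "(real \<Rightarrow> real^2) \<Rightarrow> real \<Rightarrow> real \<Rightarrow> (real^2) measure" where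
  "arclength_measure \<gamma> a b =
     distr (density (restrict_space lborel {a..<b}) (\<lambda>t. ennreal (speed \<gamma> t)))
           (restrict_space borel (\<gamma> ` {a..b})) \<gamma>"

definition L2_space :: "(real \<Rightarrow> real^2) \<Rightarrow> real \<Rightarrow> real \<Rightarrow> (real^2 \<Rightarrow> real) set" where
  "L2_space \<gamma> a b = {v. v \<in> borel_measurable (arclength_measure \<gamma> a b) \<and>
                         integrable (arclength_measure \<gamma> a b) (\<lambda>x. (v x)\<^sup>2)}"

definition L2_norm ::
    "(real \<Rightarrow> real^2) \<Rightarrow> real \<Rightarrow> real \<Rightarrow> (real^2) set \<Rightarrow> (real^2 \<Rightarrow> real) \<Rightarrow> real" where
  "L2_norm \<gamma> a b S v = sqrt (LINT x:S|arclength_measure \<gamma> a b. (v x)\<^sup>2)"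

text \<open>\<open>g \<in> L\<^sup>2(\<Gamma>)\<close> is the arclength derivative of \<open>v\<close> if \<open>v\<close> agrees almost everywhere with an
  absolutely continuous function on the closed curve whose derivative with respect to arclength
  is \<open>g\<close>, i.e. with an indefinite arclength integral of \<open>g\<close>.  The last condition says that this
  function has the same value at the two parameters \<open>a\<close> and \<open>b\<close> of the point where the curve
  closes.\<close>

definition has_arclength_derivative ::
    "(real \<Rightarrow> real^2) \<Rightarrow> real \<Rightarrow> real \<Rightarrow> (real^2 \<Rightarrow> real) \<Rightarrow> (real^2 \<Rightarrow> real) \<Rightarrow> bool" where
  "has_arclength_derivative \<gamma> a b v g \<longleftrightarrow>
     g \<in> L2_space \<gamma> a b \<and>
     (\<exists>c. AE t in lborel. t \<in> {a..b} \<longrightarrow>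
            v (\<gamma> t) = c + (LINT s:{a..t}|lborel. g (\<gamma> s) * speed \<gamma> s)) \<and>
     (LINT s:{a..b}|lborel. g (\<gamma> s) * speed \<gamma> s) = 0"

text \<open>The derivative is unique up to null sets, so its \<open>L\<^sup>2\<close> norms do not depend on the choice.\<close>

definition arclength_derivative ::
    "(real \<Rightarrow> real^2) \<Rightarrow> real \<Rightarrow> real \<Rightarrow> (real^2 \<Rightarrow> real) \<Rightarrow> real^2 \<Rightarrow> real" where
  "arclength_derivative \<gamma> a b v = (SOME g. has_arclength_derivative \<gamma> a b v g)"

definition H1_space :: "(real \<Rightarrow> real^2) \<Rightarrow> real \<Rightarrow> real \<Rightarrow> (real^2 \<Rightarrow> real) set" where
  "H1_space \<gamma> a b = {v \<in> L2_space \<gamma> a b. \<exists>g. has_arclength_derivative \<gamma> a b v g}"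

definition H1_seminorm ::
    "(real \<Rightarrow> real^2) \<Rightarrow> real \<Rightarrow> real \<Rightarrow> (real^2) set \<Rightarrow> (real^2 \<Rightarrow> real) \<Rightarrow> real" where
  "H1_seminorm \<gamma> a b S v = L2_norm \<gamma> a b S (arclength_derivative \<gamma> a b v)"

definition H1_norm :: "(real \<Rightarrow> real^2) \<Rightarrow> real \<Rightarrow> real \<Rightarrow> (real^2 \<Rightarrow> real) \<Rightarrow> real" where
  "H1_norm \<gamma> a b v =
     sqrt ((L2_norm \<gamma> a b (\<gamma> ` {a..b}) v)\<^sup>2 + (H1_seminorm \<gamma> a b (\<gamma> ` {a..b}) v)\<^sup>2)"

text \<open>Peetre's \<open>K\<close>-functional of the couple \<open>(L\<^sup>2(\<Gamma>), H\<^sup>1(\<Gamma>))\<close>, and the interpolation norm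
  \<open>(\<integral>\<^sub>0\<^sup>\<infinity> (t\<^sup>-\<^sup>\<sigma> K(t,v))\<^sup>2 dt/t)\<^sup>1\<^sup>/\<^sup>2\<close>.\<close>

definition K_functional ::
    "(real \<Rightarrow> real^2) \<Rightarrow> real \<Rightarrow> real \<Rightarrow> real \<Rightarrow> (real^2 \<Rightarrow> real) \<Rightarrow> real" where
  "K_functional \<gamma> a b t v =
     (INF w\<in>H1_space \<gamma> a b. L2_norm \<gamma> a b (\<gamma> ` {a..b}) (\<lambda>x. v x - w x) + t * H1_norm \<gamma> a b w)"

definition K_method_integral ::
    "(real \<Rightarrow> real^2) \<Rightarrow> real \<Rightarrow> real \<Rightarrow> real \<Rightarrow> (real^2 \<Rightarrow> real) \<Rightarrow> ennreal" where
  "K_method_integral \<gamma> a b \<sigma> v =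
     (\<integral>\<^sup>+t\<in>{0<..}. ennreal ((t powr (-\<sigma>) * K_functional \<gamma> a b t v)\<^sup>2 / t) \<partial>lborel)"

definition Hs_space :: "(real \<Rightarrow> real^2) \<Rightarrow> real \<Rightarrow> real \<Rightarrow> real \<Rightarrow> (real^2 \<Rightarrow> real) set" where
  "Hs_space \<gamma> a b \<sigma> =
     (if \<sigma> = 0 then L2_space \<gamma> a b
      else if \<sigma> = 1 then H1_space \<gamma> a b
      else {v \<in> L2_space \<gamma> a b. K_method_integral \<gamma> a b \<sigma> v < \<infinity>})"

definition Hs_norm ::
    "(real \<Rightarrow> real^2) \<Rightarrow> real \<Rightarrow> real \<Rightarrow> real \<Rightarrow> (real^2 \<Rightarrow> real) \<Rightarrow> real" where
  "Hs_norm \<gamma> a b \<sigma> v =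
     (if \<sigma> = 0 then L2_norm \<gamma> a b (\<gamma> ` {a..b}) v
      else if \<sigma> = 1 then H1_norm \<gamma> a b v
      else sqrt (enn2real (K_method_integral \<gamma> a b \<sigma> v)))"


section \<open>Knot vectors and refinement\<close>

text \<open>A knot vector is given by the multiset of its knots in the parameter domain \<open>(a,b]\<close>: the
  underlying set is \<open>{\<zeta>\<^sub>1, \<dots>, \<zeta>\<^sub>n}\<close> with \<open>\<zeta>\<^sub>n = b\<close>, the counts are the multiplicities, and the
  size is the total number \<open>N\<close> of knots.  The point \<open>\<zeta>\<^sub>0 = a\<close> is not an element.\<close>

type_synonym knots = "real multiset"

definition knot_vector :: "(real \<Rightarrow> real^2) \<Rightarrow> real \<Rightarrow> real \<Rightarrow> nat \<Rightarrow> knots \<Rightarrow> bool" where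
  "knot_vector \<gamma> a b p K \<longleftrightarrow>
     set_mset K \<subseteq> {a<..b} \<and> count K b = p + 1 \<and>
     (\<forall>z\<in>set_mset K - {b}. count K z \<le> p) \<and>
     (\<forall>(c, d)\<in>cells a (set_mset K). C1_on_interval \<gamma> c d)"

definition nodes :: "(real \<Rightarrow> real^2) \<Rightarrow> knots \<Rightarrow> (real^2) set" where
  "nodes \<gamma> K = \<gamma> ` set_mset K"

definition param_elements :: "real \<Rightarrow> knots \<Rightarrow> (real \<times> real) set" where
  "param_elements a K = cells a (set_mset K)"

definition elem :: "(real \<Rightarrow> real^2) \<Rightarrow> real \<times> real \<Rightarrow> (real^2) set" where
  "elem \<gamma> I = \<gamma> ` {fst I..snd I}"

definition param_width :: "real \<times> real \<Rightarrow> real" where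
  "param_width I = snd I - fst I"

definition elem_length :: "(real \<Rightarrow> real^2) \<Rightarrow> real \<Rightarrow> real \<Rightarrow> real \<times> real \<Rightarrow> real" where
  "elem_length \<gamma> a b I = measure (arclength_measure \<gamma> a b) (elem \<gamma> I)"

text \<open>The mesh width function \<open>h\<close>; at the finitely many nodes it takes the value of one of the
  adjacent elements.\<close>

definition mesh_width :: "(real \<Rightarrow> real^2) \<Rightarrow> real \<Rightarrow> real \<Rightarrow> knots \<Rightarrow> real^2 \<Rightarrow> real" where
  "mesh_width \<gamma> a b K x =
     (\<Sum>I\<in>param_elements a K. elem_length \<gamma> a b I * indicator (\<gamma> ` {fst I..<snd I}) x)"

fun patch ::
    "(real \<Rightarrow> real^2) \<Rightarrow> real \<Rightarrow> knots \<Rightarrow> nat \<Rightarrow> (real^2) set \<Rightarrow> (real^2) set" where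
  "patch \<gamma> a K 0 S = S"
| "patch \<gamma> a K (Suc m) S =
     \<Union> {elem \<gamma> I | I. I \<in> param_elements a K \<and> elem \<gamma> I \<inter> patch \<gamma> a K m S \<noteq> {}}"

definition kappa_hat :: "(real \<Rightarrow> real^2) \<Rightarrow> real \<Rightarrow> knots \<Rightarrow> real" where
  "kappa_hat \<gamma> a K =
     Max {param_width I / param_width I' | I I'.
            I \<in> param_elements a K \<and> I' \<in> param_elements a K \<and> elem \<gamma> I \<inter> elem \<gamma> I' \<noteq> {}}"

definition both_marked ::
    "(real \<Rightarrow> real^2) \<Rightarrow> real \<Rightarrow> knots \<Rightarrow> (real^2) set \<Rightarrow> (real \<times> real) set" where
  "both_marked \<gamma> a K M = {I \<in> param_elements a K. \<gamma> (fst I) \<in> M \<and> \<gamma> (snd I) \<in> M}"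

definition other_marked ::
    "(real \<Rightarrow> real^2) \<Rightarrow> real \<Rightarrow> knots \<Rightarrow> (real^2) set \<Rightarrow> (real^2) set" where
  "other_marked \<gamma> a K M = {z \<in> M. \<forall>I\<in>both_marked \<gamma> a K M. z \<noteq> \<gamma> (fst I) \<and> z \<noteq> \<gamma> (snd I)}"

definition raised_knots ::
    "(real \<Rightarrow> real^2) \<Rightarrow> real \<Rightarrow> nat \<Rightarrow> knots \<Rightarrow> (real^2) set \<Rightarrow> real set" where
  "raised_knots \<gamma> a p K M =
     {z \<in> set_mset K. \<gamma> z \<in> other_marked \<gamma> a K M \<and> count K z \<le> p - 1}"

inductive_set marked_elements ::
    "(real \<Rightarrow> real^2) \<Rightarrow> real \<Rightarrow> nat \<Rightarrow> real \<Rightarrow> knots \<Rightarrow> (real^2) set \<Rightarrow> (real \<times> real) set"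
  for \<gamma> a p \<kappa> K M where
  both: "I \<in> both_marked \<gamma> a K M \<Longrightarrow> I \<in> marked_elements \<gamma> a p \<kappa> K M"
| node: "\<lbrakk>z \<in> set_mset K; \<gamma> z \<in> other_marked \<gamma> a K M; \<not> count K z \<le> p - 1;
          I \<in> param_elements a K; \<gamma> z \<in> elem \<gamma> I\<rbrakk> \<Longrightarrow> I \<in> marked_elements \<gamma> a p \<kappa> K M"
| ratio: "\<lbrakk>I' \<in> marked_elements \<gamma> a p \<kappa> K M; I \<in> param_elements a K; elem \<gamma> I \<inter> elem \<gamma> I' \<noteq> {};
           max (param_width I / param_width I') (param_width I' / param_width I) > \<kappa>\<rbrakk>
          \<Longrightarrow> I \<in> marked_elements \<gamma> a p \<kappa> K M"

definition refine ::
    "(real \<Rightarrow> real^2) \<Rightarrow> real \<Rightarrow> nat \<Rightarrow> real \<Rightarrow> knots \<Rightarrow> (real^2) set \<Rightarrow> knots" where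
  "refine \<gamma> a p \<kappa> K M =
     K + mset_set (raised_knots \<gamma> a p K M)
       + mset_set ((\<lambda>I. (fst I + snd I) / 2) ` marked_elements \<gamma> a p \<kappa> K M)"

inductive_set refinements :: "(real \<Rightarrow> real^2) \<Rightarrow> real \<Rightarrow> nat \<Rightarrow> knots \<Rightarrow> knots set"
  for \<gamma> a p K0 where
  initial: "K0 \<in> refinements \<gamma> a p K0"
| step: "\<lbrakk>K \<in> refinements \<gamma> a p K0; M \<subseteq> nodes \<gamma> K\<rbrakk>
         \<Longrightarrow> refine \<gamma> a p (kappa_hat \<gamma> a K0) K M \<in> refinements \<gamma> a p K0"


section \<open>Rational splines\<close>

definition knot :: "real \<Rightarrow> knots \<Rightarrow> int \<Rightarrow> real" where
  "knot a K i = (if i \<le> 0 then a else sorted_list_of_multiset K ! nat (i - 1))"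

definition spline_indices :: "nat \<Rightarrow> knots \<Rightarrow> int set" where
  "spline_indices p K = {1 - int p .. int (size K) - int p}"

text \<open>Cox-de Boor recursion for the right-continuous, normalized B-spline with knots
  \<open>t (i - 1), \<dots>, t (i + p)\<close>.  Terms with coinciding knots vanish because of \<open>x / 0 = 0\<close>.\<close>

primrec bspline :: "(int \<Rightarrow> real) \<Rightarrow> nat \<Rightarrow> int \<Rightarrow> real \<Rightarrow> real" where
  "bspline t 0 i x = (if t (i - 1) \<le> x \<and> x < t i then 1 else 0)"
| "bspline t (Suc q) i x =
     (x - t (i - 1)) / (t (i + int q) - t (i - 1)) * bspline t q i x
   + (t (i + int q + 1) - x) / (t (i + int q + 1) - t i) * bspline t q (i + 1) x"

definition weight_function :: "real \<Rightarrow> nat \<Rightarrow> knots \<Rightarrow> (int \<Rightarrow> real) \<Rightarrow> real \<Rightarrow> real" where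
  "weight_function a p K w x = (\<Sum>k\<in>spline_indices p K. w k * bspline (knot a K) p k x)"

definition initial_weights ::
    "nat \<Rightarrow> knots \<Rightarrow> (int \<Rightarrow> real) \<Rightarrow> real \<Rightarrow> real \<Rightarrow> bool" where
  "initial_weights p K0 w0 wmin wmax \<longleftrightarrow>
     (\<forall>i\<in>spline_indices p K0. 0 < w0 i) \<and>
     w0 (1 - int p) = w0 (int (size K0) - int p) \<and>
     Min (w0 ` spline_indices p K0) = wmin \<and> Max (w0 ` spline_indices p K0) = wmax"

text \<open>The coefficients of the initial weight function with respect to the B-splines of \<open>K\<close>, set
  to zero outside the index range.\<close>

definition weights ::
    "real \<Rightarrow> real \<Rightarrow> nat \<Rightarrow> knots \<Rightarrow> (int \<Rightarrow> real) \<Rightarrow> knots \<Rightarrow> int \<Rightarrow> real" where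
  "weights a b p K0 w0 K =
     (THE w. (\<forall>k. k \<notin> spline_indices p K \<longrightarrow> w k = 0) \<and>
             (\<forall>x\<in>{a..<b}. weight_function a p K0 w0 x = weight_function a p K w x))"

definition param_nurbs ::
    "real \<Rightarrow> real \<Rightarrow> nat \<Rightarrow> knots \<Rightarrow> (int \<Rightarrow> real) \<Rightarrow> knots \<Rightarrow> int \<Rightarrow> real \<Rightarrow> real" where
  "param_nurbs a b p K0 w0 K i t =
     weights a b p K0 w0 K i * bspline (knot a K) p i t / weight_function a p K0 w0 t"

definition nurbs ::
    "(real \<Rightarrow> real^2) \<Rightarrow> real \<Rightarrow> real \<Rightarrow> nat \<Rightarrow> knots \<Rightarrow> (int \<Rightarrow> real) \<Rightarrow> knots \<Rightarrow> int
      \<Rightarrow> real^2 \<Rightarrow> real" where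
  "nurbs \<gamma> a b p K0 w0 K i x = param_nurbs a b p K0 w0 K i (the_inv_into {a..<b} \<gamma> x)"

definition ansatz_space ::
    "(real \<Rightarrow> real^2) \<Rightarrow> real \<Rightarrow> real \<Rightarrow> nat \<Rightarrow> knots \<Rightarrow> (int \<Rightarrow> real) \<Rightarrow> knots
      \<Rightarrow> (real^2 \<Rightarrow> real) set" where
  "ansatz_space \<gamma> a b p K0 w0 K =
     {V. (\<exists>c. V = (\<lambda>x. \<Sum>i\<in>spline_indices p K. c i * nurbs \<gamma> a b p K0 w0 K i x)) \<and>
         ((\<lambda>t. V (\<gamma> t)) \<longlongrightarrow> V (\<gamma> a)) (at_left b)}"


section \<open>The Scott--Zhang-type operator\<close>

text \<open>Support of an element of \<open>L\<^sup>2(a,b)\<close>, i.e. the complement of the largest relatively open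
  set on which it vanishes almost everywhere.\<close>

definition ess_support :: "real \<Rightarrow> real \<Rightarrow> (real \<Rightarrow> real) \<Rightarrow> real set" where
  "ess_support a b f =
     {t \<in> {a..b}. \<forall>e>0. \<not> (AE s in lborel. s \<in> {a..b} \<and> dist s t < e \<longrightarrow> f s = 0)}"

definition local_knots :: "real \<Rightarrow> nat \<Rightarrow> knots \<Rightarrow> int \<Rightarrow> real list" where
  "local_knots a p K i = map (knot a K) [i - 1..i + int p]"

text \<open>That a dual function depends only on its local knots is expressed by the type of the
  family \<open>Bst\<close>: it maps the list of local knots to the dual function.\<close>

definition dual_functions ::
    "(real \<Rightarrow> real^2) \<Rightarrow> real \<Rightarrow> real \<Rightarrow> nat \<Rightarrow> knots \<Rightarrow> (real list \<Rightarrow> real \<Rightarrow> real) \<Rightarrow> bool" where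
  "dual_functions \<gamma> a b p K0 Bst \<longleftrightarrow>
     (\<forall>K\<in>refinements \<gamma> a p K0. \<forall>i\<in>spline_indices p K.
        let f = Bst (local_knots a p K i); t = knot a K in
          set_borel_measurable lborel {a..b} f \<and>
          set_integrable lborel {a..b} (\<lambda>x. (f x)\<^sup>2) \<and>
          ess_support a b f = {t (i - 1)..t (i + int p)} \<and>
          (\<forall>j\<in>spline_indices p K.
             (LINT x:{a..b}|lborel. f x * bspline t p j x) = (if i = j then 1 else 0)) \<and>
          sqrt (LINT x:{a..b}|lborel. (f x)\<^sup>2)
            \<le> 9 ^ p * (2 * real p + 3) * (t (i + int p) - t (i - 1)) powr (- 1 / 2))"

definition dual_nurbs ::
    "real \<Rightarrow> real \<Rightarrow> nat \<Rightarrow> knots \<Rightarrow> (int \<Rightarrow> real) \<Rightarrow> (real list \<Rightarrow> real \<Rightarrow> real) \<Rightarrow> knots \<Rightarrow> int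
      \<Rightarrow> real \<Rightarrow> real" where
  "dual_nurbs a b p K0 w0 Bst K i t =
     Bst (local_knots a p K i) t * weight_function a p K0 w0 t / weights a b p K0 w0 K i"

definition scott_zhang ::
    "(real \<Rightarrow> real^2) \<Rightarrow> real \<Rightarrow> real \<Rightarrow> nat \<Rightarrow> knots \<Rightarrow> (int \<Rightarrow> real) \<Rightarrow> (real list \<Rightarrow> real \<Rightarrow> real)
      \<Rightarrow> knots \<Rightarrow> (real^2 \<Rightarrow> real) \<Rightarrow> real^2 \<Rightarrow> real" where
  "scott_zhang \<gamma> a b p K0 w0 Bst K v x =
     (let i0 = 1 - int p; i1 = int (size K) - int p;
          R = nurbs \<gamma> a b p K0 w0 K; Rst = dual_nurbs a b p K0 w0 Bst K in
        (LINT t:{a..b}|lborel. (Rst i0 t + Rst i1 t) / 2 * v (\<gamma> t)) * (R i0 x + R i1 x)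
      + (\<Sum>i\<in>{i0 + 1..i1 - 1}. (LINT t:{a..b}|lborel. Rst i t * v (\<gamma> t)) * R i x))"

end

theory Submission
  imports Defs
begin

text \<open>
  Everything is pulled back to the parameter interval \<open>[a,b)\<close>.  The speed of \<open>\<gamma>\<close> is continuous and
  nonzero on the closed pieces of the parametrization, hence lies between two positive constants
  (\<open>speed_bounds\<close>), so \<open>L\<^sup>2\<close> norms and \<open>H\<^sup>1\<close> seminorms on a part of \<open>\<Gamma>\<close> are equivalent to the
  corresponding norms on its preimage, and \<open>H\<^sup>1(\<Gamma>)\<close> becomes the space of absolutely continuous
  functions with equal values at \<open>a\<close> and \<open>b\<close> (\<open>H1_D\<close>, \<open>H1_I\<close>).

  Three facts about the mesh are needed.  The refinement rule keeps the widths of touching elements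
  comparable (\<open>graded_mesh_refinements\<close>); inserting a knot replaces the weights by convex
  combinations of neighbouring ones, so all weights stay in \<open>[wmin, wmax]\<close> (\<open>knot_insertion\<close>,
  \<open>refined_weights\<close>); and the \<open>p\<close>-th patch of an element contains the supports of all B-splines that
  live on the element, has comparable length, and meets only boundedly many other patches
  (\<open>support_in_patch\<close>, \<open>measure_PP\<close>, \<open>patch_overlap\<close>).

  Since the duals are biorthogonal to the B-splines and the coefficient of a basis function only
  sees the support of its dual, the operator reproduces splines locally (\<open>coef_local_projection\<close>).
  Cauchy--Schwarz and the bound on the duals give the local \<open>L\<^sup>2\<close> bound and, with an inverse
  inequality, \<open>\<parallel>(J v)'\<parallel> \<le> C h\<inverse> \<parallel>v\<parallel>\<close> (\<open>local_L2\<close>).  Constants are reproduced, so \<open>v\<close> may be replaced by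
  \<open>v\<close> minus a constant, and a Poincare inequality on the patch turns these two bounds into local
  \<open>H\<^sup>1\<close> stability and into \<open>\<parallel>v - J v\<parallel> \<le> C h \<parallel>v'\<parallel>\<close> (\<open>patch_Poincare\<close>, \<open>local_H1\<close>).

  The interpolation estimates are obtained directly from the \<open>K\<close>-functional.  For the first one, splitting \<open>v = (v - z) + z\<close>
  with \<open>z \<in> H\<^sup>1\<close> and using the \<open>L\<^sup>2\<close> bound for \<open>v - z\<close> and the first order bound for \<open>z\<close> gives

    \<open>\<Sum>\<^sub>I r\<^sup>2 / (h\<^sub>I\<^sup>2 + r\<^sup>2) * \<parallel>v - J v\<parallel>\<^sup>2 \<le> C K(r,v)\<^sup>2\<close>

  with the \<open>I\<close>-th norm taken over the element \<open>I\<close>;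
  integration over \<open>r\<close>, where each summand only needs \<open>r \<in> [h\<^sub>I, 2 h\<^sub>I]\<close>, produces the weight
  \<open>h\<^sub>I powr (- 2 * \<sigma>)\<close> (\<open>K_functional_ge\<close>, \<open>interpolated_error\<close>).  For the second one, a competitor
  for \<open>K(r, v - J v)\<close> is the product of \<open>v - J v\<close> with a cut-off that is close to one where \<open>h\<close> is
  much larger than \<open>r\<close> and close to zero where \<open>h\<close> is much smaller than \<open>r\<close>.  A rational spline with coefficients \<open>\<eta> / (r + \<eta>)\<close>, where \<open>\<eta>\<close> is
  the length of the support of the basis function, has these properties, and its derivative is of
  order \<open>1 / (r + h)\<close>.  This yields

    \<open>K(r, v - J v)\<^sup>2 \<le> C \<Sum>\<^sub>I (r h\<^sub>I / (r + h\<^sub>I))\<^sup>2 * \<parallel>v'\<parallel>\<^sup>2\<close>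

  with the \<open>I\<close>-th norm over the patch of \<open>I\<close>, and the \<open>r\<close>-integral of the kernel is at most a multiple of
  \<open>h\<^sub>I powr (2 - 2 * \<sigma>)\<close> (\<open>K_functional_err\<close>, \<open>kernel_integral\<close>).
\<close>

section \<open>B-splines\<close>

lemma bspline_cong:
  assumes "\<And>j. i - 1 \<le> j \<Longrightarrow> j \<le> i + int q \<Longrightarrow> t j = s j"
  shows "bspline t q i x = bspline s q i x"
  using assms
proof (induction q arbitrary: i)
  case (Suc q)
  have "bspline t q i x = bspline s q i x" "bspline t q (i + 1) x = bspline s q (i + 1) x"
    by (rule Suc.IH; rule Suc.prems; simp)+
  moreover have "t (i - 1) = s (i - 1)" "t (i + int q) = s (i + int q)"
    "t (i + int q + 1) = s (i + int q + 1)" "t i = s i"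
    by (rule Suc.prems; simp)+
  ultimately show ?case by simp
qed simp

lemma borel_measurable_bspline [measurable]: "bspline t q i \<in> borel_measurable borel"
proof (induction q arbitrary: i)
  case 0
  have "bspline t 0 i = indicator {t (i - 1)..<t i}"
    by (auto simp: fun_eq_iff indicator_def)
  then show ?case by simp
next
  case (Suc q)
  have [measurable]: "bspline t q j \<in> borel_measurable borel" for j by (rule Suc)
  have "(\<lambda>x. bspline t (Suc q) i x) \<in> borel_measurable borel" unfolding bspline.simps by measurable
  then show ?case by simp
qed

text \<open>The derivative away from the knots, defined by differentiating the recursion for \<open>bspline\<close>; at
  a knot it takes the value from the right.\<close>

primrec dspline :: "(int \<Rightarrow> real) \<Rightarrow> nat \<Rightarrow> int \<Rightarrow> real \<Rightarrow> real" where
  "dspline t 0 i x = 0"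
| "dspline t (Suc q) i x =
     (bspline t q i x + (x - t (i - 1)) * dspline t q i x) / (t (i + int q) - t (i - 1))
   + ((t (i + int q + 1) - x) * dspline t q (i + 1) x - bspline t q (i + 1) x)
       / (t (i + int q + 1) - t i)"

lemma borel_measurable_dspline [measurable]: "dspline t q i \<in> borel_measurable borel"
proof (induction q arbitrary: i)
  case 0
  have "dspline t 0 i = (\<lambda>x. 0)"
    by (auto simp: fun_eq_iff indicator_def)
  then show ?case by simp
next
  case (Suc q)
  have [measurable]: "dspline t q j \<in> borel_measurable borel" for j by (rule Suc)
  have "(\<lambda>x. dspline t (Suc q) i x) \<in> borel_measurable borel" unfolding dspline.simps by measurable
  then show ?case by simp
qed

text \<open>The left-continuous variant of the B-splines, which gives their left limits.\<close>

primrec bspline_left :: "(int \<Rightarrow> real) \<Rightarrow> nat \<Rightarrow> int \<Rightarrow> real \<Rightarrow> real" where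
  "bspline_left t 0 i x = (if t (i - 1) < x \<and> x \<le> t i then 1 else 0)"
| "bspline_left t (Suc q) i x =
     (x - t (i - 1)) / (t (i + int q) - t (i - 1)) * bspline_left t q i x
   + (t (i + int q + 1) - x) / (t (i + int q + 1) - t i) * bspline_left t q (i + 1) x"

lemma bspline_tendsto_left: "(bspline t q i \<longlongrightarrow> bspline_left t q i x) (at_left x)"
proof (induction q arbitrary: i)
  case 0
  have "eventually (\<lambda>y. bspline t 0 i y = bspline_left t 0 i x) (at_left x)"
  proof (cases "t (i - 1) < x \<and> x \<le> t i")
    case True
    have "eventually (\<lambda>y. y \<in> {t (i - 1)<..<x}) (at_left x)"
      by (rule eventually_at_leftI[of "t (i - 1)"]) (use True in auto)
    then show ?thesis by eventually_elim (use True in auto)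
  next
    case False
    then consider "x \<le> t (i - 1)" | "t i < x" by linarith
    then show ?thesis
    proof cases
      case 1
      have "eventually (\<lambda>y. y < x) (at_left x)" by (simp add: eventually_at_filter)
      then show ?thesis by eventually_elim (use 1 in auto)
    next
      case 2
      have "eventually (\<lambda>y. y \<in> {t i<..<x}) (at_left x)"
        by (rule eventually_at_leftI[of "t i"]) (use 2 in auto)
      then show ?thesis by eventually_elim (use 2 in auto)
    qed
  qed
  then show ?case by (rule tendsto_eventually)
next
  case (Suc q)
  show ?case unfolding bspline.simps bspline_left.simps divide_inverse
    by (intro tendsto_add tendsto_mult Suc tendsto_intros)
qed

lemma bspline_tendsto_right: "(bspline t q i \<longlongrightarrow> bspline t q i x) (at_right x)"
proof (induction q arbitrary: i)
  case 0
  have "eventually (\<lambda>y. bspline t 0 i y = bspline t 0 i x) (at_right x)"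
  proof (cases "t (i - 1) \<le> x \<and> x < t i")
    case True
    have "eventually (\<lambda>y. y \<in> {x<..<t i}) (at_right x)"
      by (rule eventually_at_rightI[of _ "t i"]) (use True in auto)
    then show ?thesis by eventually_elim (use True in auto)
  next
    case False
    then consider "x < t (i - 1)" | "t i \<le> x" by linarith
    then show ?thesis
    proof cases
      case 1
      have "eventually (\<lambda>y. y \<in> {x<..<t (i - 1)}) (at_right x)"
        by (rule eventually_at_rightI[of _ "t (i - 1)"]) (use 1 in auto)
      then show ?thesis by eventually_elim (use 1 in auto)
    next
      case 2
      have "eventually (\<lambda>y. x < y) (at_right x)" by (simp add: eventually_at_filter)
      then show ?thesis by eventually_elim (use 2 in auto)
    qed
  qed
  then show ?case by (rule tendsto_eventually)
next
  case (Suc q)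
  show ?case unfolding bspline.simps
    unfolding divide_inverse by (intro tendsto_add tendsto_mult Suc tendsto_intros)
qed

lemma bspline_support:
  assumes "mono t" "bspline t q i x \<noteq> 0"
  shows "t (i - 1) \<le> x \<and> x < t (i + int q)"
  using assms(2)
proof (induction q arbitrary: i)
  case 0 then show ?case by (auto split: if_splits)
next
  case (Suc q)
  have *: "t (i - 1) \<le> t i" "t (i + int q) \<le> t (i + int q + 1)"
    using \<open>mono t\<close> by (auto intro: monoD)
  have "bspline t q i x \<noteq> 0 \<or> bspline t q (i + 1) x \<noteq> 0" using Suc.prems by auto
  then show ?case using Suc.IH[of i] Suc.IH[of "i + 1"] * by (auto simp: algebra_simps)
qed

lemma dspline_support:
  assumes "mono t" "dspline t q i x \<noteq> 0"
  shows "t (i - 1) \<le> x \<and> x < t (i + int q)"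
  using assms(2)
proof (induction q arbitrary: i)
  case 0 then show ?case by simp
next
  case (Suc q)
  have *: "t (i - 1) \<le> t i" "t (i + int q) \<le> t (i + int q + 1)"
    using \<open>mono t\<close> by (auto intro: monoD)
  have "bspline t q i x \<noteq> 0 \<or> bspline t q (i + 1) x \<noteq> 0 \<or> dspline t q i x \<noteq> 0 \<or> dspline t q (i + 1) x \<noteq> 0"
    using Suc.prems by auto
  moreover have "t (i - 1) \<le> x \<and> x < t (i + int q)" if "bspline t q i x \<noteq> 0 \<or> dspline t q i x \<noteq> 0"
    using that Suc.IH[of i] bspline_support[OF assms(1), of q i x] by blast
  moreover have "t i \<le> x \<and> x < t (i + int q + 1)" if "bspline t q (i + 1) x \<noteq> 0 \<or> dspline t q (i + 1) x \<noteq> 0"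
  proof -
    have "i + 1 - 1 = i" "i + 1 + int q = i + int q + 1" by auto
    then show ?thesis
      using that Suc.IH[of "i + 1"] bspline_support[OF assms(1), of q "i + 1" x] by metis
  qed
  ultimately have "t (i - 1) \<le> x" "x < t (i + int q + 1)" using * by force+
  moreover have "i + int (Suc q) = i + int q + 1" by simp
  ultimately show ?case by metis
qed

lemma support_index_range:
  assumes "mono t" "t (J - 1) \<le> x" "x < t J" "t (i - 1) \<le> x" "x < t (i + int q)"
  shows "i \<in> {J - int q..J}"
proof -
  have "i - 1 < J"
  proof (rule ccontr)
    assume "\<not> i - 1 < J" then show False using monoD[OF assms(1), of J "i - 1"] assms by simp
  qed
  moreover have "J - 1 < i + int q"
  proof (rule ccontr)
    assume "\<not> J - 1 < i + int q" then show False using monoD[OF assms(1), of "i + int q" "J - 1"] assms by simp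
  qed
  ultimately show ?thesis by simp
qed

lemma bspline_nonneg:
  assumes "mono t" shows "0 \<le> bspline t q i x"
proof (induction q arbitrary: i)
  case (Suc q)
  have 1: "0 \<le> (x - t (i - 1)) / (t (i + int q) - t (i - 1)) * bspline t q i x"
  proof (cases "bspline t q i x = 0")
    case False
    then show ?thesis using bspline_support[OF assms False] Suc.IH[of i] by simp
  qed simp
  have 2: "0 \<le> (t (i + int q + 1) - x) / (t (i + int q + 1) - t i) * bspline t q (i + 1) x"
  proof (cases "bspline t q (i + 1) x = 0")
    case False
    then show ?thesis using bspline_support[OF assms False] Suc.IH[of "i+1"] by (simp add: algebra_simps)
  qed simp
  show ?case using 1 2 by simp
qed simp

text \<open>The two fractions that the recursion attaches to one B-spline of lower degree add up to one, so the
  sums for consecutive degrees agree.\<close>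

lemma bspline_partition_of_unity:
  assumes "mono t" "t (J - 1) \<le> x" "x < t J"
  shows "(\<Sum>i\<in>{J - int q..J}. bspline t q i x) = 1"
proof (induction q)
  case 0 then show ?case using assms by simp
next
  case (Suc q)
  define L where "L i = (x - t (i - 1)) / (t (i + int q) - t (i - 1))" for i
  have nz: "t (i - 1) < t (i + int q)" if "i \<in> {J - int q..J}" for i
    using monoD[OF assms(1), of "i - 1" "J - 1"] monoD[OF assms(1), of J "i + int q"] that assms by auto
  have out: "bspline t q i x = 0" if "i \<notin> {J - int q..J}" for i
    using bspline_support[OF assms(1), of q i x] support_index_range[OF assms] that by blast
  have R: "(t (i + int q) - x) / (t (i + int q) - t (i - 1)) * bspline t q i x = (1 - L i) * bspline t q i x" for i
    using nz[of i] out[of i] by (cases "i \<in> {J - int q..J}") (auto simp: L_def field_simps)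
  have "(\<Sum>i\<in>{J - int (Suc q)..J}. bspline t (Suc q) i x) =
     (\<Sum>i\<in>{J - int (Suc q)..J}. L i * bspline t q i x) + (\<Sum>i\<in>{J - int (Suc q)..J}. (1 - L (i + 1)) * bspline t q (i + 1) x)"
    unfolding sum.distrib[symmetric]
  proof (rule sum.cong)
    fix i show "bspline t (Suc q) i x = L i * bspline t q i x + (1 - L (i + 1)) * bspline t q (i + 1) x"
      using R[of "i + 1"] by (simp add: L_def[of i] algebra_simps)
  qed simp
  also have "(\<Sum>i\<in>{J - int (Suc q)..J}. L i * bspline t q i x) = (\<Sum>i\<in>{J - int q..J}. L i * bspline t q i x)"
    by (rule sum.mono_neutral_right) (auto simp: out)
  also have "(\<Sum>i\<in>{J - int (Suc q)..J}. (1 - L (i + 1)) * bspline t q (i + 1) x)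
      = (\<Sum>i\<in>{J - int q..J + 1}. (1 - L i) * bspline t q i x)"
    by (rule sum.reindex_bij_witness[of _ "\<lambda>i. i - 1" "\<lambda>i. i + 1"]) auto
  also have "\<dots> = (\<Sum>i\<in>{J - int q..J}. (1 - L i) * bspline t q i x)"
    by (rule sum.mono_neutral_right) (auto simp: out)
  also have "(\<Sum>i\<in>{J - int q..J}. L i * bspline t q i x) + \<dots> = (\<Sum>i\<in>{J - int q..J}. bspline t q i x)"
    by (simp add: sum.distrib[symmetric] algebra_simps)
  finally show ?case using Suc by simp
qed

lemma bspline_outside:
  assumes "mono t" "t (J - 1) \<le> x" "x < t J" "i \<notin> {J - int q..J}"
  shows "bspline t q i x = 0" "dspline t q i x = 0"
  using bspline_support[OF assms(1), of q i x] dspline_support[OF assms(1), of q i x]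
    support_index_range[OF assms(1-3), of i q] assms(4) by argo+

lemma bspline_le_1:
  assumes "mono t" "t (J - 1) \<le> x" "x < t J"
  shows "bspline t q i x \<le> 1"
proof (cases "i \<in> {J - int q..J}")
  case True
  then have "bspline t q i x \<le> (\<Sum>i\<in>{J - int q..J}. bspline t q i x)"
    by (intro member_le_sum bspline_nonneg[OF assms(1)]) auto
  then show ?thesis using bspline_partition_of_unity[OF assms] by simp
qed (use bspline_outside[OF assms] in auto)

lemma bspline_has_derivative:
  assumes "mono t" "t (J - 1) < x" "x < t J"
  shows "(bspline t q i has_real_derivative dspline t q i x) (at x)"
proof (induction q arbitrary: i)
  case 0
  have *: "bspline t 0 i y = (if i = J then 1 else 0)" if y: "y \<in> {t (J - 1)<..<t J}" for y
  proof (cases "i = J")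
    case False
    have "t (J - 1) \<le> y" "y < t J" using y by auto
    then have "bspline t 0 i y = 0" using False by (intro bspline_outside(1)[OF assms(1), of J]) auto
    then show ?thesis using False by simp
  qed (use y in auto)
  have "((\<lambda>y. if i = J then 1 else 0) has_real_derivative 0) (at x)" by simp
  moreover have "x \<in> {t (J - 1)<..<t J}" using assms by simp
  ultimately have "(bspline t 0 i has_real_derivative 0) (at x)"
    by (rule has_field_derivative_transform_within_open[OF _ open_greaterThanLessThan]) (rule *[symmetric])
  then show ?case unfolding dspline.simps .
next
  case (Suc q)
  have "((\<lambda>x. (x - t (i - 1)) * inverse (t (i + int q) - t (i - 1)) * bspline t q i x
     + (t (i + int q + 1) - x) * inverse (t (i + int q + 1) - t i) * bspline t q (i + 1) x) has_real_derivative
     ((1 - 0) * inverse (t (i + int q) - t (i - 1)) * bspline t q i x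
        + dspline t q i x * ((x - t (i - 1)) * inverse (t (i + int q) - t (i - 1)))
      + ((0 - 1) * inverse (t (i + int q + 1) - t i) * bspline t q (i + 1) x
        + dspline t q (i + 1) x * ((t (i + int q + 1) - x) * inverse (t (i + int q + 1) - t i))))) (at x)"
    by (intro DERIV_add DERIV_mult DERIV_cmult_right DERIV_diff DERIV_ident DERIV_const Suc.IH)
  moreover have "(1 - 0) * c * B + D * (u * c) + ((0 - 1) * d * B' + D' * (v * d))
     = (B + u * D) * c + (v * D' - B') * d" for c B D u d B' D' v :: real by (simp add: algebra_simps)
  ultimately show ?case unfolding bspline.simps dspline.simps divide_inverse by (simp only:)
qed

text \<open>The recursion differentiates to two terms, each a quotient by the length of a support that contains
  the cell of \<open>x\<close>.  The factor in front of the lower derivative is at most this length, so every degree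
  costs a factor of at most four.\<close>

lemma abs_dspline_le:
  assumes "mono t" "t (J - 1) \<le> x" "x < t J"
  shows "\<bar>dspline t q i x\<bar> \<le> 4 ^ q / (t J - t (J - 1))"
proof (induction q arbitrary: i)
  case 0
  have "t (J - 1) \<le> t J" using assms(2,3) by linarith
  then show ?case by simp
next
  case (Suc q)
  define h where "h = t J - t (J - 1)"
  have h: "h > 0" using assms by (simp add: h_def)
  have *: "\<bar>(s * bspline t q i x + y * dspline t q i x) / (t (i + int q) - t (i - 1))\<bar> \<le> (1 + 4 ^ q) / h"
    if y: "i \<in> {J - int q..J} \<Longrightarrow> \<bar>y\<bar> \<le> t (i + int q) - t (i - 1)" and s: "\<bar>s\<bar> = 1" for i s y
  proof (cases "i \<in> {J - int q..J}")
    case True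
    define w where "w = t (i + int q) - t (i - 1)"
    have "t (i - 1) \<le> t (J - 1)" "t J \<le> t (i + int q)" using True by (auto intro!: monoD[OF assms(1)])
    then have w: "h \<le> w" unfolding h_def w_def by linarith
    have yw: "\<bar>y\<bar> \<le> w" using y[OF True] unfolding w_def .
    have 1: "\<bar>y * dspline t q i x\<bar> \<le> w * (4 ^ q / h)"
      unfolding abs_mult by (rule mult_mono[OF yw]) (use Suc.IH[of i] h w in \<open>simp_all add: h_def\<close>)
    have "\<bar>s * bspline t q i x\<bar> \<le> 1"
      using bspline_le_1[OF assms, of q i] bspline_nonneg[OF assms(1), of q i x] s by (simp add: abs_mult)
    also have "1 \<le> w * (1 / h)" using h w by simp
    finally have 2: "\<bar>s * bspline t q i x\<bar> \<le> w * (1 / h)" .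
    have "w * ((1 + 4 ^ q) / h) = w * (1 / h) + w * (4 ^ q / h)" by (simp add: add_divide_distrib distrib_left)
    then have "\<bar>s * bspline t q i x + y * dspline t q i x\<bar> \<le> w * ((1 + 4 ^ q) / h)"
      using 1 2 abs_triangle_ineq[of "s * bspline t q i x" "y * dspline t q i x"] by linarith
    moreover have "0 < w" using h w by linarith
    ultimately show ?thesis unfolding w_def[symmetric] abs_divide
      by (simp add: pos_divide_le_eq mult.commute)
  next
    case False
    show ?thesis unfolding bspline_outside[OF assms False] using h by simp
  qed
  have tJ: "t (i - 1) \<le> t (J - 1) \<and> t J \<le> t (i + int q)" if "i \<in> {J - int q..J}" for i
    using that by (auto intro!: monoD[OF assms(1)])
  have "\<bar>(1 * bspline t q i x + (x - t (i - 1)) * dspline t q i x) / (t (i + int q) - t (i - 1))\<bar> \<le> (1 + 4 ^ q) / h"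
  proof (rule *)
    assume "i \<in> {J - int q..J}"
    then show "\<bar>x - t (i - 1)\<bar> \<le> t (i + int q) - t (i - 1)" using tJ[of i] assms(2,3) by linarith
  qed simp
  then have 1: "\<bar>(bspline t q i x + (x - t (i - 1)) * dspline t q i x) / (t (i + int q) - t (i - 1))\<bar> \<le> (1 + 4 ^ q) / h"
    by (simp only: mult_1)
  have "\<bar>(- 1 * bspline t q (i + 1) x + (t (i + 1 + int q) - x) * dspline t q (i + 1) x)
      / (t (i + 1 + int q) - t (i + 1 - 1))\<bar> \<le> (1 + 4 ^ q) / h"
  proof (rule *)
    assume "i + 1 \<in> {J - int q..J}"
    then show "\<bar>t (i + 1 + int q) - x\<bar> \<le> t (i + 1 + int q) - t (i + 1 - 1)" using tJ[of "i + 1"] assms(2,3) by linarith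
  qed simp
  moreover have "i + 1 + int q = i + int q + 1" "i + 1 - 1 = i" by auto
  moreover have "- 1 * B + C = C - B" for B C :: real by simp
  ultimately have 2: "\<bar>((t (i + int q + 1) - x) * dspline t q (i + 1) x - bspline t q (i + 1) x)
       / (t (i + int q + 1) - t i)\<bar> \<le> (1 + 4 ^ q) / h" by metis
  have "\<bar>dspline t (Suc q) i x\<bar> \<le> (1 + 4 ^ q) / h + (1 + 4 ^ q) / h"
    unfolding dspline.simps by (rule order_trans[OF abs_triangle_ineq add_mono[OF 1 2]])
  also have "\<dots> = (2 + 2 * 4 ^ q) / h" by (simp add: add_divide_distrib)
  also have "\<dots> \<le> 4 ^ Suc q / h"
    using one_le_power[of "4::real" q] h by (intro divide_right_mono) auto
  finally show ?case unfolding h_def .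
qed

text \<open>At a knot of multiplicity at least \<open>m\<close> the B-splines of degree \<open>k \<le> m\<close> are interpolatory: only the
  one whose \<open>k\<close> interior knots all lie there survives.\<close>

lemma bspline_at_knot:
  assumes "mono t" "t (J - 1) \<le> \<tau>" "\<tau> < t J"
    "\<And>l. J - int m \<le> l \<Longrightarrow> l < J \<Longrightarrow> t l = \<tau>" "k \<le> m"
  shows "bspline t k i \<tau> = (if i = J - int k then 1 else 0)"
  using \<open>k \<le> m\<close>
proof (induction k arbitrary: i)
  case 0
  have "i = J" if "t (i - 1) \<le> \<tau>" "\<tau> < t i"
    using support_index_range[OF assms(1-3), of i 0] that by simp
  then show ?case using assms(2,3) by (cases "i = J") (simp_all, argo)
next
  case (Suc k)
  have IH: "bspline t k i \<tau> = (if i = J - int k then 1 else 0)" for i using Suc by simp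
  have "t (J - int k - 1) = \<tau>" using Suc.prems by (intro assms(4)) auto
  then show ?case using assms(3) by (auto simp: IH algebra_simps)
qed

lemma bspline_left_at_knot:
  assumes "mono t" "t (j - 1) < \<tau>" "\<tau> \<le> t j"
    "\<And>l. j \<le> l \<Longrightarrow> l < j + int m \<Longrightarrow> t l = \<tau>" "k \<le> m"
  shows "bspline_left t k i \<tau> = (if i = j then 1 else 0)"
  using \<open>k \<le> m\<close>
proof (induction k arbitrary: i)
  case 0
  have "i = j" if "t (i - 1) < \<tau>" "\<tau> \<le> t i"
  proof (rule antisym; rule ccontr)
    assume "\<not> i \<le> j" then show False using monoD[OF assms(1), of j "i - 1"] that assms by simp
  next
    assume "\<not> j \<le> i" then show False using monoD[OF assms(1), of i "j - 1"] that assms by simp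
  qed
  then show ?case using assms(2,3) by (cases "i = j") (simp_all, argo)
next
  case (Suc k)
  have IH: "bspline_left t k i \<tau> = (if i = j then 1 else 0)" for i using Suc by simp
  have "t (j + int k) = \<tau>" using Suc.prems by (intro assms(4)) auto
  then show ?case using assms(2) by (auto simp: IH algebra_simps)
qed

text \<open>Continuity at a knot whose multiplicity does not exceed the degree: for degree equal to the
  multiplicity both one-sided values are given by the interpolation property, and higher degrees
  inherit the equality through the recursion, whose coefficients are continuous.\<close>

lemma bspline_left_eq_bspline:
  assumes "mono t" "t (j - 1) < \<tau>" "\<tau> \<le> t j" "t (j + int m - 1) \<le> \<tau>" "\<tau> < t (j + int m)" "m \<le> q"
  shows "bspline_left t q i \<tau> = bspline t q i \<tau>"
proof -
  have base: "bspline_left t m i \<tau> = bspline t m i \<tau>" for i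
  proof -
    have *: "t l = \<tau>" if "j \<le> l" "l < j + int m" for l
      using monoD[OF assms(1), of j l] monoD[OF assms(1), of l "j + int m - 1"] that assms by simp
    show ?thesis
      using bspline_left_at_knot[OF assms(1-3) *, of m m i] bspline_at_knot[OF assms(1,4,5), of m m i] * by simp
  qed
  show ?thesis
    using \<open>m \<le> q\<close>
  proof (induction q arbitrary: i rule: dec_induct)
    case base then show ?case by (rule \<open>\<And>i. bspline_left t m i \<tau> = bspline t m i \<tau>\<close>)
  next
    case (step n)
    show ?case unfolding bspline_left.simps bspline.simps step.IH ..
  qed
qed

text \<open>The ratio from Boehm's knot insertion algorithm.  The first two cases also cover degenerate supports,
  where the quotient would be \<open>x / 0\<close>.\<close>

definition insertion_coeff :: "(int \<Rightarrow> real) \<Rightarrow> real \<Rightarrow> nat \<Rightarrow> int \<Rightarrow> real" where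
  "insertion_coeff s z q i =
     (if z \<le> s (i - 1) then 0 else if s (i + int q) \<le> z then 1
      else (z - s (i - 1)) / (s (i + int q) - s (i - 1)))"

lemma insertion_coeff_bounds:
  shows "0 \<le> insertion_coeff s z q i" "insertion_coeff s z q i \<le> 1"
  by (auto simp: insertion_coeff_def)

lemma insertion_coeff_0: "z \<le> s (i - 1) \<Longrightarrow> insertion_coeff s z q i = 0"
  by (simp add: insertion_coeff_def)

lemma insertion_coeff_1: "s (i - 1) < s (i + int q) \<Longrightarrow> s (i + int q) \<le> z \<Longrightarrow> insertion_coeff s z q i = 1"
  by (simp add: insertion_coeff_def)

lemma insertion_coeff_mid:
  "s (i - 1) < s (i + int q) \<Longrightarrow> s (i - 1) \<le> z \<Longrightarrow> z \<le> s (i + int q)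
   \<Longrightarrow> insertion_coeff s z q i = (z - s (i - 1)) / (s (i + int q) - s (i - 1))"
  by (cases "z = s (i + int q)") (auto simp: insertion_coeff_def)

text \<open>The three identities between the recursion coefficients that make knot insertion compatible with the
  recursion.  They only hold on nondegenerate supports; on degenerate ones the corresponding B-spline
  vanishes.\<close>

lemma knot_insertion_step:
  fixes t s :: "int \<Rightarrow> real" and q :: nat and i :: int
  assumes mono: "mono s" and t: "\<And>j. t j = (if j \<le> r then s j else s (j + 1))" and z: "z = s (r + 1)"
  defines "\<alpha> \<equiv> insertion_coeff s z"
  shows "s (i - 1) < s (i + int q) \<Longrightarrow>
      (x - t (i - 1)) / (t (i + int q) - t (i - 1)) * \<alpha> q i
      = \<alpha> (Suc q) i * ((x - s (i - 1)) / (s (i + int q) - s (i - 1)))" (is "_ \<Longrightarrow> ?X")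
    and "s i < s (i + int q + 1) \<Longrightarrow>
      (x - t (i - 1)) / (t (i + int q) - t (i - 1)) * (1 - \<alpha> q (i + 1))
      + (t (i + int q + 1) - x) / (t (i + int q + 1) - t i) * \<alpha> q (i + 1)
      = \<alpha> (Suc q) i * ((s (i + int q + 1) - x) / (s (i + int q + 1) - s i))
      + (1 - \<alpha> (Suc q) (i + 1)) * ((x - s i) / (s (i + int q + 1) - s i))" (is "_ \<Longrightarrow> ?Y")
    and "s (i + 1) < s (i + int q + 2) \<Longrightarrow>
      (t (i + int q + 1) - x) / (t (i + int q + 1) - t i) * (1 - \<alpha> q (i + 2))
      = (1 - \<alpha> (Suc q) (i + 1)) * ((s (i + int q + 2) - x) / (s (i + int q + 2) - s (i + 1)))" (is "_ \<Longrightarrow> ?Z")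
proof -
  have sm: "s j \<le> s k" if "j \<le> k" for j k using mono that by (rule monoD)
  have lo: "s j \<le> z" if "j \<le> r + 1" for j using sm[OF that] z by simp
  have hi: "z \<le> s j" if "r + 1 \<le> j" for j using sm[OF that] z by simp
  have e[simp]: "i + int (Suc q) = i + int q + 1" "i + 1 + int q = i + int q + 1" "i + 1 + int (Suc q) = i + int q + 2"
    "i + 2 + int q = i + int q + 2" "i + 1 - 1 = i" "i + 2 - 1 = i + 1" "i - 1 + 1 = i" "i + int q + 1 + 1 = i + int q + 2"
    "i + (1 + int q) = i + int q + 1" "2 + (i + int q) = i + int q + 2" by auto
  show ?X if nd: "s (i - 1) < s (i + int q)"
  proof (cases "i - 1 \<le> r")
    case False
    then have "z \<le> s (i - 1)" by (intro hi) simp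
    then show ?thesis by (simp add: \<alpha>_def insertion_coeff_0)
  next
    case True
    then have ti: "t (i - 1) = s (i - 1)" and zi: "s (i - 1) \<le> z" by (auto simp: t intro: lo)
    have nd': "s (i - 1) < s (i + int q + 1)" using nd sm[of "i + int q" "i + int q + 1"] by simp
    show ?thesis
    proof (cases "i + int q \<le> r")
      case True
      then have "s (i + int q) \<le> z" "s (i + int q + 1) \<le> z" by (auto intro: lo)
      then have "\<alpha> q i = 1" "\<alpha> (Suc q) i = 1" using nd nd' by (auto simp: \<alpha>_def intro!: insertion_coeff_1)
      then show ?thesis using True ti by (simp add: t)
    next
      case False
      then have "z \<le> s (i + int q)" "z \<le> s (i + int q + 1)" by (auto intro: hi)
      then have "\<alpha> q i = (z - s (i - 1)) / (s (i + int q) - s (i - 1))"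
        "\<alpha> (Suc q) i = (z - s (i - 1)) / (s (i + int q + 1) - s (i - 1))"
        unfolding \<alpha>_def using nd nd' zi by (subst insertion_coeff_mid; simp)+
      then show ?thesis using False ti by (simp add: t)
    qed
  qed
  show ?Z if nd: "s (i + 1) < s (i + int q + 2)"
  proof (cases "i + int q + 1 \<le> r")
    case True
    then have "s (i + int q + 2) \<le> z" by (intro lo) simp
    then have "\<alpha> q (i + 2) = 1" "\<alpha> (Suc q) (i + 1) = 1"
      using nd sm[of i "i + 1"] by (auto simp: \<alpha>_def intro!: insertion_coeff_1)
    then show ?thesis by simp
  next
    case False
    then have ti: "t (i + int q + 1) = s (i + int q + 2)" and zi: "z \<le> s (i + int q + 2)" by (auto simp: t intro: hi)
    have nd': "s i < s (i + int q + 2)" using nd sm[of i "i + 1"] by simp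
    show ?thesis
    proof (cases "i \<le> r")
      case False
      then have "z \<le> s i" "z \<le> s (i + 1)" by (auto intro: hi)
      then have "\<alpha> q (i + 2) = 0" "\<alpha> (Suc q) (i + 1) = 0" by (auto simp: \<alpha>_def intro!: insertion_coeff_0)
      then show ?thesis using False ti by (simp add: t)
    next
      case True
      then have zz: "s (i + 1) \<le> z" "s i \<le> z" by (auto intro: lo)
      have "\<alpha> q (i + 2) = (z - s (i + 1)) / (s (i + int q + 2) - s (i + 1))"
        "\<alpha> (Suc q) (i + 1) = (z - s i) / (s (i + int q + 2) - s i)"
        unfolding \<alpha>_def using nd nd' zi zz by (subst insertion_coeff_mid; simp)+
      then have "1 - \<alpha> q (i + 2) = (s (i + int q + 2) - z) / (s (i + int q + 2) - s (i + 1))"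
        "1 - \<alpha> (Suc q) (i + 1) = (s (i + int q + 2) - z) / (s (i + int q + 2) - s i)"
        using nd nd' by (auto simp: field_simps)
      then show ?thesis using True ti by (simp add: t)
    qed
  qed
  show ?Y if nd: "s i < s (i + int q + 1)"
  proof -
    define A B C D where "A = s (i - 1)" and "B = s i" and "C = s (i + int q + 1)" and "D = s (i + int q + 2)"
    have ord: "A \<le> B" "B < C" "C \<le> D" using nd sm[of "i - 1" i] sm[of "i + int q + 1" "i + int q + 2"]
      by (auto simp: A_def B_def C_def D_def)
    \<comment> \<open>the position of the new knot \<open>z = s (r + 1)\<close> relative to the support \<open>[B, C]\<close> of the middle B-spline\<close>
    consider "r + 1 < i" | "r + 1 = i" | "i \<le> r" "r \<le> i + int q - 1" | "r = i + int q" | "i + int q < r" by linarith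
    then show ?thesis
    proof cases
      case 1
      then have "z \<le> s (i - 1)" "z \<le> s i" by (auto intro: hi)
      then have "\<alpha> q (i + 1) = 0" "\<alpha> (Suc q) (i + 1) = 0" "\<alpha> (Suc q) i = 0"
        by (auto simp: \<alpha>_def intro!: insertion_coeff_0)
      then show ?thesis using 1 by (simp add: t)
    next
      case 2
      then have zB: "z = B" by (simp add: B_def z)
      have "\<alpha> q (i + 1) = 0" "\<alpha> (Suc q) (i + 1) = 0"
        by (auto simp: \<alpha>_def zB B_def intro!: insertion_coeff_0)
      moreover have "\<alpha> (Suc q) i = (B - A) / (C - A)"
        unfolding \<alpha>_def using ord by (subst insertion_coeff_mid) (auto simp: zB A_def B_def C_def)
      moreover have "t (i - 1) = A" "t (i + int q) = C" using 2 by (auto simp: t A_def C_def)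
      moreover have "(x - A) / (C - A) = (B - A) / (C - A) * ((C - x) / (C - B)) + (x - B) / (C - B)"
        using ord by (simp add: divide_simps) (simp add: algebra_simps)
      ultimately show ?thesis by (simp add: B_def[symmetric] C_def[symmetric])
    next
      case 3
      have zB: "B \<le> z" "z \<le> C" unfolding B_def C_def using 3 by (auto intro: lo hi)
      have "\<alpha> q (i + 1) = (z - B) / (C - B)" "\<alpha> (Suc q) (i + 1) = (z - B) / (D - B)"
        "\<alpha> (Suc q) i = (z - A) / (C - A)"
        unfolding \<alpha>_def using ord zB by (subst insertion_coeff_mid; simp add: A_def B_def C_def D_def)+
      then have *: "1 - \<alpha> q (i + 1) = (C - z) / (C - B)" "1 - \<alpha> (Suc q) (i + 1) = (D - z) / (D - B)"
        "\<alpha> q (i + 1) = (z - B) / (C - B)" "\<alpha> (Suc q) i = (z - A) / (C - A)"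
        using ord by (auto simp: field_simps)
      have tt: "t (i - 1) = A" "t (i + int q) = C" "t (i + int q + 1) = D" "t i = B"
        using 3 by (auto simp: t A_def B_def C_def D_def)
      have "(x - A) / (C - A) * ((C - z) / (C - B)) - (z - A) / (C - A) * ((C - x) / (C - B)) = (x - z) / (C - B)"
        using ord by (simp add: divide_simps) (simp add: algebra_simps)
      moreover have "(D - z) / (D - B) * ((x - B) / (C - B)) - (D - x) / (D - B) * ((z - B) / (C - B)) = (x - z) / (C - B)"
        using ord by (simp add: divide_simps) (simp add: algebra_simps)
      ultimately show ?thesis unfolding *(1,2) tt A_def[symmetric] B_def[symmetric] C_def[symmetric]
        unfolding *(3,4) by linarith
    next
      case 4
      then have zC: "z = C" by (simp add: C_def z)
      have "\<alpha> q (i + 1) = 1" "\<alpha> (Suc q) i = 1"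
        unfolding \<alpha>_def using ord by (subst insertion_coeff_1; simp add: zC A_def B_def C_def)+
      moreover have "\<alpha> (Suc q) (i + 1) = (C - B) / (D - B)"
        unfolding \<alpha>_def using ord by (subst insertion_coeff_mid) (auto simp: zC B_def D_def)
      moreover have "t i = B" "t (i + int q + 1) = D" using 4 by (auto simp: t B_def D_def)
      moreover have "(D - x) / (D - B) = (C - x) / (C - B) + (1 - (C - B) / (D - B)) * ((x - B) / (C - B))"
        using ord by (simp add: divide_simps) (simp add: algebra_simps)
      ultimately show ?thesis by (simp add: B_def[symmetric] C_def[symmetric])
    next
      case 5
      then have "s (i + int q + 1) \<le> z" "s (i + int q + 2) \<le> z" by (auto intro: lo)
      moreover have "s (i - 1) < s (i + int q + 1)" "s i < s (i + int q + 2)" using ord by (auto simp: A_def B_def C_def D_def)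
      ultimately have "\<alpha> q (i + 1) = 1" "\<alpha> (Suc q) (i + 1) = 1" "\<alpha> (Suc q) i = 1"
        unfolding \<alpha>_def using nd by (subst insertion_coeff_1; simp)+
      then show ?thesis using 5 by (simp add: t)
    qed
  qed
qed

text \<open>Every B-spline for the coarse knots is a combination, with coefficients in \<open>[0,1]\<close>, of two B-splines
  for the knots with one more knot \<open>z\<close>: induction over the degree, comparing the coefficients of the three fine
  B-splines of lower degree.\<close>

lemma knot_insertion:
  fixes t s :: "int \<Rightarrow> real"
  assumes mono: "mono s" and t: "\<And>j. t j = (if j \<le> r then s j else s (j + 1))" and z: "z = s (r + 1)"
  shows "bspline t q i x = insertion_coeff s z q i * bspline s q i x
           + (1 - insertion_coeff s z q (i + 1)) * bspline s q (i + 1) x"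
proof (induction q arbitrary: i)
  case 0
  have sm: "s j \<le> s k" if "j \<le> k" for j k using mono that by (rule monoD)
  consider "i \<le> r" | "i = r + 1" | "r + 1 < i" by linarith
  then show ?case
  proof cases
    case 1
    then have "s i \<le> z" "s (i + 1) \<le> z" using sm z by auto
    moreover have "bspline t 0 i x = bspline s 0 i x" using 1 by (simp add: t)
    ultimately show ?thesis by (auto simp: insertion_coeff_def)
  next
    case 2
    then show ?thesis using sm[of r "r + 1"] sm[of "r + 1" "r + 2"]
      by (auto simp: insertion_coeff_def t z algebra_simps)
  next
    case 3
    then have "z \<le> s (i - 1)" "z \<le> s i" using sm z by auto
    moreover have "bspline t 0 i x = bspline s 0 (i + 1) x" using 3 by (simp add: t)
    ultimately show ?thesis by (auto simp: insertion_coeff_def)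
  qed
next
  case (Suc q)
  let ?\<alpha> = "insertion_coeff s z"
  define X Y Z where "X = bspline s q i x" and "Y = bspline s q (i + 1) x" and "Z = bspline s q (i + 2) x"
  note step = knot_insertion_step[OF mono t z, of i q x]
  define c d where "c = (x - t (i - 1)) / (t (i + int q) - t (i - 1))"
    and "d = (t (i + int q + 1) - x) / (t (i + int q + 1) - t i)"
  define e1 e2 e3 e4 where "e1 = (x - s (i - 1)) / (s (i + int q) - s (i - 1))"
    and "e2 = (s (i + int q + 1) - x) / (s (i + int q + 1) - s i)"
    and "e3 = (x - s i) / (s (i + int q + 1) - s i)"
    and "e4 = (s (i + int q + 2) - x) / (s (i + int q + 2) - s (i + 1))"
  have eqs: "i + 1 + int q = i + int q + 1" "i + 1 + int q + 1 = i + int q + 2" "i + 1 - 1 = i" "i + 1 + 1 = i + 2"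
    "i + 2 + int q = i + int q + 2" "i + 2 - 1 = i + 1" "i + int q + 1 + 1 = i + int q + 2" by auto
  have X: "X = 0 \<or> c * ?\<alpha> q i = ?\<alpha> (Suc q) i * e1"
    using bspline_support[OF mono, of q i x] step(1) unfolding X_def c_def e1_def by fastforce
  have Y: "Y = 0 \<or> c * (1 - ?\<alpha> q (i + 1)) + d * ?\<alpha> q (i + 1) = ?\<alpha> (Suc q) i * e2 + (1 - ?\<alpha> (Suc q) (i + 1)) * e3"
    using bspline_support[OF mono, of q "i + 1" x] step(2) unfolding Y_def c_def d_def e2_def e3_def eqs by fastforce
  have Z: "Z = 0 \<or> d * (1 - ?\<alpha> q (i + 2)) = (1 - ?\<alpha> (Suc q) (i + 1)) * e4"
    using bspline_support[OF mono, of q "i + 2" x] step(3) unfolding Z_def d_def e4_def eqs by fastforce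
  have "bspline t (Suc q) i x = c * (?\<alpha> q i * X + (1 - ?\<alpha> q (i + 1)) * Y) + d * (?\<alpha> q (i + 1) * Y + (1 - ?\<alpha> q (i + 2)) * Z)"
    unfolding bspline.simps c_def d_def X_def Y_def Z_def Suc.IH eqs ..
  also have "\<dots> = (c * ?\<alpha> q i) * X + (c * (1 - ?\<alpha> q (i + 1)) + d * ?\<alpha> q (i + 1)) * Y + (d * (1 - ?\<alpha> q (i + 2))) * Z"
    by (simp add: algebra_simps)
  also have "\<dots> = (?\<alpha> (Suc q) i * e1) * X + (?\<alpha> (Suc q) i * e2 + (1 - ?\<alpha> (Suc q) (i + 1)) * e3) * Y
      + ((1 - ?\<alpha> (Suc q) (i + 1)) * e4) * Z"
    using X Y Z by auto
  also have "\<dots> = ?\<alpha> (Suc q) i * (e1 * X + e2 * Y) + (1 - ?\<alpha> (Suc q) (i + 1)) * (e3 * Y + e4 * Z)"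
    by (simp add: algebra_simps)
  also have "\<dots> = ?\<alpha> (Suc q) i * bspline s (Suc q) i x + (1 - ?\<alpha> (Suc q) (i + 1)) * bspline s (Suc q) (i + 1) x"
    unfolding bspline.simps e1_def e2_def e3_def e4_def X_def Y_def Z_def eqs ..
  finally show ?case .
qed

section \<open>Knot sequences\<close>

text \<open>The knots continued by \<open>b\<close>.  The knot function of the spline space is only meaningful up to index
  \<open>N\<close>; a sequence that is monotone on all of \<open>\<int>\<close> lets the lemmas on B-splines apply without
  range conditions.\<close>

definition knot_ext :: "real \<Rightarrow> real \<Rightarrow> knots \<Rightarrow> int \<Rightarrow> real" where
  "knot_ext a b K i = (if i \<le> 0 then a else if i \<le> int (size K) then sorted_list_of_multiset K ! nat (i - 1) else b)"

lemma insort_split: "\<exists>ys zs. xs = ys @ zs \<and> insort z xs = ys @ z # zs"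
proof (induction xs)
  case (Cons x xs)
  then obtain ys zs where *: "xs = ys @ zs" "insort z xs = ys @ z # zs" by blast
  show ?case
  proof (cases "z \<le> x")
    case True
    then have "x # xs = [] @ (x # xs) \<and> insort z (x # xs) = [] @ z # (x # xs)" by simp
    then show ?thesis by blast
  next
    case False
    then have "x # xs = (x # ys) @ zs \<and> insort z (x # xs) = (x # ys) @ z # zs" using * by simp
    then show ?thesis by blast
  qed
qed simp

locale knot_seq =
  fixes a b :: real and p :: nat and K :: knots
  assumes ab: "a < b" and p1: "1 \<le> p" and knots_sub: "set_mset K \<subseteq> {a<..b}"
    and count_b: "count K b = p + 1"
    and count_le: "\<And>z. z \<in> set_mset K \<Longrightarrow> z \<noteq> b \<Longrightarrow> count K z \<le> p"
begin

abbreviation "N \<equiv> int (size K)"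
abbreviation "t \<equiv> knot_ext a b K"
abbreviation "ks \<equiv> sorted_list_of_multiset K"

lemma length_ks: "length ks = size K"
  by (metis mset_sorted_list_of_multiset size_mset)

lemma ks_in: "i < size K \<Longrightarrow> ks ! i \<in> set_mset K"
  by (metis length_ks nth_mem set_sorted_list_of_multiset)

lemma ks_bounds: "i < size K \<Longrightarrow> a < ks ! i \<and> ks ! i \<le> b"
  using ks_in knots_sub by fastforce

lemma ks_mono: "i \<le> j \<Longrightarrow> j < size K \<Longrightarrow> ks ! i \<le> ks ! j"
  by (simp add: length_ks sorted_nth_mono)

lemma card_ks: "card {i. i < size K \<and> ks ! i = z} = count K z"
proof -
  have "count K z = count (mset ks) z" by simp
  also have "\<dots> = length (filter ((=) z) ks)" by (simp only: count_mset count_list_eq_length_filter)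
  also have "\<dots> = card {i. i < length ks \<and> z = ks ! i}" by (rule length_filter_conv_card)
  also have "{i. i < length ks \<and> z = ks ! i} = {i. i < size K \<and> ks ! i = z}" by (auto simp: length_ks)
  finally show ?thesis by simp
qed

lemma size_ge: "p + 1 \<le> size K"
  using count_b count_le_size[of K b] by simp

lemma t_le_b: "t i \<le> b"
  using ab ks_bounds[of "nat (i - 1)"] by (auto simp: knot_ext_def)

lemma t_nonpos: "i \<le> 0 \<Longrightarrow> t i = a"
  by (simp add: knot_ext_def)

lemma t_gt_a: "1 \<le> i \<Longrightarrow> a < t i"
  using ab ks_bounds[of "nat (i - 1)"] by (auto simp: knot_ext_def)

lemma t_ge_a: "a \<le> t i"
  using t_nonpos[of i] t_gt_a[of i] by (cases "i \<le> 0") auto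

lemma mono_t: "mono t"
proof (rule monoI)
  fix i j :: int assume "i \<le> j"
  consider "i \<le> 0" | "N < j" | "1 \<le> i" "j \<le> N" by linarith
  then show "t i \<le> t j"
  proof cases
    case 1
    then have "t i = a" by (rule t_nonpos)
    then show ?thesis using t_ge_a[of j] by simp
  next
    case 2
    then have "t j = b" unfolding knot_ext_def by simp
    then show ?thesis using t_le_b[of i] by simp
  next
    case 3
    then have "ks ! nat (i - 1) \<le> ks ! nat (j - 1)" using \<open>i \<le> j\<close> by (intro ks_mono) auto
    then show ?thesis using 3 \<open>i \<le> j\<close> by (simp add: knot_ext_def)
  qed
qed

lemma ks_eq_b_iff: "i < size K \<Longrightarrow> ks ! i = b \<longleftrightarrow> size K - (p + 1) \<le> i"
proof -
  assume i: "i < size K"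
  let ?S = "{i. i < size K \<and> ks ! i = b}"
  have "?S \<subseteq> {size K - (p + 1)..<size K}"
  proof
    fix i assume i: "i \<in> ?S"
    have "{i..<size K} \<subseteq> ?S"
    proof
      fix j assume j: "j \<in> {i..<size K}"
      then have "ks ! i \<le> ks ! j" by (intro ks_mono) auto
      moreover have "ks ! j \<le> b" using j ks_bounds[of j] by simp
      ultimately show "j \<in> ?S" using i j by auto
    qed
    then have "card {i..<size K} \<le> p + 1"
      using card_mono[of ?S "{i..<size K}"] card_ks[of b] count_b by simp
    then show "i \<in> {size K - (p + 1)..<size K}" using i by auto
  qed
  moreover have "card ?S = card {size K - (p + 1)..<size K}"
    using card_ks[of b] count_b size_ge by simp
  ultimately have "?S = {size K - (p + 1)..<size K}" by (rule card_subset_eq[OF finite_atLeastLessThan])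
  then have "i \<in> ?S \<longleftrightarrow> i \<in> {size K - (p + 1)..<size K}" by (simp only:)
  then show ?thesis using i by simp
qed

lemma t_eq_b: "N - int p \<le> i \<Longrightarrow> t i = b"
proof -
  assume i: "N - int p \<le> i"
  show ?thesis
  proof (cases "i \<le> N")
    case True
    have "nat (i - 1) < size K" "size K - (p + 1) \<le> nat (i - 1)" "\<not> i \<le> 0" using True i size_ge by linarith+
    then show ?thesis using True ks_eq_b_iff by (simp add: knot_ext_def)
  qed (simp add: knot_ext_def)
qed

lemma t_less_b: "i < N - int p \<Longrightarrow> t i < b"
proof -
  assume i: "i < N - int p"
  show ?thesis
  proof (cases "i \<le> 0")
    case False
    then have "nat (i - 1) < size K" "\<not> size K - (p + 1) \<le> nat (i - 1)" using i by linarith+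
    then have "ks ! nat (i - 1) \<noteq> b" using ks_eq_b_iff by blast
    moreover have "ks ! nat (i - 1) \<le> b" using False i ks_bounds[of "nat (i - 1)"] by simp
    ultimately show ?thesis using False i by (simp add: knot_ext_def)
  qed (use ab in \<open>simp add: knot_ext_def\<close>)
qed

text \<open>More than \<open>p\<close> coinciding knots in the interior would contradict the bound on the counts in \<open>K\<close>.\<close>

lemma multiplicity: "1 \<le> k \<Longrightarrow> t k < b \<Longrightarrow> t k < t (k + int p)"
proof (rule ccontr)
  assume k: "1 \<le> k" "t k < b" and "\<not> t k < t (k + int p)"
  moreover have "t k \<le> t (k + int p)" by (rule monoD[OF mono_t]) simp
  ultimately have eq: "t (k + int p) = t k" by linarith
  then have kN: "k + int p \<le> N" using k t_eq_b[of "k + int p"] by linarith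
  define z where "z = t k"
  have "{nat (k - 1)..nat (k + int p - 1)} \<subseteq> {i. i < size K \<and> ks ! i = z}"
  proof safe
    fix i assume i: "i \<in> {nat (k - 1)..nat (k + int p - 1)}"
    then have "k \<le> int i + 1" "int i + 1 \<le> k + int p" unfolding atLeastAtMost_iff using k p1 by linarith+
    then have "t k \<le> t (int i + 1)" "t (int i + 1) \<le> t (k + int p)" by (auto intro: monoD[OF mono_t])
    then have "t (int i + 1) = z" using eq unfolding z_def by linarith
    moreover show iK: "i < size K" using i kN k p1 unfolding atLeastAtMost_iff by linarith
    ultimately show "ks ! i = z" by (simp add: knot_ext_def)
  qed
  then have "card {nat (k - 1)..nat (k + int p - 1)} \<le> count K z"
    unfolding card_ks[symmetric] by (rule card_mono[rotated]) simp
  moreover have "Suc (nat (k + int p - 1)) - nat (k - 1) = p + 1" using k p1 by linarith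
  ultimately have "p + 1 \<le> count K z" by (simp only: card_atLeastAtMost)
  moreover have "z \<in> set_mset K"
  proof -
    have "nat (k - 1) < size K" using k kN p1 by linarith
    moreover have "z = ks ! nat (k - 1)" using k kN by (simp add: z_def knot_ext_def)
    ultimately show ?thesis using ks_in by simp
  qed
  moreover have "z \<noteq> b" using k(2) z_def by simp
  ultimately show False using count_le[of z] by simp
qed

text \<open>The least index at which a property that holds at \<open>b\<close> but not at \<open>a\<close> becomes true.  It is used to
  locate a point in the knot sequence, once with strict and once with weak inequality.\<close>

lemma first_above:
  assumes "P b" "\<not> P a"
  shows "\<exists>j\<ge>1. j \<le> N - int p \<and> P (t j) \<and> \<not> P (t (j - 1))"
proof -
  define n where "n = (LEAST n. P (t (int n)))"
  have ex: "P (t (int (nat (N - int p))))" using assms size_ge by (auto simp: t_eq_b)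
  have n: "P (t (int n))" unfolding n_def by (rule LeastI, rule ex)
  have le: "n \<le> nat (N - int p)" unfolding n_def by (rule Least_le, rule ex)
  have "n \<noteq> 0" using n assms(2) by (metis t_nonpos of_nat_0 order_refl)
  moreover have "\<not> P (t (int (n - 1)))"
    using not_less_Least[of "n - 1" "\<lambda>n. P (t (int n))"] \<open>n \<noteq> 0\<close> unfolding n_def[symmetric] by simp
  ultimately show ?thesis using n le size_ge by (intro exI[of _ "int n"]) (auto simp: of_nat_diff)
qed

lemma cell_exists:
  assumes "a \<le> x" "x < b"
  shows "\<exists>J\<ge>1. J \<le> N - int p \<and> t (J - 1) \<le> x \<and> x < t J"
  using first_above[of "\<lambda>y. x < y"] assms by (auto simp: not_less)

lemma knot_position:
  assumes "a < \<tau>" "\<tau> < b"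
  shows "\<exists>j m. m \<le> p \<and> t (j - 1) < \<tau> \<and> \<tau> \<le> t j \<and> t (j + int m - 1) \<le> \<tau> \<and> \<tau> < t (j + int m)"
proof -
  obtain j where j: "1 \<le> j" "\<tau> \<le> t j" "t (j - 1) < \<tau>"
    using first_above[of "\<lambda>y. \<tau> \<le> y"] assms by (auto simp: not_le)
  obtain J where J: "t (J - 1) \<le> \<tau>" "\<tau> < t J" using cell_exists[of \<tau>] assms by auto
  have "j \<le> J"
  proof (rule ccontr)
    assume "\<not> j \<le> J" then show False using monoD[OF mono_t, of J "j - 1"] j J by simp
  qed
  moreover have "J - j \<le> int p"
  proof (rule ccontr)
    assume *: "\<not> J - j \<le> int p"
    then have "t (j + int p) \<le> \<tau>" using monoD[OF mono_t, of "j + int p" "J - 1"] J by simp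
    then have "t (j + int p) \<le> t j" "t j < b"
      using j(2) assms monoD[OF mono_t, of j "j + int p"] by auto
    then show False using multiplicity[OF j(1)] by simp
  qed
  ultimately show ?thesis using j J
    by (intro exI[of _ j] exI[of _ "nat (J - j)"]) auto
qed

text \<open>Both knot functions agree up to index \<open>N\<close>, which is the last knot that a B-spline of the space uses.\<close>

lemma bspline_knot_eq:
  assumes "i \<in> spline_indices p K"
  shows "bspline (knot a K) p i = bspline t p i"
proof
  fix x
  show "bspline (knot a K) p i x = bspline t p i x"
    by (rule bspline_cong) (use assms in \<open>auto simp: spline_indices_def knot_def knot_ext_def\<close>)
qed

text \<open>The knot \<open>a\<close> is repeated \<open>p + 1\<close> times by convention and \<open>b\<close> by the assumption on \<open>K\<close>, so that
  exactly one B-spline is nonzero at either end.  This is why continuity of a rational spline on the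
  closed curve amounts to equality of its first and last coefficient.\<close>

lemma bspline_at_a: "bspline t p i a = (if i = 1 - int p then 1 else 0)"
  by (rule bspline_at_knot[OF mono_t, of 1 a p p, unfolded])
     (use t_nonpos t_gt_a[of 1] in auto)

lemma bspline_left_at_b: "bspline_left t p i b = (if i = N - int p then 1 else 0)"
  by (rule bspline_left_at_knot[OF mono_t, of _ _ p]) (use t_eq_b t_less_b in auto)

lemma bspline_tendsto_b: "(bspline t p i \<longlongrightarrow> (if i = N - int p then 1 else 0)) (at_left b)"
  using bspline_tendsto_left[of t p i b] by (simp add: bspline_left_at_b)

lemma isCont_bspline:
  assumes "a < x" "x < b" shows "isCont (bspline t p i) x"
proof -
  obtain j m where "m \<le> p" "t (j - 1) < x" "x \<le> t j" "t (j + int m - 1) \<le> x" "x < t (j + int m)"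
    using knot_position[OF assms] by blast
  then have "bspline_left t p i x = bspline t p i x"
    by (intro bspline_left_eq_bspline[OF mono_t])
  then show ?thesis
    using bspline_tendsto_left[of t p i x] bspline_tendsto_right[of t p i x]
    by (simp add: isCont_def filterlim_at_split)
qed

lemma bspline_zero_out:
  assumes "a \<le> x" "x < b" "i \<notin> spline_indices p K"
  shows "bspline t p i x = 0"
proof (rule ccontr)
  assume "\<not> ?thesis"
  then have *: "t (i - 1) \<le> x" "x < t (i + int p)" using bspline_support[OF mono_t] by auto
  have "i + int p > 0" using * assms t_nonpos[of "i + int p"] by linarith
  moreover have "i - 1 < N - int p" using * assms t_eq_b[of "i - 1"] by linarith
  ultimately show False using assms(3) by (auto simp: spline_indices_def)
qed

lemma cell_index_range:
  assumes "t (J - 1) < t J" shows "1 \<le> J" "J \<le> N - int p" "{J - int p..J} \<subseteq> spline_indices p K"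
proof -
  show 1: "1 \<le> J" using assms t_nonpos[of J] t_nonpos[of "J - 1"] by linarith
  show 2: "J \<le> N - int p" using assms t_eq_b[of "J - 1"] t_le_b[of J] by linarith
  show "{J - int p..J} \<subseteq> spline_indices p K" using 1 2 by (auto simp: spline_indices_def)
qed

lemma partition_of_unity:
  assumes "a \<le> x" "x < b"
  shows "(\<Sum>i\<in>spline_indices p K. bspline t p i x) = 1"
proof -
  obtain J where J: "t (J - 1) \<le> x" "x < t J" using cell_exists[OF assms] by blast
  have "(\<Sum>i\<in>spline_indices p K. bspline t p i x) = (\<Sum>i\<in>{J - int p..J}. bspline t p i x)"
    using cell_index_range(3)[of J] J bspline_outside[OF mono_t J]
    by (intro sum.mono_neutral_right) (auto simp: spline_indices_def)
  then show ?thesis using bspline_partition_of_unity[OF mono_t J] by simp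
qed

lemma range_t: "range t = insert a (set_mset K)"
proof (intro equalityI subsetI)
  fix x assume "x \<in> range t"
  then obtain i where "x = t i" by blast
  moreover have "b \<in> set_mset K" using count_b by (metis add_is_0 count_eq_zero_iff one_neq_zero)
  ultimately show "x \<in> insert a (set_mset K)" using ks_in[of "nat (i - 1)"] by (auto simp: knot_ext_def)
next
  fix x assume "x \<in> insert a (set_mset K)"
  then consider "x = a" | "x \<in> set ks" by auto
  then show "x \<in> range t"
  proof cases
    case 1 then show ?thesis using t_nonpos[of 0] by (metis order_refl rangeI)
  next
    case 2
    then obtain n where "n < size K" "ks ! n = x" by (metis in_set_conv_nth length_ks)
    then have "x = t (int n + 1)" by (simp add: knot_ext_def)
    then show ?thesis by blast
  qed
qed

lemma param_elements_iff:
  "I \<in> param_elements a K \<longleftrightarrow> (\<exists>J. I = (t (J - 1), t J) \<and> t (J - 1) < t J)"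
proof
  assume "I \<in> param_elements a K"
  then obtain c d where I: "I = (c, d)" "c \<in> range t" "d \<in> set_mset K" "c < d" "{c<..<d} \<inter> set_mset K = {}"
    by (auto simp: param_elements_def cells_def range_t)
  have "a < d" "d \<le> b" using I knots_sub by auto
  obtain l where l: "c = t l" using I by blast
  obtain J where J: "1 \<le> J" "d \<le> t J" "t (J - 1) < d"
    using first_above[of "\<lambda>y. d \<le> y"] \<open>a < d\<close> \<open>d \<le> b\<close> by (auto simp: not_le)
  obtain k where k: "d = t k" using I(3) range_t by (metis imageE insertI2)
  have "t J = d"
  proof -
    have "J \<le> k" by (rule ccontr) (use k J monoD[OF mono_t, of k "J - 1"] in auto)
    then show ?thesis using k J monoD[OF mono_t, of J k] by simp
  qed
  moreover have "t (J - 1) = c"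
  proof (rule antisym)
    have "l \<le> J - 1" by (rule ccontr) (use l \<open>t J = d\<close> I(4) monoD[OF mono_t, of J l] in auto)
    then show "c \<le> t (J - 1)" using l mono_t by (simp add: monoD)
    show "t (J - 1) \<le> c"
    proof (rule ccontr)
      assume *: "\<not> t (J - 1) \<le> c"
      then have "t (J - 1) \<noteq> a" using l t_ge_a[of l] by auto
      then have "t (J - 1) \<in> set_mset K" using range_t by blast
      moreover have "t (J - 1) \<in> {c<..<d}" using J(3) * by simp
      ultimately show False using I(5) by blast
    qed
  qed
  ultimately show "\<exists>J. I = (t (J - 1), t J) \<and> t (J - 1) < t J" using I by (intro exI[of _ J]) auto
next
  assume "\<exists>J. I = (t (J - 1), t J) \<and> t (J - 1) < t J"
  then obtain J where J: "I = (t (J - 1), t J)" "t (J - 1) < t J" by blast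
  have "t (J - 1) \<in> insert a (set_mset K)" "t J \<in> insert a (set_mset K)" using range_t by blast+
  moreover have "t J \<noteq> a" using t_ge_a[of "J - 1"] J(2) by linarith
  moreover have "{t (J - 1)<..<t J} \<inter> set_mset K = {}"
  proof (intro equals0I, elim IntE)
    fix x assume x: "x \<in> {t (J - 1)<..<t J}" "x \<in> set_mset K"
    then obtain k where "x = t k" using range_t by (metis imageE insertI2)
    then show False using x monoD[OF mono_t, of k "J - 1"] monoD[OF mono_t, of J k] by (cases "k \<le> J - 1") auto
  qed
  ultimately show "I \<in> param_elements a K" using J by (auto simp: param_elements_def cells_def)
qed

end

lemma knot_ext_insert:
  assumes "a < z" "z < b" "set_mset K \<subseteq> {a<..b}"
  shows "\<exists>r. (\<forall>j. knot_ext a b K j = (if j \<le> r then knot_ext a b (add_mset z K) j else knot_ext a b (add_mset z K) (j + 1)))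
     \<and> z = knot_ext a b (add_mset z K) (r + 1)"
proof -
  obtain ys zs where *: "sorted_list_of_multiset K = ys @ zs" "insort z (sorted_list_of_multiset K) = ys @ z # zs"
    using insort_split by blast
  have sz: "size K = length ys + length zs" using *(1) by (metis length_append mset_sorted_list_of_multiset size_mset)
  have ins: "sorted_list_of_multiset (add_mset z K) = ys @ z # zs" using *(2) by simp
  show ?thesis
  proof (intro exI[of _ "int (length ys)"] conjI allI)
    fix j :: int
    consider "j \<le> 0" | "1 \<le> j" "j \<le> int (length ys)" | "int (length ys) < j" "1 \<le> j" "j \<le> size K" | "size K < j" "1 \<le> j"
      by linarith
    then show "knot_ext a b K j = (if j \<le> int (length ys) then knot_ext a b (add_mset z K) j else knot_ext a b (add_mset z K) (j + 1))"
    proof cases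
      case 2
      then have "nat (j - 1) < length ys" by linarith
      then show ?thesis using 2 sz by (simp add: knot_ext_def ins *(1) nth_append del: sorted_list_of_multiset_insert)
    next
      case 3
      then have "\<not> nat (j - 1) < length ys" "\<not> nat j < length ys" "nat j - length ys = Suc (nat (j - 1) - length ys)" by linarith+
      then show ?thesis using 3 sz by (simp add: knot_ext_def ins *(1) nth_append del: sorted_list_of_multiset_insert)
    qed (use sz in \<open>auto simp: knot_ext_def\<close>)
    show "z = knot_ext a b (add_mset z K) (int (length ys) + 1)"
      using sz by (simp add: knot_ext_def ins nth_append del: sorted_list_of_multiset_insert)
  qed
qed

text \<open>One knot at a time: by \<open>knot_insertion\<close> the new coefficients are convex combinations of two
  neighbouring old ones, hence stay in \<open>[lo, hi]\<close>.  The coefficients are given on all of \<open>\<int>\<close> to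
  avoid a special treatment of the ends of the index range.\<close>

lemma refined_weights:
  assumes "a < b" "1 \<le> p" and "set_mset M \<subseteq> {a<..<b}"
    and "set_mset K \<subseteq> {a<..b}" "count K b = p + 1"
    and "\<And>i. w i \<in> {lo..hi}"
    and "\<And>z. z \<in> set_mset (K + M) \<Longrightarrow> z \<noteq> b \<Longrightarrow> count (K + M) z \<le> p"
  shows "\<exists>w'. (\<forall>i. w' i \<in> {lo..hi}) \<and>
    (\<forall>x\<in>{a..<b}. (\<Sum>i\<in>spline_indices p K. w i * bspline (knot_ext a b K) p i x)
        = (\<Sum>i\<in>spline_indices p (K + M). w' i * bspline (knot_ext a b (K + M)) p i x))"
  using assms(3-)
proof (induction M arbitrary: K w)
  case empty
  then show ?case by auto
next
  case (add z M)
  let ?K = "add_mset z K"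
  have z: "a < z" "z < b" using add.prems(1) by auto
  have cle: "count K y \<le> p" if "y \<in># K" "y \<noteq> b" for y
    using add.prems(5)[of y] that by (auto split: if_splits)
  have cle': "count ?K y \<le> p" if "y \<in># ?K" "y \<noteq> b" for y
    using add.prems(5)[of y] that by (auto split: if_splits)
  interpret K: knot_seq a b p K using assms(1,2) add.prems cle by unfold_locales auto
  interpret K': knot_seq a b p ?K using assms(1,2) add.prems z cle' by unfold_locales auto
  obtain r where r: "\<And>j. K.t j = (if j \<le> r then K'.t j else K'.t (j + 1))" "z = K'.t (r + 1)"
    using knot_ext_insert[OF z add.prems(2)] by blast
  let ?\<alpha> = "insertion_coeff K'.t z p"
  define w' where "w' i = ?\<alpha> i * w i + (1 - ?\<alpha> i) * w (i - 1)" for i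
  have w'b: "w' i \<in> {lo..hi}" for i
    using convex_bound_le[of "w i" hi "w (i - 1)" "?\<alpha> i" "1 - ?\<alpha> i"]
       convex_bound_le[of "- w i" "- lo" "- w (i - 1)" "?\<alpha> i" "1 - ?\<alpha> i"]
       add.prems(4)[of i] add.prems(4)[of "i - 1"] insertion_coeff_bounds[of K'.t z p i]
    by (auto simp: w'_def)
  have eq: "(\<Sum>i\<in>spline_indices p K. w i * bspline K.t p i x)
        = (\<Sum>i\<in>spline_indices p ?K. w' i * bspline K'.t p i x)" if x: "x \<in> {a..<b}" for x
  proof -
    let ?B = "\<lambda>i. bspline K'.t p i x"
    let ?R = "{- int p..int (size K) - int p + 1}"
    have "(\<Sum>i\<in>spline_indices p K. w i * bspline K.t p i x) = (\<Sum>i\<in>?R. w i * bspline K.t p i x)"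
      using x by (intro sum.mono_neutral_left) (auto simp: spline_indices_def intro!: K.bspline_zero_out)
    also have "\<dots> = (\<Sum>i\<in>?R. w i * ?\<alpha> i * ?B i + w i * (1 - ?\<alpha> (i + 1)) * ?B (i + 1))"
      by (rule sum.cong, simp, subst knot_insertion[OF K'.mono_t r]) (simp add: algebra_simps)
    also have "\<dots> = (\<Sum>i\<in>?R. w i * ?\<alpha> i * ?B i) + (\<Sum>i\<in>?R. w i * (1 - ?\<alpha> (i + 1)) * ?B (i + 1))"
      by (rule sum.distrib)
    also have "(\<Sum>i\<in>?R. w i * ?\<alpha> i * ?B i) = (\<Sum>i\<in>spline_indices p ?K. w i * ?\<alpha> i * ?B i)"
      using x by (intro sum.mono_neutral_right) (auto simp: spline_indices_def intro!: K'.bspline_zero_out)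
    also have "(\<Sum>i\<in>?R. w i * (1 - ?\<alpha> (i + 1)) * ?B (i + 1))
        = (\<Sum>i\<in>{1 - int p..int (size K) - int p + 2}. w (i - 1) * (1 - ?\<alpha> i) * ?B i)"
      by (rule sum.reindex_bij_witness[of _ "\<lambda>i. i - 1" "\<lambda>i. i + 1"]) auto
    also have "\<dots> = (\<Sum>i\<in>spline_indices p ?K. w (i - 1) * (1 - ?\<alpha> i) * ?B i)"
      using x by (intro sum.mono_neutral_right) (auto simp: spline_indices_def intro!: K'.bspline_zero_out)
    finally show ?thesis by (simp add: w'_def sum.distrib[symmetric] algebra_simps)
  qed
  have "\<exists>w''. (\<forall>i. w'' i \<in> {lo..hi}) \<and>
    (\<forall>x\<in>{a..<b}. (\<Sum>i\<in>spline_indices p ?K. w' i * bspline K'.t p i x)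
        = (\<Sum>i\<in>spline_indices p (?K + M). w'' i * bspline (knot_ext a b (?K + M)) p i x))"
    using add.prems K'.knots_sub K'.count_b w'b by (intro add.IH) auto
  then show ?case using eq by simp
qed

section \<open>Refinement\<close>

lemma cellsD:
  assumes "(c, d) \<in> cells a Z" "Z \<subseteq> {a<..b}"
  shows "a \<le> c" "c < d" "d \<le> b" "d \<in> Z" "\<And>z. z \<in> Z \<Longrightarrow> z \<le> c \<or> d \<le> z"
  using assms by (force simp: cells_def)+

lemma finite_cells: "finite Z \<Longrightarrow> finite (cells a Z)"
  by (rule finite_subset[of _ "insert a Z \<times> Z"]) (auto simp: cells_def)

lemma cell_containing:
  assumes "finite Z" "Z \<subseteq> {a<..b}" "b \<in> Z" "a \<le> x" "x < b"
  shows "\<exists>c d. (c, d) \<in> cells a Z \<and> c \<le> x \<and> x < d"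
proof -
  define c d where "c = Max {z \<in> insert a Z. z \<le> x}" and "d = Min {z \<in> Z. x < z}"
  have "c \<in> {z \<in> insert a Z. z \<le> x}" unfolding c_def using assms by (intro Max_in) auto
  moreover have "d \<in> {z \<in> Z. x < z}" unfolding d_def using assms by (intro Min_in) auto
  moreover have "z \<le> c \<or> d \<le> z" if "z \<in> Z" for z
  proof (cases "z \<le> x")
    case True
    then have "z \<le> c" unfolding c_def using assms that by (intro Max_ge) auto
    then show ?thesis ..
  next
    case False
    then have "d \<le> z" unfolding d_def using assms that by (intro Min_le) auto
    then show ?thesis ..
  qed
  ultimately show ?thesis by (intro exI[of _ c] exI[of _ d]) (force simp: cells_def)
qed

lemma cells_disjoint:
  assumes "(c, d) \<in> cells a Z" "(c', d') \<in> cells a Z" "Z \<subseteq> {a<..b}" "c < x" "x < d" "c' \<le> x" "x < d'"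
  shows "c = c'" "d = d'"
proof -
  note C = cellsD[OF assms(1,3)] and C' = cellsD[OF assms(2,3)]
  have "d \<le> d'" using C(5)[OF C'(4)] assms by auto
  moreover have "d' \<le> d" using C'(5)[OF C(4)] assms by auto
  ultimately show "d = d'" by simp
  have cc: "c = a \<or> c \<in> Z" "c' = a \<or> c' \<in> Z" using assms(1,2) by (auto simp: cells_def)
  have "c \<le> c'" using cc(1) C'(1) C'(5)[of c] assms by auto
  moreover have "c' \<le> c" using cc(2) C(1) C(5)[of c'] assms by auto
  ultimately show "c = c'" by simp
qed

abbreviation "midpoint_of \<equiv> \<lambda>I::real \<times> real. (fst I + snd I) / 2"

text \<open>The cell of the coarse partition around the centre of a fine cell contains the whole fine cell; it is
  cut at most once, and only if it is marked.\<close>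

lemma bisected_cells:
  assumes "finite Z" "Z \<subseteq> {a<..b}" "b \<in> Z" "M \<subseteq> cells a Z"
    and J: "(c, d) \<in> cells a (Z \<union> midpoint_of ` M)"
  shows "\<exists>c0 d0. (c0, d0) \<in> cells a Z \<and> c0 \<le> c \<and> d \<le> d0 \<and>
    d - c = (if (c0, d0) \<in> M then (d0 - c0) / 2 else d0 - c0)"
proof -
  let ?Z = "Z \<union> midpoint_of ` M"
  have mid: "c' < (c' + d') / 2 \<and> (c' + d') / 2 < d'" if "(c', d') \<in> cells a Z" for c' d'
    using cellsD[OF that assms(2)] by auto
  have Zsub: "?Z \<subseteq> {a<..b}"
  proof safe
    fix c' d' assume "(c', d') \<in> M"
    then have "(c', d') \<in> cells a Z" using assms(4) by blast
    then show "midpoint_of (c', d') \<in> {a<..b}" using cellsD[OF _ assms(2), of c' d'] mid[of c' d'] by auto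
  qed (use assms(2) in auto)
  note CJ = cellsD[OF J Zsub]
  obtain c0 d0 where I: "(c0, d0) \<in> cells a Z" "c0 \<le> (c + d) / 2" "(c + d) / 2 < d0"
    using cell_containing[OF assms(1-3), of "(c + d) / 2"] CJ by auto
  note C0 = cellsD[OF I(1) assms(2)]
  have c0: "c0 = a \<or> c0 \<in> Z" using I(1) by (auto simp: cells_def)
  have le: "c0 \<le> c" "d \<le> d0"
    using c0 CJ(5)[of c0] CJ(5)[of d0] CJ(1,2) C0(4) I by auto
  have new: "(c0, d0) \<in> M \<and> e = (c0 + d0) / 2" if e: "e \<in> ?Z" "c0 < e" "e < d0" for e
  proof -
    have "e \<notin> Z" using C0(5)[of e] e by auto
    then obtain c' d' where "(c', d') \<in> M" and e': "e = (c' + d') / 2" using e by auto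
    moreover have "c0 = c'" "d0 = d'"
      using cells_disjoint[OF I(1), of c' d' b e] assms(2,4) e mid[of c' d'] calculation by auto
    ultimately show ?thesis by simp
  qed
  have cZ: "c = a \<or> c \<in> ?Z" "d \<in> ?Z" using J by (auto simp: cells_def)
  have c: "c = c0 \<or> ((c0, d0) \<in> M \<and> c = (c0 + d0) / 2)"
    using cZ(1) new[of c] le CJ(2) C0(1) by fastforce
  have d: "d = d0 \<or> ((c0, d0) \<in> M \<and> d = (c0 + d0) / 2)"
    using cZ(2) new[of d] le CJ(2) by fastforce
  have "(c0 + d0) / 2 \<le> c \<or> d \<le> (c0 + d0) / 2" if "(c0, d0) \<in> M"
    using CJ(5)[of "(c0 + d0) / 2"] that by force
  then have "d - c = (if (c0, d0) \<in> M then (d0 - c0) / 2 else d0 - c0)"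
    using c d CJ(2) C0(2) by auto
  then show ?thesis using I(1) le by blast
qed

lemma marked_elements_subset: "I \<in> marked_elements \<gamma> a p \<kappa> K M \<Longrightarrow> I \<in> param_elements a K"
  by (induction rule: marked_elements.induct) (auto simp: both_marked_def)

text \<open>The invariant of the refinement: besides the conditions on multiplicities, the widths of touching
  elements differ at most by the factor \<open>2 * \<kappa>\<close>.\<close>

definition graded_mesh :: "(real \<Rightarrow> real^2) \<Rightarrow> real \<Rightarrow> real \<Rightarrow> nat \<Rightarrow> real \<Rightarrow> knots \<Rightarrow> bool" where
  "graded_mesh \<gamma> a b p \<kappa> K \<longleftrightarrow> set_mset K \<subseteq> {a<..b} \<and> count K b = p + 1 \<and>
     (\<forall>z\<in>set_mset K - {b}. count K z \<le> p) \<and>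
     (\<forall>I\<in>param_elements a K. \<forall>I'\<in>param_elements a K. elem \<gamma> I \<inter> elem \<gamma> I' \<noteq> {} \<longrightarrow>
        param_width I \<le> 2 * \<kappa> * param_width I')"

lemma param_width_pos:
  assumes "I \<in> param_elements a K" shows "0 < param_width I"
  using assms by (auto simp: param_elements_def cells_def param_width_def)

lemma finite_param_elements: "finite (param_elements a K)"
  unfolding param_elements_def by (rule finite_cells) simp

lemma kappa_hat_ge:
  assumes "I \<in> param_elements a K" "I' \<in> param_elements a K" "elem \<gamma> I \<inter> elem \<gamma> I' \<noteq> {}"
  shows "param_width I \<le> kappa_hat \<gamma> a K * param_width I'"
proof -
  let ?S = "{param_width I / param_width I' | I I'.
            I \<in> param_elements a K \<and> I' \<in> param_elements a K \<and> elem \<gamma> I \<inter> elem \<gamma> I' \<noteq> {}}"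
  have "finite ?S"
    by (rule finite_subset[of _ "(\<lambda>(I, I'). param_width I / param_width I') ` (param_elements a K \<times> param_elements a K)"])
       (auto simp: finite_param_elements)
  then have "param_width I / param_width I' \<le> kappa_hat \<gamma> a K"
    unfolding kappa_hat_def
  proof (rule Max_ge)
    show "param_width I / param_width I' \<in> ?S" using assms by blast
  qed
  then show ?thesis using param_width_pos[OF assms(2)] by (simp add: pos_divide_le_eq)
qed

text \<open>If both parents or none of them are bisected, the ratio of widths does not change.  If exactly one
  is, then the closure of the marked set under the ratio rule bounds the ratio of the parents by \<open>\<kappa>\<close>,
  and bisection at most doubles it.\<close>

lemma graded_mesh_refine:
  assumes g: "graded_mesh \<gamma> a b p \<kappa> K" and "1 \<le> \<kappa>" "1 \<le> p"
  shows "graded_mesh \<gamma> a b p \<kappa> (refine \<gamma> a p \<kappa> K M)"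
    and "\<exists>L. refine \<gamma> a p \<kappa> K M = K + L \<and> set_mset L \<subseteq> {a<..<b}"
proof -
  let ?Mk = "marked_elements \<gamma> a p \<kappa> K M" and ?R = "raised_knots \<gamma> a p K M"
  let ?Z = "set_mset K"
  have sub: "?Z \<subseteq> {a<..b}" and cb: "count K b = p + 1" and cle: "\<And>z. z \<in> ?Z \<Longrightarrow> z \<noteq> b \<Longrightarrow> count K z \<le> p"
    and ratio: "\<And>I I'. I \<in> param_elements a K \<Longrightarrow> I' \<in> param_elements a K \<Longrightarrow> elem \<gamma> I \<inter> elem \<gamma> I' \<noteq> {} \<Longrightarrow>
        param_width I \<le> 2 * \<kappa> * param_width I'"
    using g by (auto simp: graded_mesh_def)
  have bZ: "b \<in> ?Z" using cb by (metis add_is_0 count_eq_zero_iff one_neq_zero)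
  have Mk: "?Mk \<subseteq> cells a ?Z" using marked_elements_subset by (fastforce simp: param_elements_def)
  have fin: "finite ?Mk" using finite_subset[OF Mk finite_cells] by simp
  have finR: "finite ?R" by (rule finite_subset[of _ ?Z]) (auto simp: raised_knots_def)
  have mids: "m \<notin> ?Z \<and> a < m \<and> m < b" if m: "m \<in> midpoint_of ` ?Mk" for m
  proof -
    obtain I where I: "I \<in> ?Mk" "m = midpoint_of I" using m by blast
    obtain c d where "I = (c, d)" by (cases I)
    then have cd: "(c, d) \<in> cells a ?Z" "m = (c + d) / 2" using I Mk by auto
    note C = cellsD[OF cd(1) sub]
    have "c < m" "m < d" using cd C(2) by auto
    moreover from this have "m \<notin> ?Z" using C(5)[of m] by auto
    ultimately show ?thesis using C by auto
  qed
  have Rb: "a < z \<and> z < b \<and> z \<in> ?Z \<and> count K z \<le> p - 1" if "z \<in> ?R" for z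
  proof -
    have z: "z \<in> ?Z" "count K z \<le> p - 1" using that by (auto simp: raised_knots_def)
    then have "z \<noteq> b" using cb by auto
    moreover have "a < z" "z \<le> b" using z sub by auto
    ultimately show ?thesis using z by auto
  qed
  let ?K = "refine \<gamma> a p \<kappa> K M"
  let ?L = "mset_set ?R + mset_set (midpoint_of ` ?Mk)"
  have KL: "?K = K + ?L" by (simp add: refine_def add.assoc)
  have Lset: "set_mset ?L = ?R \<union> midpoint_of ` ?Mk" using fin finR by simp
  have Lsub: "set_mset ?L \<subseteq> {a<..<b}" unfolding Lset
  proof
    fix z assume "z \<in> ?R \<union> midpoint_of ` ?Mk"
    then have "a < z \<and> z < b" using mids Rb by blast
    then show "z \<in> {a<..<b}" by simp
  qed
  then show "\<exists>L. ?K = K + L \<and> set_mset L \<subseteq> {a<..<b}" using KL by blast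
  have setK: "set_mset ?K = ?Z \<union> midpoint_of ` ?Mk"
    using fin finR Rb by (auto simp: KL)
  have bL: "b \<notin># ?L" using Lsub by auto
  then have cb': "count ?K b = p + 1" using cb by (simp only: KL count_union) (simp add: not_in_iff)
  have cle': "count ?K z \<le> p" if "z \<in> set_mset ?K" "z \<noteq> b" for z
  proof (cases "z \<in> ?Z")
    case True
    then have "z \<notin> midpoint_of ` ?Mk" using mids by blast
    then have "count ?K z = count K z + count (mset_set ?R) z" using fin by (simp add: KL)
    moreover have "count (mset_set ?R) z = (if z \<in> ?R then 1 else 0)" using finR by simp
    ultimately show ?thesis using Rb[of z] cle[OF True that(2)] assms(3) by auto
  next
    case False
    then have "z \<notin> ?R" "count K z = 0" using Rb by (blast, simp add: not_in_iff)
    then have "count ?K z = count (mset_set (midpoint_of ` ?Mk)) z" using finR by (simp add: KL)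
    also have "\<dots> \<le> 1" by (cases "z \<in> midpoint_of ` ?Mk") (auto simp: fin)
    finally show ?thesis using assms(3) by simp
  qed
  have "param_width J \<le> 2 * \<kappa> * param_width J'"
    if JJ: "J \<in> param_elements a ?K" "J' \<in> param_elements a ?K" "elem \<gamma> J \<inter> elem \<gamma> J' \<noteq> {}" for J J'
  proof -
    \<comment> \<open>every new element sits in an old one, from which it inherits its neighbours\<close>
    have parent: "\<exists>I\<in>param_elements a K. elem \<gamma> J \<subseteq> elem \<gamma> I \<and>
        param_width J = (if I \<in> ?Mk then param_width I / 2 else param_width I)"
      if pJ: "J \<in> param_elements a ?K" for J
    proof -
      obtain c d where J: "J = (c, d)" by (cases J)
      obtain c0 d0 where *: "(c0, d0) \<in> cells a ?Z" "c0 \<le> c" "d \<le> d0"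
        "d - c = (if (c0, d0) \<in> ?Mk then (d0 - c0) / 2 else d0 - c0)"
        using bisected_cells[OF _ sub bZ Mk, of c d] pJ unfolding param_elements_def setK J by auto
      then show ?thesis
        by (intro bexI[of _ "(c0, d0)"]) (auto simp: J elem_def param_width_def param_elements_def)
    qed
    obtain I where I: "I \<in> param_elements a K" "elem \<gamma> J \<subseteq> elem \<gamma> I"
      "param_width J = (if I \<in> ?Mk then param_width I / 2 else param_width I)" using parent[OF JJ(1)] by blast
    obtain I' where I': "I' \<in> param_elements a K" "elem \<gamma> J' \<subseteq> elem \<gamma> I'"
      "param_width J' = (if I' \<in> ?Mk then param_width I' / 2 else param_width I')" using parent[OF JJ(2)] by blast
    have adj: "elem \<gamma> I \<inter> elem \<gamma> I' \<noteq> {}" "elem \<gamma> I' \<inter> elem \<gamma> I \<noteq> {}" using I(2) I'(2) JJ(3) by auto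
    have w: "0 < param_width I" "0 < param_width I'" using I I' param_width_pos by auto
    have unmarked: "max (param_width J / param_width J') (param_width J' / param_width J) \<le> \<kappa>"
      if "J \<in> param_elements a K" "J \<notin> ?Mk" "J' \<in> ?Mk" "elem \<gamma> J \<inter> elem \<gamma> J' \<noteq> {}" for J J'
      using marked_elements.ratio[OF that(3,1,4)] that(2) by force
    consider "I \<in> ?Mk \<longleftrightarrow> I' \<in> ?Mk" | "I \<in> ?Mk" "I' \<notin> ?Mk" | "I \<notin> ?Mk" "I' \<in> ?Mk" by blast
    then show ?thesis
    proof cases
      case 1
      then show ?thesis using ratio[OF I(1) I'(1) adj(1)] I(3) I'(3) by auto
    next
      case 2
      have "param_width I / param_width I' \<le> \<kappa>" using unmarked[OF I'(1) 2(2) 2(1) adj(2)] by simp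
      then have "param_width I \<le> \<kappa> * param_width I'" using w by (simp add: pos_divide_le_eq)
      moreover have "0 \<le> \<kappa> * param_width I'" using w assms(2) by simp
      ultimately show ?thesis using 2 I(3) I'(3) w by simp
    next
      case 3
      have "param_width I / param_width I' \<le> \<kappa>" using unmarked[OF I(1) 3(1) 3(2) adj(1)] by simp
      then have "param_width I \<le> \<kappa> * param_width I'" using w by (simp add: pos_divide_le_eq)
      moreover have "param_width J = param_width I" "param_width J' = param_width I' / 2" using 3 I(3) I'(3) by simp_all
      moreover have "2 * \<kappa> * (param_width I' / 2) = \<kappa> * param_width I'" by simp
      ultimately show ?thesis by (simp only:)
    qed
  qed
  moreover have "set_mset ?K \<subseteq> {a<..b}" using setK sub mids by fastforce
  ultimately show "graded_mesh \<gamma> a b p \<kappa> ?K"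
    using cb' cle' by (auto simp: graded_mesh_def)
qed

lemma graded_mesh_refinements:
  assumes "K \<in> refinements \<gamma> a p K0" "knot_vector \<gamma> a b p K0" "1 \<le> p" "a < b"
  shows "graded_mesh \<gamma> a b p (kappa_hat \<gamma> a K0) K \<and> 1 \<le> kappa_hat \<gamma> a K0 \<and> (\<exists>L. K = K0 + L \<and> set_mset L \<subseteq> {a<..<b})"
  using assms(1)
proof induction
  case initial
  have kv: "set_mset K0 \<subseteq> {a<..b}" "count K0 b = p + 1" "\<forall>z\<in>set_mset K0 - {b}. count K0 z \<le> p"
    using assms(2) by (auto simp: knot_vector_def)
  have "b \<in> set_mset K0" using kv(2) by (metis add_is_0 count_eq_zero_iff one_neq_zero)
  then obtain c d where cd: "(c, d) \<in> cells a (set_mset K0)"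
    using cell_containing[of "set_mset K0" a b a] kv(1) assms(4) by auto
  then have I: "(c, d) \<in> param_elements a K0" by (simp add: param_elements_def)
  have "elem \<gamma> (c, d) \<inter> elem \<gamma> (c, d) \<noteq> {}" using param_width_pos[OF I] by (auto simp: elem_def param_width_def)
  then have "param_width (c, d) \<le> kappa_hat \<gamma> a K0 * param_width (c, d)" by (rule kappa_hat_ge[OF I I])
  then have \<kappa>: "1 \<le> kappa_hat \<gamma> a K0" using param_width_pos[OF I] by simp
  have "param_width I \<le> 2 * kappa_hat \<gamma> a K0 * param_width I'"
    if "I \<in> param_elements a K0" "I' \<in> param_elements a K0" "elem \<gamma> I \<inter> elem \<gamma> I' \<noteq> {}" for I I'
  proof -
    have "0 \<le> kappa_hat \<gamma> a K0 * param_width I'" using \<kappa> param_width_pos[OF that(2)] by simp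
    then show ?thesis using kappa_hat_ge[OF that] by linarith
  qed
  then show ?case using kv \<kappa> by (auto simp: graded_mesh_def intro!: exI[of _ "{#}"])
next
  case (step K M)
  note r = graded_mesh_refine[of \<gamma> a b p "kappa_hat \<gamma> a K0" K M]
  obtain L where L: "K = K0 + L" "set_mset L \<subseteq> {a<..<b}" using step by blast
  obtain L' where L': "refine \<gamma> a p (kappa_hat \<gamma> a K0) K M = K + L'" "set_mset L' \<subseteq> {a<..<b}"
    using r(2) step assms(3) by blast
  have "refine \<gamma> a p (kappa_hat \<gamma> a K0) K M = K0 + (L + L')" using L(1) L'(1) by (simp add: add.assoc)
  moreover have "set_mset (L + L') \<subseteq> {a<..<b}" using L(2) L'(2) by simp
  ultimately show ?case using r(1) step assms(3) by blast
qed

section \<open>The boundary curve and its arclength measure\<close>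

lemma sum_indicator_cells:
  assumes "finite Z" "Z \<subseteq> {a<..b}" "b \<in> Z"
  shows "(\<Sum>I\<in>cells a Z. indicator {fst I..<snd I} t) = (indicator {a..<b} t :: real)"
proof (cases "t \<in> {a..<b}")
  case True
  obtain c d where cd: "(c, d) \<in> cells a Z" "c \<le> t" "t < d" using cell_containing[OF assms, of t] True by auto
  have "I = (c, d)" if I: "I \<in> cells a Z" "t \<in> {fst I..<snd I}" for I
  proof -
    obtain c' d' where I': "I = (c', d')" by (cases I)
    have t: "c' \<le> t" "t < d'" using I(2) I' by simp_all
    obtain x where x: "t < x" "x < min d d'" using dense[of t "min d d'"] cd(3) t(2) by (metis min_less_iff_conj)
    have C': "(c', d') \<in> cells a Z" using I(1) I' by simp
    have "c < x" "x < d" "c' \<le> x" "x < d'" using x cd(2) t by linarith+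
    then have "c = c'" "d = d'" using cells_disjoint[OF cd(1) C' assms(2)] by blast+
    then show ?thesis using I' by simp
  qed
  then have uniq: "t \<notin> {fst I..<snd I}" if "I \<in> cells a Z" "I \<noteq> (c, d)" for I using that by blast
  have "indicator {fst I..<snd I} t = (if I = (c, d) then 1 else 0 :: real)" if "I \<in> cells a Z" for I
    using uniq[OF that] cd by (cases "I = (c, d)") (simp_all add: indicator_def)
  then have "(\<Sum>I\<in>cells a Z. indicator {fst I..<snd I} t) = (\<Sum>I\<in>cells a Z. if I = (c, d) then 1 else 0 :: real)"
    by (rule sum.cong[OF refl])
  also have "\<dots> = 1" using cd finite_cells[OF assms(1)] by simp
  finally show ?thesis using True by simp
next
  case False
  have "t \<notin> {fst I..<snd I}" if "I \<in> cells a Z" for I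
    using cellsD[of "fst I" "snd I" a Z b] that assms(2) False by auto
  then show ?thesis using False by simp
qed

text \<open>A set of one point is null, but \<open>F b\<close> is arbitrary, so measurability has to be transferred along with
  the integral.\<close>

lemma integral_endpoint:
  fixes F :: "real \<Rightarrow> real"
  assumes "(\<lambda>s. indicator {a..<b} s * F s) \<in> borel_measurable borel" "\<And>s. s \<notin> {a..b} \<Longrightarrow> F s = 0"
  shows "integral\<^sup>L lborel F = (LINT s|lborel. indicator {a..<b} s * F s)" "F \<in> borel_measurable borel"
proof -
  have "F = (\<lambda>s. indicator {a..<b} s * F s + indicator {b} s * (if a \<le> b then F b else 0))"
  proof
    fix s
    consider "a \<le> s \<and> s < b" | "s = b \<and> a \<le> b" | "s < a \<or> b < s"
      using linorder_less_linear[of s b] linorder_le_less_linear[of a s] by blast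
    then show "F s = indicator {a..<b} s * F s + indicator {b} s * (if a \<le> b then F b else 0)"
      by cases (use assms(2)[of s] in \<open>auto simp: indicator_def\<close>)
  qed
  moreover have "(\<lambda>s. indicator {a..<b} s * F s + indicator {b} s * (if a \<le> b then F b else 0)) \<in> borel_measurable borel"
    using assms(1) by measurable
  ultimately show m: "F \<in> borel_measurable borel" by metis
  have "AE s in lborel. F s = indicator {a..<b} s * F s"
    using AE_lborel_singleton[of b]
  proof eventually_elim
    case (elim s)
    then show ?case using assms(2)[of s] by (cases "s \<in> {a..<b}") (auto simp: indicator_def)
  qed
  then show "integral\<^sup>L lborel F = (LINT s|lborel. indicator {a..<b} s * F s)"
    using m assms(1) by (intro integral_cong_AE) auto
qed

locale curve =
  fixes \<gamma> :: "real \<Rightarrow> real^2" and a b :: real and \<Gamma> :: "(real^2) set"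
  assumes bp: "boundary_parametrization \<gamma> a b \<Gamma>"
begin

lemma ab: "a < b" and cont: "continuous_on {a..b} \<gamma>" and closed: "\<gamma> a = \<gamma> b"
  and bij: "bij_betw \<gamma> {a..<b} \<Gamma>"
  using bp by (auto simp: boundary_parametrization_def)

lemma inj: "inj_on \<gamma> {a..<b}" using bij by (simp add: bij_betw_def)

lemma image_Ico: "\<gamma> ` {a..<b} = \<Gamma>" using bij by (simp add: bij_betw_def)

lemma image_Icc: "\<gamma> ` {a..b} = \<Gamma>"
proof -
  have "{a..b} = insert b {a..<b}" using ab by auto
  moreover have "\<gamma> b \<in> \<gamma> ` {a..<b}" using closed ab by (metis atLeastLessThan_iff imageI order_refl)
  ultimately show ?thesis using image_Ico by auto
qed

lemma in_\<Gamma>: "t \<in> {a..b} \<Longrightarrow> \<gamma> t \<in> \<Gamma>" using image_Icc by blast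

lemma left_nonzero: "t \<in> {a<..b} \<Longrightarrow> left_deriv \<gamma> t \<noteq> 0"
  and right_nonzero: "t \<in> {a..<b} \<Longrightarrow> right_deriv \<gamma> t \<noteq> 0"
  using bp unfolding boundary_parametrization_def by blast+

text \<open>On a smooth piece the right derivative coincides with the derivative on the closed piece, except at
  its right end, where the latter is the left derivative.  Both one-sided derivatives are nonzero.\<close>

lemma speed_cells:
  "\<exists>Z. finite Z \<and> Z \<subseteq> {a<..b} \<and> b \<in> Z \<and> (\<forall>I\<in>cells a Z.
     (\<exists>D. continuous_on {fst I..snd I} D \<and> (\<forall>t\<in>{fst I..<snd I}. speed \<gamma> t = norm (D t)) \<and>
       (\<forall>t\<in>{fst I..snd I}. D t \<noteq> (0::real^2))))"
proof -
  obtain Z where Z: "finite Z" "Z \<subseteq> {a<..b}" "b \<in> Z" "\<forall>(c, d)\<in>cells a Z. C1_on_interval \<gamma> c d"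
    using bp by (auto simp: boundary_parametrization_def piecewise_C1_def)
  have main: "\<exists>D. continuous_on {c..d} D \<and> (\<forall>t\<in>{c..<d}. speed \<gamma> t = norm (D t)) \<and> (\<forall>t\<in>{c..d}. D t \<noteq> (0::real^2))"
    if cd: "(c, d) \<in> cells a Z" for c d
  proof -
    note C = cellsD[OF cd Z(2)]
    obtain D where D: "\<And>t. t \<in> {c..d} \<Longrightarrow> (\<gamma> has_vector_derivative D t) (at t within {c..d})" "continuous_on {c..d} D"
    proof -
      have "C1_on_interval \<gamma> c d" using Z(4) cd by blast
      then show ?thesis unfolding C1_on_interval_def using that by blast
    qed
    have r: "right_deriv \<gamma> t = D t" if t: "t \<in> {c..<d}" for t
    proof -
      have "(\<gamma> has_vector_derivative D t) (at t within {t..d})"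
        using t by (intro has_vector_derivative_within_subset[OF D(1)]) auto
      then have "(\<gamma> has_vector_derivative D t) (at_right t)"
        using at_within_Icc_at_right[of t d] t by simp
      then show ?thesis unfolding right_deriv_def by (intro vector_derivative_within) simp_all
    qed
    have "(\<gamma> has_vector_derivative D d) (at d within {c..d})" using C(2) by (intro D(1)) auto
    then have "(\<gamma> has_vector_derivative D d) (at_left d)"
      using at_within_Icc_at_left[OF C(2)] by simp
    then have l: "left_deriv \<gamma> d = D d" unfolding left_deriv_def by (intro vector_derivative_within) simp_all
    have "D t \<noteq> 0" if t: "t \<in> {c..d}" for t
    proof (cases "t = d")
      case True
      have "left_deriv \<gamma> d \<noteq> 0" using C by (intro left_nonzero) auto
      then show ?thesis using l True by simp
    next
      case False
      then have t': "t \<in> {c..<d}" using t by auto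
      then have "right_deriv \<gamma> t \<noteq> 0" using C(1,3) by (intro right_nonzero) auto
      then show ?thesis using r[OF t'] by simp
    qed
    then have "\<forall>t\<in>{c..d}. D t \<noteq> 0" by (intro ballI)
    moreover have "\<forall>t\<in>{c..<d}. speed \<gamma> t = norm (D t)" unfolding speed_def by (intro ballI arg_cong[of _ _ norm] r)
    ultimately have "continuous_on {c..d} D \<and> (\<forall>t\<in>{c..<d}. speed \<gamma> t = norm (D t)) \<and> (\<forall>t\<in>{c..d}. D t \<noteq> 0)"
      using D(2) by (intro conjI)
    then show ?thesis by (rule exI[of _ D])
  qed
  show ?thesis
  proof (intro exI[of _ Z] conjI ballI Z(1-3))
    fix I assume "I \<in> cells a Z"
    then have "(fst I, snd I) \<in> cells a Z" by simp
    then show "\<exists>D. continuous_on {fst I..snd I} D \<and> (\<forall>t\<in>{fst I..<snd I}. speed \<gamma> t = norm (D t)) \<and>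
       (\<forall>t\<in>{fst I..snd I}. D t \<noteq> (0::real^2))" by (rule main)
  qed
qed

text \<open>The density of the arclength measure in the parameter domain, extended by zero.\<close>

definition \<rho> :: "real \<Rightarrow> real" where "\<rho> t = indicator {a..<b} t * speed \<gamma> t"

lemma \<rho>_measurable [measurable]: "\<rho> \<in> borel_measurable borel"
proof -
  obtain Z where Z: "finite Z" "Z \<subseteq> {a<..b}" "b \<in> Z"
    and D: "\<And>I. I \<in> cells a Z \<Longrightarrow> \<exists>D. continuous_on {fst I..snd I} D \<and>
        (\<forall>t\<in>{fst I..<snd I}. speed \<gamma> t = norm (D t)) \<and> (\<forall>t\<in>{fst I..snd I}. D t \<noteq> (0::real^2))"
    using speed_cells by blast
  have m: "(\<lambda>t. indicator {fst I..<snd I} t * speed \<gamma> t) \<in> borel_measurable borel" if I: "I \<in> cells a Z" for I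
  proof -
    obtain D where D: "continuous_on {fst I..snd I} D" "\<And>t. t \<in> {fst I..<snd I} \<Longrightarrow> speed \<gamma> t = norm (D t :: real^2)"
      using D[OF I] by blast
    have [measurable]: "(\<lambda>t. indicator {fst I..snd I} t *\<^sub>R norm (D t)) \<in> borel_measurable borel"
      by (rule borel_measurable_continuous_on_indicator) (auto intro!: continuous_intros D)
    have "(\<lambda>t. indicator {fst I..<snd I} t * speed \<gamma> t) = (\<lambda>t. indicator {fst I..<snd I} t * (indicator {fst I..snd I} t *\<^sub>R norm (D t)))"
      using D(2) by (auto simp: fun_eq_iff indicator_def)
    moreover have "(\<lambda>t. indicator {fst I..<snd I} t * (indicator {fst I..snd I} t *\<^sub>R norm (D t))) \<in> borel_measurable borel"
      by measurable
    ultimately show ?thesis by (simp only:)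
  qed
  have "\<rho> = (\<lambda>t. \<Sum>I\<in>cells a Z. indicator {fst I..<snd I} t * speed \<gamma> t)"
    by (simp add: \<rho>_def fun_eq_iff sum_indicator_cells[OF Z, symmetric] sum_distrib_right)
  then show ?thesis using m by simp
qed

text \<open>On each of the finitely many closed pieces the speed extends to a continuous nonvanishing function, which
  attains its extrema.\<close>

lemma speed_bounds: "\<exists>m B. 0 < m \<and> m \<le> B \<and> (\<forall>t\<in>{a..<b}. m \<le> speed \<gamma> t \<and> speed \<gamma> t \<le> B)"
proof -
  obtain Z where Z: "finite Z" "Z \<subseteq> {a<..b}" "b \<in> Z"
    and D: "\<And>I. I \<in> cells a Z \<Longrightarrow> \<exists>D. continuous_on {fst I..snd I} D \<and>
        (\<forall>t\<in>{fst I..<snd I}. speed \<gamma> t = norm (D t)) \<and> (\<forall>t\<in>{fst I..snd I}. D t \<noteq> (0::real^2))"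
    using speed_cells by blast
  have "\<exists>m B. 0 < m \<and> (\<forall>t\<in>{fst I..<snd I}. m \<le> speed \<gamma> t \<and> speed \<gamma> t \<le> B)" if I: "I \<in> cells a Z" for I
  proof -
    have ne: "{fst I..snd I} \<noteq> {}" using cellsD[of "fst I" "snd I" a Z b] I Z(2) by auto
    obtain D where D: "continuous_on {fst I..snd I} D" "\<And>t. t \<in> {fst I..<snd I} \<Longrightarrow> speed \<gamma> t = norm (D t :: real^2)"
      "\<And>t. t \<in> {fst I..snd I} \<Longrightarrow> D t \<noteq> 0"
      using D[OF I] by blast
    have c: "continuous_on {fst I..snd I} (\<lambda>t. norm (D t))" by (intro continuous_intros D)
    obtain x where x: "x \<in> {fst I..snd I}" "\<And>y. y \<in> {fst I..snd I} \<Longrightarrow> norm (D x) \<le> norm (D y)"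
      using continuous_attains_inf[OF compact_Icc ne c] by blast
    obtain y where y: "y \<in> {fst I..snd I}" "\<And>z. z \<in> {fst I..snd I} \<Longrightarrow> norm (D z) \<le> norm (D y)"
      using continuous_attains_sup[OF compact_Icc ne c] by blast
    show ?thesis using x y D(2) D(3)[OF x(1)]
      by (intro exI[of _ "norm (D x)"] exI[of _ "norm (D y)"]) auto
  qed
  then obtain m B where mB: "\<And>I. I \<in> cells a Z \<Longrightarrow> 0 < m I"
    "\<And>I t. I \<in> cells a Z \<Longrightarrow> t \<in> {fst I..<snd I} \<Longrightarrow> m I \<le> speed \<gamma> t \<and> speed \<gamma> t \<le> B I" by metis
  let ?m = "Min (m ` cells a Z)" and ?B = "Max (B ` cells a Z)"
  have fin: "finite (cells a Z)" by (rule finite_cells[OF Z(1)])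
  have bd: "?m \<le> speed \<gamma> t \<and> speed \<gamma> t \<le> ?B" if t: "t \<in> {a..<b}" for t
  proof -
    obtain c d where cd: "(c, d) \<in> cells a Z" "c \<le> t" "t < d" using cell_containing[OF Z, of t] t by auto
    have "?m \<le> m (c, d)" "B (c, d) \<le> ?B" using fin cd(1) by (auto intro: Min_le Max_ge)
    moreover have "m (c, d) \<le> speed \<gamma> t" "speed \<gamma> t \<le> B (c, d)" using mB(2)[OF cd(1), of t] cd by simp_all
    ultimately show ?thesis by linarith
  qed
  have ne: "cells a Z \<noteq> {}" using cell_containing[OF Z, of a] ab by blast
  then have "0 < ?m" using mB(1) fin by simp
  moreover have "?m \<le> ?B" using bd[of a] ab by fastforce
  ultimately show ?thesis using bd by blast
qed

abbreviation "\<mu> \<equiv> arclength_measure \<gamma> a b"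

lemma Ico_restrict: "{a..<b} \<inter> space lborel \<in> sets lborel" by simp

lemma speed_meas: "speed \<gamma> \<in> borel_measurable (restrict_space lborel {a..<b})"
  using \<rho>_measurable by (subst borel_measurable_restrict_space_iff) (simp_all add: \<rho>_def[abs_def])

lemma \<gamma>_meas: "\<gamma> \<in> measurable (restrict_space lborel {a..<b}) (restrict_space borel \<Gamma>)"
proof (rule measurable_restrict_space2)
  show "\<gamma> \<in> space (restrict_space lborel {a..<b}) \<rightarrow> \<Gamma>" using image_Ico by (auto simp: space_restrict_space)
  have "\<gamma> \<in> borel_measurable (restrict_space borel {a..<b})"
    by (rule borel_measurable_continuous_on_restrict) (rule continuous_on_subset[OF cont], auto)
  moreover have "sets (restrict_space borel {a..<b}) = sets (restrict_space lborel {a..<b})"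
    by (rule sets_restrict_space_cong) simp
  ultimately show "\<gamma> \<in> borel_measurable (restrict_space lborel {a..<b})"
    using measurable_cong_sets by blast
qed

lemma \<mu>_def: "\<mu> = distr (density (restrict_space lborel {a..<b}) (\<lambda>t. ennreal (speed \<gamma> t))) (restrict_space borel \<Gamma>) \<gamma>"
  by (simp add: arclength_measure_def image_Icc)

lemma sets_\<mu>: "sets \<mu> = sets (restrict_space borel \<Gamma>)" and space_\<mu>: "space \<mu> = \<Gamma>"
  by (simp_all add: \<mu>_def space_restrict_space)

lemma measurable_\<mu>: "measurable \<mu> N = measurable (restrict_space borel \<Gamma>) N"
  by (rule measurable_cong_sets[OF sets_\<mu> refl])

lemma \<gamma>_meas': "\<gamma> \<in> measurable (density (restrict_space lborel {a..<b}) (\<lambda>t. ennreal (speed \<gamma> t))) (restrict_space borel \<Gamma>)"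
  using \<gamma>_meas by simp

text \<open>Functions on \<open>\<Gamma>\<close> seen in the parameter domain.  Extension by zero makes all integrals run over \<open>\<real>\<close>.\<close>

definition pull :: "(real^2 \<Rightarrow> real) \<Rightarrow> real \<Rightarrow> real" where
  "pull v t = indicator {a..<b} t * v (\<gamma> t)"

lemma pull_measurable: "v \<in> borel_measurable \<mu> \<Longrightarrow> pull v \<in> borel_measurable borel"
  unfolding measurable_\<mu> using measurable_compose[OF \<gamma>_meas, of v borel]
  by (subst (asm) borel_measurable_restrict_space_iff) (simp_all add: pull_def[abs_def])

lemma integral_\<mu>:
  assumes "f \<in> borel_measurable \<mu>"
  shows "integral\<^sup>L \<mu> f = (LINT t|lborel. \<rho> t * pull f t)"
    and "integrable \<mu> f \<longleftrightarrow> integrable lborel (\<lambda>t. \<rho> t * pull f t)"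
proof -
  have f: "f \<in> borel_measurable (restrict_space borel \<Gamma>)" using assms by (simp add: measurable_\<mu>)
  have f\<gamma>: "(\<lambda>t. f (\<gamma> t)) \<in> borel_measurable (restrict_space lborel {a..<b})"
    using measurable_compose[OF \<gamma>_meas f] .
  have eq: "indicat_real {a..<b} t *\<^sub>R speed \<gamma> t *\<^sub>R f (\<gamma> t) = \<rho> t * pull f t" for t
    by (auto simp: \<rho>_def pull_def indicator_def)
  have nn: "AE x in restrict_space lborel {a..<b}. 0 \<le> speed \<gamma> x" by (simp add: speed_def)
  show "integral\<^sup>L \<mu> f = (LINT t|lborel. \<rho> t * pull f t)"
    unfolding \<mu>_def integral_distr[OF \<gamma>_meas' f] integral_density[OF f\<gamma> speed_meas nn]
      integral_restrict_space[OF Ico_restrict] eq ..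
  show "integrable \<mu> f \<longleftrightarrow> integrable lborel (\<lambda>t. \<rho> t * pull f t)"
    unfolding \<mu>_def integrable_distr_eq[OF \<gamma>_meas' f] integrable_density[OF f\<gamma> speed_meas nn]
      integrable_restrict_space[OF Ico_restrict] eq ..
qed

lemma speed_pos: "t \<in> {a..<b} \<Longrightarrow> 0 < speed \<gamma> t"
  using speed_bounds by fastforce

lemma AE_\<mu>I:
  assumes "{x \<in> \<Gamma>. P x} \<in> sets \<mu>" "AE t in lborel. t \<in> {a..<b} \<longrightarrow> P (\<gamma> t)"
  shows "AE x in \<mu>. P x"
proof -
  have "AE t in restrict_space lborel {a..<b}. P (\<gamma> t)"
    using assms(2) by (subst AE_restrict_space_iff) auto
  then have "AE t in restrict_space lborel {a..<b}. 0 < ennreal (speed \<gamma> t) \<longrightarrow> P (\<gamma> t)" by eventually_elim simp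
  then have "AE t in density (restrict_space lborel {a..<b}) (\<lambda>t. ennreal (speed \<gamma> t)). P (\<gamma> t)"
    using speed_meas by (subst AE_density) auto
  then show ?thesis
    unfolding \<mu>_def using assms(1) sets_\<mu> by (subst AE_distr_iff[OF \<gamma>_meas']) (auto simp: space_restrict_space)
qed

lemma AE_\<mu>D:
  assumes "AE x in \<mu>. P x" shows "AE t in lborel. t \<in> {a..<b} \<longrightarrow> P (\<gamma> t)"
proof -
  have "AE t in density (restrict_space lborel {a..<b}) (\<lambda>t. ennreal (speed \<gamma> t)). P (\<gamma> t)"
    using AE_distrD[OF \<gamma>_meas'] assms unfolding \<mu>_def by blast
  then have "AE t in restrict_space lborel {a..<b}. 0 < ennreal (speed \<gamma> t) \<longrightarrow> P (\<gamma> t)"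
    using speed_meas by (subst (asm) AE_density) auto
  then have "AE t in lborel. t \<in> {a..<b} \<longrightarrow> 0 < ennreal (speed \<gamma> t) \<longrightarrow> P (\<gamma> t)"
    by (subst (asm) AE_restrict_space_iff) auto
  then show ?thesis by eventually_elim (use speed_pos in auto)
qed

lemma image_Icc_meas: "{c..d} \<subseteq> {a..b} \<Longrightarrow> \<gamma> ` {c..d} \<in> sets \<mu>"
proof -
  assume s: "{c..d} \<subseteq> {a..b}"
  have "compact (\<gamma> ` {c..d})" by (intro compact_continuous_image continuous_on_subset[OF cont s]) simp
  then have "\<gamma> ` {c..d} \<in> sets borel" by (intro borel_closed compact_imp_closed)
  moreover have "\<gamma> ` {c..d} = \<Gamma> \<inter> \<gamma> ` {c..d}" using s image_Icc by blast
  ultimately show ?thesis unfolding sets_\<mu> sets_restrict_space by blast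
qed

definition \<tau> :: "real^2 \<Rightarrow> real" where "\<tau> = the_inv_into {a..<b} \<gamma>"

lemma \<tau>_\<gamma>: "t \<in> {a..<b} \<Longrightarrow> \<tau> (\<gamma> t) = t"
  unfolding \<tau>_def using inj by (rule the_inv_into_f_f)

lemma \<gamma>_\<tau>: "x \<in> \<Gamma> \<Longrightarrow> \<gamma> (\<tau> x) = x" "x \<in> \<Gamma> \<Longrightarrow> \<tau> x \<in> {a..<b}"
proof -
  show "\<gamma> (\<tau> x) = x" if "x \<in> \<Gamma>" unfolding \<tau>_def using that image_Ico by (intro f_the_inv_into_f[OF inj]) simp
  show "\<tau> x \<in> {a..<b}" if "x \<in> \<Gamma>" unfolding \<tau>_def using that image_Ico by (intro the_inv_into_into[OF inj]) auto
qed

lemma \<tau>_measurable: "\<tau> \<in> borel_measurable \<mu>"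
  unfolding borel_measurable_iff_le
proof
  fix s
  consider "s < a" | "s \<in> {a..<b}" | "b \<le> s" by force
  then show "{x \<in> space \<mu>. \<tau> x \<le> s} \<in> sets \<mu>"
  proof cases
    case 1
    have "\<not> \<tau> x \<le> s" if "x \<in> space \<mu>" for x using \<gamma>_\<tau>(2)[of x] that 1 by (auto simp: space_\<mu>)
    then have "{x \<in> space \<mu>. \<tau> x \<le> s} = {}" by blast
    then show ?thesis by (simp only: sets.empty_sets)
  next
    case 2
    have "{x \<in> space \<mu>. \<tau> x \<le> s} = \<gamma> ` {a..s}"
    proof safe
      fix x assume "x \<in> space \<mu>" "\<tau> x \<le> s"
      then show "x \<in> \<gamma> ` {a..s}" using \<gamma>_\<tau>[of x] by (intro image_eqI[of _ _ "\<tau> x"]) (auto simp: space_\<mu>)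
    next
      fix t assume "t \<in> {a..s}"
      then show "\<gamma> t \<in> space \<mu>" "\<tau> (\<gamma> t) \<le> s" using 2 \<tau>_\<gamma>[of t] in_\<Gamma>[of t] by (auto simp: space_\<mu>)
    qed
    then show ?thesis using 2 by (simp add: image_Icc_meas)
  next
    case 3
    have "\<tau> x \<le> s" if "x \<in> space \<mu>" for x using \<gamma>_\<tau>(2)[of x] that 3 by (auto simp: space_\<mu>)
    then have "{x \<in> space \<mu>. \<tau> x \<le> s} = space \<mu>" by blast
    then show ?thesis by (simp only: sets.top)
  qed
qed

lemma push_measurable: "f \<in> borel_measurable borel \<Longrightarrow> (\<lambda>x. f (\<tau> x)) \<in> borel_measurable \<mu>"
  by (rule measurable_compose[OF \<tau>_measurable])

end

section \<open>Absolutely continuous functions\<close>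

lemma Cauchy_Schwarz_integral:
  fixes f g :: "'a \<Rightarrow> real"
  assumes [measurable]: "f \<in> borel_measurable M" "g \<in> borel_measurable M"
    and f2: "integrable M (\<lambda>x. (f x)\<^sup>2)" and g2: "integrable M (\<lambda>x. (g x)\<^sup>2)"
  shows "integrable M (\<lambda>x. f x * g x)"
    and "(LINT x|M. f x * g x)\<^sup>2 \<le> (LINT x|M. (f x)\<^sup>2) * (LINT x|M. (g x)\<^sup>2)"
proof -
  show fg: "integrable M (\<lambda>x. f x * g x)"
  proof (rule Bochner_Integration.integrable_bound)
    show "integrable M (\<lambda>x. (f x)\<^sup>2 + (g x)\<^sup>2)" using f2 g2 by simp
    have "norm (f x * g x) \<le> norm ((f x)\<^sup>2 + (g x)\<^sup>2)" for x
    proof -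
      have "2 * (\<bar>f x\<bar> * \<bar>g x\<bar>) \<le> (f x)\<^sup>2 + (g x)\<^sup>2"
        using sum_squares_bound[of "\<bar>f x\<bar>" "\<bar>g x\<bar>"] by (simp add: mult.assoc)
      moreover have "0 \<le> \<bar>f x\<bar> * \<bar>g x\<bar>" by simp
      ultimately have "\<bar>f x * g x\<bar> \<le> (f x)\<^sup>2 + (g x)\<^sup>2" unfolding abs_mult by linarith
      then show ?thesis by simp
    qed
    then show "AE x in M. norm (f x * g x) \<le> norm ((f x)\<^sup>2 + (g x)\<^sup>2)" by simp
  qed measurable
  let ?A = "LINT x|M. (f x)\<^sup>2" and ?B = "LINT x|M. f x * g x" and ?C = "LINT x|M. (g x)\<^sup>2"
  have quad: "0 \<le> y\<^sup>2 * ?A + 2 * y * ?B + ?C" for y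
  proof -
    have "0 \<le> (LINT x|M. (y * f x + g x)\<^sup>2)" by simp
    also have "(LINT x|M. (y * f x + g x)\<^sup>2) = (LINT x|M. y\<^sup>2 * (f x)\<^sup>2 + (2 * y * (f x * g x) + (g x)\<^sup>2))"
      by (rule Bochner_Integration.integral_cong) (auto simp: power2_eq_square algebra_simps)
    also have "\<dots> = y\<^sup>2 * ?A + (2 * y * ?B + ?C)" using f2 g2 fg by simp
    finally show ?thesis by simp
  qed
  show "?B\<^sup>2 \<le> ?A * ?C"
  proof (cases "?A = 0")
    case True
    have "?B = 0"
    proof (rule ccontr)
      assume "?B \<noteq> 0"
      then have "2 * (- (?C + 1) / (2 * ?B)) * ?B = - (?C + 1)" by (simp add: field_simps)
      then show False using quad[of "- (?C + 1) / (2 * ?B)"] True by simp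
    qed
    then show ?thesis using True by simp
  next
    case False
    moreover have "0 \<le> ?A" by simp
    ultimately have A: "0 < ?A" by linarith
    have "(- ?B / ?A)\<^sup>2 * ?A + 2 * (- ?B / ?A) * ?B + ?C = ?C - ?B\<^sup>2 / ?A"
      using A by (simp add: power2_eq_square field_simps)
    then have "?B\<^sup>2 / ?A \<le> ?C" using quad[of "- ?B / ?A"] by linarith
    then show ?thesis using A by (simp add: pos_divide_le_eq mult.commute)
  qed
qed

lemma integrable_indicator_mult:
  fixes f :: "real \<Rightarrow> real"
  assumes "integrable lborel f" "A \<in> sets borel"
  shows "integrable lborel (\<lambda>x. indicator A x * f x)"
  using integrable_mult_indicator[of A lborel f] assms by simp

lemma integrable_bounded_on:
  fixes f :: "real \<Rightarrow> real"
  assumes "f \<in> borel_measurable borel" "\<And>x. \<bar>f x\<bar> \<le> B" "\<And>x. x \<notin> {a..<b} \<Longrightarrow> f x = 0"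
  shows "integrable lborel f"
proof -
  have "integrable lborel (\<lambda>x. indicator {a..<b} x *\<^sub>R f x)"
  proof (rule integrableI_bounded_set_indicator[of _ _ _ B])
    show "emeasure lborel {a..<b} < \<infinity>" by (cases "a \<le> b") auto
  qed (use assms in auto)
  moreover have "(\<lambda>x. indicator {a..<b} x *\<^sub>R f x) = f" using assms(3) by (auto simp: fun_eq_iff indicator_def)
  ultimately show ?thesis by simp
qed

text \<open>\<open>u\<close> is absolutely continuous on \<open>[a,b]\<close> with square integrable derivative \<open>u'\<close> and takes equal values
  at the ends.  The derivative vanishes outside \<open>[a,b)\<close>, and \<open>u\<close> is unconstrained outside \<open>[a,b]\<close>.\<close>

definition periodic_ac :: "real \<Rightarrow> real \<Rightarrow> (real \<Rightarrow> real) \<Rightarrow> (real \<Rightarrow> real) \<Rightarrow> bool" where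
  "periodic_ac a b u u' \<longleftrightarrow> u' \<in> borel_measurable borel \<and> integrable lborel (\<lambda>t. (u' t)\<^sup>2) \<and>
     (\<forall>t. t \<notin> {a..<b} \<longrightarrow> u' t = 0) \<and>
     (\<forall>t\<in>{a..b}. u t = u a + (LINT s|lborel. indicator {a..t} s * u' s)) \<and> u b = u a"

lemma square_integrable_imp_integrable:
  fixes f :: "real \<Rightarrow> real"
  assumes [measurable]: "f \<in> borel_measurable borel" and "integrable lborel (\<lambda>t. (f t)\<^sup>2)"
    and "\<And>t. t \<notin> {a..<b} \<Longrightarrow> f t = 0"
  shows "integrable lborel f"
proof -
  have "integrable lborel (\<lambda>t. indicator {a..<b} t * f t)"
    by (rule Cauchy_Schwarz_integral) (auto intro!: assms integrable_bounded_on[of _ 1 a b] simp: indicator_def)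
  moreover have "(\<lambda>t. indicator {a..<b} t * f t) = f" using assms(3) by (auto simp: fun_eq_iff indicator_def)
  ultimately show ?thesis by simp
qed

lemma periodic_acD:
  assumes "periodic_ac a b u u'"
  shows "u' \<in> borel_measurable borel" "integrable lborel (\<lambda>t. (u' t)\<^sup>2)" "\<And>t. t \<notin> {a..<b} \<Longrightarrow> u' t = 0"
    "\<And>t. t \<in> {a..b} \<Longrightarrow> u t = u a + (LINT s|lborel. indicator {a..t} s * u' s)" "u b = u a"
    "integrable lborel u'"
proof -
  show *: "u' \<in> borel_measurable borel" "integrable lborel (\<lambda>t. (u' t)\<^sup>2)" "\<And>t. t \<notin> {a..<b} \<Longrightarrow> u' t = 0"
    "\<And>t. t \<in> {a..b} \<Longrightarrow> u t = u a + (LINT s|lborel. indicator {a..t} s * u' s)" "u b = u a"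
    using assms unfolding periodic_ac_def by blast+
  show "integrable lborel u'" using square_integrable_imp_integrable[OF *(1,2,3)] .
qed

lemma periodic_ac_increment:
  assumes "periodic_ac a b u u'" "a \<le> c" "c \<le> x" "x \<le> d" "c \<le> y" "y \<le> d" "d \<le> b"
  shows "\<bar>u y - u x\<bar> \<le> (LINT s|lborel. indicator {c..<d} s * \<bar>u' s\<bar>)"
proof -
  note P = periodic_acD[OF assms(1)]
  have I: "integrable lborel (\<lambda>s. indicator A s * u' s)" if "A \<in> sets borel" for A
    using integrable_indicator_mult[OF P(6) that] .
  have Ia: "integrable lborel (\<lambda>s. indicator A s * \<bar>u' s\<bar>)" if "A \<in> sets borel" for A
    using integrable_indicator_mult[OF integrable_abs[OF P(6)] that] .
  have *: "\<bar>u y - u x\<bar> \<le> (LINT s|lborel. indicator {c..<d} s * \<bar>u' s\<bar>)"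
    if "c \<le> x" "x \<le> y" "y \<le> d" for x y
  proof -
    have "u y - u x = (LINT s|lborel. indicator {a..y} s * u' s) - (LINT s|lborel. indicator {a..x} s * u' s)"
      using P(4)[of x] P(4)[of y] that assms by simp
    also have "\<dots> = (LINT s|lborel. indicator {a..y} s * u' s - indicator {a..x} s * u' s)"
      using I by (intro Bochner_Integration.integral_diff[symmetric]) auto
    finally have "\<bar>u y - u x\<bar> \<le> (LINT s|lborel. \<bar>indicator {a..y} s * u' s - indicator {a..x} s * u' s\<bar>)"
      using integral_abs_bound[of lborel "\<lambda>s. indicator {a..y} s * u' s - indicator {a..x} s * u' s"] by simp
    also have "\<dots> \<le> (LINT s|lborel. indicator {c..<d} s * \<bar>u' s\<bar>)"
    proof (rule integral_mono_AE)
      show "integrable lborel (\<lambda>s. \<bar>indicator {a..y} s * u' s - indicator {a..x} s * u' s\<bar>)"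
        using I by auto
      show "integrable lborel (\<lambda>s. indicator {c..<d} s * \<bar>u' s\<bar>)" using Ia by auto
      show "AE s in lborel. \<bar>indicator {a..y} s * u' s - indicator {a..x} s * u' s\<bar> \<le> indicator {c..<d} s * \<bar>u' s\<bar>"
        using AE_lborel_singleton[of d]
        by eventually_elim (use that assms in \<open>auto simp: indicator_def\<close>)
    qed
    finally show ?thesis .
  qed
  show ?thesis
  proof (cases "x \<le> y")
    case True then show ?thesis using *[of x y] assms by simp
  next
    case False then show ?thesis using *[of y x] assms by simp
  qed
qed

lemma periodic_ac_continuous:
  assumes "periodic_ac a b u u'"
  shows "continuous_on {a..b} u"
proof -
  note P = periodic_acD[OF assms(1)]
  have si: "set_integrable lborel {a..t} u'" for t
    using integrable_indicator_mult[OF P(6), of "{a..t}"] by (simp add: set_integrable_def)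
  have "u t = u a + integral {a..t} u'" if "t \<in> {a..b}" for t
    using P(4)[OF that] set_borel_integral_eq_integral(2)[OF si[of t]]
    by (simp add: set_lebesgue_integral_def)
  moreover have "continuous_on {a..b} (\<lambda>t. u a + integral {a..t} u')"
    by (intro continuous_intros indefinite_integral_continuous_1 set_borel_integral_eq_integral(1)[OF si])
  ultimately show ?thesis by (metis (no_types, lifting) continuous_on_cong)
qed

lemma periodic_ac_bounded:
  assumes "periodic_ac a b u u'"
  shows "\<exists>B. \<forall>t\<in>{a..b}. \<bar>u t\<bar> \<le> B"
proof -
  have "compact (u ` {a..b})" by (intro compact_continuous_image periodic_ac_continuous[OF assms]) simp
  then have "bounded (u ` {a..b})" by (rule compact_imp_bounded)
  then show ?thesis by (auto simp: bounded_iff)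
qed

text \<open>The integrals of \<open>f\<close> over all half-lines vanish.  Hence the measures with densities \<open>max f 0\<close> and
  \<open>max (- f) 0\<close> agree on a generator of the Borel sets, and densities are unique.\<close>

lemma AE_zero_of_primitive_zero:
  fixes f :: "real \<Rightarrow> real"
  assumes f: "integrable lborel f" and out: "\<And>t. t \<notin> {a..<b} \<Longrightarrow> f t = 0"
    and zero: "\<And>t. t \<in> {a..b} \<Longrightarrow> (LINT s|lborel. indicator {a..t} s * f s) = 0" and ab: "a < b"
  shows "AE t in lborel. f t = 0"
proof -
  have [measurable]: "f \<in> borel_measurable borel" using f by auto
  have tail: "(LINT s|lborel. indicator {x<..} s * f s) = 0" for x
  proof -
    define t where "t = max a (min b x)"
    have t: "t \<in> {a..b}" using ab by (auto simp: t_def)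
    have "AE s in lborel. indicator {x<..} s * f s = indicator {a..b} s * f s - indicator {a..t} s * f s"
      using AE_lborel_singleton[of a]
    proof eventually_elim
      case (elim s)
      then show ?case using out[of s] ab by (auto simp: indicator_def t_def)
    qed
    then have "(LINT s|lborel. indicator {x<..} s * f s) = (LINT s|lborel. indicator {a..b} s * f s - indicator {a..t} s * f s)"
      by (intro integral_cong_AE) auto
    also have "\<dots> = (LINT s|lborel. indicator {a..b} s * f s) - (LINT s|lborel. indicator {a..t} s * f s)"
      by (intro Bochner_Integration.integral_diff integrable_indicator_mult[OF f]) auto
    also have "\<dots> = 0" using zero[of b] zero[OF t] ab by simp
    finally show ?thesis .
  qed
  let ?M = "density lborel (\<lambda>x. ennreal (f x))" and ?N = "density lborel (\<lambda>x. ennreal (- f x))"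
  have M: "emeasure ?M {x<..} = (\<integral>\<^sup>+ s. ennreal (indicator {x<..} s * f s) \<partial>lborel)" for x
    by (subst emeasure_density) (auto intro!: nn_integral_cong simp: indicator_def)
  have N: "emeasure ?N {x<..} = (\<integral>\<^sup>+ s. ennreal (- (indicator {x<..} s * f s)) \<partial>lborel)" for x
    by (subst emeasure_density) (auto intro!: nn_integral_cong simp: indicator_def)
  have fin: "(\<integral>\<^sup>+ s. ennreal (indicator {x<..} s * f s) \<partial>lborel) \<noteq> \<infinity>"
    "(\<integral>\<^sup>+ s. ennreal (- (indicator {x<..} s * f s)) \<partial>lborel) \<noteq> \<infinity>" for x
    using integrable_indicator_mult[OF f, of "{x<..}"] unfolding real_integrable_def by auto
  have eq: "emeasure ?M {x<..} = emeasure ?N {x<..}" for x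
  proof -
    have "enn2real (\<integral>\<^sup>+ s. ennreal (indicator {x<..} s * f s) \<partial>lborel) = enn2real (\<integral>\<^sup>+ s. ennreal (- (indicator {x<..} s * f s)) \<partial>lborel)"
      using tail[of x] real_lebesgue_integral_def[OF integrable_indicator_mult[OF f, of "{x<..}"]] by simp
    then have "ennreal (enn2real (emeasure ?M {x<..})) = ennreal (enn2real (emeasure ?N {x<..}))" unfolding M N by (simp only:)
    moreover have "emeasure ?M {x<..} < top" "emeasure ?N {x<..} < top" unfolding M N using fin[of x] by (simp_all add: less_top)
    ultimately show ?thesis by (simp only: ennreal_enn2real)
  qed
  have "?M = ?N"
    using eq fin by (intro measure_eqI_lessThan) (auto simp: M less_top)
  then have "AE t in lborel. ennreal (f t) = ennreal (- f t)"
    by (intro sigma_finite_measure.density_unique) (auto intro: sigma_finite_lborel)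
  then show ?thesis
  proof eventually_elim
    case (elim t)
    then show ?case by (cases "0 \<le> f t") (auto simp: ennreal_neg)
  qed
qed

text \<open>Continuous functions that agree almost everywhere agree, and then the derivatives have the same
  primitive.  It makes the arclength derivative unique, whichever one the choice operator selects.\<close>

lemma periodic_ac_unique:
  assumes u: "periodic_ac a b u u'" and w: "periodic_ac a b w w'" and "a < b"
    and ae: "AE t in lborel. t \<in> {a..<b} \<longrightarrow> u t = w t"
  shows "\<And>t. t \<in> {a..b} \<Longrightarrow> u t = w t" "AE t in lborel. u' t = w' t"
proof -
  note U = periodic_acD[OF u] and W = periodic_acD[OF w]
  have c: "continuous_on {a..b} (\<lambda>t. u t - w t)"
    by (intro continuous_intros periodic_ac_continuous[OF u] periodic_ac_continuous[OF w])
  show eq: "u x = w x" if x: "x \<in> {a..b}" for x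
  proof (rule ccontr)
    assume ne: "u x \<noteq> w x"
    obtain \<delta> where \<delta>: "0 < \<delta>" "\<And>y. y \<in> {a..b} \<Longrightarrow> dist y x < \<delta> \<Longrightarrow> dist (u y - w y) (u x - w x) < \<bar>u x - w x\<bar>"
      using c[unfolded continuous_on_iff, rule_format, OF x, of "\<bar>u x - w x\<bar>"] ne by auto
    let ?I = "{max a (x - \<delta>)<..<min b (x + \<delta>)}"
    have sub: "u y \<noteq> w y \<and> y \<in> {a..<b}" if "y \<in> ?I" for y
    proof -
      have y: "y \<in> {a..b}" "y \<in> {a..<b}" "dist y x < \<delta>" using that x by (auto simp: dist_real_def)
      then have "\<bar>(u y - w y) - (u x - w x)\<bar> < \<bar>u x - w x\<bar>" using \<delta>(2)[OF y(1,3)] by (simp add: dist_real_def)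
      then have "u y \<noteq> w y" by (cases "u y = w y") auto
      then show ?thesis using y(2) by blast
    qed
    have "AE y in lborel. y \<notin> ?I" using ae by eventually_elim (use sub in blast)
    then have "emeasure lborel ?I = 0" by (subst (asm) AE_iff_null_sets[symmetric]) auto
    moreover have lt: "max a (x - \<delta>) < min b (x + \<delta>)" using x \<delta>(1) assms(3) by auto
    ultimately have "ennreal (min b (x + \<delta>) - max a (x - \<delta>)) = 0"
      using emeasure_lborel_Ioo[of "max a (x - \<delta>)" "min b (x + \<delta>)"] by (simp only: less_imp_le)
    then have "min b (x + \<delta>) - max a (x - \<delta>) \<le> 0" by (simp only: ennreal_eq_0_iff)
    then show False using lt by linarith
  qed
  have "AE t in lborel. u' t - w' t = 0"
  proof (rule AE_zero_of_primitive_zero)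
    show "integrable lborel (\<lambda>t. u' t - w' t)" using U(6) W(6) by simp
    show "u' t - w' t = 0" if "t \<notin> {a..<b}" for t using U(3)[OF that] W(3)[OF that] by simp
    show "(LINT s|lborel. indicator {a..t} s * (u' s - w' s)) = 0" if "t \<in> {a..b}" for t
    proof -
      have "(LINT s|lborel. indicator {a..t} s * (u' s - w' s)) =
         (LINT s|lborel. indicator {a..t} s * u' s) - (LINT s|lborel. indicator {a..t} s * w' s)"
        unfolding right_diff_distrib
        by (intro Bochner_Integration.integral_diff integrable_indicator_mult U(6) W(6)) auto
      then show ?thesis using U(4)[OF that] W(4)[OF that] eq[OF that] eq[of a] assms(3) by simp
    qed
  qed (rule assms(3))
  then show "AE t in lborel. u' t = w' t" by eventually_elim simp
qed

lemma periodic_ac_add: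
  assumes u: "periodic_ac a b u u'" and w: "periodic_ac a b w w'"
  shows "periodic_ac a b (\<lambda>t. k * u t + l * w t + m) (\<lambda>t. k * u' t + l * w' t)"
proof -
  note U = periodic_acD[OF u] and W = periodic_acD[OF w]
  have [measurable]: "u' \<in> borel_measurable borel" "w' \<in> borel_measurable borel" using U W by auto
  have "integrable lborel (\<lambda>t. k\<^sup>2 * (u' t)\<^sup>2 + l\<^sup>2 * (w' t)\<^sup>2 + 2 * k * l * (u' t * w' t))"
    using U(2) W(2) Cauchy_Schwarz_integral(1)[of u' lborel w'] by simp
  moreover have "(k * u' t + l * w' t)\<^sup>2 = k\<^sup>2 * (u' t)\<^sup>2 + l\<^sup>2 * (w' t)\<^sup>2 + 2 * k * l * (u' t * w' t)" for t
    by (simp add: power2_eq_square algebra_simps)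
  ultimately have sq: "integrable lborel (\<lambda>t. (k * u' t + l * w' t)\<^sup>2)" by simp
  have "k * u t + l * w t + m = k * u a + l * w a + m + (LINT s|lborel. indicator {a..t} s * (k * u' s + l * w' s))"
    if "t \<in> {a..b}" for t
  proof -
    have "(LINT s|lborel. indicator {a..t} s * (k * u' s + l * w' s)) =
        (LINT s|lborel. k * (indicator {a..t} s * u' s) + l * (indicator {a..t} s * w' s))"
      by (simp add: algebra_simps)
    also have "\<dots> = k * (LINT s|lborel. indicator {a..t} s * u' s) + l * (LINT s|lborel. indicator {a..t} s * w' s)"
      using integrable_indicator_mult[OF U(6), of "{a..t}"] integrable_indicator_mult[OF W(6), of "{a..t}"] by simp
    finally show ?thesis using U(4)[OF that] W(4)[OF that] by (simp add: algebra_simps)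
  qed
  then show ?thesis unfolding periodic_ac_def
  proof (intro conjI ballI allI impI sq)
    show "k * u' t + l * w' t = 0" if "t \<notin> {a..<b}" for t using U(3)[OF that] W(3)[OF that] by simp
  qed (use U(5) W(5) in \<open>measurable, blast, simp\<close>)
qed

lemma periodic_ac_piecewise_smooth:
  assumes "a < b" "finite S" "continuous_on {a..b} F" "F b = F a"
    and der: "\<And>x. x \<in> {a<..<b} - S \<Longrightarrow> (F has_real_derivative D x) (at x)"
    and D [measurable]: "D \<in> borel_measurable borel" and bd: "\<And>x. \<bar>D x\<bar> \<le> B" and out: "\<And>x. x \<notin> {a..<b} \<Longrightarrow> D x = 0"
  shows "periodic_ac a b F D"
proof -
  have "\<bar>(D x)\<^sup>2\<bar> \<le> B\<^sup>2" for x using bd[of x] by (simp add: abs_le_square_iff[symmetric])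
  then have "integrable lborel (\<lambda>t. (D t)\<^sup>2)"
    by (intro integrable_bounded_on[of _ "B\<^sup>2" a b]) (auto simp: out)
  moreover have "F t = F a + (LINT s|lborel. indicator {a..t} s * D s)" if t: "t \<in> {a..b}" for t
  proof -
    have "integrable lborel D" using bd out by (intro integrable_bounded_on[of _ B a b]) auto
    then have si: "set_integrable lborel {a..t} D"
      using integrable_indicator_mult[of D "{a..t}"] by (simp add: set_integrable_def)
    have "(D has_integral (F t - F a)) {a..t}"
    proof (rule fundamental_theorem_of_calculus_interior_strong[OF assms(2)])
      show "continuous_on {a..t} F" by (rule continuous_on_subset[OF assms(3)]) (use t in auto)
      show "(F has_vector_derivative D x) (at x)" if "x \<in> {a<..<t} - S" for x
        using der[of x] that t by (simp add: has_real_derivative_iff_has_vector_derivative)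
    qed (use t in auto)
    then have "integral {a..t} D = F t - F a" by (rule integral_unique)
    then show ?thesis using set_borel_integral_eq_integral(2)[OF si] by (simp add: set_lebesgue_integral_def)
  qed
  ultimately show ?thesis unfolding periodic_ac_def using D assms(4) out by blast
qed

lemma periodic_ac_mult:
  assumes u: "periodic_ac a b u u'" and w: "periodic_ac a b w w'" and "a < b"
  shows "periodic_ac a b (\<lambda>t. u t * w t) (\<lambda>t. indicator {a..<b} t * (u' t * w t + u t * w' t))"
proof -
  note U = periodic_acD[OF u] and W = periodic_acD[OF w]
  have [measurable]: "u' \<in> borel_measurable borel" "w' \<in> borel_measurable borel" using U W by auto
  have ext: "(\<lambda>t. indicator {a..b} t * f t) \<in> borel_measurable borel" if "continuous_on {a..b} f" for f :: "real \<Rightarrow> real"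
    using borel_measurable_continuous_on_indicator[OF _ that] by simp
  define U0 W0 where "U0 t = indicator {a..b} t * u t" and "W0 t = indicator {a..b} t * w t" for t
  have [measurable]: "U0 \<in> borel_measurable borel" "W0 \<in> borel_measurable borel"
    unfolding U0_def W0_def by (intro ext periodic_ac_continuous[OF u] periodic_ac_continuous[OF w])+
  obtain Bu Bw where B: "\<And>t. t \<in> {a..b} \<Longrightarrow> \<bar>u t\<bar> \<le> Bu" "\<And>t. t \<in> {a..b} \<Longrightarrow> \<bar>w t\<bar> \<le> Bw"
    using periodic_ac_bounded[OF u] periodic_ac_bounded[OF w] by blast
  have Bnn: "0 \<le> Bu" "0 \<le> Bw" using B(1)[of a] B(2)[of a] \<open>a < b\<close> by auto
  have B0: "\<bar>U0 t\<bar> \<le> Bu" "\<bar>W0 t\<bar> \<le> Bw" for t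
    using B(1)[of t] B(2)[of t] Bnn by (auto simp: U0_def W0_def indicator_def)
  define h where "h t = u' t * W0 t + U0 t * w' t" for t
  have h: "h = (\<lambda>t. indicator {a..<b} t * (u' t * w t + u t * w' t))"
    using U(3) W(3) by (auto simp: h_def U0_def W0_def fun_eq_iff indicator_def)
  have [measurable]: "h \<in> borel_measurable borel" unfolding h_def by measurable
  have bi: "integrable lborel (\<lambda>t. f t * g t)" if "integrable lborel f" "g \<in> borel_measurable borel" "\<And>t. \<bar>g t\<bar> \<le> B"
    for f g :: "real \<Rightarrow> real" and B
  proof (rule Bochner_Integration.integrable_bound)
    show "integrable lborel (\<lambda>t. B * f t)" using that(1) by simp
    have "norm (f t * g t) \<le> norm (B * f t)" for t
      using mult_right_mono[OF order_trans[OF that(3)[of t] abs_ge_self[of B]], of "\<bar>f t\<bar>"] by (simp add: abs_mult mult.commute)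
    then show "AE t in lborel. norm (f t * g t) \<le> norm (B * f t)" by simp
    show "(\<lambda>t. f t * g t) \<in> borel_measurable lborel" using that(1,2) by measurable
  qed
  have h2: "integrable lborel (\<lambda>t. (h t)\<^sup>2)"
  proof -
    have "integrable lborel (\<lambda>t. (u' t)\<^sup>2 * (W0 t)\<^sup>2)"
      by (rule bi[OF U(2), of _ "Bw\<^sup>2"]) (use B0 Bnn in \<open>auto simp: abs_le_square_iff[symmetric]\<close>)
    moreover have "integrable lborel (\<lambda>t. (w' t)\<^sup>2 * (U0 t)\<^sup>2)"
      by (rule bi[OF W(2), of _ "Bu\<^sup>2"]) (use B0 Bnn in \<open>auto simp: abs_le_square_iff[symmetric]\<close>)
    moreover have "integrable lborel (\<lambda>t. (u' t * w' t) * (U0 t * W0 t))"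
      by (rule bi[OF Cauchy_Schwarz_integral(1), of _ _ _ "Bu * Bw"])
         (use U(2) W(2) B0 Bnn in \<open>auto simp: abs_mult intro!: mult_mono\<close>)
    ultimately have "integrable lborel (\<lambda>t. (u' t)\<^sup>2 * (W0 t)\<^sup>2 + (w' t)\<^sup>2 * (U0 t)\<^sup>2 + 2 * ((u' t * w' t) * (U0 t * W0 t)))"
      by simp
    moreover have "(h t)\<^sup>2 = (u' t)\<^sup>2 * (W0 t)\<^sup>2 + (w' t)\<^sup>2 * (U0 t)\<^sup>2 + 2 * ((u' t * w' t) * (U0 t * W0 t))" for t
      by (simp add: h_def power2_eq_square algebra_simps)
    ultimately show ?thesis by simp
  qed
  have "u t * w t = u a * w a + (LINT s|lborel. indicator {a..t} s * h s)" if t: "t \<in> {a..b}" for t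
  proof -
    define f g where "f s = indicator {a..t} s * u' s" and "g s = indicator {a..t} s * w' s" for s
    have f: "integrable lborel f" and g: "integrable lborel g"
      unfolding f_def g_def by (intro integrable_indicator_mult U(6) W(6); simp)+
    have [measurable]: "f \<in> borel_measurable borel" "g \<in> borel_measurable borel" unfolding f_def g_def by measurable
    have F: "integral\<^sup>L lborel f = u t - u a" and G: "integral\<^sup>L lborel g = w t - w a"
      using U(4)[OF t] W(4)[OF t] by (auto simp: f_def[abs_def] g_def[abs_def])
    have int: "integrable (lborel \<Otimes>\<^sub>M lborel) (\<lambda>(r, s). f r * g s * indicator {..s} r)"
    proof (rule Bochner_Integration.integrable_bound)
      show "integrable (lborel \<Otimes>\<^sub>M lborel) (\<lambda>(r, s). f r * g s)"
      proof (rule lborel_pair.Fubini_integrable)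
        have "(\<lambda>x. LINT y|lborel. norm (case (x, y) of (r, s) \<Rightarrow> f r * g s)) = (\<lambda>x. \<bar>f x\<bar> * (LINT y|lborel. \<bar>g y\<bar>))"
          by (simp add: abs_mult)
        then show "integrable lborel (\<lambda>x. LINT y|lborel. norm (case (x, y) of (r, s) \<Rightarrow> f r * g s))" using f by simp
        show "AE x in lborel. integrable lborel (\<lambda>y. case (x, y) of (r, s) \<Rightarrow> f r * g s)" using g by simp
      qed measurable
      have eq: "(\<lambda>x. indicator {..snd x} (fst x) :: real) = (\<lambda>x :: real \<times> real. if fst x \<le> snd x then 1 else 0)"
        by (auto simp: indicator_def fun_eq_iff)
      have [measurable]: "(\<lambda>x :: real \<times> real. indicator {..snd x} (fst x) :: real) \<in> borel_measurable (lborel \<Otimes>\<^sub>M lborel)"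
        unfolding eq by measurable
      have "(\<lambda>x. f (fst x) * g (snd x) * indicator {..snd x} (fst x)) \<in> borel_measurable (lborel \<Otimes>\<^sub>M lborel)"
        by measurable
      then show "(\<lambda>(r, s). f r * g s * indicator {..s} r) \<in> borel_measurable (lborel \<Otimes>\<^sub>M lborel)"
        by (simp add: case_prod_beta)
      show "AE x in lborel \<Otimes>\<^sub>M lborel. norm (case x of (r, s) \<Rightarrow> f r * g s * indicator {..s} r) \<le> norm (case x of (r, s) \<Rightarrow> f r * g s)"
        by (auto simp: indicator_def)
    qed
    have "(LINT s|lborel. LINT r|lborel. f r * g s * indicator {..s} r) = (LINT r|lborel. LINT s|lborel. f r * g s * indicator {..s} r)"
      using lborel_pair.Fubini_integral[OF int] .
    also have "(LINT s|lborel. LINT r|lborel. f r * g s * indicator {..s} r) = (LINT s|lborel. g s * (U0 s - u a))"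
    proof (rule Bochner_Integration.integral_cong[OF refl])
      fix s
      show "(LINT r|lborel. f r * g s * indicator {..s} r) = g s * (U0 s - u a)"
      proof (cases "s \<in> {a..t}")
        case True
        have "(\<lambda>r. f r * g s * indicator {..s} r) = (\<lambda>r. g s * (indicator {a..s} r * u' r))"
          using True by (auto simp: f_def indicator_def fun_eq_iff)
        then show ?thesis using U(4)[of s] True t by (simp add: U0_def)
      qed (simp add: g_def)
    qed
    also have "(LINT r|lborel. LINT s|lborel. f r * g s * indicator {..s} r) = (LINT r|lborel. f r * (w t - W0 r))"
    proof (rule Bochner_Integration.integral_cong[OF refl])
      fix r
      show "(LINT s|lborel. f r * g s * indicator {..s} r) = f r * (w t - W0 r)"
      proof (cases "r \<in> {a..t}")
        case True
        have "(LINT s|lborel. f r * g s * indicator {..s} r) = (LINT s|lborel. f r * (indicator {a..t} s * w' s - indicator {a..r} s * w' s))"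
        proof (rule integral_cong_AE)
          show "AE s in lborel. f r * g s * indicator {..s} r = f r * (indicator {a..t} s * w' s - indicator {a..r} s * w' s)"
            using AE_lborel_singleton[of r] by eventually_elim (use True in \<open>auto simp: g_def indicator_def\<close>)
          have eq: "(\<lambda>s. f r * g s * indicator {..s} r) = (\<lambda>s. f r * g s * indicator {r..} s)"
            by (auto simp: indicator_def fun_eq_iff)
          show "(\<lambda>s. f r * g s * indicator {..s} r) \<in> borel_measurable lborel" unfolding eq by measurable
        qed measurable
        also have "\<dots> = f r * ((LINT s|lborel. indicator {a..t} s * w' s) - (LINT s|lborel. indicator {a..r} s * w' s))"
          using integrable_indicator_mult[OF W(6), of "{a..t}"] integrable_indicator_mult[OF W(6), of "{a..r}"] by simp
        finally show ?thesis using W(4)[OF t] W(4)[of r] True t by (simp add: W0_def)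
      qed (simp add: f_def)
    qed
    finally have eq: "(LINT s|lborel. g s * (U0 s - u a)) = (LINT r|lborel. f r * (w t - W0 r))" .
    have i1: "integrable lborel (\<lambda>s. g s * U0 s)" "integrable lborel (\<lambda>s. f s * W0 s)"
      using B0 by (auto intro!: bi f g)
    have "(LINT s|lborel. g s * U0 s) - (w t - w a) * u a = (u t - u a) * w t - (LINT r|lborel. f r * W0 r)"
      using eq i1 f g unfolding right_diff_distrib by (simp add: F G)
    moreover have "(LINT s|lborel. indicator {a..t} s * h s) = (LINT s|lborel. g s * U0 s + f s * W0 s)"
      by (rule Bochner_Integration.integral_cong) (auto simp: f_def g_def h_def algebra_simps)
    ultimately show ?thesis using i1 by (simp add: algebra_simps)
  qed
  moreover have "h t = 0" if "t \<notin> {a..<b}" for t using U(3)[OF that] W(3)[OF that] by (simp add: h_def)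
  moreover have "h \<in> borel_measurable borel" by measurable
  ultimately show ?thesis unfolding h[symmetric] periodic_ac_def U(5) W(5) using h2 by blast
qed

section \<open>Sobolev functions in the parameter domain\<close>

text \<open>The squared \<open>L\<^sup>2(A)\<close> norm in the parameter domain.\<close>

definition nsq :: "real set \<Rightarrow> (real \<Rightarrow> real) \<Rightarrow> real" where
  "nsq A f = (LINT t|lborel. indicator A t * (f t)\<^sup>2)"

lemma nsq_nonneg: "0 \<le> nsq A f"
  unfolding nsq_def by (intro integral_nonneg_AE) simp

lemma nsq_mono:
  assumes "integrable lborel (\<lambda>t. (f t)\<^sup>2)" "A \<in> sets borel" "B \<in> sets borel" "AE t in lborel. t \<in> A \<longrightarrow> t \<in> B"
  shows "nsq A f \<le> nsq B f"
  unfolding nsq_def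
proof (rule integral_mono_AE)
  show "AE t in lborel. indicator A t * (f t)\<^sup>2 \<le> indicator B t * (f t)\<^sup>2"
    using assms(4) by eventually_elim (auto simp: indicator_def)
qed (auto intro!: integrable_indicator_mult assms)

locale curve_bounds = curve +
  fixes smin smax :: real
  assumes smin_pos: "0 < smin" and speed_ge: "\<And>t. t \<in> {a..<b} \<Longrightarrow> smin \<le> speed \<gamma> t"
    and speed_le: "\<And>t. t \<in> {a..<b} \<Longrightarrow> speed \<gamma> t \<le> smax"
begin

lemma \<rho>_bounds: "0 \<le> \<rho> t" "\<rho> t \<le> smax" "t \<in> {a..<b} \<Longrightarrow> smin \<le> \<rho> t" "t \<notin> {a..<b} \<Longrightarrow> \<rho> t = 0"
proof -
  show "0 \<le> \<rho> t" by (simp add: \<rho>_def speed_def)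
  have "0 \<le> smax" using speed_ge[of a] speed_le[of a] smin_pos ab by simp
  then show "\<rho> t \<le> smax" using speed_le[of t] by (auto simp: \<rho>_def indicator_def)
  show "t \<in> {a..<b} \<Longrightarrow> smin \<le> \<rho> t" using speed_ge[of t] by (simp add: \<rho>_def)
  show "t \<notin> {a..<b} \<Longrightarrow> \<rho> t = 0" by (simp add: \<rho>_def)
qed

lemma smax_pos: "0 < smax"
  using speed_ge[of a] speed_le[of a] smin_pos ab by simp

lemma integrable_dominated:
  fixes f g :: "real \<Rightarrow> real"
  assumes "integrable lborel g" "f \<in> borel_measurable borel" "\<And>t. \<bar>f t\<bar> \<le> C * g t"
  shows "integrable lborel f"
proof (rule Bochner_Integration.integrable_bound)
  show "integrable lborel (\<lambda>t. C * g t)" using assms(1) by simp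
  show "AE t in lborel. norm (f t) \<le> norm (C * g t)" using assms(3) by (auto intro: order_trans[OF _ abs_ge_self])
qed (use assms in simp)

lemma pull_sq: "pull (\<lambda>x. (v x)\<^sup>2) t = (pull v t)\<^sup>2"
  by (simp add: pull_def indicator_def)

lemma weighted_sq_integrable_iff:
  assumes [measurable]: "f \<in> borel_measurable borel" and out: "\<And>t. t \<notin> {a..<b} \<Longrightarrow> f t = 0"
  shows "integrable lborel (\<lambda>t. \<rho> t * (f t)\<^sup>2) \<longleftrightarrow> integrable lborel (\<lambda>t. (f t)\<^sup>2)"
proof
  assume "integrable lborel (\<lambda>t. \<rho> t * (f t)\<^sup>2)"
  then show "integrable lborel (\<lambda>t. (f t)\<^sup>2)"
  proof (rule integrable_dominated)
    show "\<bar>(f t)\<^sup>2\<bar> \<le> (1 / smin) * (\<rho> t * (f t)\<^sup>2)" for t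
      using \<rho>_bounds(3)[of t] out[of t] smin_pos mult_right_mono[of smin "\<rho> t" "(f t)\<^sup>2"]
      by (cases "t \<in> {a..<b}") (auto simp: field_simps)
  qed measurable
next
  assume "integrable lborel (\<lambda>t. (f t)\<^sup>2)"
  then show "integrable lborel (\<lambda>t. \<rho> t * (f t)\<^sup>2)"
  proof (rule integrable_dominated)
    show "\<bar>\<rho> t * (f t)\<^sup>2\<bar> \<le> smax * (f t)\<^sup>2" for t
      using \<rho>_bounds(1,2)[of t] by (simp add: abs_mult mult_right_mono)
  qed measurable
qed

lemma L2_iff: "v \<in> L2_space \<gamma> a b \<longleftrightarrow> v \<in> borel_measurable \<mu> \<and> integrable lborel (\<lambda>t. (pull v t)\<^sup>2)"
proof -
  have "integrable \<mu> (\<lambda>x. (v x)\<^sup>2) \<longleftrightarrow> integrable lborel (\<lambda>t. (pull v t)\<^sup>2)" if m: "v \<in> borel_measurable \<mu>"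
  proof -
    have "(\<lambda>x. (v x)\<^sup>2) \<in> borel_measurable \<mu>" using m by measurable
    then have "integrable \<mu> (\<lambda>x. (v x)\<^sup>2) \<longleftrightarrow> integrable lborel (\<lambda>t. \<rho> t * (pull v t)\<^sup>2)"
      by (simp add: integral_\<mu>(2) pull_sq)
    also have "\<dots> \<longleftrightarrow> integrable lborel (\<lambda>t. (pull v t)\<^sup>2)"
    proof (rule weighted_sq_integrable_iff)
      show "pull v \<in> borel_measurable borel" by (rule pull_measurable[OF m])
      show "pull v t = 0" if "t \<notin> {a..<b}" for t using that by (simp add: pull_def)
    qed
    finally show ?thesis .
  qed
  then show ?thesis by (auto simp: L2_space_def)
qed

lemma L2_D:
  assumes "v \<in> L2_space \<gamma> a b"
  shows "v \<in> borel_measurable \<mu>" "pull v \<in> borel_measurable borel" "integrable lborel (\<lambda>t. (pull v t)\<^sup>2)"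
  using assms pull_measurable unfolding L2_iff by auto

text \<open>The part of the parameter interval that lies over \<open>S\<close>.\<close>

definition PS :: "(real^2) set \<Rightarrow> real set" where "PS S = {t \<in> {a..<b}. \<gamma> t \<in> S}"

lemma PS_measurable: "S \<in> sets \<mu> \<Longrightarrow> PS S \<in> sets borel"
proof -
  assume "S \<in> sets \<mu>"
  then have "\<gamma> -` S \<inter> space (restrict_space lborel {a..<b}) \<in> sets (restrict_space lborel {a..<b})"
    using measurable_sets[OF \<gamma>_meas] sets_\<mu> by simp
  moreover have "\<gamma> -` S \<inter> space (restrict_space lborel {a..<b}) = PS S" by (auto simp: PS_def space_restrict_space)
  ultimately have "PS S \<in> sets (restrict_space lborel {a..<b})" by simp
  then show ?thesis by (auto simp: sets_restrict_space)
qed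

lemma L2_norm_sq:
  assumes S: "S \<in> sets \<mu>" and v: "v \<in> borel_measurable \<mu>"
  shows "(L2_norm \<gamma> a b S v)\<^sup>2 = (LINT t|lborel. indicator (PS S) t * (\<rho> t * (pull v t)\<^sup>2))"
proof -
  have m: "(\<lambda>x. indicator S x *\<^sub>R (v x)\<^sup>2) \<in> borel_measurable \<mu>" using S v by measurable
  have "0 \<le> (LINT x|\<mu>. indicator S x *\<^sub>R (v x)\<^sup>2)" by (intro integral_nonneg_AE) simp
  then have "(L2_norm \<gamma> a b S v)\<^sup>2 = (LINT x|\<mu>. indicator S x *\<^sub>R (v x)\<^sup>2)"
    by (simp add: L2_norm_def set_lebesgue_integral_def)
  also have "\<dots> = (LINT t|lborel. \<rho> t * pull (\<lambda>x. indicator S x *\<^sub>R (v x)\<^sup>2) t)" by (rule integral_\<mu>(1)[OF m])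
  also have "\<dots> = (LINT t|lborel. indicator (PS S) t * (\<rho> t * (pull v t)\<^sup>2))"
    by (rule Bochner_Integration.integral_cong) (auto simp: pull_def PS_def indicator_def)
  finally show ?thesis .
qed

lemma L2_norm_nonneg: "0 \<le> L2_norm \<gamma> a b S v"
  unfolding L2_norm_def set_lebesgue_integral_def
  by (intro real_sqrt_ge_zero integral_nonneg_AE) simp

lemma L2_norm_bounds:
  assumes S: "S \<in> sets \<mu>" and v: "v \<in> L2_space \<gamma> a b"
  shows "smin * nsq (PS S) (pull v) \<le> (L2_norm \<gamma> a b S v)\<^sup>2" "(L2_norm \<gamma> a b S v)\<^sup>2 \<le> smax * nsq (PS S) (pull v)"
proof -
  note V = L2_D[OF v]
  have [measurable]: "pull v \<in> borel_measurable borel" by (rule V(2))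
  have i1: "integrable lborel (\<lambda>t. indicator (PS S) t * (pull v t)\<^sup>2)"
    by (rule integrable_indicator_mult[OF V(3) PS_measurable[OF S]])
  have "integrable lborel (\<lambda>t. \<rho> t * (pull v t)\<^sup>2)"
    by (subst weighted_sq_integrable_iff) (auto simp: pull_def V(3)[unfolded pull_def[abs_def]] V(2)[unfolded pull_def[abs_def]])
  then have i2: "integrable lborel (\<lambda>t. indicator (PS S) t * (\<rho> t * (pull v t)\<^sup>2))"
    by (rule integrable_indicator_mult[OF _ PS_measurable[OF S]])
  have b: "smin * (indicator (PS S) t * (pull v t)\<^sup>2) \<le> indicator (PS S) t * (\<rho> t * (pull v t)\<^sup>2) \<and>
     indicator (PS S) t * (\<rho> t * (pull v t)\<^sup>2) \<le> smax * (indicator (PS S) t * (pull v t)\<^sup>2)" for t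
    using \<rho>_bounds(2,3)[of t] by (auto simp: indicator_def PS_def intro!: mult_right_mono)
  show "smin * nsq (PS S) (pull v) \<le> (L2_norm \<gamma> a b S v)\<^sup>2"
    unfolding L2_norm_sq[OF S V(1)] nsq_def integral_mult_right_zero[symmetric]
    using b i1 i2 by (intro integral_mono) auto
  show "(L2_norm \<gamma> a b S v)\<^sup>2 \<le> smax * nsq (PS S) (pull v)"
    unfolding L2_norm_sq[OF S V(1)] nsq_def integral_mult_right_zero[symmetric]
    using b i1 i2 by (intro integral_mono) auto
qed

text \<open>A derivative with respect to the parameter is the arclength derivative times the speed.  Squaring gives
  \<open>\<rho>\<^sup>2\<close>, of which one factor belongs to the measure, so the other one is estimated.\<close>

lemma derivative_norm_bounds:
  assumes S: "S \<in> sets \<mu>" and g: "g \<in> L2_space \<gamma> a b"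
    and u': "AE t in lborel. u' t = \<rho> t * pull g t" and [measurable]: "u' \<in> borel_measurable borel"
  shows "smin * (L2_norm \<gamma> a b S g)\<^sup>2 \<le> nsq (PS S) u'" "nsq (PS S) u' \<le> smax * (L2_norm \<gamma> a b S g)\<^sup>2"
    "integrable lborel (\<lambda>t. (u' t)\<^sup>2)"
proof -
  note V = L2_D[OF g]
  have [measurable]: "pull g \<in> borel_measurable borel" "PS S \<in> sets borel" by (rule V(2), rule PS_measurable[OF S])
  have i: "integrable lborel (\<lambda>t. \<rho> t * (pull g t)\<^sup>2)"
    by (subst weighted_sq_integrable_iff) (auto simp: pull_def V(3)[unfolded pull_def[abs_def]] V(2)[unfolded pull_def[abs_def]])
  have i2: "integrable lborel (\<lambda>t. (\<rho> t * pull g t)\<^sup>2)"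
  proof (rule integrable_dominated[OF i])
    show "\<bar>(\<rho> t * pull g t)\<^sup>2\<bar> \<le> smax * (\<rho> t * (pull g t)\<^sup>2)" for t
      using \<rho>_bounds(1,2)[of t] by (auto simp: power_mult_distrib power2_eq_square[of "\<rho> t"] mult.assoc intro!: mult_right_mono mult_nonneg_nonneg)
  qed measurable
  then show "integrable lborel (\<lambda>t. (u' t)\<^sup>2)"
    using u' by (subst integrable_cong_AE[of _ _ "\<lambda>t. (\<rho> t * pull g t)\<^sup>2"]) auto
  have eq: "nsq (PS S) u' = (LINT t|lborel. indicator (PS S) t * (\<rho> t * pull g t)\<^sup>2)"
    unfolding nsq_def using u' by (intro integral_cong_AE) auto
  have b: "smin * (indicator (PS S) t * (\<rho> t * (pull g t)\<^sup>2)) \<le> indicator (PS S) t * (\<rho> t * pull g t)\<^sup>2 \<and>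
     indicator (PS S) t * (\<rho> t * pull g t)\<^sup>2 \<le> smax * (indicator (PS S) t * (\<rho> t * (pull g t)\<^sup>2))" for t
    using \<rho>_bounds(1,2,3)[of t] by (auto simp: indicator_def PS_def power_mult_distrib power2_eq_square[of "\<rho> t"] mult.assoc intro!: mult_right_mono mult_nonneg_nonneg)
  have i1: "integrable lborel (\<lambda>t. indicator (PS S) t * (\<rho> t * (pull g t)\<^sup>2))"
    "integrable lborel (\<lambda>t. indicator (PS S) t * (\<rho> t * pull g t)\<^sup>2)"
    using i i2 by (auto intro!: integrable_indicator_mult)
  show "smin * (L2_norm \<gamma> a b S g)\<^sup>2 \<le> nsq (PS S) u'"
    unfolding L2_norm_sq[OF S V(1)] eq integral_mult_right_zero[symmetric]
    using b i1 by (intro integral_mono) auto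
  show "nsq (PS S) u' \<le> smax * (L2_norm \<gamma> a b S g)\<^sup>2"
    unfolding L2_norm_sq[OF S V(1)] eq integral_mult_right_zero[symmetric]
    using b i1 by (intro integral_mono) auto
qed

lemma arclength_integral_eq:
  assumes g: "pull g \<in> borel_measurable borel" and t: "t \<in> {a..b}"
  shows "(LINT s:{a..t}|lborel. g (\<gamma> s) * speed \<gamma> s) = (LINT s|lborel. indicator {a..t} s * (\<rho> s * pull g s))"
proof -
  have eq: "indicator {a..<b} s * (indicator {a..t} s *\<^sub>R (g (\<gamma> s) * speed \<gamma> s)) = indicator {a..t} s * (\<rho> s * pull g s)" for s
    by (auto simp: \<rho>_def pull_def indicator_def)
  show ?thesis unfolding set_lebesgue_integral_def eq[symmetric]
  proof (rule integral_endpoint(1))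
    show "(\<lambda>s. indicator {a..<b} s * (indicator {a..t} s *\<^sub>R (g (\<gamma> s) * speed \<gamma> s))) \<in> borel_measurable borel"
      unfolding eq using g by measurable
    show "indicator {a..t} s *\<^sub>R (g (\<gamma> s) * speed \<gamma> s) = 0" if "s \<notin> {a..b}" for s
      using that t by (auto simp: indicator_def)
  qed
qed

lemma has_arclength_derivativeD:
  assumes "has_arclength_derivative \<gamma> a b v g"
  shows "\<exists>u. periodic_ac a b u (\<lambda>t. \<rho> t * pull g t) \<and> (AE t in lborel. t \<in> {a..<b} \<longrightarrow> v (\<gamma> t) = u t)"
proof -
  obtain c where g: "g \<in> L2_space \<gamma> a b"
    and c: "AE t in lborel. t \<in> {a..b} \<longrightarrow> v (\<gamma> t) = c + (LINT s:{a..t}|lborel. g (\<gamma> s) * speed \<gamma> s)"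
    and z: "(LINT s:{a..b}|lborel. g (\<gamma> s) * speed \<gamma> s) = 0"
    using assms unfolding has_arclength_derivative_def by blast
  note V = L2_D[OF g]
  have [measurable]: "pull g \<in> borel_measurable borel" by (rule V(2))
  let ?u' = "\<lambda>t. \<rho> t * pull g t"
  define u where "u t = c + (LINT s|lborel. indicator {a..t} s * ?u' s)" for t
  have "AE s in lborel. indicator {a..a} s * ?u' s = 0"
    using AE_lborel_singleton[of a] by eventually_elim (auto simp: indicator_def)
  then have "(LINT s|lborel. indicator {a..a} s * ?u' s) = 0" by (rule integral_eq_zero_AE)
  then have ua: "u a = c" by (simp add: u_def)
  have ub: "u b = c" using z arclength_integral_eq[OF V(2), of b] ab by (simp add: u_def)
  have "integrable lborel (\<lambda>t. (?u' t)\<^sup>2)"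
    using derivative_norm_bounds(3)[of "{}" g ?u'] g by simp
  then have "periodic_ac a b u ?u'"
    unfolding periodic_ac_def ua ub using \<rho>_bounds(4) by (auto simp: u_def)
  moreover have "AE t in lborel. t \<in> {a..<b} \<longrightarrow> v (\<gamma> t) = u t"
    using c
  proof eventually_elim
    case (elim t)
    then show ?case using arclength_integral_eq[OF V(2), of t] by (auto simp: u_def)
  qed
  ultimately show ?thesis by blast
qed

lemma H1_D:
  assumes "v \<in> H1_space \<gamma> a b"
  shows "v \<in> L2_space \<gamma> a b" "arclength_derivative \<gamma> a b v \<in> L2_space \<gamma> a b"
    "\<exists>u. periodic_ac a b u (\<lambda>t. \<rho> t * pull (arclength_derivative \<gamma> a b v) t) \<and>
        (AE t in lborel. t \<in> {a..<b} \<longrightarrow> v (\<gamma> t) = u t)"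
proof -
  have d: "has_arclength_derivative \<gamma> a b v (arclength_derivative \<gamma> a b v)"
  proof -
    have "\<exists>g. has_arclength_derivative \<gamma> a b v g" using assms by (simp add: H1_space_def)
    then show ?thesis unfolding arclength_derivative_def by (rule someI_ex)
  qed
  show "v \<in> L2_space \<gamma> a b" using assms by (simp add: H1_space_def)
  show "arclength_derivative \<gamma> a b v \<in> L2_space \<gamma> a b" using d by (simp add: has_arclength_derivative_def)
  show "\<exists>u. periodic_ac a b u (\<lambda>t. \<rho> t * pull (arclength_derivative \<gamma> a b v) t) \<and>
        (AE t in lborel. t \<in> {a..<b} \<longrightarrow> v (\<gamma> t) = u t)"
    by (rule has_arclength_derivativeD[OF d])
qed

text \<open>The candidate for the arclength derivative is \<open>u' / \<rho>\<close>, transported to the curve.\<close>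

lemma H1_I:
  assumes v: "v \<in> borel_measurable \<mu>" and u: "periodic_ac a b u u'"
    and ae: "AE t in lborel. t \<in> {a..<b} \<longrightarrow> v (\<gamma> t) = u t"
  shows "v \<in> H1_space \<gamma> a b" "AE t in lborel. u' t = \<rho> t * pull (arclength_derivative \<gamma> a b v) t"
proof -
  note U = periodic_acD[OF u]
  have [measurable]: "u' \<in> borel_measurable borel" by (rule U(1))
  define g where "g x = u' (\<tau> x) / \<rho> (\<tau> x)" for x
  have gm: "g \<in> borel_measurable \<mu>" unfolding g_def by (rule push_measurable) measurable
  have pg: "pull g t = u' t / \<rho> t" for t
    using \<rho>_bounds(4)[of t] by (cases "t \<in> {a..<b}") (auto simp: pull_def g_def \<tau>_\<gamma>)
  have \<rho>g: "\<rho> t * pull g t = u' t" for t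
    using U(3)[of t] \<rho>_bounds(3)[of t] smin_pos by (cases "t \<in> {a..<b}") (auto simp: pg)
  have [measurable]: "pull g \<in> borel_measurable borel" by (rule pull_measurable[OF gm])
  have "integrable lborel (\<lambda>t. (pull g t)\<^sup>2)"
  proof (rule integrable_dominated[OF U(2)])
    show "\<bar>(pull g t)\<^sup>2\<bar> \<le> (1 / smin\<^sup>2) * (u' t)\<^sup>2" for t
    proof (cases "t \<in> {a..<b}")
      case True
      then have "smin\<^sup>2 \<le> (\<rho> t)\<^sup>2" using \<rho>_bounds(3)[of t] smin_pos by (intro power_mono) auto
      then have "(u' t)\<^sup>2 / (\<rho> t)\<^sup>2 \<le> (u' t)\<^sup>2 / smin\<^sup>2" using smin_pos
        by (intro divide_left_mono mult_pos_pos) (auto intro: less_le_trans[of 0 "smin\<^sup>2"])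
      then show ?thesis by (simp add: pg power_divide)
    qed (simp add: pull_def)
  qed measurable
  then have gL: "g \<in> L2_space \<gamma> a b" using gm by (simp add: L2_iff)
  have iu: "u t = u a + (LINT s:{a..t}|lborel. g (\<gamma> s) * speed \<gamma> s)" if "t \<in> {a..b}" for t
    using arclength_integral_eq[of g t] that U(4)[OF that] by (simp add: \<rho>g)
  have d: "has_arclength_derivative \<gamma> a b v g"
    unfolding has_arclength_derivative_def
  proof (intro conjI gL exI[of _ "u a"])
    show "AE t in lborel. t \<in> {a..b} \<longrightarrow> v (\<gamma> t) = u a + (LINT s:{a..t}|lborel. g (\<gamma> s) * speed \<gamma> s)"
      using ae AE_lborel_singleton[of b]
    proof eventually_elim
      case (elim t)
      then show ?case using iu[of t] by auto
    qed
    show "(LINT s:{a..b}|lborel. g (\<gamma> s) * speed \<gamma> s) = 0" using iu[of b] U(5) ab by simp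
  qed
  obtain B where B: "\<And>t. t \<in> {a..b} \<Longrightarrow> \<bar>u t\<bar> \<le> B" using periodic_ac_bounded[OF u] by blast
  have [measurable]: "pull v \<in> borel_measurable borel" by (rule pull_measurable[OF v])
  have um: "(\<lambda>t. indicator {a..b} t *\<^sub>R u t) \<in> borel_measurable borel"
    by (rule borel_measurable_continuous_on_indicator) (simp_all add: periodic_ac_continuous[OF u])
  have "integrable lborel (\<lambda>t. indicator {a..<b} t * (indicator {a..b} t *\<^sub>R u t)\<^sup>2)"
  proof (rule integrable_bounded_on[of _ "B\<^sup>2" a b])
    show "(\<lambda>t. indicator {a..<b} t * (indicator {a..b} t *\<^sub>R u t)\<^sup>2) \<in> borel_measurable borel" using um by measurable
    show "\<bar>indicator {a..<b} t * (indicator {a..b} t *\<^sub>R u t)\<^sup>2\<bar> \<le> B\<^sup>2" for t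
      using B[of t] by (auto simp: indicator_def abs_le_square_iff[symmetric])
  qed simp
  moreover have "AE t in lborel. (pull v t)\<^sup>2 = indicator {a..<b} t * (indicator {a..b} t *\<^sub>R u t)\<^sup>2"
    using ae by eventually_elim (auto simp: pull_def indicator_def)
  ultimately have "integrable lborel (\<lambda>t. (pull v t)\<^sup>2)"
    using um by (subst integrable_cong_AE[of _ _ "\<lambda>t. indicator {a..<b} t * (indicator {a..b} t *\<^sub>R u t)\<^sup>2"]) auto
  then have "v \<in> L2_space \<gamma> a b" using v by (simp add: L2_iff)
  then show H: "v \<in> H1_space \<gamma> a b" using d by (auto simp: H1_space_def)
  obtain w where w: "periodic_ac a b w (\<lambda>t. \<rho> t * pull (arclength_derivative \<gamma> a b v) t)"
    "AE t in lborel. t \<in> {a..<b} \<longrightarrow> v (\<gamma> t) = w t" using H1_D(3)[OF H] by blast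
  have "AE t in lborel. t \<in> {a..<b} \<longrightarrow> u t = w t" using ae w(2) by eventually_elim auto
  then show "AE t in lborel. u' t = \<rho> t * pull (arclength_derivative \<gamma> a b v) t"
    by (rule periodic_ac_unique(2)[OF u w(1) ab])
qed

end

section \<open>Patches\<close>

lemma sym_relpow:
  assumes "sym A" shows "sym (A ^^ n)"
proof (induction n)
  case (Suc n)
  show ?case
  proof (rule symI)
    fix x y assume "(x, y) \<in> A ^^ Suc n"
    then obtain z where "(x, z) \<in> A ^^ n" "(z, y) \<in> A" by auto
    then have "(z, x) \<in> A ^^ n" "(y, z) \<in> A" using Suc assms by (auto dest: symD)
    then show "(y, x) \<in> A ^^ Suc n" by (rule relpow_Suc_I2[rotated])
  qed
qed (simp add: sym_Id)

locale mesh = curve_bounds \<gamma> a b \<Gamma> smin smax + kn?: knot_seq a b p K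
  for \<gamma> a b \<Gamma> smin smax p K +
  fixes \<kappa> :: real
  assumes \<kappa>1: "1 \<le> \<kappa>"
    and ratio: "\<And>I I'. I \<in> param_elements a K \<Longrightarrow> I' \<in> param_elements a K \<Longrightarrow> elem \<gamma> I \<inter> elem \<gamma> I' \<noteq> {} \<Longrightarrow>
        param_width I \<le> \<kappa> * param_width I'"
begin

abbreviation "E \<equiv> param_elements a K"
abbreviation cell :: "real \<times> real \<Rightarrow> real set" where "cell I \<equiv> {fst I..<snd I}"

lemma E_cells: "I \<in> E \<longleftrightarrow> (fst I, snd I) \<in> cells a (set_mset K)"
  by (simp add: param_elements_def)

lemma b_in_K: "b \<in> set_mset K"
  using count_b by (metis add_is_0 count_eq_zero_iff one_neq_zero)

lemma E_bounds: "I \<in> E \<Longrightarrow> a \<le> fst I" "I \<in> E \<Longrightarrow> fst I < snd I" "I \<in> E \<Longrightarrow> snd I \<le> b"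
  using cellsD[of "fst I" "snd I" a "set_mset K" b] knots_sub unfolding E_cells by auto

lemma finite_E: "finite E" by (rule finite_param_elements)

lemma width_pos: "I \<in> E \<Longrightarrow> 0 < param_width I" by (rule param_width_pos)

lemma sum_indicator_E: "(\<Sum>I\<in>E. indicator (cell I) x) = (indicator {a..<b} x :: real)"
  unfolding param_elements_def by (rule sum_indicator_cells) (simp_all add: knots_sub b_in_K)

lemma elem_sub: "I \<in> E \<Longrightarrow> elem \<gamma> I \<subseteq> \<Gamma>"
  using E_bounds[of I] in_\<Gamma> by (auto simp: elem_def)

lemma elem_meas: "I \<in> E \<Longrightarrow> elem \<gamma> I \<in> sets \<mu>"
  unfolding elem_def using E_bounds[of I] by (intro image_Icc_meas) auto

lemma elem_ne: "I \<in> E \<Longrightarrow> elem \<gamma> I \<noteq> {}"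
  using E_bounds(2)[of I] by (auto simp: elem_def)

lemma E_cover: "x \<in> \<Gamma> \<Longrightarrow> \<exists>I\<in>E. x \<in> elem \<gamma> I"
proof -
  assume x: "x \<in> \<Gamma>"
  have tx: "a \<le> \<tau> x" "\<tau> x < b" using \<gamma>_\<tau>(2)[OF x] by auto
  obtain c d where cd: "(c, d) \<in> cells a (set_mset K)" "c \<le> \<tau> x" "\<tau> x < d"
    using cell_containing[OF _ knots_sub b_in_K tx] by auto
  have "x = \<gamma> (\<tau> x)" using \<gamma>_\<tau>(1)[OF x] by simp
  then have "x \<in> elem \<gamma> (c, d)" using cd by (auto simp: elem_def)
  then show ?thesis using cd(1) by (auto simp: param_elements_def)
qed

text \<open>Adjacency is taken on the closed curve: the first and the last element touch at \<open>\<gamma> a = \<gamma> b\<close>.\<close>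

definition Adj :: "((real \<times> real) \<times> (real \<times> real)) set" where
  "Adj = {(I, I'). I \<in> E \<and> I' \<in> E \<and> elem \<gamma> I \<inter> elem \<gamma> I' \<noteq> {}}"

definition nb :: "nat \<Rightarrow> real \<times> real \<Rightarrow> (real \<times> real) set" where
  "nb m I = {J. (I, J) \<in> Adj ^^ m}"

lemma nb_0: "nb 0 I = {I}" by (auto simp: nb_def)

lemma nb_Suc: "nb (Suc m) I = {J. \<exists>J'\<in>nb m I. (J', J) \<in> Adj}"
  by (auto simp: nb_def)

lemma nb_sym: "J \<in> nb m I \<longleftrightarrow> I \<in> nb m J"
proof -
  have "sym Adj" by (auto simp: Adj_def sym_def)
  then have "sym (Adj ^^ m)" by (rule sym_relpow)
  then show ?thesis unfolding nb_def using symD by fast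
qed

lemma nb_sub: "I \<in> E \<Longrightarrow> nb m I \<subseteq> E"
  by (cases m) (auto simp: nb_0 nb_Suc Adj_def)

lemma nb_width: "J \<in> nb m I \<Longrightarrow> I \<in> E \<Longrightarrow> param_width J \<le> \<kappa> ^ m * param_width I"
proof (induction m arbitrary: J)
  case (Suc m)
  then obtain J' where J': "J' \<in> nb m I" "(J', J) \<in> Adj" by (auto simp: nb_Suc)
  have "param_width J \<le> \<kappa> * param_width J'" using J'(2) by (intro ratio) (auto simp: Adj_def)
  also have "\<dots> \<le> \<kappa> * (\<kappa> ^ m * param_width I)" using Suc.IH[OF J'(1) Suc.prems(2)] \<kappa>1 by (intro mult_left_mono) auto
  finally show ?case by simp
qed (simp add: nb_0)

lemma patch_Suc_iff: "x \<in> patch \<gamma> a K (Suc m) S \<longleftrightarrow> (\<exists>J\<in>E. x \<in> elem \<gamma> J \<and> elem \<gamma> J \<inter> patch \<gamma> a K m S \<noteq> {})"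
  unfolding patch.simps by blast

lemma patch_eq: "I \<in> E \<Longrightarrow> patch \<gamma> a K m (elem \<gamma> I) = (\<Union>J\<in>nb m I. elem \<gamma> J)"
proof (induction m)
  case (Suc m)
  have *: "J \<in> nb (Suc m) I \<longleftrightarrow> J \<in> E \<and> elem \<gamma> J \<inter> (\<Union>J'\<in>nb m I. elem \<gamma> J') \<noteq> {}" for J
    using nb_sub[OF Suc.prems, of m] unfolding nb_Suc Adj_def by blast
  show ?case
  proof (rule set_eqI)
    fix x show "x \<in> patch \<gamma> a K (Suc m) (elem \<gamma> I) \<longleftrightarrow> x \<in> (\<Union>J\<in>nb (Suc m) I. elem \<gamma> J)"
      unfolding patch_Suc_iff Suc.IH[OF Suc.prems] using * by blast
  qed
qed (simp add: nb_0)

lemma finite_nb: "I \<in> E \<Longrightarrow> finite (nb m I)"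
  using finite_subset[OF nb_sub finite_E] .

lemma same_left: "I \<in> E \<Longrightarrow> J \<in> E \<Longrightarrow> fst I = fst J \<Longrightarrow> I = J"
proof -
  assume *: "I \<in> E" "J \<in> E" "fst I = fst J"
  obtain x where x: "fst I < x" "x < min (snd I) (snd J)"
    using dense[of "fst I" "min (snd I) (snd J)"] E_bounds(2)[OF *(1)] E_bounds(2)[OF *(2)] *(3) by auto
  have "snd I = snd J"
    using * x by (intro cells_disjoint(2)[of "fst I" _ a "set_mset K" "fst J" _ b x]) (auto simp: E_cells knots_sub)
  then show "I = J" using *(3) by (simp add: prod_eq_iff)
qed

lemma same_right: "I \<in> E \<Longrightarrow> J \<in> E \<Longrightarrow> snd I = snd J \<Longrightarrow> I = J"
proof -
  assume *: "I \<in> E" "J \<in> E" "snd I = snd J"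
  obtain x where x: "max (fst I) (fst J) < x" "x < snd I"
    using dense[of "max (fst I) (fst J)" "snd I"] E_bounds(2)[OF *(1)] E_bounds(2)[OF *(2)] *(3) by auto
  have "fst I = fst J"
    using * x by (intro cells_disjoint(1)[of _ "snd I" a "set_mset K" _ "snd J" b x]) (auto simp: E_cells knots_sub)
  then show "I = J" using *(3) by (simp add: prod_eq_iff)
qed

lemma \<gamma>_eq: "s \<in> {a..b} \<Longrightarrow> s' \<in> {a..b} \<Longrightarrow> \<gamma> s = \<gamma> s' \<Longrightarrow> s = s' \<or> (s = a \<and> s' = b) \<or> (s = b \<and> s' = a)"
proof -
  assume *: "s \<in> {a..b}" "s' \<in> {a..b}" "\<gamma> s = \<gamma> s'"
  have A: "a \<in> {a..<b}" using ab by simp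
  show ?thesis
  proof (cases "s = b")
    case True
    then have "\<gamma> a = \<gamma> s'" using * closed by simp
    then show ?thesis using True * inj_onD[OF inj _ A, of s'] by (cases "s' = b") auto
  next
    case False
    then have s: "s \<in> {a..<b}" using * by auto
    show ?thesis
    proof (cases "s' = b")
      case True
      then have "\<gamma> s = \<gamma> a" using * closed by simp
      then show ?thesis using True inj_onD[OF inj _ s A] by auto
    next
      case False
      then have "s' \<in> {a..<b}" using * by auto
      then show ?thesis using inj_onD[OF inj *(3) s] by auto
    qed
  qed
qed

text \<open>A neighbour of \<open>I\<close> is \<open>I\<close> itself, shares one of its two end points, or is one of the two elements at
  the point where the curve closes.\<close>

lemma card_Adj: "card {J. (I, J) \<in> Adj} \<le> 5"
proof -
  let ?P = "\<lambda>Q. {J \<in> E. Q J}"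
  have fin: "finite (?P Q)" for Q using finite_E by simp
  have c1: "card (?P (\<lambda>J. fst J = x)) \<le> 1" "card (?P (\<lambda>J. snd J = x)) \<le> 1" for x
    unfolding One_nat_def by (subst card_le_Suc0_iff_eq[OF fin]; use same_left same_right in \<open>metis (mono_tags, lifting) mem_Collect_eq\<close>)+
  let ?U = "{I} \<union> ?P (\<lambda>J. fst J = snd I) \<union> ?P (\<lambda>J. snd J = fst I) \<union> ?P (\<lambda>J. fst J = a) \<union> ?P (\<lambda>J. snd J = b)"
  have "{J. (I, J) \<in> Adj} \<subseteq> ?U"
  proof
    fix J assume "J \<in> {J. (I, J) \<in> Adj}"
    then have IJ: "I \<in> E" "J \<in> E" "elem \<gamma> I \<inter> elem \<gamma> J \<noteq> {}" by (auto simp: Adj_def)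
    then obtain z where z: "z \<in> \<gamma> ` {fst I..snd I}" "z \<in> \<gamma> ` {fst J..snd J}" unfolding elem_def by blast
    obtain s where s1: "s \<in> {fst I..snd I}" "z = \<gamma> s" using z(1) by blast
    obtain s' where s2: "s' \<in> {fst J..snd J}" "z = \<gamma> s'" using z(2) by blast
    have s: "s \<in> {fst I..snd I}" "s' \<in> {fst J..snd J}" "\<gamma> s = \<gamma> s'" using s1 s2 by simp_all
    have "s \<in> {a..b}" "s' \<in> {a..b}" using s(1,2) E_bounds[OF IJ(1)] E_bounds[OF IJ(2)] by auto
    then consider "s = s'" | "s' = b" | "s' = a" using \<gamma>_eq s(3) by blast
    then show "J \<in> ?U"
    proof cases
      case 1
      note CI = cellsD[OF IJ(1)[unfolded E_cells] knots_sub] and CJ = cellsD[OF IJ(2)[unfolded E_cells] knots_sub]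
      have "snd J \<le> fst I \<or> snd I \<le> snd J" by (rule CI(5)[OF CJ(4)])
      moreover have "snd I \<le> fst J \<or> snd J \<le> snd I" by (rule CJ(5)[OF CI(4)])
      ultimately consider "snd J \<le> fst I" | "snd I \<le> fst J" | "snd I = snd J" by linarith
      then show ?thesis
      proof cases
        case 1
        then have "snd J = fst I" using s \<open>s = s'\<close> by auto
        then show ?thesis using IJ by auto
      next
        case 2
        then have "fst J = snd I" using s \<open>s = s'\<close> by auto
        then show ?thesis using IJ by auto
      next
        case 3
        then show ?thesis using same_right[OF IJ(1,2)] by auto
      qed
    next
      case 2
      then have "snd J = b" using s(2) E_bounds(3)[OF IJ(2)] by auto
      then show ?thesis using IJ by auto
    next
      case 3
      then have "fst J = a" using s(2) E_bounds(1)[OF IJ(2)] by auto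
      then show ?thesis using IJ by auto
    qed
  qed
  then have "card {J. (I, J) \<in> Adj} \<le> card ?U" using fin by (intro card_mono) auto
  also have "\<dots> \<le> 5"
    using card_Un_le[of "{I} \<union> ?P (\<lambda>J. fst J = snd I) \<union> ?P (\<lambda>J. snd J = fst I) \<union> ?P (\<lambda>J. fst J = a)" "?P (\<lambda>J. snd J = b)"]
      card_Un_le[of "{I} \<union> ?P (\<lambda>J. fst J = snd I) \<union> ?P (\<lambda>J. snd J = fst I)" "?P (\<lambda>J. fst J = a)"]
      card_Un_le[of "{I} \<union> ?P (\<lambda>J. fst J = snd I)" "?P (\<lambda>J. snd J = fst I)"]
      card_Un_le[of "{I}" "?P (\<lambda>J. fst J = snd I)"] c1(1)[of "snd I"] c1(2)[of "fst I"] c1(1)[of a] c1(2)[of b]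
    by simp
  finally show ?thesis .
qed

lemma card_nb: "I \<in> E \<Longrightarrow> card (nb m I) \<le> 5 ^ m"
proof (induction m)
  case (Suc m)
  have "nb (Suc m) I = (\<Union>J'\<in>nb m I. {J. (J', J) \<in> Adj})" by (auto simp: nb_Suc)
  then have "card (nb (Suc m) I) \<le> (\<Sum>J'\<in>nb m I. card {J. (J', J) \<in> Adj})"
    using card_UN_le[OF finite_nb[OF Suc.prems, of m], of "\<lambda>J'. {J. (J', J) \<in> Adj}"] by simp
  also have "\<dots> \<le> (\<Sum>J'\<in>nb m I. 5)" by (rule sum_mono) (rule card_Adj)
  also have "\<dots> \<le> 5 ^ Suc m" using Suc.IH[OF Suc.prems] by simp
  finally show ?case .
qed (simp add: nb_0)

lemma patch_meas: "I \<in> E \<Longrightarrow> patch \<gamma> a K m (elem \<gamma> I) \<in> sets \<mu>"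
  unfolding patch_eq using finite_nb nb_sub by (intro sets.finite_UN elem_meas) blast+

lemma patch_sub: "I \<in> E \<Longrightarrow> patch \<gamma> a K m (elem \<gamma> I) \<subseteq> \<Gamma>"
  unfolding patch_eq using elem_sub nb_sub by blast

lemma patch_step: "J \<in> E \<Longrightarrow> elem \<gamma> J \<inter> patch \<gamma> a K m S \<noteq> {} \<Longrightarrow> elem \<gamma> J \<subseteq> patch \<gamma> a K (Suc m) S"
  using patch_Suc_iff by blast

lemma patch_Suc_mono: "patch \<gamma> a K m S \<subseteq> \<Gamma> \<Longrightarrow> patch \<gamma> a K m S \<subseteq> patch \<gamma> a K (Suc m) S"
proof
  fix x assume "patch \<gamma> a K m S \<subseteq> \<Gamma>" "x \<in> patch \<gamma> a K m S"
  then obtain J where "J \<in> E" "x \<in> elem \<gamma> J" using E_cover by blast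
  then show "x \<in> patch \<gamma> a K (Suc m) S" using patch_step[of J m S] \<open>x \<in> patch \<gamma> a K m S\<close> by blast
qed

lemma patch_mono: "I \<in> E \<Longrightarrow> m \<le> n \<Longrightarrow> patch \<gamma> a K m (elem \<gamma> I) \<subseteq> patch \<gamma> a K n (elem \<gamma> I)"
  by (rule lift_Suc_mono_le[of "\<lambda>m. patch \<gamma> a K m (elem \<gamma> I)", OF patch_Suc_mono[OF patch_sub]])

text \<open>The patch of order \<open>p\<close> in the parameter domain.\<close>

definition PP :: "real \<times> real \<Rightarrow> real set" where "PP I = PS (patch \<gamma> a K p (elem \<gamma> I))"

lemma PP_meas: "I \<in> E \<Longrightarrow> PP I \<in> sets borel"
  unfolding PP_def by (intro PS_measurable patch_meas)

lemma cell_sub_PS: "I \<in> E \<Longrightarrow> cell I \<subseteq> PS (elem \<gamma> I)"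
  using E_bounds[of I] by (auto simp: PS_def elem_def)

lemma AE_PS_elem: "I \<in> E \<Longrightarrow> AE t in lborel. t \<in> PS (elem \<gamma> I) \<longrightarrow> t \<in> cell I"
proof -
  assume I: "I \<in> E"
  show ?thesis using AE_lborel_singleton[of a] AE_lborel_singleton[of "snd I"]
  proof eventually_elim
    case (elim t)
    show ?case
    proof
      assume "t \<in> PS (elem \<gamma> I)"
      then obtain s where s: "t \<in> {a..<b}" "s \<in> {fst I..snd I}" "\<gamma> t = \<gamma> s" by (auto simp: PS_def elem_def)
      have "t \<in> {a..b}" "s \<in> {a..b}" using s E_bounds[OF I] by auto
      then have "t = s" using \<gamma>_eq[of t s] s elim by auto
      then show "t \<in> cell I" using s elim by auto
    qed
  qed
qed

lemma cell_norm_eq: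
  assumes I: "I \<in> E" and f: "integrable lborel (\<lambda>t. (f t)\<^sup>2)"
  shows "nsq (PS (elem \<gamma> I)) f = nsq (cell I) f"
proof (rule antisym)
  show "nsq (PS (elem \<gamma> I)) f \<le> nsq (cell I) f"
    by (rule nsq_mono[OF f PS_measurable[OF elem_meas[OF I]] _ AE_PS_elem[OF I]]) simp
  show "nsq (cell I) f \<le> nsq (PS (elem \<gamma> I)) f"
  proof (rule nsq_mono[OF f _ PS_measurable[OF elem_meas[OF I]]])
    show "AE t in lborel. t \<in> cell I \<longrightarrow> t \<in> PS (elem \<gamma> I)"
      by (intro AE_I2 impI) (rule subsetD[OF cell_sub_PS[OF I]])
  qed simp
qed

lemma AE_PP:
  assumes "I \<in> E"
  shows "AE t in lborel. t \<in> PP I \<longrightarrow> (\<exists>J\<in>nb p I. t \<in> cell J)"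
proof -
  have "AE t in lborel. \<forall>J\<in>nb p I. t \<in> PS (elem \<gamma> J) \<longrightarrow> t \<in> cell J"
    using finite_nb[OF assms] nb_sub[OF assms] by (intro AE_finite_allI AE_PS_elem) auto
  then show ?thesis
    by eventually_elim (auto simp: PP_def PS_def patch_eq[OF assms])
qed

lemma integral_PP_le:
  fixes F :: "real \<Rightarrow> real"
  assumes I: "I \<in> E" and F: "integrable lborel F" "\<And>t. 0 \<le> F t"
  shows "(LINT t|lborel. indicator (PP I) t * F t) \<le> (\<Sum>J\<in>nb p I. (LINT t|lborel. indicator (cell J) t * F t))"
proof -
  have "(LINT t|lborel. indicator (PP I) t * F t) \<le> (LINT t|lborel. (\<Sum>J\<in>nb p I. indicator (cell J) t * F t))"
  proof (rule integral_mono_AE)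
    show "AE t in lborel. indicator (PP I) t * F t \<le> (\<Sum>J\<in>nb p I. indicator (cell J) t * F t)"
      using AE_PP[OF I]
    proof eventually_elim
      case (elim t)
      show ?case
      proof (cases "t \<in> PP I")
        case True
        then obtain J where J: "J \<in> nb p I" "t \<in> cell J" using elim by blast
        have "indicator (PP I) t * F t = indicator (cell J) t * F t" using True J by simp
        also have "\<dots> \<le> (\<Sum>J\<in>nb p I. indicator (cell J) t * F t)"
          using finite_nb[OF I] F(2) J by (intro member_le_sum[of J _ "\<lambda>J. indicator (cell J) t * F t"]) auto
        finally show ?thesis .
      next
        case False
        have "0 \<le> (\<Sum>J\<in>nb p I. indicator (cell J) t * F t)" by (intro sum_nonneg mult_nonneg_nonneg F(2)) simp
        then show ?thesis using False by simp
      qed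
    qed
  qed (auto intro!: integrable_indicator_mult F PP_meas[OF I])
  also have "\<dots> = (\<Sum>J\<in>nb p I. (LINT t|lborel. indicator (cell J) t * F t))"
    by (intro Bochner_Integration.integral_sum integrable_indicator_mult F) simp
  finally show ?thesis .
qed

lemma integral_cell: "I \<in> E \<Longrightarrow> (LINT t|lborel. indicator (cell I) t * k) = k * param_width I"
  using E_bounds(2)[of I] by (simp add: param_width_def)

definition Cpatch :: real where "Cpatch = 5 ^ p * \<kappa> ^ p"

lemma Cpatch_ge: "1 \<le> Cpatch"
  unfolding Cpatch_def using \<kappa>1 mult_mono[of 1 "5 ^ p :: real" 1 "\<kappa> ^ p"] by (simp add: one_le_power)

text \<open>A patch consists of at most \<open>5 ^ p\<close> elements, each at most \<open>\<kappa> ^ p\<close> times as long as the central one.\<close>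

lemma measure_PP:
  assumes I: "I \<in> E"
  shows "(LINT t|lborel. indicator (PP I) t :: real) \<le> Cpatch * param_width I"
proof -
  have PPsub: "PP I \<subseteq> {a..<b}" by (auto simp: PP_def PS_def)
  have i: "integrable lborel (indicator {a..<b} :: real \<Rightarrow> real)"
    by (rule integrable_bounded_on[of _ 1 a b]) (auto simp: indicator_def)
  have "(LINT t|lborel. indicator (PP I) t :: real) = (LINT t|lborel. indicator (PP I) t * indicator {a..<b} t)"
    using PPsub by (intro Bochner_Integration.integral_cong) (auto simp: indicator_def)
  also have "\<dots> \<le> (\<Sum>J\<in>nb p I. (LINT t|lborel. indicator (cell J) t * indicator {a..<b} t))"
    by (rule integral_PP_le[OF I i]) simp
  also have "\<dots> \<le> (\<Sum>J\<in>nb p I. \<kappa> ^ p * param_width I)"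
  proof (rule sum_mono)
    fix J assume J: "J \<in> nb p I"
    then have JE: "J \<in> E" using nb_sub[OF I] by blast
    have "(LINT t|lborel. indicator (cell J) t * indicator {a..<b} t :: real) = (LINT t|lborel. indicator (cell J) t * 1)"
      using E_bounds[OF JE] by (intro Bochner_Integration.integral_cong) (auto simp: indicator_def)
    also have "\<dots> = param_width J" using integral_cell[OF JE, of 1] by simp
    also have "\<dots> \<le> \<kappa> ^ p * param_width I" by (rule nb_width[OF J I])
    finally show "(LINT t|lborel. indicator (cell J) t * indicator {a..<b} t :: real) \<le> \<kappa> ^ p * param_width I" .
  qed
  also have "\<dots> = real (card (nb p I)) * (\<kappa> ^ p * param_width I)" by simp
  also have "\<dots> \<le> 5 ^ p * (\<kappa> ^ p * param_width I)"
  proof (rule mult_right_mono)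
    show "real (card (nb p I)) \<le> 5 ^ p" using card_nb[OF I, of p] by (metis of_nat_le_iff of_nat_numeral of_nat_power)
    show "0 \<le> \<kappa> ^ p * param_width I" using \<kappa>1 width_pos[OF I] by simp
  qed
  finally show ?thesis by (simp add: Cpatch_def)
qed

text \<open>Exchanging the order of summation, since being in the \<open>p\<close>-th patch is a symmetric relation and every
  element belongs to at most \<open>5 ^ p\<close> patches.\<close>

lemma patch_overlap:
  fixes F :: "real \<Rightarrow> real"
  assumes F: "integrable lborel F" "\<And>t. 0 \<le> F t"
    and c: "\<And>I. I \<in> E \<Longrightarrow> 0 \<le> c I" "\<And>I J. I \<in> E \<Longrightarrow> J \<in> E \<Longrightarrow> I \<in> nb p J \<Longrightarrow> c I \<le> D * c J"
  shows "(\<Sum>I\<in>E. c I * (LINT t|lborel. indicator (PP I) t * F t))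
       \<le> 5 ^ p * D * (\<Sum>J\<in>E. c J * (LINT t|lborel. indicator (cell J) t * F t))"
proof -
  define G where "G J = (LINT t|lborel. indicator (cell J) t * F t)" for J
  have G0: "0 \<le> G J" for J unfolding G_def by (intro integral_nonneg_AE) (simp add: F)
  have "(\<Sum>I\<in>E. c I * (LINT t|lborel. indicator (PP I) t * F t)) \<le> (\<Sum>I\<in>E. c I * (\<Sum>J\<in>nb p I. G J))"
    unfolding G_def by (intro sum_mono mult_left_mono integral_PP_le F c)
  also have "\<dots> = (\<Sum>I\<in>E. \<Sum>J\<in>{J \<in> E. J \<in> nb p I}. c I * G J)"
  proof (rule sum.cong[OF refl])
    fix I assume "I \<in> E"
    then have "nb p I = {J \<in> E. J \<in> nb p I}" using nb_sub by blast
    then show "c I * (\<Sum>J\<in>nb p I. G J) = (\<Sum>J\<in>{J \<in> E. J \<in> nb p I}. c I * G J)" by (metis sum_distrib_left)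
  qed
  also have "\<dots> = (\<Sum>J\<in>E. \<Sum>I\<in>{I \<in> E. J \<in> nb p I}. c I * G J)"
    by (rule sum.swap_restrict) (rule finite_E)+
  also have "\<dots> \<le> (\<Sum>J\<in>E. 5 ^ p * D * (c J * G J))"
  proof (rule sum_mono)
    fix J assume J: "J \<in> E"
    have "J \<in> nb p J"
    proof -
      have "(J, J) \<in> Adj" using J elem_ne[OF J] by (auto simp: Adj_def)
      then have "(J, J) \<in> Adj ^^ n" for n by (induction n) auto
      then show ?thesis by (simp add: nb_def)
    qed
    then have D0: "0 \<le> D * c J" using c(1)[OF J] c(2)[OF J J] by linarith
    have "(\<Sum>I\<in>{I \<in> E. J \<in> nb p I}. c I * G J) \<le> (\<Sum>I\<in>{I \<in> E. J \<in> nb p I}. D * c J * G J)"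
      using c(2) nb_sym J by (intro sum_mono mult_right_mono G0) auto
    also have "\<dots> = real (card {I \<in> E. J \<in> nb p I}) * (D * c J * G J)" by simp
    also have "\<dots> \<le> 5 ^ p * (D * c J * G J)"
    proof (rule mult_right_mono)
      have "{I \<in> E. J \<in> nb p I} = nb p J" using nb_sub[OF J] nb_sym by blast
      then show "real (card {I \<in> E. J \<in> nb p I}) \<le> 5 ^ p" using card_nb[OF J, of p] by (metis of_nat_le_iff of_nat_numeral of_nat_power)
      show "0 \<le> D * c J * G J" using D0 G0 by simp
    qed
    finally show "(\<Sum>I\<in>{I \<in> E. J \<in> nb p I}. c I * G J) \<le> 5 ^ p * D * (c J * G J)" by (simp add: mult.assoc)
  qed
  also have "\<dots> = 5 ^ p * D * (\<Sum>J\<in>E. c J * G J)" by (simp add: sum_distrib_left)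
  finally show ?thesis by (simp add: G_def)
qed

text \<open>Every point of the \<open>m\<close>-th patch is joined to the central element by a chain of \<open>m\<close> elements, on each
  of which the variation is at most the integral of \<open>\<bar>u'\<bar>\<close>.  Going through points of the curve
  instead of parameters makes a chain across \<open>\<gamma> a = \<gamma> b\<close> an ordinary case.\<close>

lemma patch_oscillation:
  assumes u: "periodic_ac a b u u'" and I: "I \<in> E"
    and x: "x \<in> patch \<gamma> a K m (elem \<gamma> I)" and r: "r \<in> {fst I..snd I}"
  shows "\<bar>u (\<tau> x) - u r\<bar> \<le> real (m + 1) * (LINT t|lborel. indicator (PS (patch \<gamma> a K m (elem \<gamma> I))) t * \<bar>u' t\<bar>)"
  using x
proof (induction m arbitrary: x)
  note U = periodic_acD[OF u]
  have i: "integrable lborel (\<lambda>t. indicator A t * \<bar>u' t\<bar>)" if "A \<in> sets borel" for A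
    by (rule integrable_indicator_mult[OF integrable_abs[OF U(6)] that])
  have u\<tau>: "u (\<tau> (\<gamma> s)) = u s" if "s \<in> {a..b}" for s
  proof (cases "s = b")
    case True
    then show ?thesis using closed \<tau>_\<gamma>[of a] ab U(5) by simp
  next
    case False
    then show ?thesis using \<tau>_\<gamma>[of s] that by simp
  qed
  have one: "\<bar>u (\<tau> x) - u (\<tau> y)\<bar> \<le> (LINT t|lborel. indicator (PS S) t * \<bar>u' t\<bar>)"
    if J: "J \<in> E" "x \<in> elem \<gamma> J" "y \<in> elem \<gamma> J" and S: "elem \<gamma> J \<subseteq> S" "S \<in> sets \<mu>" for J x y S
  proof -
    obtain s s' where s: "x = \<gamma> s" "s \<in> {fst J..snd J}" "y = \<gamma> s'" "s' \<in> {fst J..snd J}" using J by (auto simp: elem_def)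
    have "\<bar>u (\<tau> x) - u (\<tau> y)\<bar> = \<bar>u s - u s'\<bar>" using u\<tau>[of s] u\<tau>[of s'] s E_bounds[OF J(1)] by auto
    also have "\<dots> \<le> (LINT t|lborel. indicator (cell J) t * \<bar>u' t\<bar>)"
      using s E_bounds[OF J(1)] by (intro periodic_ac_increment[OF u]) auto
    also have "\<dots> \<le> (LINT t|lborel. indicator (PS S) t * \<bar>u' t\<bar>)"
    proof (rule integral_mono)
      show "indicator (cell J) t * \<bar>u' t\<bar> \<le> indicator (PS S) t * \<bar>u' t\<bar>" for t
        using cell_sub_PS[OF J(1)] S(1) by (auto simp: indicator_def PS_def)
    qed (auto intro!: i PS_measurable S)
    finally show ?thesis .
  qed
  {
    case 0
    have "\<gamma> r \<in> elem \<gamma> I" using r by (auto simp: elem_def)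
    moreover have "u (\<tau> (\<gamma> r)) = u r" using r E_bounds[OF I] by (intro u\<tau>) auto
    ultimately show ?case using one[OF I, of x "\<gamma> r" "elem \<gamma> I"] 0 elem_meas[OF I] by simp
  next
    case (Suc m)
    let ?S = "patch \<gamma> a K m (elem \<gamma> I)" and ?T = "patch \<gamma> a K (Suc m) (elem \<gamma> I)"
    obtain J z where J: "J \<in> E" "x \<in> elem \<gamma> J" "z \<in> elem \<gamma> J" "z \<in> ?S" using Suc.prems by auto
    have JT: "elem \<gamma> J \<subseteq> ?T" using J by (intro patch_step) auto
    have "\<bar>u (\<tau> x) - u (\<tau> z)\<bar> \<le> (LINT t|lborel. indicator (PS ?T) t * \<bar>u' t\<bar>)"
      by (rule one[OF J(1-3) JT patch_meas[OF I]])
    moreover have "\<bar>u (\<tau> z) - u r\<bar> \<le> real (m + 1) * (LINT t|lborel. indicator (PS ?T) t * \<bar>u' t\<bar>)"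
    proof (rule order_trans[OF Suc.IH[OF J(4)]], rule mult_left_mono)
      show "(LINT t|lborel. indicator (PS ?S) t * \<bar>u' t\<bar>) \<le> (LINT t|lborel. indicator (PS ?T) t * \<bar>u' t\<bar>)"
      proof (rule integral_mono)
        show "indicator (PS ?S) t * \<bar>u' t\<bar> \<le> indicator (PS ?T) t * \<bar>u' t\<bar>" for t
          using patch_Suc_mono[OF patch_sub[OF I, of m]] by (auto simp: indicator_def PS_def simp del: patch.simps)
      qed (auto intro!: i PS_measurable patch_meas[OF I] simp del: patch.simps)
    qed simp
    ultimately show ?case by (simp add: algebra_simps del: patch.simps)
  }
qed

text \<open>The oscillation is at most a multiple of the \<open>L\<^sup>1\<close> norm of \<open>u'\<close>.  Cauchy--Schwarz and integration over
  the patch produce the length of the patch twice, that is, its square in total.\<close>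

lemma patch_Poincare:
  assumes u: "periodic_ac a b u u'" and I: "I \<in> E"
  shows "nsq (PP I) (\<lambda>t. u t - u (fst I)) \<le> (real (p + 1) * (Cpatch * param_width I))\<^sup>2 * nsq (PP I) u'"
proof -
  note U = periodic_acD[OF u]
  have [measurable]: "u' \<in> borel_measurable borel" "PP I \<in> sets borel" by (rule U(1), rule PP_meas[OF I])
  define L where "L = (LINT t|lborel. indicator (PP I) t * \<bar>u' t\<bar>)"
  define M where "M = (LINT t|lborel. indicator (PP I) t :: real)"
  have sq: "(indicator (PP I) t :: real)\<^sup>2 = indicator (PP I) t" for t by (simp add: indicator_def)
  have ii: "integrable lborel (\<lambda>t. (indicator (PP I) t :: real)\<^sup>2)"
    unfolding sq
  proof (rule integrable_bounded_on[of _ 1 a b])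
    show "(indicator (PP I) t :: real) = 0" if "t \<notin> {a..<b}" for t using that by (auto simp: PP_def PS_def)
  qed (simp_all add: indicator_def)
  have iu: "integrable lborel (\<lambda>t. (indicator (PP I) t * \<bar>u' t\<bar>)\<^sup>2)"
    using integrable_indicator_mult[OF U(2), of "PP I"] PP_meas[OF I] by (simp add: power_mult_distrib sq)
  have "L = (LINT t|lborel. indicator (PP I) t * (indicator (PP I) t * \<bar>u' t\<bar>))"
    unfolding L_def by (intro Bochner_Integration.integral_cong) (auto simp: indicator_def)
  then have "L\<^sup>2 \<le> (LINT t|lborel. (indicator (PP I) t)\<^sup>2) * (LINT t|lborel. (indicator (PP I) t * \<bar>u' t\<bar>)\<^sup>2)"
    using Cauchy_Schwarz_integral(2)[OF _ _ ii iu] by simp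
  then have L2: "L\<^sup>2 \<le> M * nsq (PP I) u'" by (simp add: sq power_mult_distrib M_def nsq_def)
  have osc: "\<bar>u t - u (fst I)\<bar> \<le> real (p + 1) * L" if "t \<in> PP I" for t
    using patch_oscillation[OF u I, of "\<gamma> t" p "fst I"] that E_bounds(2)[OF I] \<tau>_\<gamma>[of t]
    by (auto simp: PP_def[symmetric] L_def) (auto simp: PP_def PS_def)
  have "nsq (PP I) (\<lambda>t. u t - u (fst I)) \<le> (LINT t|lborel. (real (p + 1) * L)\<^sup>2 * indicator (PP I) t)"
    unfolding nsq_def
  proof (rule integral_mono')
    show "integrable lborel (\<lambda>t. (real (p + 1) * L)\<^sup>2 * indicator (PP I) t)" using ii unfolding sq by simp
    show "indicator (PP I) t * (u t - u (fst I))\<^sup>2 \<le> (real (p + 1) * L)\<^sup>2 * indicator (PP I) t" for t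
      using osc[of t] by (auto simp: indicator_def abs_le_square_iff[symmetric] intro: order_trans[OF _ abs_ge_self])
  qed simp
  also have "\<dots> = (real (p + 1))\<^sup>2 * L\<^sup>2 * M" by (simp add: M_def power_mult_distrib)
  also have "\<dots> \<le> (real (p + 1))\<^sup>2 * (M * nsq (PP I) u') * M"
    using L2 by (intro mult_right_mono mult_left_mono) (auto simp: M_def)
  also have "\<dots> = (real (p + 1))\<^sup>2 * nsq (PP I) u' * M\<^sup>2" by (simp add: power2_eq_square)
  also have "\<dots> \<le> (real (p + 1))\<^sup>2 * nsq (PP I) u' * (Cpatch * param_width I)\<^sup>2"
    using measure_PP[OF I] by (intro mult_left_mono power_mono) (auto simp: M_def nsq_nonneg)
  finally show ?thesis by (simp add: power_mult_distrib mult.assoc mult.commute mult.left_commute)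
qed

end

section \<open>Local estimates for the quasi-interpolation operator\<close>

text \<open>The local analysis only uses the weights through the bounds \<open>wmin\<close> and \<open>wmax\<close> and the dual functions
  through their support, biorthogonality and norm; \<open>w\<close>, \<open>W\<close> and \<open>bst\<close> are therefore left abstract.\<close>

locale sz = mesh \<gamma> a b \<Gamma> smin smax p K \<kappa>
  for \<gamma> a b \<Gamma> smin smax p K \<kappa> +
  fixes w :: "int \<Rightarrow> real" and W :: "real \<Rightarrow> real" and bst :: "int \<Rightarrow> real \<Rightarrow> real" and wmin wmax :: real
  assumes wmin_pos: "0 < wmin"
    and w_bounds: "\<And>i. i \<in> spline_indices p K \<Longrightarrow> wmin \<le> w i \<and> w i \<le> wmax"
    and W_eq: "\<And>x. x \<in> {a..<b} \<Longrightarrow> W x = (\<Sum>i\<in>spline_indices p K. w i * bspline (knot_ext a b K) p i x)"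
    and bst_meas: "\<And>i. i \<in> spline_indices p K \<Longrightarrow> (\<lambda>x. indicator {a..b} x * bst i x) \<in> borel_measurable borel"
    and bst_sq: "\<And>i. i \<in> spline_indices p K \<Longrightarrow> integrable lborel (\<lambda>x. indicator {a..b} x * (bst i x)\<^sup>2)"
    and bst_supp: "\<And>i. i \<in> spline_indices p K \<Longrightarrow>
        ess_support a b (bst i) = {knot_ext a b K (i - 1)..knot_ext a b K (i + int p)}"
    and bst_dual: "\<And>i j. i \<in> spline_indices p K \<Longrightarrow> j \<in> spline_indices p K \<Longrightarrow>
        (LINT x|lborel. indicator {a..b} x * (bst i x * bspline (knot_ext a b K) p j x)) = (if i = j then 1 else 0)"
    and bst_norm: "\<And>i. i \<in> spline_indices p K \<Longrightarrow> sqrt (LINT x|lborel. indicator {a..b} x * (bst i x)\<^sup>2)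
        \<le> 9 ^ p * (2 * real p + 3) * (knot_ext a b K (i + int p) - knot_ext a b K (i - 1)) powr (- 1 / 2)"
begin

abbreviation "SI \<equiv> spline_indices p K"
abbreviation "B \<equiv> bspline t p"
abbreviation "dB \<equiv> dspline t p"
abbreviation "i0 \<equiv> 1 - int p"
abbreviation "i1 \<equiv> N - int p"

text \<open>The weight function.  In contrast to \<open>W\<close> it is Borel on the whole line, being a sum of B-splines.\<close>

definition Wp :: "real \<Rightarrow> real" where "Wp x = (\<Sum>i\<in>SI. w i * B i x)"
definition dW :: "real \<Rightarrow> real" where "dW x = (\<Sum>i\<in>SI. w i * dB i x)"
definition R :: "int \<Rightarrow> real \<Rightarrow> real" where "R i x = w i * B i x / Wp x"
definition dR :: "int \<Rightarrow> real \<Rightarrow> real" where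
  "dR i x = indicator {a..<b} x * ((w i * dB i x * Wp x - w i * B i x * dW x) / (Wp x * Wp x))"

lemma finite_SI: "finite SI" by (simp add: spline_indices_def)

lemma i01: "i0 \<in> SI" "i1 \<in> SI" "i0 < i1"
  using size_ge p1 by (auto simp: spline_indices_def)

lemma w_pos: "i \<in> SI \<Longrightarrow> 0 < w i" using w_bounds[of i] wmin_pos by simp

lemma wmax_pos: "0 < wmax" "wmin \<le> wmax" using w_bounds[OF i01(1)] wmin_pos by auto

lemma Wp_measurable [measurable]: "Wp \<in> borel_measurable borel"
  unfolding Wp_def by measurable

lemma dW_measurable [measurable]: "dW \<in> borel_measurable borel"
  unfolding dW_def by measurable

lemma R_measurable [measurable]: "R i \<in> borel_measurable borel"
  unfolding R_def by measurable

lemma dR_measurable [measurable]: "dR i \<in> borel_measurable borel"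
  unfolding dR_def by measurable

lemma B_nonneg: "0 \<le> B i x" by (rule bspline_nonneg[OF mono_t])

lemma Wp_bounds:
  assumes x: "x \<in> {a..<b}" shows "wmin \<le> Wp x" "Wp x \<le> wmax" "0 < Wp x"
proof -
  have one: "(\<Sum>i\<in>SI. B i x) = 1" using x by (intro partition_of_unity) auto
  have "wmin * (\<Sum>i\<in>SI. B i x) \<le> Wp x"
    unfolding Wp_def sum_distrib_left using w_bounds by (intro sum_mono mult_right_mono B_nonneg) auto
  then show *: "wmin \<le> Wp x" using one by simp
  have "Wp x \<le> wmax * (\<Sum>i\<in>SI. B i x)"
    unfolding Wp_def sum_distrib_left using w_bounds by (intro sum_mono mult_right_mono B_nonneg) auto
  then show "Wp x \<le> wmax" using one by simp
  show "0 < Wp x" using * wmin_pos by simp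
qed

lemma R_sum:
  assumes x: "x \<in> {a..<b}" shows "(\<Sum>i\<in>SI. R i x) = 1"
  unfolding R_def sum_divide_distrib[symmetric] Wp_def[symmetric] using Wp_bounds(3)[OF x] by simp

lemma R_bounds:
  assumes x: "x \<in> {a..<b}" and i: "i \<in> SI" shows "0 \<le> R i x" "R i x \<le> 1"
proof -
  have nn: "0 \<le> R j x" if "j \<in> SI" for j
    unfolding R_def using w_pos[OF that] B_nonneg Wp_bounds(3)[OF x] by simp
  then show "0 \<le> R i x" using i by simp
  have "R i x \<le> (\<Sum>i\<in>SI. R i x)" using nn i finite_SI by (intro member_le_sum) auto
  then show "R i x \<le> 1" using R_sum[OF x] by simp
qed

lemma R_outside:
  assumes "t (J - 1) \<le> x" "x < t J" "i \<notin> {J - int p..J}" shows "R i x = 0" "dR i x = 0"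
  using bspline_outside[OF mono_t assms] by (simp_all add: R_def dR_def)

lemma dR_sum: "(\<Sum>i\<in>SI. dR i x) = 0"
proof -
  have "(\<Sum>i\<in>SI. dR i x) = indicator {a..<b} x * (((\<Sum>i\<in>SI. w i * dB i x) * Wp x - (\<Sum>i\<in>SI. w i * B i x) * dW x) / (Wp x * Wp x))"
    unfolding dR_def sum_distrib_left[symmetric] sum_divide_distrib[symmetric] sum_subtractf sum_distrib_right ..
  also have "\<dots> = 0" by (simp only: Wp_def[symmetric] dW_def[symmetric] mult.commute[of "Wp x" "dW x"]) simp
  finally show ?thesis .
qed

definition Cd :: real where "Cd = (real p + 2) * (wmax / wmin) * 4 ^ p"

lemma Cd_nonneg: "0 \<le> Cd" unfolding Cd_def using wmax_pos wmin_pos by simp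

text \<open>In the quotient rule the weight function is bounded below by \<open>wmin\<close>, and its derivative is a
  sum of at most \<open>p + 1\<close> terms on a cell.\<close>

lemma dR_bound:
  assumes x: "t (J - 1) \<le> x" "x < t J" and i: "i \<in> SI"
  shows "\<bar>dR i x\<bar> \<le> Cd / (t J - t (J - 1))"
proof -
  define h where "h = t J - t (J - 1)"
  have h: "0 < h" using x by (simp add: h_def)
  define M where "M = 4 ^ p / h"
  have M: "0 \<le> M" using h by (simp add: M_def)
  have dB: "\<bar>dB j x\<bar> \<le> M" for j unfolding M_def h_def by (rule abs_dspline_le[OF mono_t x])
  have xab: "x \<in> {a..<b}" using x t_ge_a[of "J - 1"] t_le_b[of J] by auto
  note Wx = Wp_bounds[OF xab]
  have cJ: "{J - int p..J} \<subseteq> SI" using x by (intro cell_index_range) auto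
  have "dW x = (\<Sum>j\<in>{J - int p..J}. w j * dB j x)"
    unfolding dW_def using cJ bspline_outside(2)[OF mono_t x] by (intro sum.mono_neutral_right finite_SI) auto
  then have "\<bar>dW x\<bar> \<le> (\<Sum>j\<in>{J - int p..J}. \<bar>w j * dB j x\<bar>)" by (simp add: sum_abs)
  also have "\<dots> \<le> (\<Sum>j\<in>{J - int p..J}. wmax * M)"
  proof (rule sum_mono)
    fix j assume "j \<in> {J - int p..J}"
    then have j: "j \<in> SI" using cJ by blast
    show "\<bar>w j * dB j x\<bar> \<le> wmax * M"
      unfolding abs_mult using w_bounds[OF j] w_pos[OF j] dB[of j] M by (intro mult_mono) auto
  qed
  also have "\<dots> = (real p + 1) * (wmax * M)" by simp
  finally have dWb: "\<bar>dW x\<bar> \<le> (real p + 1) * (wmax * M)" .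
  have eq: "dR i x = w i * dB i x / Wp x - R i x * (dW x / Wp x)"
    using Wx(3) xab by (simp add: dR_def R_def field_simps)
  have k: "wmax * M / Wp x \<le> wmax * M / wmin" using Wx(1) wmin_pos wmax_pos M by (intro divide_left_mono) auto
  have "\<bar>w i * dB i x / Wp x\<bar> \<le> wmax * M / Wp x"
    unfolding abs_divide abs_mult using w_bounds[OF i] w_pos[OF i] dB[of i] M Wx(3)
    by (simp add: divide_right_mono mult_mono)
  then have 1: "\<bar>w i * dB i x / Wp x\<bar> \<le> wmax * M / wmin" using k by linarith
  have "\<bar>R i x * (dW x / Wp x)\<bar> \<le> 1 * ((real p + 1) * (wmax * M) / Wp x)"
    unfolding abs_mult abs_divide using R_bounds[OF xab i] dWb Wx(3)
    by (intro mult_mono) (auto intro: divide_right_mono)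
  also have "\<dots> = (real p + 1) * (wmax * M / Wp x)" by simp
  also have "\<dots> \<le> (real p + 1) * (wmax * M / wmin)" using k by (intro mult_left_mono) auto
  finally have "\<bar>dR i x\<bar> \<le> wmax * M / wmin + (real p + 1) * (wmax * M / wmin)"
    unfolding eq using 1 abs_triangle_ineq4[of "w i * dB i x / Wp x" "R i x * (dW x / Wp x)"] by linarith
  also have "\<dots> = (real p + 2) * (wmax * M / wmin)" by (simp only: distrib_right) simp
  also have "\<dots> = Cd / h" by (simp add: Cd_def M_def mult.assoc mult.commute[of h])
  finally show ?thesis by (simp add: h_def)
qed

lemma R_has_derivative:
  assumes x: "t (J - 1) < x" "x < t J" and i: "i \<in> SI"
  shows "(R i has_real_derivative dR i x) (at x)"
proof -
  have xab: "x \<in> {a..<b}" using x t_ge_a[of "J - 1"] t_le_b[of J] by auto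
  note Bd = bspline_has_derivative[OF mono_t x, of p]
  have Wd: "(Wp has_real_derivative dW x) (at x)"
    unfolding Wp_def[abs_def] dW_def by (intro DERIV_sum DERIV_cmult Bd)
  have "((\<lambda>x. w i * B i x / Wp x) has_real_derivative ((w i * dB i x * Wp x - w i * B i x * dW x) / (Wp x * Wp x))) (at x)"
    using Wp_bounds(3)[OF xab] by (intro DERIV_divide DERIV_cmult Bd Wd) auto
  then show ?thesis using xab by (simp add: R_def[abs_def] dR_def)
qed

lemma isCont_R:
  assumes "a < x" "x < b" shows "isCont (R i) x"
  unfolding R_def[abs_def] Wp_def[abs_def]
  using Wp_bounds(3)[of x] assms
  by (intro isCont_divide isCont_mult isCont_sum ballI continuous_const isCont_bspline) (auto simp: Wp_def)

lemma tendsto_SI: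
  fixes f :: "int \<Rightarrow> real \<Rightarrow> real"
  assumes "\<And>i. i \<in> SI \<Longrightarrow> (f i \<longlongrightarrow> (if i = k then 1 else 0)) G" "k \<in> SI"
  shows "((\<lambda>x. \<Sum>i\<in>SI. c i * f i x) \<longlongrightarrow> c k) G"
proof -
  have "((\<lambda>x. \<Sum>i\<in>SI. c i * f i x) \<longlongrightarrow> (\<Sum>i\<in>SI. c i * (if i = k then 1 else 0))) G"
    by (intro tendsto_sum tendsto_mult tendsto_const assms(1))
  also have "(\<Sum>i\<in>SI. c i * (if i = k then 1 else 0)) = c k"
    using assms(2) finite_SI by (simp add: if_distrib sum.delta cong: if_cong)
  finally show ?thesis .
qed

lemma R_limits:
  assumes i: "i \<in> SI"
  shows "(R i \<longlongrightarrow> (if i = i0 then 1 else 0)) (at_right a)" "(R i \<longlongrightarrow> (if i = i1 then 1 else 0)) (at_left b)"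
    "R i a = (if i = i0 then 1 else 0)"
proof -
  have Ba: "(B j \<longlongrightarrow> (if j = i0 then 1 else 0)) (at_right a)" for j
    using bspline_tendsto_right[of t p j a] by (simp add: bspline_at_a)
  have "(Wp \<longlongrightarrow> w i0) (at_right a)" unfolding Wp_def[abs_def] by (rule tendsto_SI[OF Ba i01(1)])
  then have "((\<lambda>x. w i * B i x / Wp x) \<longlongrightarrow> w i * (if i = i0 then 1 else 0) / w i0) (at_right a)"
    using w_pos[OF i01(1)] by (intro tendsto_intros Ba) auto
  then show "(R i \<longlongrightarrow> (if i = i0 then 1 else 0)) (at_right a)"
    using w_pos[OF i01(1)] by (simp add: R_def[abs_def] split: if_splits)
  have "(Wp \<longlongrightarrow> w i1) (at_left b)" unfolding Wp_def[abs_def] by (rule tendsto_SI[OF bspline_tendsto_b i01(2)])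
  then have "((\<lambda>x. w i * B i x / Wp x) \<longlongrightarrow> w i * (if i = i1 then 1 else 0) / w i1) (at_left b)"
    using w_pos[OF i01(2)] by (intro tendsto_intros bspline_tendsto_b) auto
  then show "(R i \<longlongrightarrow> (if i = i1 then 1 else 0)) (at_left b)"
    using w_pos[OF i01(2)] by (simp add: R_def[abs_def] split: if_splits)
  have "Wp a = w i0" unfolding Wp_def using i01(1) finite_SI
    by (simp add: bspline_at_a if_distrib sum.delta cong: if_cong)
  then show "R i a = (if i = i0 then 1 else 0)" using w_pos[OF i01(1)] by (simp add: R_def bspline_at_a)
qed

lemma sum_R_a: "(\<Sum>i\<in>SI. c i * R i a) = c i0"
  using i01(1) finite_SI by (simp add: R_limits(3) if_distrib sum.delta cong: if_cong)

text \<open>A spline and its piecewise derivative, given by the coefficients with respect to the rational basis.\<close>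

definition spl :: "(int \<Rightarrow> real) \<Rightarrow> real \<Rightarrow> real" where "spl c x = (\<Sum>i\<in>SI. c i * R i x)"
definition dspl :: "(int \<Rightarrow> real) \<Rightarrow> real \<Rightarrow> real" where "dspl c x = (\<Sum>i\<in>SI. c i * dR i x)"

lemma spl_measurable [measurable]: "spl c \<in> borel_measurable borel"
  unfolding spl_def by measurable

lemma dspl_measurable [measurable]: "dspl c \<in> borel_measurable borel"
  unfolding dspl_def by measurable

lemma spl_limits: "(spl c \<longlongrightarrow> c i0) (at_right a)" "(spl c \<longlongrightarrow> c i1) (at_left b)" "spl c a = c i0"
  unfolding spl_def[abs_def] using R_limits i01 sum_R_a[of c]
  by (auto intro!: tendsto_SI)

lemma spl_cell:
  assumes x: "t (J - 1) \<le> x" "x < t J"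
  shows "spl c x = (\<Sum>i\<in>{J - int p..J}. c i * R i x)" "dspl c x = (\<Sum>i\<in>{J - int p..J}. c i * dR i x)"
proof -
  have cJ: "{J - int p..J} \<subseteq> SI" using x by (intro cell_index_range) auto
  show "spl c x = (\<Sum>i\<in>{J - int p..J}. c i * R i x)" "dspl c x = (\<Sum>i\<in>{J - int p..J}. c i * dR i x)"
    unfolding spl_def dspl_def using cJ R_outside[OF x] by (intro sum.mono_neutral_right finite_SI; auto)+
qed

text \<open>Only \<open>p + 1\<close> basis functions are active on a cell; they are bounded by one and their derivatives by
  the reciprocal width.  The second bound is the inverse inequality.\<close>

lemma spl_local_bounds:
  assumes x: "t (J - 1) \<le> x" "x < t J" and A: "\<And>i. i \<in> {J - int p..J} \<Longrightarrow> (c i)\<^sup>2 \<le> A"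
  shows "(spl c x)\<^sup>2 \<le> (real p + 1)\<^sup>2 * A" "(dspl c x)\<^sup>2 \<le> (real p + 1)\<^sup>2 * A * (Cd / (t J - t (J - 1)))\<^sup>2"
proof -
  have cJ: "{J - int p..J} \<subseteq> SI" using x by (intro cell_index_range) auto
  have xab: "x \<in> {a..<b}" using x t_ge_a[of "J - 1"] t_le_b[of J] by auto
  have "(c J)\<^sup>2 \<le> A" by (rule A) simp
  then have A0: "0 \<le> A" by (rule order_trans[OF zero_le_power2])
  have main: "(\<Sum>i\<in>{J - int p..J}. c i * f i)\<^sup>2 \<le> (real p + 1)\<^sup>2 * A * M\<^sup>2"
    if f: "\<And>i. i \<in> {J - int p..J} \<Longrightarrow> \<bar>f i\<bar> \<le> M" for f M
  proof -
    have "\<bar>\<Sum>i\<in>{J - int p..J}. c i * f i\<bar> \<le> (\<Sum>i\<in>{J - int p..J}. \<bar>c i * f i\<bar>)" by (rule sum_abs)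
    also have "\<dots> \<le> (\<Sum>i\<in>{J - int p..J}. sqrt A * M)"
    proof (rule sum_mono)
      fix i assume i: "i \<in> {J - int p..J}"
      have "\<bar>c i\<bar> \<le> sqrt A" using A[OF i] by (simp add: real_le_rsqrt)
      then show "\<bar>c i * f i\<bar> \<le> sqrt A * M" unfolding abs_mult using f[OF i] A0 by (intro mult_mono) auto
    qed
    also have "\<dots> = (real p + 1) * (sqrt A * M)" by simp
    finally have "\<bar>\<Sum>i\<in>{J - int p..J}. c i * f i\<bar> \<le> (real p + 1) * (sqrt A * M)" .
    then have "\<bar>\<Sum>i\<in>{J - int p..J}. c i * f i\<bar>\<^sup>2 \<le> ((real p + 1) * (sqrt A * M))\<^sup>2" by (intro power_mono) auto
    then show ?thesis using A0 by (simp add: power_mult_distrib mult.assoc)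
  qed
  show "(spl c x)\<^sup>2 \<le> (real p + 1)\<^sup>2 * A"
    using main[of "\<lambda>i. R i x" 1] R_bounds[OF xab] cJ unfolding spl_cell(1)[OF x] by fastforce
  show "(dspl c x)\<^sup>2 \<le> (real p + 1)\<^sup>2 * A * (Cd / (t J - t (J - 1)))\<^sup>2"
    unfolding spl_cell(2)[OF x] using cJ by (intro main dR_bound[OF x]) auto
qed

text \<open>The rational splines are continuous because interior multiplicities are at most \<open>p\<close>, smooth between the
  knots with bounded derivative, and closed up by \<open>c i0 = c i1\<close>.  At \<open>b\<close>, where the right-continuous
  B-splines are zero, the value has to be set to the left limit.\<close>

lemma spl_periodic_ac:
  assumes c: "c i0 = c i1"
  shows "periodic_ac a b (\<lambda>x. if x < b then spl c x else c i1) (dspl c)"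
proof -
  define F where "F x = (if x < b then spl c x else c i1)" for x
  define m where "m = Min (param_width ` E)"
  have Ene: "E \<noteq> {}" using E_cover[of "\<gamma> a"] in_\<Gamma>[of a] ab by auto
  have m: "0 < m" unfolding m_def using finite_E Ene width_pos by simp
  define A where "A = Max ((\<lambda>i. (c i)\<^sup>2) ` SI)"
  have A: "(c i)\<^sup>2 \<le> A" if "i \<in> SI" for i unfolding A_def using finite_SI that by (intro Max_ge) auto
  have A0: "0 \<le> A" using A[OF i01(1)] order_trans zero_le_power2 by blast
  define BB where "BB = (real p + 1) * sqrt A * (Cd / m)"
  have BB: "0 \<le> BB" unfolding BB_def using A0 Cd_nonneg m by simp
  have "periodic_ac a b F (dspl c)"
  proof (rule periodic_ac_piecewise_smooth[of a b "set_mset K" F "dspl c" BB])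
    show "continuous_on {a..b} F"
      unfolding continuous_on_eq_continuous_within
    proof
      fix x assume x: "x \<in> {a..b}"
      consider "x = a" | "x = b" | "a < x" "x < b" using x by force
      then show "continuous (at x within {a..b}) F"
      proof cases
        case 1
        have "eventually (\<lambda>x. spl c x = F x) (at_right a)"
          by (rule eventually_at_rightI[of a b]) (use ab in \<open>auto simp: F_def\<close>)
        then have "(F \<longlongrightarrow> c i0) (at_right a)" using spl_limits(1)[of c] tendsto_cong by blast
        moreover have "F a = c i0" using ab spl_limits(3) by (simp add: F_def)
        ultimately show ?thesis using 1 at_within_Icc_at_right[OF ab] by (simp add: continuous_within)
      next
        case 2
        have "eventually (\<lambda>x. spl c x = F x) (at_left b)"
          by (rule eventually_at_leftI[of a]) (use ab in \<open>auto simp: F_def\<close>)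
        then have "(F \<longlongrightarrow> c i1) (at_left b)" using spl_limits(2)[of c] tendsto_cong by blast
        then show ?thesis using 2 at_within_Icc_at_left[OF ab] by (simp add: continuous_within F_def)
      next
        case 3
        have "isCont (spl c) x" unfolding spl_def[abs_def]
          using 3 by (intro isCont_sum isCont_mult continuous_const isCont_R ballI) auto
        moreover have "eventually (\<lambda>y. spl c y = F y) (nhds x)"
          by (rule eventually_nhds_in_open[of "{..<b}", THEN eventually_mono]) (use 3 in \<open>auto simp: F_def\<close>)
        ultimately have "isCont F x" using isCont_cong by blast
        then show ?thesis by (rule continuous_at_imp_continuous_at_within)
      qed
    qed
    show "F b = F a" using ab spl_limits(3) c by (simp add: F_def)
    show "(F has_real_derivative dspl c x) (at x)" if x: "x \<in> {a<..<b} - set_mset K" for x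
    proof -
      obtain J where J: "t (J - 1) \<le> x" "x < t J" using cell_exists[of x] x by auto
      have "t (J - 1) \<in> insert a (set_mset K)" using range_t by blast
      then have "t (J - 1) \<noteq> x" using x by auto
      then have J': "t (J - 1) < x" using J by linarith
      have "(spl c has_real_derivative dspl c x) (at x)"
        unfolding spl_def[abs_def] dspl_def by (intro DERIV_sum DERIV_cmult R_has_derivative[OF J' J(2)])
      then show ?thesis
        by (rule has_field_derivative_transform_within_open[of _ _ _ "{..<b}"]) (use x in \<open>auto simp: F_def\<close>)
    qed
    show "\<bar>dspl c x\<bar> \<le> BB" for x
    proof (cases "x \<in> {a..<b}")
      case True
      obtain J where J: "t (J - 1) \<le> x" "x < t J" using cell_exists[of x] True by auto
      have I: "(t (J - 1), t J) \<in> E" unfolding param_elements_iff using J by (intro exI[of _ J]) auto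
      then have "param_width (t (J - 1), t J) \<in> param_width ` E" by (rule imageI)
      then have mh: "m \<le> t J - t (J - 1)" unfolding m_def using finite_E
        by (intro Min_le) (auto simp: param_width_def)
      have cJ: "{J - int p..J} \<subseteq> SI" using J by (intro cell_index_range) auto
      have "(dspl c x)\<^sup>2 \<le> (real p + 1)\<^sup>2 * A * (Cd / (t J - t (J - 1)))\<^sup>2"
        using cJ by (intro spl_local_bounds[OF J] A) auto
      also have "\<dots> \<le> (real p + 1)\<^sup>2 * A * (Cd / m)\<^sup>2"
        using mh m Cd_nonneg A0 by (intro mult_left_mono power_mono divide_left_mono) auto
      also have "\<dots> = BB\<^sup>2" unfolding BB_def power_mult_distrib real_sqrt_pow2[OF A0] ..
      finally show ?thesis using BB by (simp add: abs_le_square_iff[symmetric])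
    next
      case False
      then show ?thesis using BB by (simp add: dspl_def dR_def)
    qed
    show "dspl c x = 0" if "x \<notin> {a..<b}" for x using that by (simp add: dspl_def dR_def)
  qed (use ab in auto)
  then show ?thesis by (simp add: F_def[abs_def])
qed

text \<open>The functions that are integrated against \<open>v\<close> to obtain the coefficients: the rational dual functions
  \<open>rst\<close>, and for \<open>i0\<close> and \<open>i1\<close> the mean of the two duals that belong to the closing point.\<close>

definition b0 :: "int \<Rightarrow> real \<Rightarrow> real" where "b0 i x = indicator {a..<b} x * bst i x"
definition rst :: "int \<Rightarrow> real \<Rightarrow> real" where "rst i x = b0 i x * Wp x / w i"
definition \<phi> :: "int \<Rightarrow> real \<Rightarrow> real" where
  "\<phi> i x = (if i = i0 \<or> i = i1 then (rst i0 x + rst i1 x) / 2 else rst i x)"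

lemma b0_measurable: "i \<in> SI \<Longrightarrow> b0 i \<in> borel_measurable borel"
proof -
  assume "i \<in> SI"
  note [measurable] = bst_meas[OF this]
  have "b0 i = (\<lambda>x. indicator {a..<b} x * (indicator {a..b} x * bst i x))" by (auto simp: b0_def fun_eq_iff indicator_def)
  moreover have "(\<lambda>x. indicator {a..<b} x * (indicator {a..b} x * bst i x)) \<in> borel_measurable borel" by measurable
  ultimately show ?thesis by simp
qed

lemma b0_sq: "i \<in> SI \<Longrightarrow> integrable lborel (\<lambda>x. (b0 i x)\<^sup>2)"
  and b0_norm: "i \<in> SI \<Longrightarrow> (LINT x|lborel. (b0 i x)\<^sup>2) \<le> (9 ^ p * (2 * real p + 3))\<^sup>2 / (t (i + int p) - t (i - 1))"
proof -
  assume i: "i \<in> SI"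
  have eq: "(b0 i x)\<^sup>2 = indicator {a..<b} x * (indicator {a..b} x * (bst i x)\<^sup>2)" for x
    by (cases "x \<in> {a..<b}") (simp_all add: b0_def)
  show int: "integrable lborel (\<lambda>x. (b0 i x)\<^sup>2)" unfolding eq by (rule integrable_indicator_mult[OF bst_sq[OF i]]) simp
  define L where "L = (LINT x|lborel. indicator {a..b} x * (bst i x)\<^sup>2)"
  have L0: "0 \<le> L" unfolding L_def by (intro integral_nonneg_AE) simp
  have "(LINT x|lborel. (b0 i x)\<^sup>2) \<le> L"
    unfolding L_def using bst_sq[OF i] int by (intro integral_mono) (auto simp: eq indicator_def)
  also have "L = (sqrt L)\<^sup>2" using L0 by simp
  also have "\<dots> \<le> (9 ^ p * (2 * real p + 3) * (t (i + int p) - t (i - 1)) powr (- 1 / 2))\<^sup>2"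
    using bst_norm[OF i] L0 by (intro power_mono) (auto simp: L_def)
  also have "\<dots> = (9 ^ p * (2 * real p + 3))\<^sup>2 * ((t (i + int p) - t (i - 1)) powr (- 1 / 2))\<^sup>2"
    by (rule power_mult_distrib)
  also have "((t (i + int p) - t (i - 1)) powr (- 1 / 2))\<^sup>2 = 1 / (t (i + int p) - t (i - 1))"
  proof -
    have "0 \<le> t (i + int p) - t (i - 1)" using monoD[OF mono_t, of "i - 1" "i + int p"] by simp
    then show ?thesis by (cases "t (i + int p) - t (i - 1) = 0") (auto simp: power2_eq_square powr_add[symmetric] powr_minus_divide)
  qed
  finally show "(LINT x|lborel. (b0 i x)\<^sup>2) \<le> (9 ^ p * (2 * real p + 3))\<^sup>2 / (t (i + int p) - t (i - 1))" by simp
qed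

text \<open>The essential support is the complement of the largest open set on which the function vanishes almost
  everywhere.  That set is a union of uncountably many balls with this property; by Lindelof countably
  many of them suffice.\<close>

lemma b0_support: "i \<in> SI \<Longrightarrow> AE x in lborel. x \<notin> {t (i - 1)..t (i + int p)} \<longrightarrow> b0 i x = 0"
proof -
  assume i: "i \<in> SI"
  let ?S = "{t (i - 1)..t (i + int p)}"
  define Z where "Z x d \<longleftrightarrow> (AE s in lborel. s \<in> {a..b} \<and> dist s x < d \<longrightarrow> bst i s = 0)" for x d
  have "\<forall>x\<in>{a..b} - ?S. \<exists>d. 0 < d \<and> Z x d"
  proof
    fix x assume x: "x \<in> {a..b} - ?S"
    then have "x \<notin> ess_support a b (bst i)" using bst_supp[OF i] by simp
    then have "\<not> (\<forall>e>0. \<not> Z x e)" using x by (simp add: ess_support_def Z_def)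
    then show "\<exists>d. 0 < d \<and> Z x d" by (simp only: not_all not_imp not_not)
  qed
  from bchoice[OF this] obtain e where e: "\<forall>x\<in>{a..b} - ?S. 0 < e x \<and> Z x (e x)" ..
  let ?F = "(\<lambda>x. ball x (e x)) ` ({a..b} - ?S)"
  obtain F' where F': "F' \<subseteq> ?F" "countable F'" "\<Union>F' = \<Union>?F"
    by (rule Lindelof[of ?F]) (blast intro: open_ball)+
  have "AE s in lborel. \<forall>U\<in>F'. s \<in> {a..b} \<and> s \<in> U \<longrightarrow> bst i s = 0"
  proof (subst AE_ball_countable[OF F'(2)], rule ballI)
    fix U assume "U \<in> F'"
    then obtain x where "x \<in> {a..b} - ?S" "U = ball x (e x)" using F'(1) by blast
    then have "AE s in lborel. s \<in> {a..b} \<and> dist s x < e x \<longrightarrow> bst i s = 0" using e unfolding Z_def by blast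
    then show "AE s in lborel. s \<in> {a..b} \<and> s \<in> U \<longrightarrow> bst i s = 0"
      unfolding \<open>U = ball x (e x)\<close> mem_ball by (simp only: dist_commute[of x])
  qed
  then show ?thesis
  proof eventually_elim
    case (elim s)
    show ?case
    proof
      assume s: "s \<notin> ?S"
      show "b0 i s = 0"
      proof (cases "s \<in> {a..<b}")
        case True
        then have sa: "s \<in> {a..b} - ?S" using s by auto
        then have "s \<in> \<Union>?F" using e by (intro UN_I[of s]) auto
        then obtain U where "U \<in> F'" "s \<in> U" using F'(3) by blast
        then have "bst i s = 0" using elim sa by blast
        then show ?thesis by (simp add: b0_def)
      qed (simp add: b0_def)
    qed
  qed
qed

lemma rst_abs: "i \<in> SI \<Longrightarrow> (rst i x)\<^sup>2 \<le> (wmax / wmin)\<^sup>2 * (b0 i x)\<^sup>2"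
proof (cases "x \<in> {a..<b}")
  case True
  assume i: "i \<in> SI"
  have "(Wp x / w i)\<^sup>2 \<le> (wmax / wmin)\<^sup>2"
    using Wp_bounds[OF True] w_bounds[OF i] w_pos[OF i] wmin_pos wmax_pos by (intro power_mono frac_le) auto
  then have "(Wp x / w i)\<^sup>2 * (b0 i x)\<^sup>2 \<le> (wmax / wmin)\<^sup>2 * (b0 i x)\<^sup>2" by (intro mult_right_mono) auto
  then show ?thesis by (simp add: rst_def power_mult_distrib power_divide mult.commute)
qed (simp add: rst_def b0_def)

lemma rst_measurable: "i \<in> SI \<Longrightarrow> rst i \<in> borel_measurable borel"
proof -
  assume "i \<in> SI"
  note [measurable] = b0_measurable[OF this]
  show ?thesis unfolding rst_def[abs_def] by measurable
qed

definition C0 :: real where "C0 = (wmax / wmin)\<^sup>2 * (9 ^ p * (2 * real p + 3))\<^sup>2"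

lemma C0_nonneg: "0 \<le> C0" by (simp add: C0_def)

lemma rst_sq: "i \<in> SI \<Longrightarrow> integrable lborel (\<lambda>x. (rst i x)\<^sup>2)"
  and rst_norm: "i \<in> SI \<Longrightarrow> (LINT x|lborel. (rst i x)\<^sup>2) \<le> C0 / (t (i + int p) - t (i - 1))"
proof -
  assume i: "i \<in> SI"
  note [measurable] = rst_measurable[OF i]
  show int: "integrable lborel (\<lambda>x. (rst i x)\<^sup>2)"
    using rst_abs[OF i] by (intro integrable_dominated[OF b0_sq[OF i], of _ "(wmax / wmin)\<^sup>2"]) auto
  have "(LINT x|lborel. (rst i x)\<^sup>2) \<le> (LINT x|lborel. (wmax / wmin)\<^sup>2 * (b0 i x)\<^sup>2)"
    using int b0_sq[OF i] rst_abs[OF i] by (intro integral_mono) auto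
  also have "\<dots> = (wmax / wmin)\<^sup>2 * (LINT x|lborel. (b0 i x)\<^sup>2)" by simp
  also have "\<dots> \<le> (wmax / wmin)\<^sup>2 * ((9 ^ p * (2 * real p + 3))\<^sup>2 / (t (i + int p) - t (i - 1)))"
    by (intro mult_left_mono b0_norm[OF i]) simp
  finally show "(LINT x|lborel. (rst i x)\<^sup>2) \<le> C0 / (t (i + int p) - t (i - 1))" by (simp add: C0_def)
qed

lemma \<phi>_measurable: "i \<in> SI \<Longrightarrow> \<phi> i \<in> borel_measurable borel"
proof -
  assume i: "i \<in> SI"
  note [measurable] = rst_measurable[OF i] rst_measurable[OF i01(1)] rst_measurable[OF i01(2)]
  show ?thesis unfolding \<phi>_def[abs_def] by measurable
qed

lemma diff_sq_le: "(x - y)\<^sup>2 \<le> 2 * x\<^sup>2 + 2 * (y::real)\<^sup>2"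
  using sum_squares_bound[of x "- y"] by (simp add: power2_diff)

lemma half_sum_sq: "((x + y) / 2)\<^sup>2 \<le> (x\<^sup>2 + y\<^sup>2) / (2::real)"
  using sum_squares_bound[of x y] by (simp add: power2_eq_square field_simps)

lemma \<phi>_sq: "i \<in> SI \<Longrightarrow> integrable lborel (\<lambda>x. (\<phi> i x)\<^sup>2)"
proof -
  assume i: "i \<in> SI"
  note [measurable] = \<phi>_measurable[OF i]
  have "integrable lborel (\<lambda>x. (rst i0 x)\<^sup>2 + (rst i1 x)\<^sup>2 + (rst i x)\<^sup>2)"
    using rst_sq[OF i] rst_sq[OF i01(1)] rst_sq[OF i01(2)] by simp
  then show ?thesis
  proof (rule integrable_dominated[of _ _ 1])
    show "\<bar>(\<phi> i x)\<^sup>2\<bar> \<le> 1 * ((rst i0 x)\<^sup>2 + (rst i1 x)\<^sup>2 + (rst i x)\<^sup>2)" for x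
    proof (cases "i = i0 \<or> i = i1")
      case True
      then have "(\<phi> i x)\<^sup>2 \<le> ((rst i0 x)\<^sup>2 + (rst i1 x)\<^sup>2) / 2" using half_sum_sq unfolding \<phi>_def by simp
      also have "\<dots> \<le> (rst i0 x)\<^sup>2 + (rst i1 x)\<^sup>2 + (rst i x)\<^sup>2" by (simp add: add_increasing2)
      finally show ?thesis unfolding abs_power2 mult_1 .
    next
      case False
      then have "\<phi> i x = rst i x" by (simp add: \<phi>_def)
      then show ?thesis by simp
    qed
  qed measurable
qed

lemma \<phi>_out: "x \<notin> {a..<b} \<Longrightarrow> \<phi> i x = 0"
  by (simp add: \<phi>_def rst_def b0_def)

text \<open>Counted with repetitions, each knot interval next to a patch is either trivial or an element that touches
  the patch.  Thus \<open>m\<close> knots to either side are reached by the \<open>m\<close>-th patch.\<close>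

lemma patch_covers:
  assumes J: "t (J - 1) < t J" and x: "x \<in> {t (J - 1 - int m)..t (J + int m)}"
  shows "\<gamma> x \<in> patch \<gamma> a K m (elem \<gamma> (t (J - 1), t J))"
  using x
proof (induction m arbitrary: x)
  case 0
  then show ?case by (auto simp: elem_def)
next
  case (Suc m)
  let ?S = "patch \<gamma> a K m (elem \<gamma> (t (J - 1), t J))"
  have I: "(t (J - 1), t J) \<in> E" unfolding param_elements_iff using J by blast
  have le: "t (J - 1 - int m) \<le> t (J + int m)" by (rule monoD[OF mono_t]) simp
  consider "x \<in> {t (J - 1 - int m)..t (J + int m)}" | "t (J + int m) < x" | "x < t (J - 1 - int m)" by force
  then show ?case
  proof cases
    case 1
    then show ?thesis using Suc.IH patch_Suc_mono[OF patch_sub[OF I, of m]] by (simp del: patch.simps add: subset_iff)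
  next
    case 2
    have x: "x \<le> t (J + int m + 1)" using Suc.prems by (simp add: algebra_simps)
    have E: "(t (J + int m), t (J + int m + 1)) \<in> E"
      unfolding param_elements_iff by (rule exI[of _ "J + int m + 1"]) (use 2 x in simp)
    have "\<gamma> (t (J + int m)) \<in> ?S" by (rule Suc.IH) (use le in auto)
    moreover have "\<gamma> (t (J + int m)) \<in> elem \<gamma> (t (J + int m), t (J + int m + 1))"
      "\<gamma> x \<in> elem \<gamma> (t (J + int m), t (J + int m + 1))" using 2 x by (auto simp: elem_def)
    ultimately show ?thesis using patch_step[OF E, of m] by blast
  next
    case 3
    have x: "t (J - 1 - int m - 1) \<le> x" using Suc.prems by (simp add: algebra_simps)
    have E: "(t (J - 1 - int m - 1), t (J - 1 - int m)) \<in> E"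
      unfolding param_elements_iff by (rule exI[of _ "J - 1 - int m"]) (use 3 x in simp)
    have "\<gamma> (t (J - 1 - int m)) \<in> ?S" by (rule Suc.IH) (use le in auto)
    moreover have "\<gamma> (t (J - 1 - int m)) \<in> elem \<gamma> (t (J - 1 - int m - 1), t (J - 1 - int m))"
      "\<gamma> x \<in> elem \<gamma> (t (J - 1 - int m - 1), t (J - 1 - int m))" using 3 x by (auto simp: elem_def)
    ultimately show ?thesis using patch_step[OF E, of m] by blast
  qed
qed

text \<open>If \<open>k\<close> is the index at the opposite end of the parameter interval, then the support of the \<open>k\<close>-th
  B-spline is a single element, which touches the element of the \<open>i\<close>-th one at \<open>\<gamma> a = \<gamma> b\<close>.  So it lies in
  the first patch, and its width is comparable by the grading of the mesh.\<close>

lemma support_in_patch: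
  assumes J: "t (J - 1) < t J" and i: "i \<in> {J - int p..J}"
    and k: "k = i \<or> (i \<in> {i0, i1} \<and> k \<in> {i0, i1})"
    and x: "x \<in> {t (k - 1)..t (k + int p)}"
  shows "\<gamma> x \<in> patch \<gamma> a K p (elem \<gamma> (t (J - 1), t J))" "(t J - t (J - 1)) / \<kappa> \<le> t (k + int p) - t (k - 1)"
proof -
  let ?I = "(t (J - 1), t J)"
  have I: "?I \<in> E" unfolding param_elements_iff using J by blast
  note cr = cell_index_range[OF J]
  have i': "J - int p \<le> i" "i \<le> J" using i by auto
  have "t (J - 1 - int p) \<le> t (i - 1)" "t (i + int p) \<le> t (J + int p)"
    by (rule monoD[OF mono_t], use i' in linarith)+
  then have own1: "{t (i - 1)..t (i + int p)} \<subseteq> {t (J - 1 - int p)..t (J + int p)}" by (intro atLeastatMost_subset_iff[THEN iffD2]) simp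
  have own2: "t (i - 1) \<le> t (J - 1)" "t J \<le> t (i + int p)"
    by (rule monoD[OF mono_t], use i' in linarith)+
  have h: "0 < t J - t (J - 1)" using J by simp
  have "(t J - t (J - 1)) / \<kappa> \<le> (t J - t (J - 1)) / 1" by (rule divide_left_mono) (use h \<kappa>1 in auto)
  then have hk: "(t J - t (J - 1)) / \<kappa> \<le> t J - t (J - 1)" by (simp only: div_by_1)
  have other: "\<gamma> x \<in> patch \<gamma> a K p (elem \<gamma> ?I) \<and> (t J - t (J - 1)) / \<kappa> \<le> t (k + int p) - t (k - 1)"
    if F: "(t (k - 1), t (k + int p)) \<in> E" and z: "z \<in> elem \<gamma> (t (k - 1), t (k + int p))" "z \<in> elem \<gamma> ?I" for z
  proof -
    let ?F = "(t (k - 1), t (k + int p))"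
    have "z \<in> elem \<gamma> ?F \<inter> patch \<gamma> a K 0 (elem \<gamma> ?I)" using z by simp
    then have "elem \<gamma> ?F \<subseteq> patch \<gamma> a K (Suc 0) (elem \<gamma> ?I)" by (intro patch_step[OF F]) blast
    then have "elem \<gamma> ?F \<subseteq> patch \<gamma> a K 1 (elem \<gamma> ?I)" by (simp only: One_nat_def)
    also have "\<dots> \<subseteq> patch \<gamma> a K p (elem \<gamma> ?I)" by (rule patch_mono[OF I p1])
    finally have "elem \<gamma> ?F \<subseteq> patch \<gamma> a K p (elem \<gamma> ?I)" .
    moreover have "\<gamma> x \<in> elem \<gamma> ?F" using x unfolding elem_def by simp
    ultimately have 1: "\<gamma> x \<in> patch \<gamma> a K p (elem \<gamma> ?I)" by blast
    have "param_width ?I \<le> \<kappa> * param_width ?F" by (rule ratio[OF I F]) (use z in blast)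
    then have "t J - t (J - 1) \<le> (t (k + int p) - t (k - 1)) * \<kappa>" by (simp add: param_width_def mult.commute)
    moreover have "0 < \<kappa>" using \<kappa>1 by simp
    ultimately show ?thesis using 1 by (simp only: pos_divide_le_eq simp_thms)
  qed
  have main: "\<gamma> x \<in> patch \<gamma> a K p (elem \<gamma> ?I) \<and> (t J - t (J - 1)) / \<kappa> \<le> t (k + int p) - t (k - 1)"
  proof (cases "k = i")
    case True
    have "\<gamma> x \<in> patch \<gamma> a K p (elem \<gamma> ?I)" using x own1 True by (intro patch_covers[OF J]) blast
    moreover have "(t J - t (J - 1)) / \<kappa> \<le> t (k + int p) - t (k - 1)" using own2 hk True by simp
    ultimately show ?thesis ..
  next
    case False
    then have "(i = i0 \<and> k = i1) \<or> (i = i1 \<and> k = i0)" using k by auto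
    then show ?thesis
    proof
      assume ik: "i = i0 \<and> k = i1"
      then have "J = 1" using i cr by auto
      have tk: "t (k + int p) = b" "t (k - 1) < b" using ik t_eq_b[of "k + int p"] t_less_b[of "k - 1"] p1 by auto
      have tk': "t k = b" using ik t_eq_b[of k] by simp
      have F: "(t (k - 1), t (k + int p)) \<in> E" unfolding param_elements_iff using tk tk' by (intro exI[of _ k]) simp
      show ?thesis
      proof (rule other[OF F])
        show "\<gamma> b \<in> elem \<gamma> (t (k - 1), t (k + int p))" using tk by (auto simp: elem_def)
        have "\<gamma> a \<in> elem \<gamma> ?I" using \<open>J = 1\<close> t_nonpos[of 0] J by (auto simp: elem_def)
        then show "\<gamma> b \<in> elem \<gamma> ?I" using closed by simp
      qed
    next
      assume ik: "i = i1 \<and> k = i0"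
      then have "J = N - int p" using i cr by auto
      have tk: "t (k + int p) = t 1" "t (k - 1) = a" using ik t_nonpos[of "k - 1"] by auto
      have F: "(t (k - 1), t (k + int p)) \<in> E" unfolding param_elements_iff tk
        using t_nonpos[of 0] t_gt_a[of 1] by (intro exI[of _ 1]) simp
      show ?thesis
      proof (rule other[OF F])
        show "\<gamma> a \<in> elem \<gamma> (t (k - 1), t (k + int p))" using tk t_gt_a[of 1] by (auto simp: elem_def)
        have "\<gamma> b \<in> elem \<gamma> ?I" using \<open>J = N - int p\<close> t_eq_b[of J] J by (auto simp: elem_def)
        then show "\<gamma> a \<in> elem \<gamma> ?I" using closed by simp
      qed
    qed
  qed
  then show "\<gamma> x \<in> patch \<gamma> a K p (elem \<gamma> (t (J - 1), t J))" "(t J - t (J - 1)) / \<kappa> \<le> t (k + int p) - t (k - 1)" by auto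
qed

lemma \<phi>_local:
  assumes J: "t (J - 1) < t J" and i: "i \<in> {J - int p..J}"
  shows "AE x in lborel. x \<notin> PP (t (J - 1), t J) \<longrightarrow> \<phi> i x = 0"
    and "(LINT x|lborel. (\<phi> i x)\<^sup>2) \<le> \<kappa> * C0 / (t J - t (J - 1))"
proof -
  let ?I = "(t (J - 1), t J)"
  have iSI: "i \<in> SI" using cell_index_range(3)[OF J] i by blast
  let ?rel = "\<lambda>k. k = i \<or> (i \<in> {i0, i1} \<and> k \<in> {i0, i1})"
  have relSI: "k \<in> SI" if "?rel k" for k using that iSI i01 by auto
  have h: "0 < t J - t (J - 1)" using J by simp
  have r0: "AE x in lborel. x \<notin> PP ?I \<longrightarrow> rst k x = 0" if k: "?rel k" for k
    using b0_support[OF relSI[OF k]]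
  proof eventually_elim
    case (elim x)
    show ?case
    proof
      assume x: "x \<notin> PP ?I"
      show "rst k x = 0"
      proof (cases "x \<in> {a..<b}")
        case True
        then have "x \<notin> {t (k - 1)..t (k + int p)}"
          using support_in_patch(1)[OF J i k, of x] x by (auto simp: PP_def PS_def)
        then show ?thesis using elim by (simp add: rst_def)
      qed (simp add: rst_def b0_def)
    qed
  qed
  have rn: "(LINT x|lborel. (rst k x)\<^sup>2) \<le> \<kappa> * C0 / (t J - t (J - 1))" if k: "?rel k" for k
  proof -
    have "t (k - 1) \<le> t (k + int p)" by (rule monoD[OF mono_t]) simp
    then have len: "(t J - t (J - 1)) / \<kappa> \<le> t (k + int p) - t (k - 1)"
      by (intro support_in_patch(2)[OF J i k, of "t (k - 1)"]) simp
    have pos: "0 < (t J - t (J - 1)) / \<kappa>" using h \<kappa>1 by simp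
    have "(LINT x|lborel. (rst k x)\<^sup>2) \<le> C0 / (t (k + int p) - t (k - 1))" by (rule rst_norm[OF relSI[OF k]])
    also have "\<dots> \<le> C0 / ((t J - t (J - 1)) / \<kappa>)"
      by (intro divide_left_mono len C0_nonneg mult_pos_pos pos less_le_trans[OF pos len])
    finally show ?thesis by (simp add: mult.commute)
  qed
  show "AE x in lborel. x \<notin> PP ?I \<longrightarrow> \<phi> i x = 0"
  proof (cases "i = i0 \<or> i = i1")
    case True
    then have "?rel i0" "?rel i1" by auto
    from r0[OF this(1)] r0[OF this(2)] show ?thesis by eventually_elim (use True in \<open>auto simp: \<phi>_def\<close>)
  next
    case False
    then show ?thesis using r0[of i] by (simp add: \<phi>_def)
  qed
  show "(LINT x|lborel. (\<phi> i x)\<^sup>2) \<le> \<kappa> * C0 / (t J - t (J - 1))"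
  proof (cases "i = i0 \<or> i = i1")
    case True
    then have rel: "?rel i0" "?rel i1" by auto
    have "(LINT x|lborel. (\<phi> i x)\<^sup>2) \<le> (LINT x|lborel. ((rst i0 x)\<^sup>2 + (rst i1 x)\<^sup>2) / 2)"
      using True half_sum_sq \<phi>_sq[OF iSI] rst_sq[OF i01(1)] rst_sq[OF i01(2)] by (intro integral_mono) (auto simp: \<phi>_def)
    also have "\<dots> = ((LINT x|lborel. (rst i0 x)\<^sup>2) + (LINT x|lborel. (rst i1 x)\<^sup>2)) / 2"
      using rst_sq[OF i01(1)] rst_sq[OF i01(2)] by simp
    also have "\<dots> \<le> \<kappa> * C0 / (t J - t (J - 1))"
      using add_mono[OF rn[OF rel(1)] rn[OF rel(2)]] by (simp only: divide_le_eq_numeral1 mult_2_right)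
    finally show ?thesis .
  next
    case False
    then show ?thesis using rn[of i] by (simp add: \<phi>_def)
  qed
qed

definition coef :: "(real \<Rightarrow> real) \<Rightarrow> int \<Rightarrow> real" where "coef u i = (LINT x|lborel. \<phi> i x * u x)"

lemma coef_bound:
  assumes J: "t (J - 1) < t J" and i: "i \<in> {J - int p..J}"
    and u: "u \<in> borel_measurable borel" "integrable lborel (\<lambda>x. (u x)\<^sup>2)"
  shows "(coef u i)\<^sup>2 \<le> \<kappa> * C0 / (t J - t (J - 1)) * nsq (PP (t (J - 1), t J)) u"
proof -
  let ?P = "PP (t (J - 1), t J)"
  have I: "(t (J - 1), t J) \<in> E" unfolding param_elements_iff using J by blast
  have iSI: "i \<in> SI" using cell_index_range(3)[OF J] i by blast
  note [measurable] = \<phi>_measurable[OF iSI] u(1) PP_meas[OF I]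
  have sq: "(indicator ?P x * u x)\<^sup>2 = indicator ?P x * (u x)\<^sup>2" for x by (simp add: indicator_def)
  have iu: "integrable lborel (\<lambda>x. (indicator ?P x * u x)\<^sup>2)"
    unfolding sq by (rule integrable_indicator_mult[OF u(2) PP_meas[OF I]])
  have "coef u i = (LINT x|lborel. \<phi> i x * (indicator ?P x * u x))"
    unfolding coef_def
  proof (rule integral_cong_AE)
    show "AE x in lborel. \<phi> i x * u x = \<phi> i x * (indicator ?P x * u x)"
      using \<phi>_local(1)[OF J i] by eventually_elim (auto simp: indicator_def)
  qed measurable
  then have "(coef u i)\<^sup>2 \<le> (LINT x|lborel. (\<phi> i x)\<^sup>2) * (LINT x|lborel. (indicator ?P x * u x)\<^sup>2)"
    using Cauchy_Schwarz_integral(2)[OF _ _ \<phi>_sq[OF iSI] iu] by simp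
  also have "(LINT x|lborel. (indicator ?P x * u x)\<^sup>2) = nsq ?P u" by (simp add: sq nsq_def)
  also have "(LINT x|lborel. (\<phi> i x)\<^sup>2) * nsq ?P u \<le> \<kappa> * C0 / (t J - t (J - 1)) * nsq ?P u"
    by (rule mult_right_mono[OF \<phi>_local(2)[OF J i] nsq_nonneg])
  finally show ?thesis .
qed

lemma coef_linear:
  assumes i: "i \<in> SI"
    and u: "u \<in> borel_measurable borel" "integrable lborel (\<lambda>x. (u x)\<^sup>2)"
    and v: "v \<in> borel_measurable borel" "integrable lborel (\<lambda>x. (v x)\<^sup>2)"
  shows "coef (\<lambda>x. k * u x + l * v x) i = k * coef u i + l * coef v i"
proof -
  note C = Cauchy_Schwarz_integral(1)[OF _ _ \<phi>_sq[OF i]]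
  have "integrable lborel (\<lambda>x. \<phi> i x * u x)" "integrable lborel (\<lambda>x. \<phi> i x * v x)"
    using u v \<phi>_measurable[OF i] by (auto intro!: C)
  then have "(LINT x|lborel. k * (\<phi> i x * u x) + l * (\<phi> i x * v x)) = k * coef u i + l * coef v i"
    by (simp add: coef_def)
  then show ?thesis by (simp add: coef_def algebra_simps)
qed

text \<open>Biorthogonality: the factors \<open>W\<close> and \<open>1 / W\<close> of the rational duals and the rational basis cancel.
  For the averaged functional at the ends the two coefficients have to agree.\<close>

lemma coef_spl:
  assumes c: "c i0 = c i1" and i: "i \<in> SI"
  shows "coef (\<lambda>x. indicator {a..<b} x * spl c x) i = c i"
proof -
  let ?u = "\<lambda>x. indicator {a..<b} x * spl c x"
  have b0B: "integrable lborel (\<lambda>x. b0 k x * B j x) \<and> (LINT x|lborel. b0 k x * B j x) = (if k = j then 1 else 0)"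
    if k: "k \<in> SI" and j: "j \<in> SI" for k j
  proof
    note [measurable] = b0_measurable[OF k] bst_meas[OF k]
    have "integrable lborel (\<lambda>x. b0 k x * (indicator {a..<b} x * B j x))"
    proof (rule Cauchy_Schwarz_integral(1)[OF _ _ b0_sq[OF k]])
      show "integrable lborel (\<lambda>x. (indicator {a..<b} x * B j x)\<^sup>2)"
      proof (rule integrable_bounded_on[of _ 1 a b])
        show "\<bar>(indicator {a..<b} x * B j x)\<^sup>2\<bar> \<le> 1" for x
        proof (cases "x \<in> {a..<b}")
          case True
          then obtain J where "t (J - 1) \<le> x" "x < t J" using cell_exists[of x] by auto
          then have "B j x \<le> 1" by (rule bspline_le_1[OF mono_t])
          then show ?thesis using B_nonneg[of j x] by (simp add: power_le_one abs_le_iff indicator_def)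
        qed simp
      qed auto
    qed measurable
    moreover have eq: "(\<lambda>x. b0 k x * (indicator {a..<b} x * B j x)) = (\<lambda>x. b0 k x * B j x)"
      by (auto simp: b0_def indicator_def fun_eq_iff)
    ultimately show "integrable lborel (\<lambda>x. b0 k x * B j x)" by simp
    have "(LINT x|lborel. indicator {a..b} x * (bst k x * B j x)) = (LINT x|lborel. indicator {a..<b} x * (indicator {a..b} x * (bst k x * B j x)))"
    proof (rule integral_endpoint(1))
      have "(\<lambda>x. indicator {a..<b} x * (indicator {a..b} x * (bst k x * B j x))) = (\<lambda>x. b0 k x * B j x)"
        by (auto simp: b0_def indicator_def fun_eq_iff)
      then show "(\<lambda>x. indicator {a..<b} x * (indicator {a..b} x * (bst k x * B j x))) \<in> borel_measurable borel"
        by (simp add: borel_measurable_times b0_measurable[OF k])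
    qed (simp add: indicator_def)
    also have "\<dots> = (LINT x|lborel. b0 k x * B j x)"
      by (rule Bochner_Integration.integral_cong) (auto simp: b0_def indicator_def)
    finally show "(LINT x|lborel. b0 k x * B j x) = (if k = j then 1 else 0)" using bst_dual[OF k j] by simp
  qed
  have rk: "integrable lborel (\<lambda>x. rst k x * ?u x) \<and> (LINT x|lborel. rst k x * ?u x) = c k" if k: "k \<in> SI" for k
  proof -
    have eq: "rst k x * ?u x = (\<Sum>j\<in>SI. c j * w j / w k * (b0 k x * B j x))" for x
    proof (cases "x \<in> {a..<b}")
      case True
      then show ?thesis using Wp_bounds(3)[OF True]
        by (simp add: rst_def spl_def R_def sum_distrib_left field_simps)
    qed (simp add: rst_def b0_def)
    have "(LINT x|lborel. rst k x * ?u x) = (\<Sum>j\<in>SI. c j * w j / w k * (if k = j then 1 else 0))"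
      unfolding eq using b0B[OF k] by (subst Bochner_Integration.integral_sum) auto
    also have "\<dots> = c k" using k finite_SI w_pos[OF k] by (simp add: if_distrib sum.delta cong: if_cong)
    finally show ?thesis unfolding eq using b0B[OF k] by auto
  qed
  show ?thesis
  proof (cases "i = i0 \<or> i = i1")
    case True
    then have "coef ?u i = (LINT x|lborel. (rst i0 x * ?u x + rst i1 x * ?u x) / 2)"
      unfolding coef_def by (intro Bochner_Integration.integral_cong) (auto simp: \<phi>_def field_simps)
    also have "\<dots> = (c i0 + c i1) / 2" using rk[OF i01(1)] rk[OF i01(2)] by simp
    finally show ?thesis using True c by auto
  next
    case False
    then show ?thesis using rk[OF i] by (simp add: coef_def \<phi>_def)
  qed
qed

lemma coef_ends: "coef u i0 = coef u i1"
  by (simp add: coef_def \<phi>_def)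

lemma coef_one: "i \<in> SI \<Longrightarrow> coef (indicator {a..<b}) i = 1"
proof -
  assume i: "i \<in> SI"
  have "(\<lambda>x. indicator {a..<b} x * spl (\<lambda>_. 1) x) = (indicator {a..<b} :: real \<Rightarrow> real)"
    using R_sum by (auto simp: spl_def indicator_def fun_eq_iff)
  then show ?thesis using coef_spl[of "\<lambda>_. 1", OF _ i] by simp
qed

text \<open>The functionals of the basis functions on a cell are supported in its patch and therefore cannot
  distinguish \<open>u\<close> from the spline with coefficients \<open>c\<close>.\<close>

lemma coef_local_projection:
  assumes J: "t (J - 1) < t J" and i: "i \<in> {J - int p..J}"
    and u: "u \<in> borel_measurable borel" and c: "c i0 = c i1"
    and ae: "AE x in lborel. x \<in> PP (t (J - 1), t J) \<longrightarrow> u x = spl c x"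
  shows "coef u i = c i"
proof -
  have iSI: "i \<in> SI" using cell_index_range(3)[OF J] i by blast
  note [measurable] = \<phi>_measurable[OF iSI] u
  have "coef u i = coef (\<lambda>x. indicator {a..<b} x * spl c x) i"
    unfolding coef_def
  proof (rule integral_cong_AE)
    show "AE x in lborel. \<phi> i x * u x = \<phi> i x * (indicator {a..<b} x * spl c x)"
      using \<phi>_local(1)[OF J i] ae
    proof eventually_elim
      case (elim x)
      then show ?case using \<phi>_out[of x i] by (cases "x \<in> PP (t (J - 1), t J)"; cases "x \<in> {a..<b}") auto
    qed
  qed measurable
  then show ?thesis using coef_spl[of c, OF c iSI] by simp
qed

definition CJ :: real where "CJ = (real p + 1)\<^sup>2 * (\<kappa> * C0)"

lemma CJ_nonneg: "0 \<le> CJ" unfolding CJ_def using \<kappa>1 C0_nonneg by simp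

lemma nsq_le_const:
  assumes I: "I \<in> E" and f: "\<And>x. x \<in> cell I \<Longrightarrow> (f x)\<^sup>2 \<le> k" and k: "0 \<le> k"
  shows "nsq (cell I) f \<le> k * param_width I"
proof -
  have "nsq (cell I) f \<le> (LINT x|lborel. indicator (cell I) x * k)"
    unfolding nsq_def
  proof (rule integral_mono')
    show "integrable lborel (\<lambda>x. indicator (cell I) x * k)"
      using k by (intro integrable_bounded_on[of _ k "fst I" "snd I"]) (auto simp: indicator_def)
  qed (use f k in \<open>auto simp: indicator_def\<close>)
  then show ?thesis unfolding integral_cell[OF I] .
qed

text \<open>The coefficients on a cell of width \<open>h\<close> are of size \<open>h powr (- 1 / 2) * \<parallel>u\<parallel>\<close>, the norm being taken over the
  patch, and the basis functions are bounded on the cell; integration over the cell restores the factor \<open>h\<close>.\<close>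

lemma local_L2:
  assumes I: "I \<in> E" and u: "u \<in> borel_measurable borel" "integrable lborel (\<lambda>x. (u x)\<^sup>2)"
  shows "nsq (cell I) (spl (coef u)) \<le> CJ * nsq (PP I) u"
    "nsq (cell I) (dspl (coef u)) \<le> CJ * Cd\<^sup>2 / (param_width I)\<^sup>2 * nsq (PP I) u"
proof -
  obtain J where J: "I = (t (J - 1), t J)" "t (J - 1) < t J" using I unfolding param_elements_iff by blast
  define h where "h = t J - t (J - 1)"
  have h: "0 < h" "param_width I = h" using J by (auto simp: h_def param_width_def)
  define n where "n = nsq (PP I) u"
  have n: "0 \<le> n" by (simp add: n_def nsq_nonneg)
  define A where "A = \<kappa> * C0 / h * n"
  have A0: "0 \<le> A" using \<kappa>1 C0_nonneg h n by (simp add: A_def)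
  have A: "(coef u i)\<^sup>2 \<le> A" if "i \<in> {J - int p..J}" for i
    using coef_bound[OF J(2) that u] by (simp add: A_def h_def n_def J(1))
  have "nsq (cell I) (spl (coef u)) \<le> (real p + 1)\<^sup>2 * A * param_width I"
  proof (rule nsq_le_const[OF I])
    show "(spl (coef u) x)\<^sup>2 \<le> (real p + 1)\<^sup>2 * A" if "x \<in> cell I" for x
      using that J(1) by (intro spl_local_bounds(1)[of J] A) auto
  qed (use A0 in simp)
  then show "nsq (cell I) (spl (coef u)) \<le> CJ * nsq (PP I) u"
    using h by (simp add: A_def CJ_def n_def[symmetric])
  have "nsq (cell I) (dspl (coef u)) \<le> (real p + 1)\<^sup>2 * A * (Cd / h)\<^sup>2 * param_width I"
  proof (rule nsq_le_const[OF I])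
    show "(dspl (coef u) x)\<^sup>2 \<le> (real p + 1)\<^sup>2 * A * (Cd / h)\<^sup>2" if "x \<in> cell I" for x
      unfolding h_def using that J(1) by (intro spl_local_bounds(2)[of J] A) auto
  qed (use A0 in simp)
  also have "\<dots> = CJ * Cd\<^sup>2 / h\<^sup>2 * n" using h by (simp add: A_def CJ_def power_divide)
  finally show "nsq (cell I) (dspl (coef u)) \<le> CJ * Cd\<^sup>2 / (param_width I)\<^sup>2 * nsq (PP I) u"
    by (simp add: h n_def)
qed

definition CP :: real where "CP = (real (p + 1) * Cpatch)\<^sup>2"
definition CH :: real where "CH = CJ * Cd\<^sup>2 * CP"
definition CA :: real where "CA = 2 * (1 + CJ) * CP"

lemma CP_nonneg: "0 \<le> CP" by (simp add: CP_def)
lemma CH_nonneg: "0 \<le> CH" using CJ_nonneg CP_nonneg by (simp add: CH_def)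
lemma CA_nonneg: "0 \<le> CA" using CJ_nonneg CP_nonneg by (simp add: CA_def)

text \<open>The operator reproduces constants, so \<open>v\<close> may be replaced by \<open>z = v - k\<close>, where the constant \<open>k\<close> is the
  value of \<open>u\<close> at a point of the element.  Poincare's inequality then trades \<open>z\<close> for \<open>h * u'\<close>.\<close>

lemma local_H1:
  assumes I: "I \<in> E" and u: "periodic_ac a b u u'"
    and v: "v \<in> borel_measurable borel" "AE x in lborel. v x = indicator {a..<b} x * u x"
  shows "nsq (cell I) (dspl (coef v)) \<le> CH * nsq (PP I) u'"
    "nsq (cell I) (\<lambda>x. v x - spl (coef v) x) \<le> CA * (param_width I)\<^sup>2 * nsq (PP I) u'"
proof -
  define h where "h = param_width I"
  have h: "0 < h" using width_pos[OF I] by (simp add: h_def)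
  define k where "k = u (fst I)"
  define z where "z x = v x - k * indicator {a..<b} x" for x
  note [measurable] = v(1) PP_meas[OF I]
  have [measurable]: "z \<in> borel_measurable borel" unfolding z_def by measurable
  obtain Bu where Bu: "\<And>t. t \<in> {a..b} \<Longrightarrow> \<bar>u t\<bar> \<le> Bu" using periodic_ac_bounded[OF u] by blast
  have um: "(\<lambda>t. indicator {a..b} t *\<^sub>R u t) \<in> borel_measurable borel"
    by (rule borel_measurable_continuous_on_indicator) (simp_all add: periodic_ac_continuous[OF u])
  have uiEq: "(indicator {a..<b} x * u x)\<^sup>2 = indicator {a..<b} x * (indicator {a..b} x *\<^sub>R u x)\<^sup>2" for x
    by (simp add: indicator_def)
  have ui: "integrable lborel (\<lambda>x. (indicator {a..<b} x * u x)\<^sup>2)"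
    unfolding uiEq
  proof (rule integrable_bounded_on[of _ "Bu\<^sup>2" a b])
    show "(\<lambda>t. indicator {a..<b} t * (indicator {a..b} t *\<^sub>R u t)\<^sup>2) \<in> borel_measurable borel" using um by measurable
    show "\<bar>indicator {a..<b} t * (indicator {a..b} t *\<^sub>R u t)\<^sup>2\<bar> \<le> Bu\<^sup>2" for t
      using Bu[of t] by (auto simp: indicator_def abs_le_square_iff[symmetric])
  qed simp
  have vsq: "integrable lborel (\<lambda>x. (v x)\<^sup>2)"
    by (rule integrable_cong_AE_imp[OF ui]) (use v(2) in \<open>auto elim!: eventually_mono\<close>)
  have isq: "integrable lborel (\<lambda>x. (indicator {a..<b} x :: real)\<^sup>2)"
    by (rule integrable_bounded_on[of _ 1 a b]) (auto simp: indicator_def)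
  have i: "integrable lborel (\<lambda>x. (z x)\<^sup>2)"
  proof -
    have "integrable lborel (\<lambda>x. 2 * (v x)\<^sup>2 + 2 * k\<^sup>2 * (indicator {a..<b} x :: real)\<^sup>2)"
      using vsq isq by (intro Bochner_Integration.integrable_add integrable_mult_right)
    then show ?thesis
    proof (rule integrable_dominated[of _ _ 1])
      show "\<bar>(z x)\<^sup>2\<bar> \<le> 1 * (2 * (v x)\<^sup>2 + 2 * k\<^sup>2 * (indicator {a..<b} x :: real)\<^sup>2)" for x
        using diff_sq_le[of "v x" "k * indicator {a..<b} x"]
        unfolding abs_power2 mult_1 z_def power_mult_distrib mult.assoc .
    qed measurable
  qed
  have coefz: "coef v i = coef z i + k" if "i \<in> SI" for i
    using coef_linear[OF that v(1) vsq _ isq, of 1 "- k"] coef_one[OF that]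
    by (simp add: z_def[abs_def])
  have dz: "dspl (coef v) = dspl (coef z)"
  proof
    fix x
    have "dspl (coef v) x = (\<Sum>i\<in>SI. coef z i * dR i x) + k * (\<Sum>i\<in>SI. dR i x)"
      unfolding dspl_def sum_distrib_left sum.distrib[symmetric] by (rule sum.cong) (auto simp: coefz algebra_simps)
    then show "dspl (coef v) x = dspl (coef z) x" by (simp add: dR_sum dspl_def)
  qed
  have sz: "spl (coef v) x = spl (coef z) x + k" if "x \<in> {a..<b}" for x
  proof -
    have "spl (coef v) x = (\<Sum>i\<in>SI. coef z i * R i x) + k * (\<Sum>i\<in>SI. R i x)"
      unfolding spl_def sum_distrib_left sum.distrib[symmetric] by (rule sum.cong) (auto simp: coefz algebra_simps)
    then show ?thesis by (simp add: R_sum[OF that] spl_def)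
  qed
  have PPab: "PP I \<subseteq> {a..<b}" by (auto simp: PP_def PS_def)
  have "nsq (PP I) z = nsq (PP I) (\<lambda>t. u t - u (fst I))"
    unfolding nsq_def
  proof (rule integral_cong_AE)
    show "AE x in lborel. indicator (PP I) x * (z x)\<^sup>2 = indicator (PP I) x * (u x - u (fst I))\<^sup>2"
      using v(2) by eventually_elim (use PPab in \<open>auto simp: z_def k_def indicator_def\<close>)
    have "(\<lambda>x. indicator (PP I) x * (u x - u (fst I))\<^sup>2) = (\<lambda>x. indicator (PP I) x * (indicator {a..b} x *\<^sub>R u x - u (fst I))\<^sup>2)"
      using PPab by (auto simp: indicator_def fun_eq_iff)
    then show "(\<lambda>x. indicator (PP I) x * (u x - u (fst I))\<^sup>2) \<in> borel_measurable lborel" using um by simp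
  qed measurable
  also have "\<dots> \<le> (real (p + 1) * (Cpatch * param_width I))\<^sup>2 * nsq (PP I) u'"
    by (rule patch_Poincare[OF u I])
  also have "\<dots> = CP * h\<^sup>2 * nsq (PP I) u'" by (simp add: CP_def h_def power_mult_distrib)
  finally have poin: "nsq (PP I) z \<le> CP * h\<^sup>2 * nsq (PP I) u'" .
  note loc = local_L2[OF I _ i]
  have "nsq (cell I) (dspl (coef v)) \<le> CJ * Cd\<^sup>2 / h\<^sup>2 * nsq (PP I) z" unfolding dz h_def by (rule loc) measurable
  also have "\<dots> \<le> CJ * Cd\<^sup>2 / h\<^sup>2 * (CP * h\<^sup>2 * nsq (PP I) u')"
    using CJ_nonneg by (intro mult_left_mono poin) simp
  also have "\<dots> = CH * nsq (PP I) u'" using h by (simp add: CH_def)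
  finally show "nsq (cell I) (dspl (coef v)) \<le> CH * nsq (PP I) u'" .
  have cab: "cell I \<subseteq> {a..<b}" using E_bounds[OF I] by auto
  have sm: "integrable lborel (\<lambda>x. indicator (cell I) x * (spl (coef z) x)\<^sup>2)"
  proof -
    obtain J where J: "I = (t (J - 1), t J)" "t (J - 1) < t J" using I unfolding param_elements_iff by blast
    define A where "A = Max ((\<lambda>i. (coef z i)\<^sup>2) ` SI)"
    have A: "(coef z i)\<^sup>2 \<le> A" if "i \<in> {J - int p..J}" for i
      unfolding A_def using finite_SI that cell_index_range(3)[OF J(2)] by (intro Max_ge) auto
    have b: "(spl (coef z) x)\<^sup>2 \<le> (real p + 1)\<^sup>2 * A" if "x \<in> cell I" for x
      using that J(1) by (intro spl_local_bounds(1)[of J] A) auto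
    have "(coef z J)\<^sup>2 \<le> A" by (rule A) simp
    then have "0 \<le> A" by (rule order_trans[OF zero_le_power2])
    then have A0: "0 \<le> (real p + 1)\<^sup>2 * A" by simp
    show ?thesis
    proof (rule integrable_bounded_on[of _ "(real p + 1)\<^sup>2 * A" "fst I" "snd I"])
      show "(\<lambda>x. indicator (cell I) x * (spl (coef z) x)\<^sup>2) \<in> borel_measurable borel" by measurable
      show "\<bar>indicator (cell I) x * (spl (coef z) x)\<^sup>2\<bar> \<le> (real p + 1)\<^sup>2 * A" for x
        using b[of x] A0 by (cases "x \<in> cell I") simp_all
      show "indicator (cell I) x * (spl (coef z) x)\<^sup>2 = 0" if "x \<notin> cell I" for x using that by simp
    qed
  qed
  have iz: "integrable lborel (\<lambda>x. indicator (cell I) x * (z x)\<^sup>2)" by (rule integrable_indicator_mult[OF i]) simp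
  have "nsq (cell I) (\<lambda>x. v x - spl (coef v) x) \<le> (LINT x|lborel. 2 * (indicator (cell I) x * (z x)\<^sup>2) + 2 * (indicator (cell I) x * (spl (coef z) x)\<^sup>2))"
    unfolding nsq_def
  proof (rule integral_mono')
    show "integrable lborel (\<lambda>x. 2 * (indicator (cell I) x * (z x)\<^sup>2) + 2 * (indicator (cell I) x * (spl (coef z) x)\<^sup>2))"
      using sm iz by simp
    fix x
    show "indicator (cell I) x * (v x - spl (coef v) x)\<^sup>2 \<le> 2 * (indicator (cell I) x * (z x)\<^sup>2) + 2 * (indicator (cell I) x * (spl (coef z) x)\<^sup>2)"
    proof (cases "x \<in> cell I")
      case True
      then have x: "x \<in> {a..<b}" using cab by blast
      have "v x - spl (coef v) x = z x - spl (coef z) x" using sz[OF x] x by (simp add: z_def)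
      moreover have "(z x - spl (coef z) x)\<^sup>2 \<le> 2 * (z x)\<^sup>2 + 2 * (spl (coef z) x)\<^sup>2"
        by (rule diff_sq_le)
      ultimately show ?thesis using True by simp
    qed simp
  qed simp
  also have "\<dots> = 2 * nsq (cell I) z + 2 * nsq (cell I) (spl (coef z))"
    using sm iz by (simp add: nsq_def)
  also have "\<dots> \<le> 2 * nsq (PP I) z + 2 * (CJ * nsq (PP I) z)"
  proof -
    have "cell I \<subseteq> PP I"
    proof -
      have "PS (elem \<gamma> I) \<subseteq> PP I" unfolding PP_def PS_def using patch_mono[OF I, of 0 p] by auto
      then show ?thesis using cell_sub_PS[OF I] by blast
    qed
    then have "AE x in lborel. x \<in> cell I \<longrightarrow> x \<in> PP I" by (intro AE_I2 impI) (rule subsetD)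
    then have "nsq (cell I) z \<le> nsq (PP I) z" by (rule nsq_mono[OF i _ PP_meas[OF I], rotated]) simp
    moreover have "nsq (cell I) (spl (coef z)) \<le> CJ * nsq (PP I) z" by (rule loc) measurable
    ultimately show ?thesis by linarith
  qed
  also have "\<dots> = 2 * (1 + CJ) * nsq (PP I) z" by (simp add: algebra_simps)
  also have "\<dots> \<le> 2 * (1 + CJ) * (CP * h\<^sup>2 * nsq (PP I) u')"
    using CJ_nonneg by (intro mult_left_mono poin) simp
  also have "\<dots> = CA * (param_width I)\<^sup>2 * nsq (PP I) u'" by (simp add: CA_def h_def)
  finally show "nsq (cell I) (\<lambda>x. v x - spl (coef v) x) \<le> CA * (param_width I)\<^sup>2 * nsq (PP I) u'" .
qed

end

section \<open>Stability and approximation on the boundary\<close>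

lemma nsq_add_le:
  assumes "integrable lborel (\<lambda>x. indicator A x * (f x)\<^sup>2)" "integrable lborel (\<lambda>x. indicator A x * (g x)\<^sup>2)"
    and le: "\<And>x. x \<in> A \<Longrightarrow> (h x)\<^sup>2 \<le> \<alpha> * (f x)\<^sup>2 + \<beta> * (g x)\<^sup>2" and nn: "0 \<le> \<alpha>" "0 \<le> \<beta>"
  shows "nsq A h \<le> \<alpha> * nsq A f + \<beta> * nsq A g"
proof -
  have "nsq A h \<le> (LINT x|lborel. \<alpha> * (indicator A x * (f x)\<^sup>2) + \<beta> * (indicator A x * (g x)\<^sup>2))"
    unfolding nsq_def
  proof (rule integral_mono')
    show "indicator A x * (h x)\<^sup>2 \<le> \<alpha> * (indicator A x * (f x)\<^sup>2) + \<beta> * (indicator A x * (g x)\<^sup>2)" for x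
      using le[of x] by (cases "x \<in> A") simp_all
  qed (use assms(1,2) nn in simp_all)
  then show ?thesis using assms(1,2) by (simp add: nsq_def)
qed

lemma nsq_mult_le:
  assumes "integrable lborel (\<lambda>x. indicator A x * (g x)\<^sup>2)"
    and le: "AE x in lborel. x \<in> A \<longrightarrow> (h x)\<^sup>2 \<le> M * (g x)\<^sup>2" and M: "0 \<le> M"
  shows "nsq A h \<le> M * nsq A g"
proof (cases "integrable lborel (\<lambda>x. indicator A x * (h x)\<^sup>2)")
  case True
  have "nsq A h \<le> (LINT x|lborel. M * (indicator A x * (g x)\<^sup>2))"
    unfolding nsq_def
  proof (rule integral_mono_AE[OF True])
    show "AE x in lborel. indicator A x * (h x)\<^sup>2 \<le> M * (indicator A x * (g x)\<^sup>2)"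
      using le by eventually_elim (auto simp: indicator_def)
  qed (use assms in simp)
  then show ?thesis by (simp add: nsq_def)
next
  case False
  then have "nsq A h = 0" unfolding nsq_def by (rule not_integrable_integral_eq)
  then show ?thesis using M nsq_nonneg[of A g] by simp
qed

lemma add_sq_le: "(x + y)\<^sup>2 \<le> 2 * x\<^sup>2 + 2 * (y::real)\<^sup>2"
  using sum_squares_bound[of x y] by (simp add: power2_sum)

context sz
begin

lemma \<Gamma>_meas: "\<Gamma> \<in> sets \<mu>" using sets.top[of \<mu>] by (simp add: space_\<mu>)

lemma PS_\<Gamma>: "PS \<Gamma> = {a..<b}" using in_\<Gamma> by (auto simp: PS_def)

lemma nsq_total:
  assumes "integrable lborel (\<lambda>t. (f t)\<^sup>2)"
  shows "nsq {a..<b} f = (\<Sum>I\<in>E. nsq (cell I) f)"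
proof -
  have "nsq {a..<b} f = (LINT t|lborel. (\<Sum>I\<in>E. indicator (cell I) t * (f t)\<^sup>2))"
    unfolding nsq_def sum_distrib_right[symmetric] sum_indicator_E ..
  also have "\<dots> = (\<Sum>I\<in>E. nsq (cell I) f)"
    unfolding nsq_def by (intro Bochner_Integration.integral_sum integrable_indicator_mult assms) simp
  finally show ?thesis .
qed

definition CO :: real where "CO = 5 ^ p * \<kappa> ^ (2 * p)"

lemma CO_ge1: "1 \<le> CO"
  unfolding CO_def using \<kappa>1 mult_mono[of 1 "5 ^ p :: real" 1 "\<kappa> ^ (2 * p)"] by (simp add: one_le_power)

text \<open>A weighted form of the finite overlap of the patches: a power of the width may be moved from the centre of a
  patch to any of its elements at the cost of a constant, which is uniform for exponents up to two.\<close>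

lemma overlap_powr:
  assumes F: "integrable lborel (\<lambda>t. (f t)\<^sup>2)" and \<alpha>: "0 \<le> \<alpha>" "\<alpha> \<le> 2"
  shows "(\<Sum>I\<in>E. param_width I powr \<alpha> * nsq (PP I) f) \<le> CO * (\<Sum>I\<in>E. param_width I powr \<alpha> * nsq (cell I) f)"
  unfolding CO_def nsq_def
proof (rule patch_overlap[OF F])
  fix I J assume IJ: "I \<in> E" "J \<in> E" "I \<in> nb p J"
  have k: "1 \<le> \<kappa> ^ p" using \<kappa>1 by (simp add: one_le_power)
  have "param_width I powr \<alpha> \<le> (\<kappa> ^ p * param_width J) powr \<alpha>"
    using nb_width[OF IJ(3,2)] width_pos[OF IJ(1)] \<alpha> by (intro powr_mono2) auto
  also have "\<dots> = (\<kappa> ^ p) powr \<alpha> * param_width J powr \<alpha>"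
    using k width_pos[OF IJ(2)] by (intro powr_mult)
  also have "\<dots> \<le> (\<kappa> ^ p) powr 2 * param_width J powr \<alpha>"
    using k \<alpha> by (intro mult_right_mono powr_mono) auto
  also have "(\<kappa> ^ p) powr 2 = \<kappa> ^ (2 * p)"
    using k by (simp add: powr_numeral power_mult[symmetric] mult.commute)
  finally show "param_width I powr \<alpha> \<le> \<kappa> ^ (2 * p) * param_width J powr \<alpha>" .
qed auto

lemma overlap_0:
  assumes F: "integrable lborel (\<lambda>t. (f t)\<^sup>2)"
  shows "(\<Sum>I\<in>E. nsq (PP I) f) \<le> CO * nsq {a..<b} f"
proof -
  have "param_width I powr 0 = 1" if "I \<in> E" for I using width_pos[OF that] by simp
  then show ?thesis using overlap_powr[OF F, of 0] by (simp add: nsq_total[OF F])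
qed

lemma elem_length_bounds:
  assumes I: "I \<in> E"
  shows "smin * param_width I \<le> elem_length \<gamma> a b I" "elem_length \<gamma> a b I \<le> smax * param_width I"
proof -
  have m: "(\<lambda>x. indicator (elem \<gamma> I) x :: real) \<in> borel_measurable \<mu>" using elem_meas[OF I] by measurable
  have "elem \<gamma> I \<inter> space \<mu> = elem \<gamma> I" using elem_sub[OF I] by (auto simp: space_\<mu>)
  then have "elem_length \<gamma> a b I = (LINT x|\<mu>. indicator (elem \<gamma> I) x)"
    by (simp add: elem_length_def)
  also have "\<dots> = (LINT t|lborel. \<rho> t * pull (\<lambda>x. indicator (elem \<gamma> I) x) t)" by (rule integral_\<mu>(1)[OF m])
  also have "\<dots> = (LINT t|lborel. indicator (cell I) t * \<rho> t)"
  proof (rule integral_cong_AE)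
    show "AE t in lborel. \<rho> t * pull (\<lambda>x. indicator (elem \<gamma> I) x) t = indicator (cell I) t * \<rho> t"
      using AE_PS_elem[OF I]
    proof eventually_elim
      case (elim t)
      then show ?case using cell_sub_PS[OF I] by (auto simp: pull_def PS_def indicator_def)
    qed
    show "(\<lambda>t. \<rho> t * pull (\<lambda>x. indicator (elem \<gamma> I) x) t) \<in> borel_measurable lborel"
      using pull_measurable[OF m] by measurable
  qed measurable
  finally have eq: "elem_length \<gamma> a b I = (LINT t|lborel. indicator (cell I) t * \<rho> t)" .
  have cab: "cell I \<subseteq> {a..<b}" using E_bounds[OF I] by auto
  have i: "integrable lborel (\<lambda>t. indicator (cell I) t * k)" for k :: real
    by (rule integrable_bounded_on[of _ "\<bar>k\<bar>" "fst I" "snd I"]) (auto simp: indicator_def)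
  have i2: "integrable lborel (\<lambda>t. indicator (cell I) t * \<rho> t)"
  proof (rule integrable_bounded_on[of _ smax "fst I" "snd I"])
    show "\<bar>indicator (cell I) t * \<rho> t\<bar> \<le> smax" for t
      using \<rho>_bounds(1,2)[of t] smax_pos by (auto simp: indicator_def)
  qed auto
  have "(LINT t|lborel. indicator (cell I) t * smin) \<le> (LINT t|lborel. indicator (cell I) t * \<rho> t)"
    using i i2 \<rho>_bounds(3) cab by (intro integral_mono) (auto simp: indicator_def)
  then show "smin * param_width I \<le> elem_length \<gamma> a b I" unfolding eq integral_cell[OF I] .
  have "(LINT t|lborel. indicator (cell I) t * \<rho> t) \<le> (LINT t|lborel. indicator (cell I) t * smax)"
    using i i2 \<rho>_bounds(2) by (intro integral_mono) (auto simp: indicator_def)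
  then show "elem_length \<gamma> a b I \<le> smax * param_width I" unfolding eq integral_cell[OF I] .
qed

lemma mesh_width_cell:
  fixes t :: real
  assumes I: "I \<in> E" and t: "t \<in> cell I"
  shows "mesh_width \<gamma> a b K (\<gamma> t) = elem_length \<gamma> a b I"
proof -
  have tab: "t \<in> {a..<b}" using t E_bounds[OF I] by auto
  have "indicator (\<gamma> ` cell J) (\<gamma> t) = (indicator (cell J) t :: real)" if J: "J \<in> E" for J
  proof -
    have "t \<in> cell J" if im: "\<gamma> t \<in> \<gamma> ` cell J"
    proof -
      obtain s where s: "s \<in> cell J" "\<gamma> t = \<gamma> s" using im by blast
      then have "s \<in> {a..<b}" using E_bounds[OF J] by auto
      then have "t = s" by (rule inj_onD[OF inj s(2) tab])
      then show ?thesis using s(1) by (simp only:)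
    qed
    then have "\<gamma> t \<in> \<gamma> ` cell J \<longleftrightarrow> t \<in> cell J" by blast
    then show ?thesis by (simp add: indicator_def)
  qed
  then have "mesh_width \<gamma> a b K (\<gamma> t) = (\<Sum>J\<in>E. elem_length \<gamma> a b J * indicator (cell J) t)"
    unfolding mesh_width_def by (intro sum.cong) auto
  also have "\<dots> = (\<Sum>J\<in>{I}. elem_length \<gamma> a b J * indicator (cell J) t)"
  proof (rule sum.mono_neutral_right[OF finite_E])
    show "\<forall>J\<in>E - {I}. elem_length \<gamma> a b J * indicator (cell J) t = 0"
    proof
      fix J assume J: "J \<in> E - {I}"
      have "t \<notin> cell J"
      proof
        assume tJ: "t \<in> cell J"
        have "indicator (cell I) t + indicator (cell J) t \<le> (\<Sum>J\<in>E. indicator (cell J) t :: real)"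
          using sum_mono2[OF finite_E, of "{I, J}" "\<lambda>J. indicator (cell J) t :: real"] I J by auto
        then show False using t tJ tab by (simp add: sum_indicator_E)
      qed
      then show "elem_length \<gamma> a b J * indicator (cell J) t = 0" by simp
    qed
  qed (use I in auto)
  also have "\<dots> = elem_length \<gamma> a b I * indicator (cell I) t" by (subst sum.insert) simp_all
  finally show ?thesis by (simp only: indicator_simps(1)[OF t] mult_1_right)
qed

lemma mesh_width_measurable: "mesh_width \<gamma> a b K \<in> borel_measurable \<mu>"
proof -
  have eq: "mesh_width \<gamma> a b K x = (\<Sum>I\<in>E. elem_length \<gamma> a b I * indicator (cell I) (\<tau> x))" if x: "x \<in> \<Gamma>" for x
  proof -
    have tab: "\<tau> x \<in> {a..<b}" by (rule \<gamma>_\<tau>(2)[OF x])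
    have "(x \<in> \<gamma> ` cell I) = (\<tau> x \<in> cell I)" if I: "I \<in> E" for I
    proof
      assume "x \<in> \<gamma> ` cell I"
      then obtain s where s: "s \<in> cell I" "x = \<gamma> s" by blast
      then show "\<tau> x \<in> cell I" using \<tau>_\<gamma>[of s] E_bounds[OF I] by auto
    next
      assume "\<tau> x \<in> cell I"
      then show "x \<in> \<gamma> ` cell I" using \<gamma>_\<tau>(1)[OF x] by (metis imageI)
    qed
    then show ?thesis unfolding mesh_width_def by (intro sum.cong refl) (simp add: indicator_def)
  qed
  have "(\<lambda>x. \<Sum>I\<in>E. elem_length \<gamma> a b I * indicator (cell I) (\<tau> x)) \<in> borel_measurable \<mu>"
    by (rule push_measurable) measurable
  then show ?thesis using eq by (subst measurable_cong[of _ _ "\<lambda>x. \<Sum>I\<in>E. elem_length \<gamma> a b I * indicator (cell I) (\<tau> x)"]) (auto simp: space_\<mu>)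
qed

text \<open>The mesh width function is constant on the half-open cells, so a weight in it splits the squared norm into a
  weighted sum over the elements.\<close>

lemma weighted_norm:
  assumes f: "f \<in> L2_space \<gamma> a b"
  shows "(\<lambda>x. mesh_width \<gamma> a b K x powr s * f x) \<in> L2_space \<gamma> a b"
    and "nsq {a..<b} (pull (\<lambda>x. mesh_width \<gamma> a b K x powr s * f x))
        = (\<Sum>I\<in>E. (elem_length \<gamma> a b I powr s)\<^sup>2 * nsq (cell I) (pull f))"
proof -
  let ?g = "\<lambda>x. mesh_width \<gamma> a b K x powr s * f x"
  note F = L2_D[OF f]
  have gm: "?g \<in> borel_measurable \<mu>" using mesh_width_measurable F(1) by measurable
  have loc: "pull ?g t = elem_length \<gamma> a b I powr s * pull f t" if "I \<in> E" "t \<in> cell I" for I t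
    using mesh_width_cell[OF that] by (simp add: pull_def)
  have "(pull ?g t)\<^sup>2 = (\<Sum>I\<in>E. indicator (cell I) t) * (pull ?g t)\<^sup>2" for t
    unfolding sum_indicator_E by (cases "t \<in> {a..<b}") (simp_all add: pull_def)
  then have sq: "(pull ?g t)\<^sup>2 = (\<Sum>I\<in>E. (elem_length \<gamma> a b I powr s)\<^sup>2 * (indicator (cell I) t * (pull f t)\<^sup>2))" for t
    unfolding sum_distrib_right
  proof (rule trans, intro sum.cong refl)
    fix I assume I: "I \<in> E"
    show "indicator (cell I) t * (pull ?g t)\<^sup>2 = (elem_length \<gamma> a b I powr s)\<^sup>2 * (indicator (cell I) t * (pull f t)\<^sup>2)"
      using loc[OF I] by (cases "t \<in> cell I") (simp_all add: power_mult_distrib)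
  qed
  have ii: "integrable lborel (\<lambda>t. (elem_length \<gamma> a b I powr s)\<^sup>2 * (indicator (cell I) t * (pull f t)\<^sup>2))" for I
    using integrable_indicator_mult[OF F(3), of "cell I"] by simp
  have int: "integrable lborel (\<lambda>t. (pull ?g t)\<^sup>2)" unfolding sq by (intro Bochner_Integration.integrable_sum ii)
  then show "?g \<in> L2_space \<gamma> a b" using gm by (simp add: L2_iff)
  have "nsq {a..<b} (pull ?g) = (LINT t|lborel. (pull ?g t)\<^sup>2)"
    unfolding nsq_def by (intro Bochner_Integration.integral_cong) (auto simp: pull_def indicator_def)
  also have "\<dots> = (\<Sum>I\<in>E. (elem_length \<gamma> a b I powr s)\<^sup>2 * nsq (cell I) (pull f))"
    unfolding sq nsq_def using ii by (subst Bochner_Integration.integral_sum) auto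
  finally show "nsq {a..<b} (pull ?g) = (\<Sum>I\<in>E. (elem_length \<gamma> a b I powr s)\<^sup>2 * nsq (cell I) (pull f))" .
qed

end

text \<open>The operator enters only through its values on \<open>\<Gamma>\<close>, as a spline whose coefficients are the functionals
  above.\<close>

locale sz_op = sz \<gamma> a b \<Gamma> smin smax p K \<kappa> w W bst wmin wmax
  for \<gamma> a b \<Gamma> smin smax p K \<kappa> w W bst wmin wmax +
  fixes Jop :: "(real^2 \<Rightarrow> real) \<Rightarrow> real^2 \<Rightarrow> real"
  assumes Jop_eq: "\<And>v x. x \<in> \<Gamma> \<Longrightarrow> Jop v x = spl (coef (pull v)) (\<tau> x)"
begin

lemma Jop_measurable: "Jop v \<in> borel_measurable \<mu>"
proof -
  have "(\<lambda>x. spl (coef (pull v)) (\<tau> x)) \<in> borel_measurable \<mu>" by (rule push_measurable) measurable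
  then show ?thesis using Jop_eq by (subst measurable_cong[of _ _ "\<lambda>x. spl (coef (pull v)) (\<tau> x)"]) (auto simp: space_\<mu>)
qed

lemma Jop_\<gamma>: "x \<in> {a..<b} \<Longrightarrow> Jop v (\<gamma> x) = spl (coef (pull v)) x"
  using Jop_eq[of "\<gamma> x" v] in_\<Gamma>[of x] \<tau>_\<gamma>[of x] by simp

lemma Jop_H1:
  "Jop v \<in> H1_space \<gamma> a b" "AE t in lborel. dspl (coef (pull v)) t = \<rho> t * pull (arclength_derivative \<gamma> a b (Jop v)) t"
  using H1_I[OF Jop_measurable spl_periodic_ac[of "coef (pull v)", OF coef_ends], of v] Jop_\<gamma> by auto

lemma Jop_L2: "Jop v \<in> L2_space \<gamma> a b" by (rule H1_D(1)[OF Jop_H1(1)])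

lemma pull_Jop: "x \<in> {a..<b} \<Longrightarrow> pull (Jop v) x = spl (coef (pull v)) x"
  by (simp add: pull_def Jop_\<gamma>)

lemma cell_ab: "I \<in> E \<Longrightarrow> cell I \<subseteq> {a..<b}" using E_bounds[of I] by auto

lemma nsq_Jop_cell: "I \<in> E \<Longrightarrow> nsq (cell I) (pull (Jop v)) = nsq (cell I) (spl (coef (pull v)))"
  using cell_ab[of I] pull_Jop unfolding nsq_def
  by (intro Bochner_Integration.integral_cong) (auto simp: indicator_def)

definition CL2 :: real where "CL2 = smax * CJ / smin"

lemma L2_stable:
  assumes v: "v \<in> L2_space \<gamma> a b" and I: "I \<in> E"
  shows "(L2_norm \<gamma> a b (elem \<gamma> I) (Jop v))\<^sup>2 \<le> CL2 * (L2_norm \<gamma> a b (patch \<gamma> a K p (elem \<gamma> I)) v)\<^sup>2"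
proof -
  note V = L2_D[OF v]
  have "(L2_norm \<gamma> a b (elem \<gamma> I) (Jop v))\<^sup>2 \<le> smax * nsq (PS (elem \<gamma> I)) (pull (Jop v))"
    by (rule L2_norm_bounds(2)[OF elem_meas[OF I] Jop_L2])
  also have "nsq (PS (elem \<gamma> I)) (pull (Jop v)) = nsq (cell I) (spl (coef (pull v)))"
    using cell_norm_eq[OF I L2_D(3)[OF Jop_L2]] nsq_Jop_cell[OF I] by simp
  also have "smax * \<dots> \<le> smax * (CJ * nsq (PP I) (pull v))"
    using smax_pos by (intro mult_left_mono local_L2(1)[OF I V(2,3)]) simp
  also have "\<dots> = CL2 * (smin * nsq (PP I) (pull v))" using smin_pos by (simp add: CL2_def)
  also have "\<dots> \<le> CL2 * (L2_norm \<gamma> a b (patch \<gamma> a K p (elem \<gamma> I)) v)\<^sup>2"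
    using L2_norm_bounds(1)[OF patch_meas[OF I] v, of p] smin_pos smax_pos CJ_nonneg
    by (intro mult_left_mono) (auto simp: PP_def CL2_def)
  finally show ?thesis .
qed

definition CH1 :: real where "CH1 = smax * CH / smin"

lemma H1_rep:
  assumes v: "v \<in> H1_space \<gamma> a b"
  obtains u u' where "periodic_ac a b u u'" "u' = (\<lambda>t. \<rho> t * pull (arclength_derivative \<gamma> a b v) t)"
    "AE t in lborel. t \<in> {a..<b} \<longrightarrow> v (\<gamma> t) = u t" "AE t in lborel. pull v t = indicator {a..<b} t * u t"
proof -
  obtain u where u: "periodic_ac a b u (\<lambda>t. \<rho> t * pull (arclength_derivative \<gamma> a b v) t)"
    "AE t in lborel. t \<in> {a..<b} \<longrightarrow> v (\<gamma> t) = u t" using H1_D(3)[OF v] by blast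
  have "AE t in lborel. pull v t = indicator {a..<b} t * u t"
    using u(2) by eventually_elim (auto simp: pull_def indicator_def)
  then show ?thesis using that u by blast
qed

lemma H1_stable:
  assumes v: "v \<in> H1_space \<gamma> a b" and I: "I \<in> E"
  shows "(H1_seminorm \<gamma> a b (elem \<gamma> I) (Jop v))\<^sup>2 \<le> CH1 * (H1_seminorm \<gamma> a b (patch \<gamma> a K p (elem \<gamma> I)) v)\<^sup>2"
proof -
  obtain u u' where u: "periodic_ac a b u u'" and u': "u' = (\<lambda>t. \<rho> t * pull (arclength_derivative \<gamma> a b v) t)"
    and vu: "AE t in lborel. pull v t = indicator {a..<b} t * u t" using H1_rep[OF v] by metis
  note V = L2_D[OF H1_D(1)[OF v]] and U = periodic_acD[OF u]
  note D = derivative_norm_bounds[OF elem_meas[OF I] H1_D(2)[OF Jop_H1(1)] Jop_H1(2) dspl_measurable]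
  have ae: "AE t in lborel. u' t = \<rho> t * pull (arclength_derivative \<gamma> a b v) t" by (simp add: u')
  have "smin * (H1_seminorm \<gamma> a b (elem \<gamma> I) (Jop v))\<^sup>2 \<le> nsq (PS (elem \<gamma> I)) (dspl (coef (pull v)))"
    unfolding H1_seminorm_def by (rule D(1))
  also have "\<dots> = nsq (cell I) (dspl (coef (pull v)))" by (rule cell_norm_eq[OF I D(3)])
  also have "\<dots> \<le> CH * nsq (PP I) u'" by (rule local_H1(1)[OF I u V(2) vu])
  also have "\<dots> \<le> CH * (smax * (H1_seminorm \<gamma> a b (patch \<gamma> a K p (elem \<gamma> I)) v)\<^sup>2)"
    unfolding PP_def H1_seminorm_def
    by (intro mult_left_mono derivative_norm_bounds(2)[OF patch_meas[OF I] H1_D(2)[OF v] ae U(1)] CH_nonneg)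
  finally show ?thesis using smin_pos by (simp add: CH1_def field_simps)
qed

text \<open>Only the coefficients that are active on the element matter there, and these are reproduced by
  \<open>coef_local_projection\<close>.\<close>

lemma projection:
  assumes v: "v \<in> L2_space \<gamma> a b" and I: "I \<in> E" and c: "c i0 = c i1"
    and ae: "AE x in \<mu>. x \<in> patch \<gamma> a K p (elem \<gamma> I) \<longrightarrow> v x = spl c (\<tau> x)"
  shows "AE x in \<mu>. x \<in> elem \<gamma> I \<longrightarrow> Jop v x = v x"
proof (rule AE_\<mu>I)
  have [measurable]: "Jop v \<in> borel_measurable \<mu>" "v \<in> borel_measurable \<mu>" "elem \<gamma> I \<in> sets \<mu>"
    using Jop_measurable L2_D(1)[OF v] elem_meas[OF I] by auto
  have "{x \<in> space \<mu>. x \<in> elem \<gamma> I \<longrightarrow> Jop v x = v x} \<in> sets \<mu>" by measurable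
  then show "{x \<in> \<Gamma>. x \<in> elem \<gamma> I \<longrightarrow> Jop v x = v x} \<in> sets \<mu>" by (simp add: space_\<mu>)
  obtain J where J: "I = (t (J - 1), t J)" "t (J - 1) < t J" using I unfolding param_elements_iff by blast
  have pv: "AE s in lborel. s \<in> PP I \<longrightarrow> pull v s = spl c s"
    using AE_\<mu>D[OF ae] by eventually_elim (auto simp: PP_def PS_def pull_def \<tau>_\<gamma>)
  have co: "coef (pull v) i = c i" if "i \<in> {J - int p..J}" for i
    using coef_local_projection[OF J(2) that L2_D(2)[OF v] c] pv by (simp add: J(1))
  show "AE s in lborel. s \<in> {a..<b} \<longrightarrow> \<gamma> s \<in> elem \<gamma> I \<longrightarrow> Jop v (\<gamma> s) = v (\<gamma> s)"
    using pv AE_PS_elem[OF I]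
  proof eventually_elim
    case (elim s)
    show ?case
    proof (intro impI)
      assume s: "s \<in> {a..<b}" "\<gamma> s \<in> elem \<gamma> I"
      then have sc: "s \<in> cell I" using elim by (auto simp: PS_def)
      then have s': "t (J - 1) \<le> s" "s < t J" by (auto simp: J(1))
      have "\<gamma> s \<in> patch \<gamma> a K p (elem \<gamma> I)" using patch_mono[OF I, of 0 p] s by auto
      then have "s \<in> PP I" using s by (auto simp: PP_def PS_def)
      then have "v (\<gamma> s) = spl c s" using elim s by (simp add: pull_def)
      also have "\<dots> = spl (coef (pull v)) s"
        unfolding spl_cell(1)[OF s'] by (rule sum.cong[OF refl]) (use co in simp)
      finally show "Jop v (\<gamma> s) = v (\<gamma> s)" using Jop_\<gamma>[OF s(1)] by simp
    qed
  qed
qed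

definition err :: "(real^2 \<Rightarrow> real) \<Rightarrow> real^2 \<Rightarrow> real" where "err v x = v x - Jop v x"

lemma pull_err: "x \<in> {a..<b} \<Longrightarrow> pull (err v) x = pull v x - spl (coef (pull v)) x"
  by (simp add: pull_def err_def Jop_\<gamma>)

lemma err_L2: "v \<in> L2_space \<gamma> a b \<Longrightarrow> err v \<in> L2_space \<gamma> a b"
proof -
  assume v: "v \<in> L2_space \<gamma> a b"
  note V = L2_D[OF v] and Jv = L2_D[OF Jop_L2[of v]]
  have m: "err v \<in> borel_measurable \<mu>" unfolding err_def[abs_def] using V(1) Jv(1) by measurable
  have "integrable lborel (\<lambda>t. (pull v t)\<^sup>2 + (pull (Jop v) t)\<^sup>2)" using V(3) Jv(3) by simp
  then have "integrable lborel (\<lambda>t. (pull (err v) t)\<^sup>2)"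
  proof (rule integrable_dominated[of _ _ 2])
    show "(\<lambda>t. (pull (err v) t)\<^sup>2) \<in> borel_measurable borel" using pull_measurable[OF m] by measurable
    show "\<bar>(pull (err v) t)\<^sup>2\<bar> \<le> 2 * ((pull v t)\<^sup>2 + (pull (Jop v) t)\<^sup>2)" for t
      using diff_sq_le[of "pull v t" "pull (Jop v) t"] by (cases "t \<in> {a..<b}") (simp_all add: pull_def err_def)
  qed
  then show ?thesis using m by (simp add: L2_iff)
qed

lemma err_L2_bound:
  assumes v: "v \<in> L2_space \<gamma> a b"
  shows "(\<Sum>I\<in>E. nsq (cell I) (pull (err v))) \<le> 2 * (1 + CJ * CO) * nsq {a..<b} (pull v)"
proof -
  note V = L2_D[OF v] and Jv = L2_D[OF Jop_L2[of v]]
  have "(\<Sum>I\<in>E. nsq (cell I) (pull (err v))) \<le> (\<Sum>I\<in>E. 2 * nsq (cell I) (pull v) + 2 * (CJ * nsq (PP I) (pull v)))"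
  proof (rule sum_mono)
    fix I assume I: "I \<in> E"
    have "nsq (cell I) (pull (err v)) \<le> 2 * nsq (cell I) (pull v) + 2 * nsq (cell I) (pull (Jop v))"
    proof (rule nsq_add_le)
      show "(pull (err v) x)\<^sup>2 \<le> 2 * (pull v x)\<^sup>2 + 2 * (pull (Jop v) x)\<^sup>2" for x
        using diff_sq_le[of "pull v x" "pull (Jop v) x"] by (cases "x \<in> {a..<b}") (simp_all add: pull_def err_def)
    qed (auto intro!: integrable_indicator_mult V Jv)
    also have "nsq (cell I) (pull (Jop v)) \<le> CJ * nsq (PP I) (pull v)"
      unfolding nsq_Jop_cell[OF I] by (rule local_L2(1)[OF I V(2,3)])
    finally show "nsq (cell I) (pull (err v)) \<le> 2 * nsq (cell I) (pull v) + 2 * (CJ * nsq (PP I) (pull v))" by simp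
  qed
  also have "\<dots> = 2 * nsq {a..<b} (pull v) + 2 * CJ * (\<Sum>I\<in>E. nsq (PP I) (pull v))"
    by (simp add: sum.distrib sum_distrib_left nsq_total[OF V(3)] mult.assoc)
  also have "\<dots> \<le> 2 * nsq {a..<b} (pull v) + 2 * CJ * (CO * nsq {a..<b} (pull v))"
    using CJ_nonneg by (intro add_left_mono mult_left_mono overlap_0 V(3)) simp
  finally show ?thesis by (simp add: algebra_simps)
qed

lemma err_local:
  assumes v: "v \<in> H1_space \<gamma> a b" and I: "I \<in> E"
    and u': "u' = (\<lambda>t. \<rho> t * pull (arclength_derivative \<gamma> a b v) t)"
  shows "nsq (cell I) (pull (err v)) \<le> CA * (param_width I)\<^sup>2 * nsq (PP I) u'"
proof -
  obtain u where u: "periodic_ac a b u u'" and vu: "AE t in lborel. pull v t = indicator {a..<b} t * u t"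
    using H1_rep[OF v] u' by metis
  note V = L2_D[OF H1_D(1)[OF v]]
  have "nsq (cell I) (pull (err v)) = nsq (cell I) (\<lambda>x. pull v x - spl (coef (pull v)) x)"
    using cell_ab[OF I] pull_err unfolding nsq_def by (intro Bochner_Integration.integral_cong) (auto simp: indicator_def)
  also have "\<dots> \<le> CA * (param_width I)\<^sup>2 * nsq (PP I) u'" by (rule local_H1(2)[OF I u V(2) vu])
  finally show ?thesis .
qed

text \<open>The error is again a function of class \<open>H\<^sup>1\<close>; \<open>y\<close> is its absolutely continuous representative in the
  parameter domain.\<close>

lemma err_H1:
  assumes v: "v \<in> H1_space \<gamma> a b" and u': "u' = (\<lambda>t. \<rho> t * pull (arclength_derivative \<gamma> a b v) t)"
  obtains y where "periodic_ac a b y (\<lambda>t. u' t - dspl (coef (pull v)) t)"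
    "AE t in lborel. t \<in> {a..<b} \<longrightarrow> err v (\<gamma> t) = y t" "err v \<in> H1_space \<gamma> a b"
    "AE t in lborel. u' t - dspl (coef (pull v)) t = \<rho> t * pull (arclength_derivative \<gamma> a b (err v)) t"
proof -
  obtain u where u: "periodic_ac a b u u'" and vu: "AE t in lborel. t \<in> {a..<b} \<longrightarrow> v (\<gamma> t) = u t"
    using H1_rep[OF v] u' by metis
  let ?s = "\<lambda>x. if x < b then spl (coef (pull v)) x else coef (pull v) i1"
  have s: "periodic_ac a b ?s (dspl (coef (pull v)))" by (rule spl_periodic_ac[OF coef_ends])
  have y: "periodic_ac a b (\<lambda>t. 1 * u t + (- 1) * ?s t + 0) (\<lambda>t. 1 * u' t + (- 1) * dspl (coef (pull v)) t)"
    by (rule periodic_ac_add[OF u s])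
  then have y': "periodic_ac a b (\<lambda>t. u t - ?s t) (\<lambda>t. u' t - dspl (coef (pull v)) t)" by simp
  have ae: "AE t in lborel. t \<in> {a..<b} \<longrightarrow> err v (\<gamma> t) = u t - ?s t"
    using vu by eventually_elim (auto simp: err_def Jop_\<gamma>)
  have m: "err v \<in> borel_measurable \<mu>" by (rule L2_D(1)[OF err_L2[OF H1_D(1)[OF v]]])
  show ?thesis by (rule that[OF y' ae H1_I(1)[OF m y' ae] H1_I(2)[OF m y' ae]])
qed

lemma err_derivative_local:
  assumes v: "v \<in> H1_space \<gamma> a b" and I: "I \<in> E"
    and u': "u' = (\<lambda>t. \<rho> t * pull (arclength_derivative \<gamma> a b v) t)"
  shows "nsq (cell I) (\<lambda>t. u' t - dspl (coef (pull v)) t) \<le> 2 * (1 + CH) * nsq (PP I) u'"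
proof -
  obtain u where u: "periodic_ac a b u u'" and vu: "AE t in lborel. pull v t = indicator {a..<b} t * u t"
    using H1_rep[OF v] u' by metis
  note V = L2_D[OF H1_D(1)[OF v]] and U = periodic_acD[OF u]
  have d2: "integrable lborel (\<lambda>t. (dspl (coef (pull v)) t)\<^sup>2)"
    using periodic_acD(2)[OF spl_periodic_ac[OF coef_ends]] .
  have "nsq (cell I) (\<lambda>t. u' t - dspl (coef (pull v)) t) \<le> 2 * nsq (cell I) u' + 2 * nsq (cell I) (dspl (coef (pull v)))"
    by (rule nsq_add_le) (auto intro!: integrable_indicator_mult U(2) d2 diff_sq_le)
  also have "nsq (cell I) (dspl (coef (pull v))) \<le> CH * nsq (PP I) u'" by (rule local_H1(1)[OF I u V(2) vu])
  also have "nsq (cell I) u' \<le> nsq (PP I) u'"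
  proof (rule nsq_mono[OF U(2) _ PP_meas[OF I]])
    have "PS (elem \<gamma> I) \<subseteq> PP I" unfolding PP_def PS_def using patch_mono[OF I, of 0 p] by auto
    then show "AE x in lborel. x \<in> cell I \<longrightarrow> x \<in> PP I" using cell_sub_PS[OF I] by (intro AE_I2 impI) blast
  qed simp
  finally show ?thesis by (simp add: algebra_simps)
qed

lemma norm_\<Gamma>:
  assumes "f \<in> L2_space \<gamma> a b"
  shows "smin * nsq {a..<b} (pull f) \<le> (L2_norm \<gamma> a b \<Gamma> f)\<^sup>2" "(L2_norm \<gamma> a b \<Gamma> f)\<^sup>2 \<le> smax * nsq {a..<b} (pull f)"
  using L2_norm_bounds[OF \<Gamma>_meas assms] by (simp_all add: PS_\<Gamma>)

lemma seminorm_\<Gamma>: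
  assumes v: "v \<in> H1_space \<gamma> a b" and u': "AE t in lborel. u' t = \<rho> t * pull (arclength_derivative \<gamma> a b v) t"
    and m: "u' \<in> borel_measurable borel"
  shows "smin * (H1_seminorm \<gamma> a b \<Gamma> v)\<^sup>2 \<le> nsq {a..<b} u'" "nsq {a..<b} u' \<le> smax * (H1_seminorm \<gamma> a b \<Gamma> v)\<^sup>2"
  using derivative_norm_bounds[OF \<Gamma>_meas H1_D(2)[OF v] u' m] by (simp_all add: PS_\<Gamma> H1_seminorm_def)

text \<open>The local first order estimates, divided by \<open>h\<^sup>2\<close> and summed over the mesh.\<close>

lemma err_H1_bound:
  assumes v: "v \<in> H1_space \<gamma> a b" and u': "u' = (\<lambda>t. \<rho> t * pull (arclength_derivative \<gamma> a b v) t)"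
  shows "(\<Sum>I\<in>E. nsq (cell I) (pull (err v)) / (param_width I)\<^sup>2) \<le> CA * CO * nsq {a..<b} u'"
proof -
  obtain u where u: "periodic_ac a b u u'" using H1_rep[OF v] u' by metis
  have "(\<Sum>I\<in>E. nsq (cell I) (pull (err v)) / (param_width I)\<^sup>2) \<le> (\<Sum>I\<in>E. CA * nsq (PP I) u')"
  proof (rule sum_mono)
    fix I assume I: "I \<in> E"
    have "0 < (param_width I)\<^sup>2" using width_pos[OF I] by simp
    then show "nsq (cell I) (pull (err v)) / (param_width I)\<^sup>2 \<le> CA * nsq (PP I) u'"
      using err_local[OF v I u'] by (simp add: pos_divide_le_eq ac_simps)
  qed
  also have "\<dots> \<le> CA * (CO * nsq {a..<b} u')"
    unfolding sum_distrib_left[symmetric] by (intro mult_left_mono overlap_0 periodic_acD(2)[OF u] CA_nonneg)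
  finally show ?thesis by (simp add: mult.assoc)
qed

end

section \<open>Interpolation\<close>

text \<open>Young's inequality with the weight chosen such that multiplication by \<open>r\<^sup>2 / (h\<^sup>2 + r\<^sup>2)\<close> leaves
  \<open>x\<^sup>2\<close> and \<open>(r / h)\<^sup>2 * y\<^sup>2\<close>.\<close>

lemma kernel_split:
  fixes h r x y :: real
  assumes "0 < h" "0 < r"
  shows "(x + y)\<^sup>2 \<le> (h\<^sup>2 + r\<^sup>2) / r\<^sup>2 * x\<^sup>2 + (h\<^sup>2 + r\<^sup>2) / h\<^sup>2 * y\<^sup>2"
proof -
  have "(h\<^sup>2 + r\<^sup>2) / r\<^sup>2 * x\<^sup>2 + (h\<^sup>2 + r\<^sup>2) / h\<^sup>2 * y\<^sup>2 = (x + y)\<^sup>2 + (x * h / r - y * r / h)\<^sup>2"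
    using assms by (simp add: power2_eq_square field_simps)
  then show ?thesis by simp
qed

context sz_op
begin

lemma H1_norm_\<Gamma>: "H1_norm \<gamma> a b z = sqrt ((L2_norm \<gamma> a b \<Gamma> z)\<^sup>2 + (H1_seminorm \<gamma> a b \<Gamma> z)\<^sup>2)"
  by (simp add: H1_norm_def image_Icc)

lemma H1_norm_sq: "(H1_norm \<gamma> a b z)\<^sup>2 = (L2_norm \<gamma> a b \<Gamma> z)\<^sup>2 + (H1_seminorm \<gamma> a b \<Gamma> z)\<^sup>2"
  by (simp add: H1_norm_\<Gamma>)

lemma H1_norm_nonneg: "0 \<le> H1_norm \<gamma> a b z" by (simp add: H1_norm_\<Gamma>)

lemma diff_L2:
  assumes "v \<in> L2_space \<gamma> a b" "z \<in> L2_space \<gamma> a b"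
  shows "(\<lambda>x. v x - z x) \<in> L2_space \<gamma> a b"
proof -
  note V = L2_D[OF assms(1)] and Z = L2_D[OF assms(2)]
  have m: "(\<lambda>x. v x - z x) \<in> borel_measurable \<mu>" using V(1) Z(1) by measurable
  have "integrable lborel (\<lambda>t. (pull v t)\<^sup>2 + (pull z t)\<^sup>2)" using V(3) Z(3) by simp
  then have "integrable lborel (\<lambda>t. (pull (\<lambda>x. v x - z x) t)\<^sup>2)"
  proof (rule integrable_dominated[of _ _ 2])
    show "(\<lambda>t. (pull (\<lambda>x. v x - z x) t)\<^sup>2) \<in> borel_measurable borel" using pull_measurable[OF m] by measurable
    show "\<bar>(pull (\<lambda>x. v x - z x) t)\<^sup>2\<bar> \<le> 2 * ((pull v t)\<^sup>2 + (pull z t)\<^sup>2)" for t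
      using diff_sq_le[of "pull v t" "pull z t"] by (cases "t \<in> {a..<b}") (simp_all add: pull_def)
  qed
  then show ?thesis using m by (simp add: L2_iff)
qed

text \<open>The error operator is linear; only additivity for the splitting of the \<open>K\<close>-functional is used.\<close>

lemma err_split:
  assumes v: "v \<in> L2_space \<gamma> a b" and z: "z \<in> L2_space \<gamma> a b"
  shows "pull (err v) x = pull (err (\<lambda>x. v x - z x)) x + pull (err z) x"
proof (cases "x \<in> {a..<b}")
  case True
  note V = L2_D[OF v] and Z = L2_D[OF z]
  have pd: "pull (\<lambda>x. v x - z x) = (\<lambda>x. 1 * pull v x + (- 1) * pull z x)" by (auto simp: pull_def fun_eq_iff algebra_simps)
  have c: "coef (pull (\<lambda>x. v x - z x)) i = coef (pull v) i - coef (pull z) i" if "i \<in> SI" for i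
    unfolding pd using coef_linear[OF that V(2,3) Z(2,3), of 1 "- 1"] by simp
  have "spl (coef (pull (\<lambda>x. v x - z x))) x = spl (coef (pull v)) x - spl (coef (pull z)) x"
    unfolding spl_def sum_subtractf[symmetric] by (rule sum.cong) (auto simp: c algebra_simps)
  moreover have "pull (\<lambda>x. v x - z x) x = pull v x - pull z x" by (simp add: pull_def algebra_simps)
  ultimately show ?thesis using True by (simp add: pull_err)
qed (simp add: pull_def)

definition CI :: real where "CI = 2 * (1 + CJ * CO) / smin + CA * CO * smax"

lemma CI_pos: "0 < CI"
proof -
  have "0 < 2 * (1 + CJ * CO) / smin" using CJ_nonneg CO_ge1 smin_pos by (intro divide_pos_pos) (auto intro: add_pos_nonneg)
  moreover have "0 \<le> CA * CO * smax" using CA_nonneg CO_ge1 smax_pos by simp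
  ultimately show ?thesis unfolding CI_def by linarith
qed

lemma err_L2_norm:
  assumes v: "v \<in> L2_space \<gamma> a b"
  shows "(\<Sum>I\<in>E. nsq (cell I) (pull (err v))) \<le> CI * (L2_norm \<gamma> a b \<Gamma> v)\<^sup>2"
proof -
  have CC: "0 \<le> 2 * (1 + CJ * CO)" using CJ_nonneg CO_ge1 by simp
  have "(\<Sum>I\<in>E. nsq (cell I) (pull (err v))) \<le> 2 * (1 + CJ * CO) * nsq {a..<b} (pull v)" by (rule err_L2_bound[OF v])
  also have "\<dots> = 2 * (1 + CJ * CO) / smin * (smin * nsq {a..<b} (pull v))" using smin_pos by simp
  also have "\<dots> \<le> 2 * (1 + CJ * CO) / smin * (L2_norm \<gamma> a b \<Gamma> v)\<^sup>2"
    using CC smin_pos by (intro mult_left_mono norm_\<Gamma>(1)[OF v]) simp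
  also have "\<dots> \<le> CI * (L2_norm \<gamma> a b \<Gamma> v)\<^sup>2"
    using CA_nonneg CO_ge1 smax_pos by (intro mult_right_mono) (auto simp: CI_def)
  finally show ?thesis .
qed

lemma err_H1_norm:
  assumes z: "z \<in> H1_space \<gamma> a b"
  shows "(\<Sum>I\<in>E. nsq (cell I) (pull (err z)) / (param_width I)\<^sup>2) \<le> CI * (H1_norm \<gamma> a b z)\<^sup>2"
proof -
  define u' where "u' = (\<lambda>t. \<rho> t * pull (arclength_derivative \<gamma> a b z) t)"
  have um: "u' \<in> borel_measurable borel" unfolding u'_def using L2_D(2)[OF H1_D(2)[OF z]] by measurable
  have "(\<Sum>I\<in>E. nsq (cell I) (pull (err z)) / (param_width I)\<^sup>2) \<le> CA * CO * nsq {a..<b} u'"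
    by (rule err_H1_bound[OF z u'_def])
  also have "\<dots> \<le> CA * CO * (smax * (H1_seminorm \<gamma> a b \<Gamma> z)\<^sup>2)"
    using CA_nonneg CO_ge1 by (intro mult_left_mono seminorm_\<Gamma>(2)[OF z _ um]) (auto simp: u'_def)
  also have "\<dots> = CA * CO * smax * (H1_seminorm \<gamma> a b \<Gamma> z)\<^sup>2" by simp
  also have "\<dots> \<le> CI * (H1_norm \<gamma> a b z)\<^sup>2"
    unfolding H1_norm_sq using CA_nonneg CO_ge1 smax_pos CJ_nonneg smin_pos
    by (intro mult_mono) (auto simp: CI_def)
  finally show ?thesis .
qed

text \<open>For a competitor \<open>z\<close> the error of \<open>v - z\<close> is bounded in \<open>L\<^sup>2\<close>, and the error of \<open>z\<close> divided by \<open>h\<close> by the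
  \<open>H\<^sup>1\<close> norm.  \<open>kernel_split\<close> weighs the two contributions on each element.\<close>

lemma K_lower:
  assumes v: "v \<in> L2_space \<gamma> a b" and z: "z \<in> H1_space \<gamma> a b" and r: "0 < r"
  shows "(\<Sum>I\<in>E. r\<^sup>2 / ((param_width I)\<^sup>2 + r\<^sup>2) * nsq (cell I) (pull (err v)))
     \<le> CI * (L2_norm \<gamma> a b \<Gamma> (\<lambda>x. v x - z x) + r * H1_norm \<gamma> a b z)\<^sup>2"
proof -
  let ?d = "\<lambda>x. v x - z x"
  have zL: "z \<in> L2_space \<gamma> a b" by (rule H1_D(1)[OF z])
  have dL: "?d \<in> L2_space \<gamma> a b" by (rule diff_L2[OF v zL])
  have "(\<Sum>I\<in>E. r\<^sup>2 / ((param_width I)\<^sup>2 + r\<^sup>2) * nsq (cell I) (pull (err v)))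
      \<le> (\<Sum>I\<in>E. nsq (cell I) (pull (err ?d)) + r\<^sup>2 * (nsq (cell I) (pull (err z)) / (param_width I)\<^sup>2))"
  proof (rule sum_mono)
    fix I assume I: "I \<in> E"
    define h where "h = param_width I"
    have h: "0 < h" using width_pos[OF I] by (simp add: h_def)
    have "nsq (cell I) (pull (err v)) \<le> (h\<^sup>2 + r\<^sup>2) / r\<^sup>2 * nsq (cell I) (pull (err ?d)) + (h\<^sup>2 + r\<^sup>2) / h\<^sup>2 * nsq (cell I) (pull (err z))"
    proof (rule nsq_add_le)
      show "(pull (err v) x)\<^sup>2 \<le> (h\<^sup>2 + r\<^sup>2) / r\<^sup>2 * (pull (err ?d) x)\<^sup>2 + (h\<^sup>2 + r\<^sup>2) / h\<^sup>2 * (pull (err z) x)\<^sup>2" for x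
        unfolding err_split[OF v zL] by (rule kernel_split[OF h r])
    qed (auto intro!: integrable_indicator_mult L2_D(3) err_L2 dL zL)
    then have "r\<^sup>2 / (h\<^sup>2 + r\<^sup>2) * nsq (cell I) (pull (err v)) \<le>
       r\<^sup>2 / (h\<^sup>2 + r\<^sup>2) * ((h\<^sup>2 + r\<^sup>2) / r\<^sup>2 * nsq (cell I) (pull (err ?d)) + (h\<^sup>2 + r\<^sup>2) / h\<^sup>2 * nsq (cell I) (pull (err z)))"
      by (intro mult_left_mono) auto
    also have "\<dots> = nsq (cell I) (pull (err ?d)) + r\<^sup>2 * (nsq (cell I) (pull (err z)) / h\<^sup>2)"
    proof -
      have "0 < h\<^sup>2 + r\<^sup>2" using h by (simp add: add_pos_nonneg)
      then show ?thesis using h r by (simp add: distrib_left)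
    qed
    finally show "r\<^sup>2 / ((param_width I)\<^sup>2 + r\<^sup>2) * nsq (cell I) (pull (err v))
       \<le> nsq (cell I) (pull (err ?d)) + r\<^sup>2 * (nsq (cell I) (pull (err z)) / (param_width I)\<^sup>2)" by (simp only: h_def)
  qed
  also have "\<dots> = (\<Sum>I\<in>E. nsq (cell I) (pull (err ?d))) + r\<^sup>2 * (\<Sum>I\<in>E. nsq (cell I) (pull (err z)) / (param_width I)\<^sup>2)"
    by (simp only: sum.distrib sum_distrib_left)
  also have "\<dots> \<le> CI * (L2_norm \<gamma> a b \<Gamma> ?d)\<^sup>2 + r\<^sup>2 * (CI * (H1_norm \<gamma> a b z)\<^sup>2)"
    by (intro add_mono mult_left_mono err_L2_norm dL err_H1_norm z) simp
  also have "\<dots> = CI * ((L2_norm \<gamma> a b \<Gamma> ?d)\<^sup>2 + (r * H1_norm \<gamma> a b z)\<^sup>2)" by (simp add: power_mult_distrib algebra_simps)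
  also have "\<dots> \<le> CI * (L2_norm \<gamma> a b \<Gamma> ?d + r * H1_norm \<gamma> a b z)\<^sup>2"
    using CI_pos r L2_norm_nonneg H1_norm_nonneg by (intro mult_left_mono) (auto simp: power2_sum)
  finally show ?thesis .
qed

lemma K_functional_ge:
  assumes v: "v \<in> L2_space \<gamma> a b" and r: "0 < r"
  shows "(\<Sum>I\<in>E. r\<^sup>2 / ((param_width I)\<^sup>2 + r\<^sup>2) * nsq (cell I) (pull (err v))) \<le> CI * (K_functional \<gamma> a b r v)\<^sup>2"
proof -
  let ?S = "\<Sum>I\<in>E. r\<^sup>2 / ((param_width I)\<^sup>2 + r\<^sup>2) * nsq (cell I) (pull (err v))"
  have S0: "0 \<le> ?S" by (intro sum_nonneg mult_nonneg_nonneg nsq_nonneg) auto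
  have "sqrt (?S / CI) \<le> K_functional \<gamma> a b r v"
    unfolding K_functional_def
  proof (rule cINF_greatest)
    show "H1_space \<gamma> a b \<noteq> {}" using Jop_H1(1) by blast
    fix z assume z: "z \<in> H1_space \<gamma> a b"
    have "?S / CI \<le> (L2_norm \<gamma> a b \<Gamma> (\<lambda>x. v x - z x) + r * H1_norm \<gamma> a b z)\<^sup>2"
      using K_lower[OF v z r] CI_pos by (simp add: pos_divide_le_eq mult.commute)
    then show "sqrt (?S / CI) \<le> L2_norm \<gamma> a b (\<gamma> ` {a..b}) (\<lambda>x. v x - z x) + r * H1_norm \<gamma> a b z"
      unfolding image_Icc using r L2_norm_nonneg H1_norm_nonneg by (intro real_le_lsqrt) auto
  qed
  then have "(sqrt (?S / CI))\<^sup>2 \<le> (K_functional \<gamma> a b r v)\<^sup>2" using S0 CI_pos by (intro power_mono) auto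
  then show ?thesis using S0 CI_pos by (simp add: pos_divide_le_eq mult.commute)
qed

text \<open>For \<open>r\<close> between \<open>h\<close> and \<open>2 * h\<close> the kernel is of order one; this part of the integral over \<open>r\<close> already
  gives the expected power of \<open>h\<close>.\<close>

lemma kernel_lower:
  fixes h r \<sigma> :: real
  assumes h: "0 < h" and t: "h \<le> r" "r \<le> 2 * h" and s: "0 \<le> \<sigma>" "\<sigma> \<le> 1"
  shows "h powr (- 2 * \<sigma>) / h / 16 \<le> r powr (- 2 * \<sigma>) / r * (r\<^sup>2 / (h\<^sup>2 + r\<^sup>2))"
proof -
  have r: "0 < r" using h t by simp
  have "(1/4) * h powr (- 2 * \<sigma>) \<le> (2 powr (- 2 * \<sigma>)) * h powr (- 2 * \<sigma>)"
  proof (rule mult_right_mono)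
    have "(2::real) powr (- 2) \<le> 2 powr (- 2 * \<sigma>)" using s by (intro powr_mono) auto
    moreover have "(2::real) powr (- 2) = 1 / 4" by (simp add: powr_minus_divide powr_numeral)
    ultimately show "1 / 4 \<le> (2::real) powr (- 2 * \<sigma>)" by simp
  qed simp
  also have "\<dots> = (2 * h) powr (- 2 * \<sigma>)" using h by (simp add: powr_mult)
  also have "\<dots> \<le> r powr (- 2 * \<sigma>)" using r t s by (intro powr_mono2') auto
  finally have 1: "h powr (- 2 * \<sigma>) / 4 \<le> r powr (- 2 * \<sigma>)" by simp
  have "h * h \<le> h * r" "r * r \<le> 2 * h * r" using t h r by (auto intro: mult_left_mono mult_right_mono)
  moreover have "0 \<le> h * r" using h r by simp
  ultimately have "h * h + r * r \<le> 4 * (h * r)" by linarith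
  then have "r * (h * h + r * r) \<le> r * (4 * (h * r))" using r by (intro mult_left_mono) auto
  then have 2: "1 / (4 * h) \<le> r / (h\<^sup>2 + r\<^sup>2)"
    using h r by (simp add: divide_simps power2_eq_square add_pos_pos) (simp add: algebra_simps)
  have "h powr (- 2 * \<sigma>) / h / 16 = (h powr (- 2 * \<sigma>) / 4) * (1 / (4 * h))" by simp
  also have "\<dots> \<le> r powr (- 2 * \<sigma>) * (r / (h\<^sup>2 + r\<^sup>2))"
    using 1 2 h by (intro mult_mono) auto
  also have "\<dots> = r powr (- 2 * \<sigma>) / r * (r\<^sup>2 / (h\<^sup>2 + r\<^sup>2))" using r by (simp add: power2_eq_square)
  finally show ?thesis .
qed

lemma Hs_norm_sq:
  assumes "0 < \<sigma>" "\<sigma> < 1"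
  shows "(Hs_norm \<gamma> a b \<sigma> v)\<^sup>2 = enn2real (K_method_integral \<gamma> a b \<sigma> v)"
  using assms by (simp add: Hs_norm_def)

text \<open>Each element only uses the part \<open>[h, 2 h]\<close> of the integral that defines the interpolation norm, but different
  elements may use overlapping parts: \<open>K_functional_ge\<close> bounds the sum over all elements for each \<open>r\<close>.\<close>

lemma interpolated_error:
  assumes v: "v \<in> Hs_space \<gamma> a b \<sigma>" and s: "0 < \<sigma>" "\<sigma> < 1"
  shows "(\<Sum>I\<in>E. param_width I powr (- 2 * \<sigma>) * nsq (cell I) (pull (err v))) \<le> 16 * CI * (Hs_norm \<gamma> a b \<sigma> v)\<^sup>2"
proof -
  have vL: "v \<in> L2_space \<gamma> a b" and fin: "K_method_integral \<gamma> a b \<sigma> v < \<infinity>" using v s by (auto simp: Hs_space_def)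
  define n where "n I = nsq (cell I) (pull (err v))" for I
  have n: "0 \<le> n I" for I by (simp add: n_def nsq_nonneg)
  \<comment> \<open>the step functions with these heights lie below the integrand; the factor 16 is that of \<open>kernel_lower\<close>\<close>
  define c where "c I = param_width I powr (- 2 * \<sigma>) / param_width I / 16 * n I / CI" for I
  have c: "0 \<le> c I" if "I \<in> E" for I using n CI_pos width_pos[OF that] by (simp add: c_def)
  have pt: "(\<Sum>I\<in>E. ennreal (c I) * indicator {param_width I..2 * param_width I} r)
     \<le> ennreal ((r powr (-\<sigma>) * K_functional \<gamma> a b r v)\<^sup>2 / r) * indicator {0<..} r" for r
  proof (cases "0 < r")
    case False
    then have "(\<Sum>I\<in>E. ennreal (c I) * indicator {param_width I..2 * param_width I} r) = 0"
      using width_pos by (intro sum.neutral ballI) (force simp: indicator_def)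
    then show ?thesis by simp
  next
    case True
    have rr: "(r powr (-\<sigma>))\<^sup>2 = r powr (- 2 * \<sigma>)" using True by (simp add: powr_power)
    have "(\<Sum>I\<in>E. c I * indicator {param_width I..2 * param_width I} r)
       \<le> (\<Sum>I\<in>E. r powr (- 2 * \<sigma>) / r / CI * (r\<^sup>2 / ((param_width I)\<^sup>2 + r\<^sup>2) * n I))"
    proof (rule sum_mono)
      fix I assume I: "I \<in> E"
      show "c I * indicator {param_width I..2 * param_width I} r \<le> r powr (- 2 * \<sigma>) / r / CI * (r\<^sup>2 / ((param_width I)\<^sup>2 + r\<^sup>2) * n I)"
      proof (cases "r \<in> {param_width I..2 * param_width I}")
        case True
        then have "param_width I powr (- 2 * \<sigma>) / param_width I / 16 \<le> r powr (- 2 * \<sigma>) / r * (r\<^sup>2 / ((param_width I)\<^sup>2 + r\<^sup>2))"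
          using s by (intro kernel_lower width_pos[OF I]) auto
        then have "param_width I powr (- 2 * \<sigma>) / param_width I / 16 * (n I / CI) \<le> r powr (- 2 * \<sigma>) / r * (r\<^sup>2 / ((param_width I)\<^sup>2 + r\<^sup>2)) * (n I / CI)"
          using n[of I] CI_pos by (intro mult_right_mono) auto
        then show ?thesis using True by (simp add: c_def ac_simps)
      next
        case False
        show ?thesis unfolding indicator_simps(2)[OF False] using n[of I] CI_pos \<open>0 < r\<close> by simp
      qed
    qed
    also have "\<dots> = r powr (- 2 * \<sigma>) / r / CI * (\<Sum>I\<in>E. r\<^sup>2 / ((param_width I)\<^sup>2 + r\<^sup>2) * n I)" by (simp only: sum_distrib_left)
    also have "\<dots> \<le> r powr (- 2 * \<sigma>) / r / CI * (CI * (K_functional \<gamma> a b r v)\<^sup>2)"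
      unfolding n_def using True CI_pos by (intro mult_left_mono K_functional_ge vL) auto
    also have "\<dots> = (r powr (-\<sigma>) * K_functional \<gamma> a b r v)\<^sup>2 / r"
      using CI_pos by (simp add: power_mult_distrib rr)
    finally have le: "(\<Sum>I\<in>E. c I * indicator {param_width I..2 * param_width I} r) \<le> (r powr (-\<sigma>) * K_functional \<gamma> a b r v)\<^sup>2 / r" .
    have "(\<Sum>I\<in>E. ennreal (c I) * indicator {param_width I..2 * param_width I} r) = (\<Sum>I\<in>E. ennreal (c I * indicator {param_width I..2 * param_width I} r))"
      by (intro sum.cong) (auto simp: indicator_def)
    also have "\<dots> = ennreal (\<Sum>I\<in>E. c I * indicator {param_width I..2 * param_width I} r)"
      using c by (intro sum_ennreal) auto
    also have "\<dots> \<le> ennreal ((r powr (-\<sigma>) * K_functional \<gamma> a b r v)\<^sup>2 / r)" by (rule ennreal_leI[OF le])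
    finally show ?thesis using True by simp
  qed
  have "ennreal (\<Sum>I\<in>E. c I * param_width I) = (\<Sum>I\<in>E. ennreal (c I * param_width I))"
    by (intro sum_ennreal[symmetric] mult_nonneg_nonneg c less_imp_le[OF width_pos])
  also have "\<dots> = (\<Sum>I\<in>E. ennreal (c I) * emeasure lborel {param_width I..2 * param_width I})"
  proof (rule sum.cong[OF refl])
    fix I assume I: "I \<in> E"
    have "emeasure lborel {param_width I..2 * param_width I} = ennreal (param_width I)"
      using width_pos[OF I] by (simp add: emeasure_lborel_Icc)
    then show "ennreal (c I * param_width I) = ennreal (c I) * emeasure lborel {param_width I..2 * param_width I}"
      using c[OF I] by (simp add: ennreal_mult')
  qed
  also have "\<dots> = (\<Sum>I\<in>E. \<integral>\<^sup>+ r. ennreal (c I) * indicator {param_width I..2 * param_width I} r \<partial>lborel)"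
    by (intro sum.cong refl nn_integral_cmult_indicator[symmetric]) simp
  also have "\<dots> = (\<integral>\<^sup>+ r. (\<Sum>I\<in>E. ennreal (c I) * indicator {param_width I..2 * param_width I} r) \<partial>lborel)"
    by (rule nn_integral_sum[symmetric]) measurable
  also have "\<dots> \<le> K_method_integral \<gamma> a b \<sigma> v"
    unfolding K_method_integral_def by (intro nn_integral_mono pt)
  also have "\<dots> = ennreal ((Hs_norm \<gamma> a b \<sigma> v)\<^sup>2)"
    unfolding Hs_norm_sq[OF s] using fin by simp
  finally have "(\<Sum>I\<in>E. c I * param_width I) \<le> (Hs_norm \<gamma> a b \<sigma> v)\<^sup>2" by (simp add: ennreal_le_iff)
  moreover have "(\<Sum>I\<in>E. c I * param_width I) = (\<Sum>I\<in>E. param_width I powr (- 2 * \<sigma>) * n I) / (16 * CI)"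
    unfolding sum_divide_distrib
  proof (rule sum.cong[OF refl])
    fix I assume "I \<in> E"
    then have "0 < param_width I" by (rule width_pos)
    then have "param_width I \<noteq> 0" by simp
    then show "c I * param_width I = param_width I powr (- 2 * \<sigma>) * n I / (16 * CI)" by (simp add: c_def)
  qed
  ultimately have "(\<Sum>I\<in>E. param_width I powr (- 2 * \<sigma>) * n I) / (16 * CI) \<le> (Hs_norm \<gamma> a b \<sigma> v)\<^sup>2" by simp
  then show ?thesis using CI_pos by (simp add: pos_divide_le_eq n_def mult.commute)
qed

definition Ca :: "real \<Rightarrow> real" where "Ca \<sigma> = smax * smin powr (- 2 * \<sigma>) * (16 * CI)"

text \<open>At the end points \<open>\<sigma> = 0\<close> and \<open>\<sigma> = 1\<close> the norm is not given by the integral, and the estimates for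
  the error itself apply.\<close>

lemma approximation_low:
  assumes v: "v \<in> Hs_space \<gamma> a b \<sigma>" and s: "0 \<le> \<sigma>" "\<sigma> \<le> 1"
  shows "(L2_norm \<gamma> a b \<Gamma> (\<lambda>x. mesh_width \<gamma> a b K x powr (- \<sigma>) * err v x))\<^sup>2 \<le> Ca \<sigma> * (Hs_norm \<gamma> a b \<sigma> v)\<^sup>2"
proof -
  have vL: "v \<in> L2_space \<gamma> a b" using v s H1_D(1) by (auto simp: Hs_space_def split: if_splits)
  define n where "n I = nsq (cell I) (pull (err v))" for I
  have n: "0 \<le> n I" for I by (simp add: n_def nsq_nonneg)
  have main: "(\<Sum>I\<in>E. param_width I powr (- 2 * \<sigma>) * n I) \<le> 16 * CI * (Hs_norm \<gamma> a b \<sigma> v)\<^sup>2"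
  proof -
    consider "\<sigma> = 0" | "\<sigma> = 1" | "0 < \<sigma>" "\<sigma> < 1" using s by linarith
    then show ?thesis
    proof cases
      case 1
      have "(\<Sum>I\<in>E. param_width I powr (- 2 * \<sigma>) * n I) = (\<Sum>I\<in>E. n I)"
        using 1 width_pos by (intro sum.cong) (force simp: powr_zero_eq_one)+
      also have "\<dots> \<le> CI * (L2_norm \<gamma> a b \<Gamma> v)\<^sup>2" unfolding n_def by (rule err_L2_norm[OF vL])
      also have "\<dots> \<le> 16 * CI * (L2_norm \<gamma> a b \<Gamma> v)\<^sup>2" using CI_pos by (intro mult_right_mono) auto
      finally show ?thesis using 1 by (simp add: Hs_norm_def image_Icc)
    next
      case 2
      have vH: "v \<in> H1_space \<gamma> a b" using v 2 by (simp add: Hs_space_def)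
      have "(\<Sum>I\<in>E. param_width I powr (- 2 * \<sigma>) * n I) = (\<Sum>I\<in>E. n I / (param_width I)\<^sup>2)"
      proof (rule sum.cong[OF refl])
        fix I assume "I \<in> E"
        then have "0 < param_width I" by (rule width_pos)
        then show "param_width I powr (- 2 * \<sigma>) * n I = n I / (param_width I)\<^sup>2"
          using 2 by (simp add: powr_minus_divide powr_numeral)
      qed
      also have "\<dots> \<le> CI * (H1_norm \<gamma> a b v)\<^sup>2" unfolding n_def by (rule err_H1_norm[OF vH])
      also have "\<dots> \<le> 16 * CI * (H1_norm \<gamma> a b v)\<^sup>2" using CI_pos by (intro mult_right_mono) auto
      finally show ?thesis using 2 by (simp add: Hs_norm_def)
    next
      case 3
      then show ?thesis unfolding n_def by (rule interpolated_error[OF v])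
    qed
  qed
  have "(L2_norm \<gamma> a b \<Gamma> (\<lambda>x. mesh_width \<gamma> a b K x powr (- \<sigma>) * err v x))\<^sup>2
     \<le> smax * (\<Sum>I\<in>E. (elem_length \<gamma> a b I powr (- \<sigma>))\<^sup>2 * n I)"
    using norm_\<Gamma>(2)[OF weighted_norm(1)[OF err_L2[OF vL]], of "- \<sigma>"] unfolding weighted_norm(2)[OF err_L2[OF vL]] n_def .
  also have "\<dots> \<le> smax * (\<Sum>I\<in>E. smin powr (- 2 * \<sigma>) * (param_width I powr (- 2 * \<sigma>) * n I))"
  proof (intro mult_left_mono sum_mono)
    fix I assume I: "I \<in> E"
    have p: "0 < smin * param_width I" using smin_pos width_pos[OF I] by simp
    have l: "0 < elem_length \<gamma> a b I" using elem_length_bounds(1)[OF I] p by linarith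
    have "(elem_length \<gamma> a b I powr (- \<sigma>))\<^sup>2 = elem_length \<gamma> a b I powr (- 2 * \<sigma>)" using l by (simp add: powr_power)
    also have "\<dots> \<le> (smin * param_width I) powr (- 2 * \<sigma>)"
      using elem_length_bounds(1)[OF I] p s by (intro powr_mono2') auto
    also have "\<dots> = smin powr (- 2 * \<sigma>) * param_width I powr (- 2 * \<sigma>)" by (rule powr_mult)
    finally have e: "(elem_length \<gamma> a b I powr (- \<sigma>))\<^sup>2 \<le> smin powr (- 2 * \<sigma>) * param_width I powr (- 2 * \<sigma>)" .
    show "(elem_length \<gamma> a b I powr (- \<sigma>))\<^sup>2 * n I \<le> smin powr (- 2 * \<sigma>) * (param_width I powr (- 2 * \<sigma>) * n I)"
      using mult_right_mono[OF e n[of I]] by (simp only: mult.assoc)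
  qed (use smax_pos in simp)
  also have "\<dots> = smax * smin powr (- 2 * \<sigma>) * (\<Sum>I\<in>E. param_width I powr (- 2 * \<sigma>) * n I)"
    by (simp add: sum_distrib_left mult.assoc)
  also have "\<dots> \<le> smax * smin powr (- 2 * \<sigma>) * (16 * CI * (Hs_norm \<gamma> a b \<sigma> v)\<^sup>2)"
    using smax_pos by (intro mult_left_mono main) simp
  finally show ?thesis by (simp add: Ca_def mult.assoc)
qed

end

section \<open>Upper bound for the interpolation norm of the error\<close>

text \<open>The kernel \<open>(r h / (r + h))\<^sup>2\<close> is at most \<open>min r h\<close> squared.  Convergence at zero uses \<open>\<sigma> < 1\<close> and
  convergence at infinity uses \<open>\<sigma> > 0\<close>.\<close>

lemma kernel_integral:
  fixes w \<sigma> :: real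
  assumes w: "0 < w" and s: "0 < \<sigma>" "\<sigma> < 1"
  shows "(\<integral>\<^sup>+ r. ennreal (indicator {0<..} r * (r powr (- 2 * \<sigma>) * (r * w / (r + w))\<^sup>2 / r)) \<partial>lborel)
     \<le> ennreal ((1 / (2 - 2 * \<sigma>) + 1 / (2 * \<sigma>)) * w powr (2 - 2 * \<sigma>))"
proof -
  define f g where "f r = r powr (1 - 2 * \<sigma>)" and "g r = w\<^sup>2 * r powr (- 2 * \<sigma> - 1)" for r
  have pt: "indicator {0<..} r * (r powr (- 2 * \<sigma>) * (r * w / (r + w))\<^sup>2 / r)
      \<le> indicator {0..w} r * f r + indicator {w..} r * g r" for r
  proof (cases "0 < r")
    case False
    then have "indicator {0<..} r * (r powr (- 2 * \<sigma>) * (r * w / (r + w))\<^sup>2 / r) = 0" by simp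
    also have "0 \<le> indicator {0..w} r * f r + indicator {w..} r * g r"
      unfolding f_def g_def by (intro add_nonneg_nonneg mult_nonneg_nonneg) simp_all
    finally show ?thesis .
  next
    case True
    have q1: "(r * w / (r + w))\<^sup>2 \<le> r\<^sup>2"
      using True w by (intro power_mono) (auto simp: pos_divide_le_eq algebra_simps)
    have q2: "(r * w / (r + w))\<^sup>2 \<le> w\<^sup>2"
      using True w by (intro power_mono) (auto simp: pos_divide_le_eq algebra_simps)
    have f: "r powr (- 2 * \<sigma>) * r\<^sup>2 / r = f r"
    proof -
      have "f r = r powr (- 2 * \<sigma>) * r powr 1" unfolding f_def powr_add[symmetric] by simp
      then show ?thesis using True by (simp add: power2_eq_square)
    qed
    have g: "r powr (- 2 * \<sigma>) * w\<^sup>2 / r = g r"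
    proof -
      have "r powr (- 2 * \<sigma> - 1) = r powr (- 2 * \<sigma>) / r powr 1" by (rule powr_diff)
      then show ?thesis using True by (simp add: g_def)
    qed
    have ff: "0 \<le> f r" "0 \<le> g r" by (simp_all add: f_def g_def)
    have "r powr (- 2 * \<sigma>) * (r * w / (r + w))\<^sup>2 / r \<le> indicator {0..w} r * f r + indicator {w..} r * g r"
    proof (cases "r \<le> w")
      case True
      have "r powr (- 2 * \<sigma>) * (r * w / (r + w))\<^sup>2 / r \<le> f r"
        unfolding f[symmetric] using \<open>0 < r\<close> by (intro divide_right_mono mult_left_mono q1) auto
      also have "f r \<le> indicator {0..w} r * f r + indicator {w..} r * g r"
        using True \<open>0 < r\<close> ff by (simp add: indicator_def)
      finally show ?thesis .
    next
      case False
      have "r powr (- 2 * \<sigma>) * (r * w / (r + w))\<^sup>2 / r \<le> g r"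
        unfolding g[symmetric] using \<open>0 < r\<close> by (intro divide_right_mono mult_left_mono q2) auto
      then show ?thesis using False by (simp add: indicator_def)
    qed
    then show ?thesis using True by simp
  qed
  have i1: "(f has_integral (w powr (2 - 2 * \<sigma>) / (2 - 2 * \<sigma>))) {0..w}"
    using has_integral_powr_from_0[of "1 - 2 * \<sigma>" w] s w by (simp add: f_def[abs_def])
  have "((\<lambda>r. r powr (- 2 * \<sigma> - 1)) has_integral (- (w powr ((- 2 * \<sigma> - 1) + 1)) / ((- 2 * \<sigma> - 1) + 1))) {w..}"
    using s w by (intro has_integral_powr_to_inf) auto
  then have gi: "(g has_integral (w\<^sup>2 * (- (w powr ((- 2 * \<sigma> - 1) + 1)) / ((- 2 * \<sigma> - 1) + 1)))) {w..}"
    unfolding g_def[abs_def] by (rule has_integral_mult_right)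
  have ge: "w\<^sup>2 * (- (w powr ((- 2 * \<sigma> - 1) + 1)) / ((- 2 * \<sigma> - 1) + 1)) = w powr (2 - 2 * \<sigma>) / (2 * \<sigma>)"
  proof -
    have "w powr (2 - 2 * \<sigma>) = w powr 2 * w powr (- 2 * \<sigma>)" unfolding powr_add[symmetric] by simp
    then show ?thesis using w by (simp add: powr_numeral)
  qed
  have i2: "(g has_integral (w powr (2 - 2 * \<sigma>) / (2 * \<sigma>))) {w..}" using gi unfolding ge .
  have n1: "(\<integral>\<^sup>+ r. ennreal (indicator {0..w} r * f r) \<partial>lborel) = ennreal (w powr (2 - 2 * \<sigma>) / (2 - 2 * \<sigma>))"
    by (rule nn_integral_has_integral_lebesgue[OF _ i1, simplified nn_integral_completion]) (simp add: f_def)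
  have n2: "(\<integral>\<^sup>+ r. ennreal (indicator {w..} r * g r) \<partial>lborel) = ennreal (w powr (2 - 2 * \<sigma>) / (2 * \<sigma>))"
    by (rule nn_integral_has_integral_lebesgue[OF _ i2, simplified nn_integral_completion]) (simp add: g_def)
  have "(\<integral>\<^sup>+ r. ennreal (indicator {0<..} r * (r powr (- 2 * \<sigma>) * (r * w / (r + w))\<^sup>2 / r)) \<partial>lborel)
     \<le> (\<integral>\<^sup>+ r. ennreal (indicator {0..w} r * f r) + ennreal (indicator {w..} r * g r) \<partial>lborel)"
  proof (rule nn_integral_mono)
    fix r
    have "ennreal (indicator {0..w} r * f r) + ennreal (indicator {w..} r * g r) = ennreal (indicator {0..w} r * f r + indicator {w..} r * g r)"
      by (rule ennreal_plus[symmetric]) (simp_all add: f_def g_def)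
    then show "ennreal (indicator {0<..} r * (r powr (- 2 * \<sigma>) * (r * w / (r + w))\<^sup>2 / r))
        \<le> ennreal (indicator {0..w} r * f r) + ennreal (indicator {w..} r * g r)"
      using ennreal_leI[OF pt[of r]] by simp
  qed
  also have "\<dots> = ennreal (w powr (2 - 2 * \<sigma>) / (2 - 2 * \<sigma>)) + ennreal (w powr (2 - 2 * \<sigma>) / (2 * \<sigma>))"
    unfolding n1[symmetric] n2[symmetric] by (rule nn_integral_add) (simp_all add: f_def g_def)
  also have "\<dots> = ennreal (w powr (2 - 2 * \<sigma>) / (2 - 2 * \<sigma>) + w powr (2 - 2 * \<sigma>) / (2 * \<sigma>))"
    using s by (intro ennreal_plus[symmetric]) auto
  also have "w powr (2 - 2 * \<sigma>) / (2 - 2 * \<sigma>) + w powr (2 - 2 * \<sigma>) / (2 * \<sigma>) = (1 / (2 - 2 * \<sigma>) + 1 / (2 * \<sigma>)) * w powr (2 - 2 * \<sigma>)"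
    by (simp add: distrib_right)
  finally show ?thesis .
qed

context sz_op
begin

text \<open>Lengths of the supports, as a mesh size attached to the basis functions.  The mean is used for the
  two functions at the ends, so that the cut-off with these coefficients is continuous on the closed
  curve.\<close>

definition len :: "int \<Rightarrow> real" where "len k = t (k + int p) - t (k - 1)"
definition \<eta> :: "int \<Rightarrow> real" where "\<eta> i = (if i = i0 \<or> i = i1 then (len i0 + len i1) / 2 else len i)"

text \<open>The support contains an element comparable to the cell and is contained in the patch of the cell.\<close>

lemma len_bounds:
  assumes J: "t (J - 1) < t J" and i: "i \<in> {J - int p..J}" and k: "k = i \<or> (i \<in> {i0, i1} \<and> k \<in> {i0, i1})"
  shows "param_width (t (J - 1), t J) / \<kappa> \<le> len k" "len k \<le> Cpatch * param_width (t (J - 1), t J)"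
proof -
  let ?I = "(t (J - 1), t J)"
  have I: "?I \<in> E" unfolding param_elements_iff using J by blast
  have le: "t (k - 1) \<le> t (k + int p)" by (rule monoD[OF mono_t]) simp
  show "param_width ?I / \<kappa> \<le> len k"
    using support_in_patch(2)[OF J i k, of "t (k - 1)"] le by (simp add: len_def param_width_def)
  have sub: "x \<in> PP ?I" if x: "x \<in> {t (k - 1)..<t (k + int p)}" for x
  proof -
    have "x \<in> {t (k - 1)..t (k + int p)}" using x by simp
    then have "\<gamma> x \<in> patch \<gamma> a K p (elem \<gamma> ?I)" by (rule support_in_patch(1)[OF J i k])
    moreover have "x \<in> {a..<b}" using x t_ge_a[of "k - 1"] t_le_b[of "k + int p"] by auto
    ultimately show ?thesis by (simp add: PP_def PS_def)
  qed
  have "len k = (LINT x|lborel. indicator {t (k - 1)..<t (k + int p)} x)" using le by (simp add: len_def)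
  also have "\<dots> \<le> (LINT x|lborel. indicator (PP ?I) x)"
  proof (rule integral_mono)
    show "integrable lborel (indicator {t (k - 1)..<t (k + int p)} :: real \<Rightarrow> real)"
      by (rule integrable_bounded_on[of _ 1 "t (k - 1)" "t (k + int p)"]) (auto simp: indicator_def)
    have "PP ?I \<subseteq> {a..<b}" by (auto simp: PP_def PS_def)
    then show "integrable lborel (indicator (PP ?I) :: real \<Rightarrow> real)"
      using PP_meas[OF I] by (intro integrable_bounded_on[of _ 1 a b]) (auto simp: indicator_def)
    show "indicator {t (k - 1)..<t (k + int p)} x \<le> (indicator (PP ?I) x :: real)" for x
    proof (cases "x \<in> {t (k - 1)..<t (k + int p)}")
      case True
      then show ?thesis using sub[OF True] by simp
    next
      case False
      show ?thesis unfolding indicator_simps(2)[OF False] by simp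
    qed
  qed
  also have "\<dots> \<le> Cpatch * param_width ?I" by (rule measure_PP[OF I])
  finally show "len k \<le> Cpatch * param_width ?I" .
qed

lemma \<eta>_bounds:
  assumes J: "t (J - 1) < t J" and i: "i \<in> {J - int p..J}"
  shows "param_width (t (J - 1), t J) / \<kappa> \<le> \<eta> i" "\<eta> i \<le> Cpatch * param_width (t (J - 1), t J)"
proof -
  have "param_width (t (J - 1), t J) / \<kappa> \<le> \<eta> i \<and> \<eta> i \<le> Cpatch * param_width (t (J - 1), t J)"
  proof (cases "i = i0 \<or> i = i1")
    case True
    note l0 = len_bounds[OF J i, of i0] and l1 = len_bounds[OF J i, of i1]
    have "\<eta> i = (len i0 + len i1) / 2" using True by (simp only: \<eta>_def if_True)
    then show ?thesis using l0 l1 True by simp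
  next
    case False
    then have "\<eta> i = len i" by (simp only: \<eta>_def if_False)
    then show ?thesis using len_bounds[OF J i, of i] by simp
  qed
  then show "param_width (t (J - 1), t J) / \<kappa> \<le> \<eta> i" "\<eta> i \<le> Cpatch * param_width (t (J - 1), t J)" by blast+
qed

definition cut :: "real \<Rightarrow> int \<Rightarrow> real" where "cut r i = \<eta> i / (r + \<eta> i)"

lemma cut_ends: "cut r i0 = cut r i1" by (simp add: cut_def \<eta>_def)

lemma cut_bounds:
  assumes J: "t (J - 1) < t J" and i: "i \<in> {J - int p..J}" and r: "0 < r"
  defines "h \<equiv> param_width (t (J - 1), t J)"
  shows "(cut r i)\<^sup>2 \<le> (Cpatch * (h / (r + h)))\<^sup>2" "(1 - cut r i)\<^sup>2 \<le> (\<kappa> * (r / (r + h)))\<^sup>2"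
proof -
  have h: "0 < h" using J by (simp add: h_def param_width_def)
  note e = \<eta>_bounds[OF J i, folded h_def]
  have e0: "0 < \<eta> i"
  proof -
    have "0 < h / \<kappa>" using h \<kappa>1 by simp
    then show ?thesis using e(1) by linarith
  qed
  have we: "h \<le> \<kappa> * \<eta> i" using e(1) \<kappa>1 by (simp add: pos_divide_le_eq mult.commute)
  have C1: "1 \<le> Cpatch" by (rule Cpatch_ge)
  show "(cut r i)\<^sup>2 \<le> (Cpatch * (h / (r + h)))\<^sup>2"
  proof (rule power_mono)
    have "\<eta> i * (r + h) \<le> (Cpatch * h) * (r + \<eta> i)"
    proof -
      have "\<eta> i * r \<le> Cpatch * h * r" using e(2) r by (intro mult_right_mono) auto
      moreover have "1 * (\<eta> i * h) \<le> Cpatch * (\<eta> i * h)" using C1 e0 h by (intro mult_right_mono) auto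
      ultimately show ?thesis by (simp add: algebra_simps)
    qed
    then have "\<eta> i / (r + \<eta> i) \<le> (Cpatch * h) / (r + h)" using e0 r h by (simp add: divide_simps)
    then show "cut r i \<le> Cpatch * (h / (r + h))" by (simp add: cut_def)
    show "0 \<le> cut r i" using e0 r by (simp add: cut_def)
  qed
  show "(1 - cut r i)\<^sup>2 \<le> (\<kappa> * (r / (r + h)))\<^sup>2"
  proof (rule power_mono)
    have eq: "1 - cut r i = r / (r + \<eta> i)" using e0 r by (simp add: cut_def field_simps)
    have "r * (r + h) \<le> (\<kappa> * r) * (r + \<eta> i)"
    proof -
      have "1 * (r * r) \<le> \<kappa> * (r * r)" using \<kappa>1 by (intro mult_right_mono) auto
      moreover have "r * h \<le> r * (\<kappa> * \<eta> i)" using we r by (intro mult_left_mono) auto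
      ultimately show ?thesis by (simp add: algebra_simps)
    qed
    then have "r / (r + \<eta> i) \<le> (\<kappa> * r) / (r + h)" using e0 r h by (simp add: divide_simps)
    then show "1 - cut r i \<le> \<kappa> * (r / (r + h))" unfolding eq by simp
    show "0 \<le> 1 - cut r i" unfolding eq using e0 r by simp
  qed
qed

text \<open>On an element of width \<open>h\<close> the coefficients are comparable to \<open>h / (r + h)\<close>.  The complementary bound follows
  since \<open>1 - spl c\<close> is the spline with the coefficients \<open>1 - c\<close>.\<close>

lemma cutoff_cell:
  assumes I: "I \<in> E" and x: "x \<in> cell I" and r: "0 < r"
  shows "(spl (cut r) x)\<^sup>2 \<le> (real p + 1)\<^sup>2 * (Cpatch * (param_width I / (r + param_width I)))\<^sup>2"
    "(1 - spl (cut r) x)\<^sup>2 \<le> (real p + 1)\<^sup>2 * (\<kappa> * (r / (r + param_width I)))\<^sup>2"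
    "(dspl (cut r) x)\<^sup>2 \<le> (real p + 1)\<^sup>2 * (Cpatch * (param_width I / (r + param_width I)))\<^sup>2 * (Cd / param_width I)\<^sup>2"
proof -
  obtain J where J: "I = (t (J - 1), t J)" "t (J - 1) < t J" using I unfolding param_elements_iff by blast
  have x': "t (J - 1) \<le> x" "x < t J" using x by (auto simp: J(1))
  have xab: "x \<in> {a..<b}" using cell_ab[OF I] x by blast
  note c = cut_bounds[OF J(2) _ r, folded J(1)]
  note s1 = spl_local_bounds[OF x', of "cut r", OF c(1)]
  show "(spl (cut r) x)\<^sup>2 \<le> (real p + 1)\<^sup>2 * (Cpatch * (param_width I / (r + param_width I)))\<^sup>2" by (rule s1(1))
  have w: "param_width I = t J - t (J - 1)" by (simp add: J(1) param_width_def)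
  show "(dspl (cut r) x)\<^sup>2 \<le> (real p + 1)\<^sup>2 * (Cpatch * (param_width I / (r + param_width I)))\<^sup>2 * (Cd / param_width I)\<^sup>2"
    using s1(2) by (simp only: w)
  have "1 - spl (cut r) x = spl (\<lambda>i. 1 - cut r i) x"
    using R_sum[OF xab] by (simp add: spl_def left_diff_distrib sum_subtractf)
  then show "(1 - spl (cut r) x)\<^sup>2 \<le> (real p + 1)\<^sup>2 * (\<kappa> * (r / (r + param_width I)))\<^sup>2"
    using spl_local_bounds(1)[OF x', of "\<lambda>i. 1 - cut r i", OF c(2)] by simp
qed

lemma K_functional_nonneg: "0 < r \<Longrightarrow> 0 \<le> K_functional \<gamma> a b r v"
  unfolding K_functional_def
proof (rule cINF_greatest)
  show "H1_space \<gamma> a b \<noteq> {}" using Jop_H1(1) by blast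
qed (use L2_norm_nonneg H1_norm_nonneg in simp)

lemma K_functional_le:
  assumes r: "0 < r" and z: "z \<in> H1_space \<gamma> a b"
  shows "(K_functional \<gamma> a b r v)\<^sup>2 \<le> 2 * (L2_norm \<gamma> a b \<Gamma> (\<lambda>x. v x - z x))\<^sup>2 + 2 * (r\<^sup>2 * (H1_norm \<gamma> a b z)\<^sup>2)"
proof -
  have "K_functional \<gamma> a b r v \<le> L2_norm \<gamma> a b \<Gamma> (\<lambda>x. v x - z x) + r * H1_norm \<gamma> a b z"
    unfolding K_functional_def image_Icc
  proof (rule cINF_lower[OF _ z])
    have "0 \<le> L2_norm \<gamma> a b \<Gamma> (\<lambda>x. v x - w x) + r * H1_norm \<gamma> a b w" for w
      using r L2_norm_nonneg H1_norm_nonneg by simp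
    then show "bdd_below ((\<lambda>w. L2_norm \<gamma> a b \<Gamma> (\<lambda>x. v x - w x) + r * H1_norm \<gamma> a b w) ` H1_space \<gamma> a b)"
      by (intro bdd_belowI2[of _ 0])
  qed
  then have "(K_functional \<gamma> a b r v)\<^sup>2 \<le> (L2_norm \<gamma> a b \<Gamma> (\<lambda>x. v x - z x) + r * H1_norm \<gamma> a b z)\<^sup>2"
    by (intro power_mono K_functional_nonneg[OF r])
  also have "\<dots> \<le> 2 * (L2_norm \<gamma> a b \<Gamma> (\<lambda>x. v x - z x))\<^sup>2 + 2 * (r * H1_norm \<gamma> a b z)\<^sup>2" by (rule add_sq_le)
  finally show ?thesis by (simp only: power_mult_distrib)
qed

definition CB :: real where
  "CB = 2 * (real p + 1)\<^sup>2 * (smax * (\<kappa>\<^sup>2 * CA) + smax * (Cpatch\<^sup>2 * CA * (b - a)\<^sup>2) + (Cpatch\<^sup>2 * (4 * (1 + CH) + 2 * Cd\<^sup>2 * CA)) / smin)"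

lemma CB_nonneg: "0 \<le> CB"
  unfolding CB_def using smax_pos smin_pos CA_nonneg CH_nonneg
  by (intro mult_nonneg_nonneg add_nonneg_nonneg divide_nonneg_pos) auto

text \<open>The competitor is \<open>z = (v - J v) * \<chi>\<close> with the cut-off \<open>\<chi> = spl (cut r)\<close>.  On an element, \<open>v - J v\<close> is of size
  \<open>h * \<parallel>v'\<parallel>\<close>, and the factors \<open>1 - \<chi>\<close>, \<open>r * \<chi>\<close> and \<open>r * \<chi>'\<close> are bounded by \<open>r / (r + h)\<close>, \<open>r * h / (r + h)\<close>
  and \<open>r / (r + h)\<close>.  So each of \<open>(v - J v) - z\<close>, \<open>r * z\<close> and \<open>r * z'\<close> is of the size
  \<open>r * h / (r + h) * \<parallel>v'\<parallel>\<close>.\<close>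

lemma K_functional_err:
  assumes v: "v \<in> H1_space \<gamma> a b" and u': "u' = (\<lambda>t. \<rho> t * pull (arclength_derivative \<gamma> a b v) t)" and r: "0 < r"
  shows "(K_functional \<gamma> a b r (err v))\<^sup>2 \<le> CB * (\<Sum>I\<in>E. (r * param_width I / (r + param_width I))\<^sup>2 * nsq (PP I) u')"
proof -
  define P where "P = (real p + 1)\<^sup>2"
  have P: "0 \<le> P" by (simp add: P_def)
  define q where "q I = (r * param_width I / (r + param_width I))\<^sup>2" for I
  define G where "G I = nsq (PP I) u'" for I
  have q: "0 \<le> q I" and G: "0 \<le> G I" for I by (simp_all add: q_def G_def nsq_nonneg)
  define y' where "y' = (\<lambda>t. u' t - dspl (coef (pull v)) t)"
  obtain y where y: "periodic_ac a b y y'" and yae: "AE t in lborel. t \<in> {a..<b} \<longrightarrow> err v (\<gamma> t) = y t"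
    using err_H1[OF v u'] unfolding y'_def by blast
  note Y = periodic_acD[OF y]
  let ?s = "\<lambda>x. if x < b then spl (cut r) x else cut r i1"
  have s: "periodic_ac a b ?s (dspl (cut r))" by (rule spl_periodic_ac[OF cut_ends])
  note yz = periodic_ac_mult[OF y s ab]
  have eL: "err v \<in> L2_space \<gamma> a b" by (rule err_L2[OF H1_D(1)[OF v]])
  note EL = L2_D[OF eL]
  define z where "z x = err v x * spl (cut r) (\<tau> x)" for x
  have zm: "z \<in> borel_measurable \<mu>"
    unfolding z_def[abs_def] by (intro borel_measurable_times EL(1) push_measurable spl_measurable)
  have zae: "AE t in lborel. t \<in> {a..<b} \<longrightarrow> z (\<gamma> t) = y t * ?s t"
    using yae by eventually_elim (auto simp: z_def \<tau>_\<gamma>)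
  have zH: "z \<in> H1_space \<gamma> a b" by (rule H1_I(1)[OF zm yz zae])
  have zL: "z \<in> L2_space \<gamma> a b" by (rule H1_D(1)[OF zH])
  define z' where "z' t = indicator {a..<b} t * (y' t * spl (cut r) t + pull (err v) t * dspl (cut r) t)" for t
  have [measurable]: "y' \<in> borel_measurable borel" "pull (err v) \<in> borel_measurable borel" by (rule Y(1), rule EL(2))
  have z'm: "z' \<in> borel_measurable borel" unfolding z'_def[abs_def] by measurable
  \<comment> \<open>the representative \<open>y\<close> is replaced by the error itself, whose norms are known\<close>
  have z'ae: "AE t in lborel. z' t = \<rho> t * pull (arclength_derivative \<gamma> a b z) t"
    using H1_I(2)[OF zm yz zae] yae
  proof eventually_elim
    case (elim t)
    then show ?case by (cases "t \<in> {a..<b}") (simp_all add: z'_def pull_def)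
  qed
  have z'2: "integrable lborel (\<lambda>t. (z' t)\<^sup>2)"
    by (rule derivative_norm_bounds(3)[OF \<Gamma>_meas H1_D(2)[OF zH] z'ae z'm])
  have dL: "(\<lambda>x. err v x - z x) \<in> L2_space \<gamma> a b" by (rule diff_L2[OF eL zL])
  have pz: "pull z x = pull (err v) x * spl (cut r) x" if "x \<in> {a..<b}" for x
    using that by (simp add: pull_def z_def \<tau>_\<gamma>)
  have pd: "pull (\<lambda>x. err v x - z x) x = pull (err v) x * (1 - spl (cut r) x)" if "x \<in> {a..<b}" for x
    using that by (simp add: pull_def z_def \<tau>_\<gamma> algebra_simps)
  have ei: "integrable lborel (\<lambda>x. indicator (cell I) x * (pull (err v) x)\<^sup>2)" for I
    by (rule integrable_indicator_mult[OF EL(3)]) simp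
  have yi: "integrable lborel (\<lambda>x. indicator (cell I) x * (y' x)\<^sup>2)" for I
    by (rule integrable_indicator_mult[OF Y(2)]) simp
  have loc: "nsq (cell I) (pull (\<lambda>x. err v x - z x)) \<le> P * (\<kappa>\<^sup>2 * CA) * (q I * G I)
      \<and> r\<^sup>2 * nsq (cell I) (pull z) \<le> P * (Cpatch\<^sup>2 * CA * (b - a)\<^sup>2) * (q I * G I)
      \<and> r\<^sup>2 * nsq (cell I) z' \<le> P * (Cpatch\<^sup>2 * (4 * (1 + CH) + 2 * Cd\<^sup>2 * CA)) * (q I * G I)" if I: "I \<in> E" for I
  proof -
    define h where "h = param_width I"
    have h: "0 < h" using width_pos[OF I] by (simp add: h_def)
    have hab: "h\<^sup>2 \<le> (b - a)\<^sup>2" using E_bounds[OF I] h by (intro power_mono) (auto simp: h_def param_width_def)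
    have qI: "q I = (r * h / (r + h))\<^sup>2" by (simp add: q_def h_def)
    note cc = cutoff_cell[OF I _ r, folded h_def P_def]
    have e: "nsq (cell I) (pull (err v)) \<le> CA * h\<^sup>2 * G I" using err_local[OF v I u'] by (simp only: h_def G_def)
    have d: "nsq (cell I) y' \<le> 2 * (1 + CH) * G I" using err_derivative_local[OF v I u'] by (simp only: y'_def G_def)
    have "nsq (cell I) (pull (\<lambda>x. err v x - z x)) \<le> P * (\<kappa> * (r / (r + h)))\<^sup>2 * nsq (cell I) (pull (err v))"
    proof (rule nsq_mult_le[OF ei AE_I2], intro impI)
      fix x assume x: "x \<in> cell I"
      then have "x \<in> {a..<b}" using cell_ab[OF I] by blast
      then show "(pull (\<lambda>x. err v x - z x) x)\<^sup>2 \<le> P * (\<kappa> * (r / (r + h)))\<^sup>2 * (pull (err v) x)\<^sup>2"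
        using mult_right_mono[OF cc(2)[OF x], of "(pull (err v) x)\<^sup>2"] by (simp add: pd power_mult_distrib mult.commute)
    qed (simp add: P)
    also have "\<dots> \<le> P * (\<kappa> * (r / (r + h)))\<^sup>2 * (CA * h\<^sup>2 * G I)" using P by (intro mult_left_mono e) simp
    also have "\<dots> = P * (\<kappa>\<^sup>2 * CA) * (q I * G I)" by (simp add: qI power_mult_distrib power_divide)
    finally have 1: "nsq (cell I) (pull (\<lambda>x. err v x - z x)) \<le> P * (\<kappa>\<^sup>2 * CA) * (q I * G I)" .
    have "nsq (cell I) (pull z) \<le> P * (Cpatch * (h / (r + h)))\<^sup>2 * nsq (cell I) (pull (err v))"
    proof (rule nsq_mult_le[OF ei AE_I2], intro impI)
      fix x assume x: "x \<in> cell I"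
      then have "x \<in> {a..<b}" using cell_ab[OF I] by blast
      then show "(pull z x)\<^sup>2 \<le> P * (Cpatch * (h / (r + h)))\<^sup>2 * (pull (err v) x)\<^sup>2"
        using mult_right_mono[OF cc(1)[OF x], of "(pull (err v) x)\<^sup>2"] by (simp add: pz power_mult_distrib mult.commute)
    qed (simp add: P)
    also have "\<dots> \<le> P * (Cpatch * (h / (r + h)))\<^sup>2 * (CA * (b - a)\<^sup>2 * G I)"
    proof (intro mult_left_mono order_trans[OF e])
      show "CA * h\<^sup>2 * G I \<le> CA * (b - a)\<^sup>2 * G I" using CA_nonneg G by (intro mult_right_mono mult_left_mono hab)
    qed (simp add: P)
    finally have "r\<^sup>2 * nsq (cell I) (pull z) \<le> r\<^sup>2 * (P * (Cpatch * (h / (r + h)))\<^sup>2 * (CA * (b - a)\<^sup>2 * G I))"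
      by (intro mult_left_mono) auto
    also have "\<dots> = P * (Cpatch\<^sup>2 * CA * (b - a)\<^sup>2) * (q I * G I)" by (simp add: qI power_mult_distrib power_divide)
    finally have 2: "r\<^sup>2 * nsq (cell I) (pull z) \<le> P * (Cpatch\<^sup>2 * CA * (b - a)\<^sup>2) * (q I * G I)" .
    have "nsq (cell I) z' \<le> 2 * (P * (Cpatch * (h / (r + h)))\<^sup>2) * nsq (cell I) y'
        + 2 * (P * (Cpatch * (h / (r + h)))\<^sup>2 * (Cd / h)\<^sup>2) * nsq (cell I) (pull (err v))"
    proof (rule nsq_add_le[OF yi ei])
      fix x assume x: "x \<in> cell I"
      then have xab: "x \<in> {a..<b}" using cell_ab[OF I] by blast
      have "(z' x)\<^sup>2 = (y' x * spl (cut r) x + pull (err v) x * dspl (cut r) x)\<^sup>2"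
        unfolding z'_def indicator_simps(1)[OF xab] by simp
      also have "\<dots> \<le> 2 * (y' x * spl (cut r) x)\<^sup>2 + 2 * (pull (err v) x * dspl (cut r) x)\<^sup>2" by (rule add_sq_le)
      also have "\<dots> = 2 * ((spl (cut r) x)\<^sup>2 * (y' x)\<^sup>2) + 2 * ((dspl (cut r) x)\<^sup>2 * (pull (err v) x)\<^sup>2)"
        by (simp only: power_mult_distrib mult.commute)
      also have "\<dots> \<le> 2 * (P * (Cpatch * (h / (r + h)))\<^sup>2 * (y' x)\<^sup>2) + 2 * (P * (Cpatch * (h / (r + h)))\<^sup>2 * (Cd / h)\<^sup>2 * (pull (err v) x)\<^sup>2)"
        by (intro add_mono mult_left_mono mult_right_mono cc(1)[OF x] cc(3)[OF x]) auto
      finally show "(z' x)\<^sup>2 \<le> 2 * (P * (Cpatch * (h / (r + h)))\<^sup>2) * (y' x)\<^sup>2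
        + 2 * (P * (Cpatch * (h / (r + h)))\<^sup>2 * (Cd / h)\<^sup>2) * (pull (err v) x)\<^sup>2" by (simp only: mult.assoc)
    qed (simp_all add: P)
    also have "\<dots> \<le> 2 * (P * (Cpatch * (h / (r + h)))\<^sup>2) * (2 * (1 + CH) * G I)
        + 2 * (P * (Cpatch * (h / (r + h)))\<^sup>2 * (Cd / h)\<^sup>2) * (CA * h\<^sup>2 * G I)"
      by (intro add_mono mult_left_mono e d) (simp_all add: P)
    finally have "r\<^sup>2 * nsq (cell I) z' \<le> r\<^sup>2 * (2 * (P * (Cpatch * (h / (r + h)))\<^sup>2) * (2 * (1 + CH) * G I)
        + 2 * (P * (Cpatch * (h / (r + h)))\<^sup>2 * (Cd / h)\<^sup>2) * (CA * h\<^sup>2 * G I))"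
      by (intro mult_left_mono) auto
    also have "\<dots> = P * (Cpatch\<^sup>2 * (4 * (1 + CH) + 2 * Cd\<^sup>2 * CA)) * (q I * G I)"
    proof -
      have e1: "r\<^sup>2 * (Cpatch * (h / (r + h)))\<^sup>2 = Cpatch\<^sup>2 * q I" by (simp add: qI power_mult_distrib power_divide)
      have e2: "(Cd / h)\<^sup>2 * h\<^sup>2 = Cd\<^sup>2" using h by (simp add: power_divide)
      have "r\<^sup>2 * (2 * (P * (Cpatch * (h / (r + h)))\<^sup>2) * (2 * (1 + CH) * G I)
          + 2 * (P * (Cpatch * (h / (r + h)))\<^sup>2 * (Cd / h)\<^sup>2) * (CA * h\<^sup>2 * G I))
        = P * (r\<^sup>2 * (Cpatch * (h / (r + h)))\<^sup>2) * (4 * (1 + CH) + 2 * ((Cd / h)\<^sup>2 * h\<^sup>2) * CA) * G I"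
        by (simp add: algebra_simps)
      also have "\<dots> = P * (Cpatch\<^sup>2 * (4 * (1 + CH) + 2 * Cd\<^sup>2 * CA)) * (q I * G I)"
        unfolding e1 e2 by (simp only: ac_simps)
      finally show ?thesis .
    qed
    finally have 3: "r\<^sup>2 * nsq (cell I) z' \<le> P * (Cpatch\<^sup>2 * (4 * (1 + CH) + 2 * Cd\<^sup>2 * CA)) * (q I * G I)" .
    show ?thesis using 1 2 3 by blast
  qed
  define Q where "Q = (\<Sum>I\<in>E. q I * G I)"
  have n1: "(L2_norm \<gamma> a b \<Gamma> (\<lambda>x. err v x - z x))\<^sup>2 \<le> smax * (P * (\<kappa>\<^sup>2 * CA) * Q)"
  proof (rule order_trans[OF norm_\<Gamma>(2)[OF dL]], rule mult_left_mono)
    show "nsq {a..<b} (pull (\<lambda>x. err v x - z x)) \<le> P * (\<kappa>\<^sup>2 * CA) * Q"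
      unfolding nsq_total[OF L2_D(3)[OF dL]] Q_def sum_distrib_left by (rule sum_mono) (use loc in blast)
  qed (use smax_pos in simp)
  have n2: "r\<^sup>2 * (L2_norm \<gamma> a b \<Gamma> z)\<^sup>2 \<le> smax * (P * (Cpatch\<^sup>2 * CA * (b - a)\<^sup>2) * Q)"
  proof -
    have "r\<^sup>2 * (L2_norm \<gamma> a b \<Gamma> z)\<^sup>2 \<le> r\<^sup>2 * (smax * nsq {a..<b} (pull z))" by (intro mult_left_mono norm_\<Gamma>(2)[OF zL]) simp
    also have "\<dots> = smax * (\<Sum>I\<in>E. r\<^sup>2 * nsq (cell I) (pull z))"
      unfolding nsq_total[OF L2_D(3)[OF zL]] by (simp only: sum_distrib_left[symmetric] mult.left_commute)
    also have "\<dots> \<le> smax * (P * (Cpatch\<^sup>2 * CA * (b - a)\<^sup>2) * Q)"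
    proof (rule mult_left_mono)
      show "(\<Sum>I\<in>E. r\<^sup>2 * nsq (cell I) (pull z)) \<le> P * (Cpatch\<^sup>2 * CA * (b - a)\<^sup>2) * Q"
        unfolding Q_def sum_distrib_left by (rule sum_mono) (use loc in blast)
    qed (use smax_pos in simp)
    finally show ?thesis .
  qed
  have n3: "r\<^sup>2 * (H1_seminorm \<gamma> a b \<Gamma> z)\<^sup>2 \<le> (P * (Cpatch\<^sup>2 * (4 * (1 + CH) + 2 * Cd\<^sup>2 * CA)) * Q) / smin"
  proof -
    have "smin * (H1_seminorm \<gamma> a b \<Gamma> z)\<^sup>2 \<le> nsq {a..<b} z'" by (rule seminorm_\<Gamma>(1)[OF zH z'ae z'm])
    then have "r\<^sup>2 * (smin * (H1_seminorm \<gamma> a b \<Gamma> z)\<^sup>2) \<le> r\<^sup>2 * nsq {a..<b} z'" by (intro mult_left_mono) auto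
    also have "\<dots> = (\<Sum>I\<in>E. r\<^sup>2 * nsq (cell I) z')" unfolding nsq_total[OF z'2] by (rule sum_distrib_left)
    also have "\<dots> \<le> P * (Cpatch\<^sup>2 * (4 * (1 + CH) + 2 * Cd\<^sup>2 * CA)) * Q"
      unfolding Q_def sum_distrib_left[of "P * (Cpatch\<^sup>2 * (4 * (1 + CH) + 2 * Cd\<^sup>2 * CA))"] by (rule sum_mono) (use loc in blast)
    finally show ?thesis using smin_pos by (simp only: pos_le_divide_eq mult.left_commute mult.commute[of _ smin])
  qed
  have "(K_functional \<gamma> a b r (err v))\<^sup>2
     \<le> 2 * (L2_norm \<gamma> a b \<Gamma> (\<lambda>x. err v x - z x))\<^sup>2 + 2 * (r\<^sup>2 * (H1_norm \<gamma> a b z)\<^sup>2)" by (rule K_functional_le[OF r zH])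
  also have "\<dots> = 2 * ((L2_norm \<gamma> a b \<Gamma> (\<lambda>x. err v x - z x))\<^sup>2 + (r\<^sup>2 * (L2_norm \<gamma> a b \<Gamma> z)\<^sup>2 + r\<^sup>2 * (H1_seminorm \<gamma> a b \<Gamma> z)\<^sup>2))"
    unfolding H1_norm_sq by (simp only: distrib_left)
  also have "\<dots> \<le> 2 * (smax * (P * (\<kappa>\<^sup>2 * CA) * Q) + (smax * (P * (Cpatch\<^sup>2 * CA * (b - a)\<^sup>2) * Q)
      + (P * (Cpatch\<^sup>2 * (4 * (1 + CH) + 2 * Cd\<^sup>2 * CA)) * Q) / smin))"
    by (intro mult_left_mono add_mono n1 n2 n3) simp
  also have "\<dots> = CB * Q"
  proof -
    have alg: "2 * (s * (P * A * Q) + (s * (P * B * Q) + (P * C * Q) / m)) = 2 * P * (s * A + s * B + C / m) * Q" for s A B C m :: real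
      by (simp add: distrib_left distrib_right ac_simps)
    show ?thesis unfolding CB_def P_def[symmetric] by (rule alg)
  qed
  finally show ?thesis by (simp only: Q_def q_def G_def)
qed

lemma interpolated_error_norm:
  assumes v: "v \<in> H1_space \<gamma> a b" and u': "u' = (\<lambda>t. \<rho> t * pull (arclength_derivative \<gamma> a b v) t)"
    and s: "0 < \<sigma>" "\<sigma> < 1"
  shows "err v \<in> Hs_space \<gamma> a b \<sigma>"
    "(Hs_norm \<gamma> a b \<sigma> (err v))\<^sup>2 \<le> CB * (1 / (2 - 2 * \<sigma>) + 1 / (2 * \<sigma>)) * (\<Sum>I\<in>E. param_width I powr (2 - 2 * \<sigma>) * nsq (PP I) u')"
proof -
  define c where "c = 1 / (2 - 2 * \<sigma>) + 1 / (2 * \<sigma>)"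
  have c: "0 \<le> c" using s by (simp add: c_def)
  define G where "G I = nsq (PP I) u'" for I
  have G: "0 \<le> G I" for I by (simp add: G_def nsq_nonneg)
  define k where "k I r = indicator {0<..} r * (r powr (- 2 * \<sigma>) * (r * param_width I / (r + param_width I))\<^sup>2 / r)" for I r
  have k: "0 \<le> k I r" for I r by (cases "0 < r") (simp_all add: k_def)
  have [measurable]: "k I \<in> borel_measurable borel" for I unfolding k_def[abs_def] by measurable
  have CG: "0 \<le> CB * G I" for I using CB_nonneg G by simp
  have pt: "ennreal ((r powr (-\<sigma>) * K_functional \<gamma> a b r (err v))\<^sup>2 / r) * indicator {0<..} r
      \<le> (\<Sum>I\<in>E. ennreal (CB * G I) * ennreal (k I r))" for r
  proof (cases "0 < r")
    case True
    have rr: "(r powr (-\<sigma>))\<^sup>2 = r powr (- 2 * \<sigma>)" using True by (simp add: powr_power)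
    have "(r powr (-\<sigma>) * K_functional \<gamma> a b r (err v))\<^sup>2 / r = r powr (- 2 * \<sigma>) / r * (K_functional \<gamma> a b r (err v))\<^sup>2"
      by (simp add: power_mult_distrib rr)
    also have "\<dots> \<le> r powr (- 2 * \<sigma>) / r * (CB * (\<Sum>I\<in>E. (r * param_width I / (r + param_width I))\<^sup>2 * G I))"
      unfolding G_def using True by (intro mult_left_mono K_functional_err[OF v u']) auto
    also have "\<dots> = (\<Sum>I\<in>E. CB * G I * k I r)"
      unfolding sum_distrib_left by (rule sum.cong[OF refl]) (use True in \<open>simp add: k_def\<close>)
    finally have "ennreal ((r powr (-\<sigma>) * K_functional \<gamma> a b r (err v))\<^sup>2 / r) \<le> ennreal (\<Sum>I\<in>E. CB * G I * k I r)" by (rule ennreal_leI)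
    also have "\<dots> = (\<Sum>I\<in>E. ennreal (CB * G I * k I r))" by (intro sum_ennreal[symmetric] mult_nonneg_nonneg CG k)
    also have "\<dots> = (\<Sum>I\<in>E. ennreal (CB * G I) * ennreal (k I r))" by (intro sum.cong refl ennreal_mult CG k)
    finally show ?thesis using True by simp
  qed simp
  define T where "T = (\<Sum>I\<in>E. param_width I powr (2 - 2 * \<sigma>) * G I)"
  have T: "0 \<le> T" unfolding T_def by (intro sum_nonneg mult_nonneg_nonneg G) simp
  have "K_method_integral \<gamma> a b \<sigma> (err v) \<le> (\<integral>\<^sup>+ r. (\<Sum>I\<in>E. ennreal (CB * G I) * ennreal (k I r)) \<partial>lborel)"
    unfolding K_method_integral_def by (intro nn_integral_mono pt)
  also have "\<dots> = (\<Sum>I\<in>E. \<integral>\<^sup>+ r. ennreal (CB * G I) * ennreal (k I r) \<partial>lborel)"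
    by (rule nn_integral_sum) measurable
  also have "\<dots> = (\<Sum>I\<in>E. ennreal (CB * G I) * (\<integral>\<^sup>+ r. ennreal (k I r) \<partial>lborel))"
    by (intro sum.cong refl nn_integral_cmult) measurable
  also have "\<dots> \<le> (\<Sum>I\<in>E. ennreal (CB * G I) * ennreal (c * param_width I powr (2 - 2 * \<sigma>)))"
    unfolding k_def c_def by (intro sum_mono mult_left_mono kernel_integral width_pos s) auto
  also have "\<dots> = (\<Sum>I\<in>E. ennreal (CB * G I * (c * param_width I powr (2 - 2 * \<sigma>))))"
    using c by (intro sum.cong refl ennreal_mult[symmetric] CG) simp
  also have "\<dots> = ennreal (\<Sum>I\<in>E. CB * G I * (c * param_width I powr (2 - 2 * \<sigma>)))"
    using c by (intro sum_ennreal mult_nonneg_nonneg[OF CG]) simp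
  also have "(\<Sum>I\<in>E. CB * G I * (c * param_width I powr (2 - 2 * \<sigma>))) = CB * c * T"
    unfolding T_def sum_distrib_left by (intro sum.cong refl) (simp only: ac_simps)
  finally have le: "K_method_integral \<gamma> a b \<sigma> (err v) \<le> ennreal (CB * c * T)" .
  then have "K_method_integral \<gamma> a b \<sigma> (err v) < \<infinity>" by (rule order_le_less_trans) simp
  then show "err v \<in> Hs_space \<gamma> a b \<sigma>" using s err_L2[OF H1_D(1)[OF v]] by (simp add: Hs_space_def)
  have "enn2real (K_method_integral \<gamma> a b \<sigma> (err v)) \<le> CB * c * T"
    using le CB_nonneg c T by (intro enn2real_leI) auto
  then show "(Hs_norm \<gamma> a b \<sigma> (err v))\<^sup>2 \<le> CB * (1 / (2 - 2 * \<sigma>) + 1 / (2 * \<sigma>)) * (\<Sum>I\<in>E. param_width I powr (2 - 2 * \<sigma>) * nsq (PP I) u')"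
    unfolding Hs_norm_sq[OF s] T_def c_def G_def .
qed

definition Cx :: "real \<Rightarrow> real" where
  "Cx \<sigma> = (if \<sigma> = 0 then smax * CA else if \<sigma> = 1 then smax * (CA * (b - a)\<^sup>2) + 2 * (1 + CH) / smin
     else CB * (1 / (2 - 2 * \<sigma>) + 1 / (2 * \<sigma>)))"

lemma Cx_nonneg: "0 \<le> \<sigma> \<Longrightarrow> \<sigma> \<le> 1 \<Longrightarrow> 0 \<le> Cx \<sigma>"
  using smax_pos smin_pos CA_nonneg CH_nonneg CB_nonneg by (simp add: Cx_def)

text \<open>The three definitions of the \<open>H\<^sup>\<sigma>\<close> norm are treated separately.  The constant depends on \<open>\<sigma>\<close> and grows without
  bound near the end points, because the interpolation norm is not normalized.\<close>

lemma error_norm: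
  assumes v: "v \<in> H1_space \<gamma> a b" and u': "u' = (\<lambda>t. \<rho> t * pull (arclength_derivative \<gamma> a b v) t)"
    and s: "0 \<le> \<sigma>" "\<sigma> \<le> 1"
  shows "err v \<in> Hs_space \<gamma> a b \<sigma>"
    "(Hs_norm \<gamma> a b \<sigma> (err v))\<^sup>2 \<le> Cx \<sigma> * (\<Sum>I\<in>E. param_width I powr (2 - 2 * \<sigma>) * nsq (PP I) u')"
proof -
  have eL: "err v \<in> L2_space \<gamma> a b" by (rule err_L2[OF H1_D(1)[OF v]])
  define y' where "y' = (\<lambda>t. u' t - dspl (coef (pull v)) t)"
  obtain y where y: "periodic_ac a b y y'" and eH: "err v \<in> H1_space \<gamma> a b"
    and yae: "AE t in lborel. y' t = \<rho> t * pull (arclength_derivative \<gamma> a b (err v)) t"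
    using err_H1[OF v u'] unfolding y'_def by blast
  note Y = periodic_acD[OF y]
  have "err v \<in> Hs_space \<gamma> a b \<sigma> \<and>
    (Hs_norm \<gamma> a b \<sigma> (err v))\<^sup>2 \<le> Cx \<sigma> * (\<Sum>I\<in>E. param_width I powr (2 - 2 * \<sigma>) * nsq (PP I) u')"
  proof -
    consider "\<sigma> = 0" | "\<sigma> = 1" | "0 < \<sigma>" "\<sigma> < 1" using s by linarith
    then show ?thesis
    proof cases
      case 1
      have "(L2_norm \<gamma> a b \<Gamma> (err v))\<^sup>2 \<le> smax * nsq {a..<b} (pull (err v))" by (rule norm_\<Gamma>(2)[OF eL])
      also have "\<dots> \<le> smax * (\<Sum>I\<in>E. CA * (param_width I)\<^sup>2 * nsq (PP I) u')"
        unfolding nsq_total[OF L2_D(3)[OF eL]] using smax_pos by (intro mult_left_mono sum_mono err_local[OF v _ u']) auto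
      also have "\<dots> = smax * CA * (\<Sum>I\<in>E. param_width I powr 2 * nsq (PP I) u')"
        unfolding sum_distrib_left by (intro sum.cong refl) (simp add: less_imp_le[OF width_pos] powr_numeral)
      finally show ?thesis using 1 eL by (simp add: Hs_norm_def Hs_space_def image_Icc Cx_def)
    next
      case 2
      have one: "(\<Sum>I\<in>E. param_width I powr 0 * nsq (PP I) u') = (\<Sum>I\<in>E. nsq (PP I) u')"
      proof (rule sum.cong[OF refl])
        fix I assume "I \<in> E"
        then have "0 < param_width I" by (rule width_pos)
        then show "param_width I powr 0 * nsq (PP I) u' = nsq (PP I) u'" by simp
      qed
      have "(L2_norm \<gamma> a b \<Gamma> (err v))\<^sup>2 \<le> smax * nsq {a..<b} (pull (err v))" by (rule norm_\<Gamma>(2)[OF eL])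
      also have "\<dots> \<le> smax * (\<Sum>I\<in>E. CA * (b - a)\<^sup>2 * nsq (PP I) u')"
        unfolding nsq_total[OF L2_D(3)[OF eL]]
      proof (intro mult_left_mono sum_mono)
        fix I assume I: "I \<in> E"
        have "(param_width I)\<^sup>2 \<le> (b - a)\<^sup>2"
          using E_bounds[OF I] less_imp_le[OF width_pos[OF I]] by (intro power_mono) (auto simp: param_width_def)
        then have "CA * (param_width I)\<^sup>2 * nsq (PP I) u' \<le> CA * (b - a)\<^sup>2 * nsq (PP I) u'"
          using CA_nonneg nsq_nonneg by (intro mult_right_mono mult_left_mono) auto
        then show "nsq (cell I) (pull (err v)) \<le> CA * (b - a)\<^sup>2 * nsq (PP I) u'" using err_local[OF v I u'] by linarith
      qed (use smax_pos in simp)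
      also have "\<dots> = smax * (CA * (b - a)\<^sup>2) * (\<Sum>I\<in>E. nsq (PP I) u')"
        by (simp only: sum_distrib_left[symmetric] mult.assoc)
      finally have l: "(L2_norm \<gamma> a b \<Gamma> (err v))\<^sup>2 \<le> smax * (CA * (b - a)\<^sup>2) * (\<Sum>I\<in>E. nsq (PP I) u')" .
      have "smin * (H1_seminorm \<gamma> a b \<Gamma> (err v))\<^sup>2 \<le> nsq {a..<b} y'" by (rule seminorm_\<Gamma>(1)[OF eH yae Y(1)])
      also have "\<dots> \<le> (\<Sum>I\<in>E. 2 * (1 + CH) * nsq (PP I) u')"
        unfolding nsq_total[OF Y(2)] unfolding y'_def by (intro sum_mono err_derivative_local[OF v _ u'])
      also have "\<dots> = 2 * (1 + CH) * (\<Sum>I\<in>E. nsq (PP I) u')" by (rule sum_distrib_left[symmetric])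
      finally have h: "(H1_seminorm \<gamma> a b \<Gamma> (err v))\<^sup>2 \<le> 2 * (1 + CH) / smin * (\<Sum>I\<in>E. nsq (PP I) u')"
        using smin_pos by (simp add: pos_le_divide_eq mult.commute)
      show ?thesis using 2 eH l h one by (simp add: Hs_norm_def Hs_space_def H1_norm_sq Cx_def distrib_right)
    next
      case 3
      then show ?thesis using interpolated_error_norm[OF v u' 3] by (simp add: Cx_def)
    qed
  qed
  then show "err v \<in> Hs_space \<gamma> a b \<sigma>"
    "(Hs_norm \<gamma> a b \<sigma> (err v))\<^sup>2 \<le> Cx \<sigma> * (\<Sum>I\<in>E. param_width I powr (2 - 2 * \<sigma>) * nsq (PP I) u')" by blast+
qed

definition Cb :: "real \<Rightarrow> real" where "Cb \<sigma> = Cx \<sigma> * CO * (smax\<^sup>2 / (smin * smin powr (2 - 2 * \<sigma>)))"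

text \<open>The sum over the patches is reduced to a sum over elements by the finite overlap, and then written with the
  mesh width function.\<close>

lemma approximation_high:
  assumes v: "v \<in> H1_space \<gamma> a b" and s: "0 \<le> \<sigma>" "\<sigma> \<le> 1"
  shows "err v \<in> Hs_space \<gamma> a b \<sigma>"
    "(Hs_norm \<gamma> a b \<sigma> (err v))\<^sup>2
      \<le> Cb \<sigma> * (L2_norm \<gamma> a b \<Gamma> (\<lambda>x. mesh_width \<gamma> a b K x powr (1 - \<sigma>) * arclength_derivative \<gamma> a b v x))\<^sup>2"
proof -
  define g where "g = arclength_derivative \<gamma> a b v"
  define u' where "u' = (\<lambda>t. \<rho> t * pull (arclength_derivative \<gamma> a b v) t)"
  show "err v \<in> Hs_space \<gamma> a b \<sigma>" by (rule error_norm(1)[OF v u'_def s])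
  have gL: "g \<in> L2_space \<gamma> a b" unfolding g_def by (rule H1_D(2)[OF v])
  note GL = L2_D[OF gL]
  have um: "u' \<in> borel_measurable borel" using GL(2) unfolding u'_def g_def by measurable
  have u2: "integrable lborel (\<lambda>t. (u' t)\<^sup>2)"
    by (rule derivative_norm_bounds(3)[OF \<Gamma>_meas H1_D(2)[OF v] _ um]) (simp add: u'_def)
  let ?S = "\<Sum>I\<in>E. param_width I powr (2 - 2 * \<sigma>) * nsq (cell I) u'"
  let ?R = "(L2_norm \<gamma> a b \<Gamma> (\<lambda>x. mesh_width \<gamma> a b K x powr (1 - \<sigma>) * g x))\<^sup>2"
  define d where "d = smin * smin powr (2 - 2 * \<sigma>)"
  have d: "0 < d" using smin_pos by (simp add: d_def)
  have "d * ?S \<le> smax\<^sup>2 * ?R"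
  proof -
    have "d * ?S \<le> smax\<^sup>2 * (smin * (\<Sum>I\<in>E. (elem_length \<gamma> a b I powr (1 - \<sigma>))\<^sup>2 * nsq (cell I) (pull g)))"
      unfolding sum_distrib_left
    proof (rule sum_mono)
      fix I assume I: "I \<in> E"
      have w: "0 < param_width I" by (rule width_pos[OF I])
      have p: "0 < smin * param_width I" using smin_pos w by simp
      have l: "0 < elem_length \<gamma> a b I" using elem_length_bounds(1)[OF I] p by linarith
      have "smin powr (2 - 2 * \<sigma>) * param_width I powr (2 - 2 * \<sigma>) = (smin * param_width I) powr (2 - 2 * \<sigma>)"
        by (rule powr_mult[symmetric])
      also have "\<dots> \<le> elem_length \<gamma> a b I powr (2 - 2 * \<sigma>)"
        using elem_length_bounds(1)[OF I] p s by (intro powr_mono2) auto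
      also have "\<dots> = (elem_length \<gamma> a b I powr (1 - \<sigma>))\<^sup>2" using l by (simp add: powr_power)
      finally have 1: "smin powr (2 - 2 * \<sigma>) * param_width I powr (2 - 2 * \<sigma>) \<le> (elem_length \<gamma> a b I powr (1 - \<sigma>))\<^sup>2" .
      have 2: "nsq (cell I) u' \<le> smax\<^sup>2 * nsq (cell I) (pull g)"
      proof (rule nsq_mult_le[OF _ AE_I2])
        show "integrable lborel (\<lambda>x. indicator (cell I) x * (pull g x)\<^sup>2)" by (rule integrable_indicator_mult[OF GL(3)]) simp
        show "x \<in> cell I \<longrightarrow> (u' x)\<^sup>2 \<le> smax\<^sup>2 * (pull g x)\<^sup>2" for x
          using power_mono[OF \<rho>_bounds(2,1), of x 2] by (simp add: u'_def g_def power_mult_distrib mult_right_mono)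
      qed simp
      have "smin * (smin powr (2 - 2 * \<sigma>) * param_width I powr (2 - 2 * \<sigma>)) * nsq (cell I) u'
         \<le> smin * (elem_length \<gamma> a b I powr (1 - \<sigma>))\<^sup>2 * (smax\<^sup>2 * nsq (cell I) (pull g))"
        using 1 2 smin_pos nsq_nonneg by (intro mult_mono mult_left_mono) auto
      then show "d * (param_width I powr (2 - 2 * \<sigma>) * nsq (cell I) u')
         \<le> smax\<^sup>2 * (smin * ((elem_length \<gamma> a b I powr (1 - \<sigma>))\<^sup>2 * nsq (cell I) (pull g)))"
        by (simp only: d_def ac_simps)
    qed
    also have "\<dots> \<le> smax\<^sup>2 * ?R"
      using norm_\<Gamma>(1)[OF weighted_norm(1)[OF gL], of "1 - \<sigma>"] unfolding weighted_norm(2)[OF gL]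
      by (intro mult_left_mono) auto
    finally show ?thesis .
  qed
  then have S: "?S \<le> smax\<^sup>2 / d * ?R" using d by (simp add: pos_le_divide_eq mult.commute)
  have "(Hs_norm \<gamma> a b \<sigma> (err v))\<^sup>2 \<le> Cx \<sigma> * (\<Sum>I\<in>E. param_width I powr (2 - 2 * \<sigma>) * nsq (PP I) u')"
    by (rule error_norm(2)[OF v u'_def s])
  also have "\<dots> \<le> Cx \<sigma> * (CO * ?S)" using s by (intro mult_left_mono overlap_powr u2 Cx_nonneg) auto
  also have "\<dots> \<le> Cx \<sigma> * (CO * (smax\<^sup>2 / d * ?R))" using s CO_ge1 by (intro mult_left_mono S Cx_nonneg) auto
  also have "\<dots> = Cb \<sigma> * ?R" by (simp only: Cb_def d_def ac_simps)
  finally show "(Hs_norm \<gamma> a b \<sigma> (err v))\<^sup>2 \<le> Cb \<sigma> * (L2_norm \<gamma> a b \<Gamma> (\<lambda>x. mesh_width \<gamma> a b K x powr (1 - \<sigma>) * arclength_derivative \<gamma> a b v x))\<^sup>2"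
    by (simp only: g_def)
qed

end

section \<open>Rational splines and the Scott--Zhang-type operator\<close>

text \<open>A function that is not integrable has integral zero, so both sides vanish if \<open>F\<close> is not measurable.  This
  gives the formula for the operator on arbitrary functions \<open>v\<close>.\<close>

lemma integral_Ico:
  fixes F :: "real \<Rightarrow> real"
  assumes "\<And>s. s \<notin> {a..b} \<Longrightarrow> F s = 0"
  shows "integral\<^sup>L lborel F = (LINT s|lborel. indicator {a..<b} s * F s)"
proof (cases "(\<lambda>s. indicator {a..<b} s * F s) \<in> borel_measurable borel")
  case True
  then show ?thesis by (rule integral_endpoint(1)[OF _ assms])
next
  case False
  have "F \<notin> borel_measurable borel"
  proof
    assume [measurable]: "F \<in> borel_measurable borel"
    have "(\<lambda>s. indicator {a..<b} s * F s) \<in> borel_measurable borel" by measurable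
    then show False using False by simp
  qed
  then have "\<not> integrable lborel F" "\<not> integrable lborel (\<lambda>s. indicator {a..<b} s * F s)"
    using False borel_measurable_integrable[of lborel] by auto
  then show ?thesis by (simp add: not_integrable_integral_eq)
qed

lemma (in knot_seq) knot_eq: "j \<le> N \<Longrightarrow> knot a K j = t j"
  by (auto simp: knot_def knot_ext_def)

lemma (in knot_seq) dual_functionsD:
  assumes "dual_functions \<gamma> a b p K0 Bst" "K \<in> refinements \<gamma> a p K0" and i: "i \<in> spline_indices p K"
  defines "f \<equiv> Bst (local_knots a p K i)"
  shows "(\<lambda>x. indicator {a..b} x * f x) \<in> borel_measurable borel"
    and "integrable lborel (\<lambda>x. indicator {a..b} x * (f x)\<^sup>2)"
    and "ess_support a b f = {t (i - 1)..t (i + int p)}"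
    and "\<And>j. j \<in> spline_indices p K \<Longrightarrow>
        (LINT x|lborel. indicator {a..b} x * (f x * bspline t p j x)) = (if i = j then 1 else 0)"
    and "sqrt (LINT x|lborel. indicator {a..b} x * (f x)\<^sup>2) \<le> 9 ^ p * (2 * real p + 3) * (t (i + int p) - t (i - 1)) powr (- 1 / 2)"
proof -
  have k: "knot a K (i - 1) = t (i - 1)" "knot a K (i + int p) = t (i + int p)"
    using i by (auto intro!: knot_eq simp: spline_indices_def)
  have *: "set_borel_measurable lborel {a..b} f \<and> set_integrable lborel {a..b} (\<lambda>x. (f x)\<^sup>2) \<and>
          ess_support a b f = {t (i - 1)..t (i + int p)} \<and>
          (\<forall>j\<in>spline_indices p K. (LINT x:{a..b}|lborel. f x * bspline (knot a K) p j x) = (if i = j then 1 else 0)) \<and>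
          sqrt (LINT x:{a..b}|lborel. (f x)\<^sup>2) \<le> 9 ^ p * (2 * real p + 3) * (t (i + int p) - t (i - 1)) powr (- 1 / 2)"
    using assms(1-3) unfolding dual_functions_def Let_def f_def k[symmetric] by blast
  show "(\<lambda>x. indicator {a..b} x * f x) \<in> borel_measurable borel"
    using * by (simp add: set_borel_measurable_def)
  show "integrable lborel (\<lambda>x. indicator {a..b} x * (f x)\<^sup>2)"
    using * by (simp add: set_integrable_def)
  show "ess_support a b f = {t (i - 1)..t (i + int p)}" using * by blast
  show "sqrt (LINT x|lborel. indicator {a..b} x * (f x)\<^sup>2) \<le> 9 ^ p * (2 * real p + 3) * (t (i + int p) - t (i - 1)) powr (- 1 / 2)"
    using * by (simp add: set_lebesgue_integral_def)
  show "(LINT x|lborel. indicator {a..b} x * (f x * bspline t p j x)) = (if i = j then 1 else 0)"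
    if j: "j \<in> spline_indices p K" for j
  proof -
    have "(LINT x:{a..b}|lborel. f x * bspline (knot a K) p j x) = (if i = j then 1 else 0)" using * j by blast
    then show ?thesis unfolding bspline_knot_eq[OF j] set_lebesgue_integral_def by simp
  qed
qed

text \<open>Linear independence of the B-splines, read off from the dual functions.\<close>

lemma (in knot_seq) bspline_coefficients_unique:
  fixes f :: "int \<Rightarrow> real \<Rightarrow> real"
  assumes zero: "\<And>x. x \<in> {a..<b} \<Longrightarrow> (\<Sum>j\<in>spline_indices p K. c j * bspline t p j x) = 0"
    and i: "i \<in> spline_indices p K"
    and fm: "(\<lambda>x. indicator {a..b} x * f i x) \<in> borel_measurable borel"
    and f2: "integrable lborel (\<lambda>x. indicator {a..b} x * (f i x)\<^sup>2)"
    and dual: "\<And>j. j \<in> spline_indices p K \<Longrightarrow>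
        (LINT x|lborel. indicator {a..b} x * (f i x * bspline t p j x)) = (if i = j then 1 else 0)"
  shows "c i = 0"
proof -
  let ?S = "spline_indices p K"
  have fin: "finite ?S" by (simp add: spline_indices_def)
  have out: "bspline t p j x = 0" if "x \<notin> {a..<b}" for j x
    using bspline_support[OF mono_t, of p j x] t_ge_a[of "j - 1"] t_le_b[of "j + int p"] that by force
  have le: "bspline t p j x \<le> 1" for j x
  proof (cases "bspline t p j x = 0")
    case False
    then have "t (j - 1) \<le> x" "x < t (j + int p)" using bspline_support[OF mono_t] by auto
    then have "a \<le> x" "x < b" using t_ge_a[of "j - 1"] t_le_b[of "j + int p"] by auto
    then obtain J where "t (J - 1) \<le> x" "x < t J" using cell_exists by blast
    then show ?thesis by (rule bspline_le_1[OF mono_t])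
  qed simp
  have int: "integrable lborel (\<lambda>x. indicator {a..b} x * (f i x * bspline t p j x))" for j
  proof -
    have "integrable lborel (\<lambda>x. (indicator {a..b} x * f i x) * (indicator {a..b} x * bspline t p j x))"
    proof (rule Cauchy_Schwarz_integral(1))
      show "(\<lambda>x. indicator {a..b} x * f i x) \<in> borel_measurable lborel" using fm by simp
      show "(\<lambda>x. indicator {a..b} x * bspline t p j x) \<in> borel_measurable lborel" by measurable
      have "(indicator {a..b} x * f i x)\<^sup>2 = indicator {a..b} x * (f i x)\<^sup>2" for x by (simp add: indicator_def)
      then show "integrable lborel (\<lambda>x. (indicator {a..b} x * f i x)\<^sup>2)" using f2 by simp
      show "integrable lborel (\<lambda>x. (indicator {a..b} x * bspline t p j x)\<^sup>2)"
      proof (rule integrable_bounded_on[of _ 1 a b])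
        show "\<bar>(indicator {a..b} x * bspline t p j x)\<^sup>2\<bar> \<le> 1" for x
          by (cases "x \<in> {a..b}") (simp_all add: power_le_one bspline_nonneg[OF mono_t] le)
      qed (simp_all add: out)
    qed
    moreover have "(indicator {a..b} x * f i x) * (indicator {a..b} x * bspline t p j x) = indicator {a..b} x * (f i x * bspline t p j x)" for x
      by (simp add: indicator_def)
    ultimately show ?thesis by simp
  qed
  have "c i = (\<Sum>j\<in>?S. c j * (if i = j then 1 else 0))" using i fin by (simp add: if_distrib sum.delta cong: if_cong)
  also have "\<dots> = (\<Sum>j\<in>?S. c j * (LINT x|lborel. indicator {a..b} x * (f i x * bspline t p j x)))"
    by (intro sum.cong refl) (simp only: dual)
  also have "\<dots> = (LINT x|lborel. (\<Sum>j\<in>?S. c j * (indicator {a..b} x * (f i x * bspline t p j x))))"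
    using int by (subst Bochner_Integration.integral_sum) auto
  also have "\<dots> = 0"
  proof (rule integral_eq_zero_AE)
    show "AE x in lborel. (\<Sum>j\<in>?S. c j * (indicator {a..b} x * (f i x * bspline t p j x))) = 0"
      using AE_lborel_singleton[of b]
    proof eventually_elim
      case (elim x)
      have "(\<Sum>j\<in>?S. c j * (indicator {a..b} x * (f i x * bspline t p j x))) = indicator {a..b} x * f i x * (\<Sum>j\<in>?S. c j * bspline t p j x)"
        unfolding sum_distrib_left by (intro sum.cong refl) (simp only: ac_simps)
      also have "\<dots> = 0" using elim zero[of x] by (cases "x \<in> {a..<b}") auto
      finally show ?case .
    qed
  qed
  finally show ?thesis .
qed

text \<open>Knot insertion provides coefficients within the bounds, and by uniqueness these are the weights selected
  by the definite description.\<close>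

lemma refined_weights_bounds:
  assumes k0: "knot_seq a b p K0" and k: "knot_seq a b p K" and L: "K = K0 + L" "set_mset L \<subseteq> {a<..<b}"
    and w0: "initial_weights p K0 w0 wmin wmax"
    and dual: "dual_functions \<gamma> a b p K0 Bst" "K \<in> refinements \<gamma> a p K0"
  shows "0 < wmin" "\<And>i. i \<in> spline_indices p K \<Longrightarrow> wmin \<le> weights a b p K0 w0 K i \<and> weights a b p K0 w0 K i \<le> wmax"
    "\<And>x. x \<in> {a..<b} \<Longrightarrow> weight_function a p K0 w0 x = (\<Sum>i\<in>spline_indices p K. weights a b p K0 w0 K i * bspline (knot_ext a b K) p i x)"
proof -
  interpret k0: knot_seq a b p K0 by (rule k0)
  interpret k: knot_seq a b p K by (rule k)
  let ?T = "spline_indices p K0" and ?S = "spline_indices p K"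
  have fin: "finite ?T" and ne: "?T \<noteq> {}"
    using k0.count_b count_le_size[of K0 b] k0.p1 by (auto simp: spline_indices_def)
  have mm: "Min (w0 ` ?T) = wmin" "Max (w0 ` ?T) = wmax" and pos: "\<forall>i\<in>?T. 0 < w0 i"
    using w0 by (auto simp: initial_weights_def)
  have w0b: "wmin \<le> w0 i" "w0 i \<le> wmax" if "i \<in> ?T" for i
    using that fin unfolding mm[symmetric] by auto
  have "wmin \<in> w0 ` ?T" unfolding mm(1)[symmetric] using fin ne by (intro Min_in) auto
  then show "0 < wmin" using pos by auto
  have mM: "wmin \<le> wmax" using ne w0b by fastforce
  define u where "u i = (if i \<in> ?T then w0 i else wmin)" for i
  have u: "u i \<in> {wmin..wmax}" for i using w0b[of i] mM by (simp add: u_def)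
  have "\<exists>w'. (\<forall>i. w' i \<in> {wmin..wmax}) \<and>
    (\<forall>x\<in>{a..<b}. (\<Sum>i\<in>?T. u i * bspline (knot_ext a b K0) p i x) = (\<Sum>i\<in>?S. w' i * bspline (knot_ext a b K) p i x))"
    unfolding L(1)
  proof (rule refined_weights[OF k0.ab k0.p1 L(2) k0.knots_sub k0.count_b u])
    show "count (K0 + L) z \<le> p" if "z \<in> set_mset (K0 + L)" "z \<noteq> b" for z
      using k.count_le[of z] that unfolding L(1) by blast
  qed
  then obtain w' where w': "\<And>i. w' i \<in> {wmin..wmax}"
    "\<And>x. x \<in> {a..<b} \<Longrightarrow> (\<Sum>i\<in>?T. u i * bspline (knot_ext a b K0) p i x) = (\<Sum>i\<in>?S. w' i * bspline (knot_ext a b K) p i x)"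
    by blast
  have W0: "weight_function a p K0 w0 x = (\<Sum>i\<in>?T. u i * bspline (knot_ext a b K0) p i x)" for x
    unfolding weight_function_def by (rule sum.cong[OF refl]) (simp add: u_def k0.bspline_knot_eq)
  have W: "weight_function a p K v x = (\<Sum>i\<in>?S. v i * bspline (knot_ext a b K) p i x)" for v x
    unfolding weight_function_def by (rule sum.cong[OF refl]) (simp add: k.bspline_knot_eq)
  define w where "w i = (if i \<in> ?S then w' i else 0)" for i
  have ww: "(\<Sum>i\<in>?S. w' i * bspline (knot_ext a b K) p i x) = (\<Sum>i\<in>?S. w i * bspline (knot_ext a b K) p i x)" for x
    by (rule sum.cong[OF refl]) (simp add: w_def)
  have Ww: "weight_function a p K0 w0 x = weight_function a p K w x" if "x \<in> {a..<b}" for x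
    unfolding W0 W ww[symmetric] by (rule w'(2)[OF that])
  have eq: "weights a b p K0 w0 K = w"
    unfolding weights_def
  proof (rule the_equality)
    show "(\<forall>k. k \<notin> ?S \<longrightarrow> w k = 0) \<and> (\<forall>x\<in>{a..<b}. weight_function a p K0 w0 x = weight_function a p K w x)"
    proof (intro conjI allI impI ballI)
      fix k assume "k \<notin> ?S" then show "w k = 0" by (simp only: w_def if_False)
    qed (rule Ww)
  next
    fix v assume v: "(\<forall>k. k \<notin> ?S \<longrightarrow> v k = 0) \<and> (\<forall>x\<in>{a..<b}. weight_function a p K0 w0 x = weight_function a p K v x)"
    show "v = w"
    proof
      fix i
      show "v i = w i"
      proof (cases "i \<in> ?S")
        case True
        note D = k.dual_functionsD[OF dual True]
        have "v i - w i = 0"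
        proof (rule k.bspline_coefficients_unique[where f = "\<lambda>i. Bst (local_knots a p K i)", OF _ True D(1,2,4)])
          fix x assume x: "x \<in> {a..<b}"
          have "weight_function a p K v x = weight_function a p K w x"
            using v x Ww[OF x] by metis
          then show "(\<Sum>j\<in>?S. (v j - w j) * bspline (knot_ext a b K) p j x) = 0"
            by (simp add: W left_diff_distrib sum_subtractf)
        qed
        then show ?thesis by simp
      next
        case False
        then show ?thesis using v by (simp add: w_def)
      qed
    qed
  qed
  show "wmin \<le> weights a b p K0 w0 K i \<and> weights a b p K0 w0 K i \<le> wmax" if "i \<in> ?S" for i
    using that w'(1)[of i] by (simp add: eq w_def)
  show "weight_function a p K0 w0 x = (\<Sum>i\<in>?S. weights a b p K0 w0 K i * bspline (knot_ext a b K) p i x)" if "x \<in> {a..<b}" for x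
    unfolding eq ww[symmetric] W0 by (rule w'(2)[OF that])
qed

locale nurbs_setting =
  sz \<gamma> a b \<Gamma> smin smax p K \<kappa> "weights a b p K0 w0 K" "weight_function a p K0 w0" "\<lambda>i. Bst (local_knots a p K i)" wmin wmax
  for \<gamma> a b \<Gamma> smin smax p K \<kappa> K0 w0 Bst wmin wmax
begin

lemma W_Wp: "x \<in> {a..<b} \<Longrightarrow> weight_function a p K0 w0 x = Wp x"
  using W_eq[of x] by (simp add: Wp_def)

lemma nurbs_R:
  assumes i: "i \<in> SI" and x: "x \<in> \<Gamma>"
  shows "nurbs \<gamma> a b p K0 w0 K i x = R i (\<tau> x)"
  unfolding nurbs_def param_nurbs_def \<tau>_def[symmetric] R_def bspline_knot_eq[OF i] W_Wp[OF \<gamma>_\<tau>(2)[OF x]] ..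

lemma sum_nurbs: "x \<in> \<Gamma> \<Longrightarrow> (\<Sum>i\<in>SI. c i * nurbs \<gamma> a b p K0 w0 K i x) = spl c (\<tau> x)"
  unfolding spl_def by (rule sum.cong[OF refl]) (simp add: nurbs_R)

text \<open>The limit at \<open>b\<close> is the last coefficient and the value at \<open>\<gamma> a\<close> is the first one.\<close>

lemma closed_spline_iff:
  defines "V \<equiv> \<lambda>c x. \<Sum>i\<in>SI. c i * nurbs \<gamma> a b p K0 w0 K i x"
  shows "((\<lambda>s. V c (\<gamma> s)) \<longlongrightarrow> V c (\<gamma> a)) (at_left b) \<longleftrightarrow> c i0 = c i1"
proof -
  have V: "V c (\<gamma> s) = spl c s" if "s \<in> {a..<b}" for s
    unfolding V_def using sum_nurbs[OF in_\<Gamma>[of s]] that \<tau>_\<gamma>[OF that] by simp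
  have Va: "V c (\<gamma> a) = c i0" using V[of a] ab spl_limits(3)[of c] by simp
  have ev: "eventually (\<lambda>s. V c (\<gamma> s) = spl c s) (at_left b)"
    using eventually_at_left[OF ab] V ab by (auto simp: eventually_at_left_field intro!: exI[of _ a])
  have "((\<lambda>s. V c (\<gamma> s)) \<longlongrightarrow> c i0) (at_left b) \<longleftrightarrow> (spl c \<longlongrightarrow> c i0) (at_left b)"
    by (rule tendsto_cong[OF ev])
  also have "\<dots> \<longleftrightarrow> c i0 = c i1"
  proof
    assume "(spl c \<longlongrightarrow> c i0) (at_left b)"
    then show "c i0 = c i1" using tendsto_unique[OF _ _ spl_limits(2)] trivial_limit_at_left_real by blast
  next
    assume "c i0 = c i1"
    then show "(spl c \<longlongrightarrow> c i0) (at_left b)" using spl_limits(2)[of c] by simp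
  qed
  finally show ?thesis by (simp only: Va)
qed

lemma ansatz_spaceE:
  assumes "V \<in> ansatz_space \<gamma> a b p K0 w0 K"
  obtains c where "c i0 = c i1" "\<forall>x\<in>\<Gamma>. V x = spl c (\<tau> x)"
proof -
  obtain c where c: "V = (\<lambda>x. \<Sum>i\<in>SI. c i * nurbs \<gamma> a b p K0 w0 K i x)" "((\<lambda>s. V (\<gamma> s)) \<longlongrightarrow> V (\<gamma> a)) (at_left b)"
    using assms unfolding ansatz_space_def by blast
  have "c i0 = c i1" using c(2) unfolding c(1) closed_spline_iff .
  moreover have "\<forall>x\<in>\<Gamma>. V x = spl c (\<tau> x)" unfolding c(1) using sum_nurbs by blast
  ultimately show ?thesis by (rule that)
qed

lemma rst_eq:
  assumes "i \<in> SI"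
  shows "indicator {a..<b} x * dual_nurbs a b p K0 w0 Bst K i x = rst i x"
  using W_Wp[of x] by (cases "x \<in> {a..<b}") (simp_all add: rst_def b0_def dual_nurbs_def)

lemma scott_zhang_spline:
  "scott_zhang \<gamma> a b p K0 w0 Bst K v = (\<lambda>x. \<Sum>i\<in>SI. coef (pull v) i * nurbs \<gamma> a b p K0 w0 K i x)"
proof
  fix x
  let ?D = "dual_nurbs a b p K0 w0 Bst K"
  have int: "(LINT s:{a..b}|lborel. G s * v (\<gamma> s)) = (LINT s|lborel. (indicator {a..<b} s * G s) * pull v s)" for G
  proof -
    have "(LINT s:{a..b}|lborel. G s * v (\<gamma> s)) = (LINT s|lborel. indicator {a..<b} s * (indicator {a..b} s * (G s * v (\<gamma> s))))"
      unfolding set_lebesgue_integral_def by (subst integral_Ico[where a = a and b = b]) auto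
    also have "\<dots> = (LINT s|lborel. (indicator {a..<b} s * G s) * pull v s)"
      by (rule Bochner_Integration.integral_cong[OF refl]) (auto simp: pull_def indicator_def)
    finally show ?thesis .
  qed
  have inner: "(LINT s:{a..b}|lborel. ?D i s * v (\<gamma> s)) = coef (pull v) i" if i: "i \<in> {i0 + 1..i1 - 1}" for i
  proof -
    have iSI: "i \<in> SI" using i by (auto simp: spline_indices_def)
    have "i \<noteq> i0" "i \<noteq> i1" using i by auto
    then show ?thesis unfolding int rst_eq[OF iSI] coef_def \<phi>_def by simp
  qed
  have ends: "(LINT s:{a..b}|lborel. (?D i0 s + ?D i1 s) / 2 * v (\<gamma> s)) = coef (pull v) i0"
  proof -
    have "indicator {a..<b} s * ((?D i0 s + ?D i1 s) / 2) = \<phi> i0 s" for s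
      unfolding \<phi>_def rst_eq[OF i01(1), symmetric] rst_eq[OF i01(2), symmetric] by (simp add: distrib_left)
    then show ?thesis unfolding int coef_def by simp
  qed
  have SI: "SI = insert i0 (insert i1 {i0 + 1..i1 - 1})" using i01(3) by (auto simp: spline_indices_def)
  have "(\<Sum>i\<in>SI. coef (pull v) i * nurbs \<gamma> a b p K0 w0 K i x)
     = coef (pull v) i0 * nurbs \<gamma> a b p K0 w0 K i0 x + (coef (pull v) i1 * nurbs \<gamma> a b p K0 w0 K i1 x
       + (\<Sum>i\<in>{i0 + 1..i1 - 1}. coef (pull v) i * nurbs \<gamma> a b p K0 w0 K i x))"
    unfolding SI using i01(3) by simp
  also have "\<dots> = scott_zhang \<gamma> a b p K0 w0 Bst K v x"
    unfolding scott_zhang_def Let_def ends coef_ends[of "pull v", symmetric] using inner by (simp add: algebra_simps)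
  finally show "scott_zhang \<gamma> a b p K0 w0 Bst K v x = (\<Sum>i\<in>SI. coef (pull v) i * nurbs \<gamma> a b p K0 w0 K i x)" by (rule sym)
qed

lemma scott_zhang_ansatz: "scott_zhang \<gamma> a b p K0 w0 Bst K v \<in> ansatz_space \<gamma> a b p K0 w0 K"
  unfolding ansatz_space_def scott_zhang_spline using closed_spline_iff[of "coef (pull v)"] coef_ends[of "pull v"] by blast

lemma sz_op_scott_zhang:
  "sz_op \<gamma> a b \<Gamma> smin smax p K \<kappa> (weights a b p K0 w0 K) (weight_function a p K0 w0) (\<lambda>i. Bst (local_knots a p K i)) wmin wmax
     (scott_zhang \<gamma> a b p K0 w0 Bst K)"
  by unfold_locales (simp add: scott_zhang_spline sum_nurbs)

end

lemma nurbs_setting_refinement: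
  assumes bp: "boundary_parametrization \<gamma> a b \<Gamma>" and p: "1 \<le> p"
    and s: "0 < smin" "\<And>t. t \<in> {a..<b} \<Longrightarrow> smin \<le> speed \<gamma> t" "\<And>t. t \<in> {a..<b} \<Longrightarrow> speed \<gamma> t \<le> smax"
    and K: "K \<in> refinements \<gamma> a p K0" and kv: "knot_vector \<gamma> a b p K0"
    and w0: "initial_weights p K0 w0 wmin wmax" and dual: "dual_functions \<gamma> a b p K0 Bst"
  shows "nurbs_setting \<gamma> a b \<Gamma> smin smax p K (2 * kappa_hat \<gamma> a K0) K0 w0 Bst wmin wmax"
proof -
  have ab: "a < b" using bp by (simp add: boundary_parametrization_def)
  obtain L where g: "graded_mesh \<gamma> a b p (kappa_hat \<gamma> a K0) K" and k1: "1 \<le> kappa_hat \<gamma> a K0"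
    and L: "K = K0 + L" "set_mset L \<subseteq> {a<..<b}" using graded_mesh_refinements[OF K kv p ab] by blast
  have g0: "graded_mesh \<gamma> a b p (kappa_hat \<gamma> a K0) K0"
    using graded_mesh_refinements[OF refinements.initial kv p ab] by blast
  have k0: "knot_seq a b p K0" using ab p g0 by unfold_locales (auto simp: graded_mesh_def)
  have k: "knot_seq a b p K" using ab p g by unfold_locales (auto simp: graded_mesh_def)
  note D = knot_seq.dual_functionsD[OF k dual K]
  note W = refined_weights_bounds[OF k0 k L w0 dual K]
  show ?thesis
    unfolding nurbs_setting_def
  proof (intro sz.intro mesh.intro curve_bounds.intro curve.intro curve_bounds_axioms.intro mesh_axioms.intro sz_axioms.intro)
    show "param_width I \<le> 2 * kappa_hat \<gamma> a K0 * param_width I'"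
      if "I \<in> param_elements a K" "I' \<in> param_elements a K" "elem \<gamma> I \<inter> elem \<gamma> I' \<noteq> {}" for I I'
      using g that by (simp add: graded_mesh_def)
  qed (rule bp | rule s | rule k | rule W | rule D | assumption | (use k1 in simp))+
qed

section \<open>All estimates with one constant\<close>

text \<open>Passage from the squared estimates to the norms.\<close>

lemma sq_le_imp_le_sqrt:
  fixes x y :: real
  assumes "x\<^sup>2 \<le> D * y\<^sup>2" "0 \<le> y" "\<bar>D\<bar> \<le> M" "sqrt M \<le> C"
  shows "x \<le> C * y"
proof -
  have "D * y\<^sup>2 \<le> M * y\<^sup>2" using assms(3) by (intro mult_right_mono) auto
  then have "x\<^sup>2 \<le> M * y\<^sup>2" using assms(1) by linarith
  then have "x \<le> sqrt (M * y\<^sup>2)" by (rule real_le_rsqrt)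
  also have "\<dots> = sqrt M * y" using assms(2) by (simp add: real_sqrt_mult)
  also have "\<dots> \<le> C * y" using assms by (intro mult_right_mono)
  finally show ?thesis .
qed

context sz_op
begin

definition Csz :: "real \<Rightarrow> real" where "Csz \<sigma> = \<bar>CL2\<bar> + \<bar>CH1\<bar> + \<bar>Ca \<sigma>\<bar> + \<bar>Cb \<sigma>\<bar>"

lemma Hs_norm_nonneg: "0 \<le> Hs_norm \<gamma> a b \<sigma> v"
  using L2_norm_nonneg H1_norm_nonneg by (simp add: Hs_norm_def)

lemma estimates:
  assumes C: "sqrt (Csz \<sigma>) \<le> C" and s: "0 \<le> \<sigma>" "\<sigma> \<le> 1"
  shows "v \<in> L2_space \<gamma> a b \<Longrightarrow> I \<in> E \<Longrightarrow> L2_norm \<gamma> a b (elem \<gamma> I) (Jop v) \<le> C * L2_norm \<gamma> a b (patch \<gamma> a K p (elem \<gamma> I)) v"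
    and "v \<in> H1_space \<gamma> a b \<Longrightarrow> I \<in> E \<Longrightarrow> H1_seminorm \<gamma> a b (elem \<gamma> I) (Jop v) \<le> C * H1_seminorm \<gamma> a b (patch \<gamma> a K p (elem \<gamma> I)) v"
    and "v \<in> Hs_space \<gamma> a b \<sigma> \<Longrightarrow> L2_norm \<gamma> a b \<Gamma> (\<lambda>x. mesh_width \<gamma> a b K x powr (- \<sigma>) * (v x - Jop v x)) \<le> C * Hs_norm \<gamma> a b \<sigma> v"
    and "v \<in> H1_space \<gamma> a b \<Longrightarrow> (\<lambda>x. v x - Jop v x) \<in> Hs_space \<gamma> a b \<sigma> \<and>
      Hs_norm \<gamma> a b \<sigma> (\<lambda>x. v x - Jop v x) \<le> C * L2_norm \<gamma> a b \<Gamma> (\<lambda>x. mesh_width \<gamma> a b K x powr (1 - \<sigma>) * arclength_derivative \<gamma> a b v x)"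
proof -
  have M: "\<bar>CL2\<bar> \<le> Csz \<sigma>" "\<bar>CH1\<bar> \<le> Csz \<sigma>" "\<bar>Ca \<sigma>\<bar> \<le> Csz \<sigma>" "\<bar>Cb \<sigma>\<bar> \<le> Csz \<sigma>" by (auto simp: Csz_def)
  have sn: "0 \<le> H1_seminorm \<gamma> a b S f" for S f unfolding H1_seminorm_def by (rule L2_norm_nonneg)
  show "L2_norm \<gamma> a b (elem \<gamma> I) (Jop v) \<le> C * L2_norm \<gamma> a b (patch \<gamma> a K p (elem \<gamma> I)) v"
    if "v \<in> L2_space \<gamma> a b" "I \<in> E" by (rule sq_le_imp_le_sqrt[OF L2_stable[OF that] L2_norm_nonneg M(1) C])
  show "H1_seminorm \<gamma> a b (elem \<gamma> I) (Jop v) \<le> C * H1_seminorm \<gamma> a b (patch \<gamma> a K p (elem \<gamma> I)) v"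
    if "v \<in> H1_space \<gamma> a b" "I \<in> E" by (rule sq_le_imp_le_sqrt[OF H1_stable[OF that] sn M(2) C])
  show "L2_norm \<gamma> a b \<Gamma> (\<lambda>x. mesh_width \<gamma> a b K x powr (- \<sigma>) * (v x - Jop v x)) \<le> C * Hs_norm \<gamma> a b \<sigma> v"
    if "v \<in> Hs_space \<gamma> a b \<sigma>"
    by (rule sq_le_imp_le_sqrt[OF approximation_low[OF that s, unfolded err_def] Hs_norm_nonneg M(3) C])
  show "(\<lambda>x. v x - Jop v x) \<in> Hs_space \<gamma> a b \<sigma> \<and>
      Hs_norm \<gamma> a b \<sigma> (\<lambda>x. v x - Jop v x) \<le> C * L2_norm \<gamma> a b \<Gamma> (\<lambda>x. mesh_width \<gamma> a b K x powr (1 - \<sigma>) * arclength_derivative \<gamma> a b v x)"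
    if "v \<in> H1_space \<gamma> a b"
    using approximation_high(1)[OF that s, unfolded err_def[abs_def]]
      sq_le_imp_le_sqrt[OF approximation_high(2)[OF that s, unfolded err_def[abs_def]] L2_norm_nonneg M(4) C] by blast
qed

end

theorem proposition4p3:
  fixes \<Omega> :: "(real^2) set" and \<gamma> :: "real \<Rightarrow> real^2" and a b :: real and p :: nat
    and Q0 :: "(real \<times> real) set" and wmin wmax \<sigma> :: real
  assumes "bounded \<Omega>" and "lipschitz_domain \<Omega>" and "connected (frontier \<Omega>)"
    and "boundary_parametrization \<gamma> a b (frontier \<Omega>)"
    and "1 \<le> p" and "0 \<le> \<sigma>" and "\<sigma> \<le> 1"
  shows "\<exists>Csz>0. \<forall>K0 w0 Bst. \<forall>K\<in>refinements \<gamma> a p K0.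
    knot_vector \<gamma> a b p K0 \<longrightarrow> param_elements a K0 = Q0 \<longrightarrow>
    initial_weights p K0 w0 wmin wmax \<longrightarrow> dual_functions \<gamma> a b p K0 Bst \<longrightarrow>
    (let \<Gamma> = frontier \<Omega>; ds = arclength_measure \<gamma> a b;
         X = ansatz_space \<gamma> a b p K0 w0 K; J = scott_zhang \<gamma> a b p K0 w0 Bst K;
         h = mesh_width \<gamma> a b K in
      (\<forall>v\<in>L2_space \<gamma> a b. J v \<in> X \<and> J v \<in> H1_space \<gamma> a b) \<and>
      (\<forall>I\<in>param_elements a K. let Q = elem \<gamma> I; \<pi>Q = patch \<gamma> a K p Q in
         (\<forall>v\<in>L2_space \<gamma> a b.
            (\<exists>V\<in>X. AE x in ds. x \<in> \<pi>Q \<longrightarrow> v x = V x) \<longrightarrow> (AE x in ds. x \<in> Q \<longrightarrow> J v x = v x)) \<and>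
         (\<forall>v\<in>L2_space \<gamma> a b. L2_norm \<gamma> a b Q (J v) \<le> Csz * L2_norm \<gamma> a b \<pi>Q v) \<and>
         (\<forall>v\<in>H1_space \<gamma> a b. H1_seminorm \<gamma> a b Q (J v) \<le> Csz * H1_seminorm \<gamma> a b \<pi>Q v)) \<and>
      (\<forall>v\<in>Hs_space \<gamma> a b \<sigma>.
         L2_norm \<gamma> a b \<Gamma> (\<lambda>x. h x powr (- \<sigma>) * (v x - J v x)) \<le> Csz * Hs_norm \<gamma> a b \<sigma> v) \<and>
      (\<forall>v\<in>H1_space \<gamma> a b.
         (\<lambda>x. v x - J v x) \<in> Hs_space \<gamma> a b \<sigma> \<and>
         Hs_norm \<gamma> a b \<sigma> (\<lambda>x. v x - J v x)
           \<le> Csz * L2_norm \<gamma> a b \<Gamma> (\<lambda>x. h x powr (1 - \<sigma>) * arclength_derivative \<gamma> a b v x)))"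
proof -
  define \<Gamma> where "\<Gamma> = frontier \<Omega>"
  have bp: "boundary_parametrization \<gamma> a b \<Gamma>" unfolding \<Gamma>_def by (rule assms(4))
  interpret curve \<gamma> a b \<Gamma> by (rule curve.intro[OF bp])
  obtain smin smax where s: "0 < smin" "\<And>t. t \<in> {a..<b} \<Longrightarrow> smin \<le> speed \<gamma> t" "\<And>t. t \<in> {a..<b} \<Longrightarrow> speed \<gamma> t \<le> smax"
    using speed_bounds by blast
  \<comment> \<open>the grading constant of all refinements, written in terms of \<open>Q0\<close> alone\<close>
  define \<kappa> where "\<kappa> = 2 * Max {param_width I / param_width I' | I I'. I \<in> Q0 \<and> I' \<in> Q0 \<and> elem \<gamma> I \<inter> elem \<gamma> I' \<noteq> {}}"
  \<comment> \<open>the constant of the locale mentions neither the knots nor the weights or dual functions; the maximum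
    makes it positive in any case\<close>
  define C where "C = max 1 (sqrt (sz_op.Csz a b smin smax p \<kappa> wmin wmax \<sigma>))"
  show ?thesis
    unfolding Let_def \<Gamma>_def[symmetric]
  proof (rule exI[of _ C], intro conjI[of "0 < C"] allI ballI impI)
    show "0 < C" by (simp add: C_def)
    fix K0 w0 Bst K
    assume K: "K \<in> refinements \<gamma> a p K0" and kv: "knot_vector \<gamma> a b p K0" and Q0: "param_elements a K0 = Q0"
      and w0: "initial_weights p K0 w0 wmin wmax" and dual: "dual_functions \<gamma> a b p K0 Bst"
    have \<kappa>: "2 * kappa_hat \<gamma> a K0 = \<kappa>" by (simp only: kappa_hat_def Q0 \<kappa>_def)
    interpret nurbs_setting \<gamma> a b \<Gamma> smin smax p K \<kappa> K0 w0 Bst wmin wmax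
      using nurbs_setting_refinement[OF bp assms(5) s K kv w0 dual] by (simp only: \<kappa>)
    interpret J: sz_op \<gamma> a b \<Gamma> smin smax p K \<kappa> "weights a b p K0 w0 K" "weight_function a p K0 w0" "\<lambda>i. Bst (local_knots a p K i)" wmin wmax
      "scott_zhang \<gamma> a b p K0 w0 Bst K" by (rule sz_op_scott_zhang)
    have C: "sqrt (J.Csz \<sigma>) \<le> C" by (simp add: C_def)
    note est = J.estimates[OF C assms(6,7)]
    have proj: "AE x in \<mu>. x \<in> elem \<gamma> I \<longrightarrow> scott_zhang \<gamma> a b p K0 w0 Bst K v x = v x"
      if I: "I \<in> param_elements a K" and v: "v \<in> L2_space \<gamma> a b" and V: "V \<in> ansatz_space \<gamma> a b p K0 w0 K"
        and ae: "AE x in \<mu>. x \<in> patch \<gamma> a K p (elem \<gamma> I) \<longrightarrow> v x = V x" for I v V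
    proof -
      obtain c where c: "c (1 - int p) = c (int (size K) - int p)" "\<forall>x\<in>\<Gamma>. V x = spl c (\<tau> x)"
        by (rule ansatz_spaceE[OF V])
      have "AE x in \<mu>. x \<in> patch \<gamma> a K p (elem \<gamma> I) \<longrightarrow> v x = spl c (\<tau> x)"
        using ae AE_space
      proof eventually_elim
        case (elim x)
        then show ?case using c(2) by (simp add: space_\<mu>)
      qed
      then show ?thesis by (rule J.projection[OF v I c(1)])
    qed
    show "(\<forall>v\<in>L2_space \<gamma> a b. scott_zhang \<gamma> a b p K0 w0 Bst K v \<in> ansatz_space \<gamma> a b p K0 w0 K \<and>
          scott_zhang \<gamma> a b p K0 w0 Bst K v \<in> H1_space \<gamma> a b) \<and>
      (\<forall>I\<in>param_elements a K.
         (\<forall>v\<in>L2_space \<gamma> a b.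
            (\<exists>V\<in>ansatz_space \<gamma> a b p K0 w0 K. AE x in \<mu>. x \<in> patch \<gamma> a K p (elem \<gamma> I) \<longrightarrow> v x = V x) \<longrightarrow>
            (AE x in \<mu>. x \<in> elem \<gamma> I \<longrightarrow> scott_zhang \<gamma> a b p K0 w0 Bst K v x = v x)) \<and>
         (\<forall>v\<in>L2_space \<gamma> a b. L2_norm \<gamma> a b (elem \<gamma> I) (scott_zhang \<gamma> a b p K0 w0 Bst K v)
            \<le> C * L2_norm \<gamma> a b (patch \<gamma> a K p (elem \<gamma> I)) v) \<and>
         (\<forall>v\<in>H1_space \<gamma> a b. H1_seminorm \<gamma> a b (elem \<gamma> I) (scott_zhang \<gamma> a b p K0 w0 Bst K v)
            \<le> C * H1_seminorm \<gamma> a b (patch \<gamma> a K p (elem \<gamma> I)) v)) \<and>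
      (\<forall>v\<in>Hs_space \<gamma> a b \<sigma>.
         L2_norm \<gamma> a b \<Gamma> (\<lambda>x. mesh_width \<gamma> a b K x powr (- \<sigma>) * (v x - scott_zhang \<gamma> a b p K0 w0 Bst K v x)) \<le> C * Hs_norm \<gamma> a b \<sigma> v) \<and>
      (\<forall>v\<in>H1_space \<gamma> a b.
         (\<lambda>x. v x - scott_zhang \<gamma> a b p K0 w0 Bst K v x) \<in> Hs_space \<gamma> a b \<sigma> \<and>
         Hs_norm \<gamma> a b \<sigma> (\<lambda>x. v x - scott_zhang \<gamma> a b p K0 w0 Bst K v x)
           \<le> C * L2_norm \<gamma> a b \<Gamma> (\<lambda>x. mesh_width \<gamma> a b K x powr (1 - \<sigma>) * arclength_derivative \<gamma> a b v x))"
      by (intro conjI ballI impI scott_zhang_ansatz J.Jop_H1(1) est(1-3) conjunct1[OF est(4)] conjunct2[OF est(4)])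
        (assumption | (erule bexE, rule proj, assumption, assumption, assumption, assumption))+
  qed
qed

end
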